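(* With $\Psi$, $\mathcal I^\alpha_\rho$, $\mathbb C$, $\eta_\xi$, $\Gamma_\xi$ as in the context: for all $\xi\in\mathbb R^2$ and $\rho\in(0,1)$ the following limits exist and $$\psi(\xi):=\lim_{\alpha\to0}2\alpha\,\Psi(\xi,\alpha,\rho)=\lim_{\alpha\to0}\alpha\int_{B_\rho}\mathbb C\,\mathcal I^\alpha_\rho\eta_\xi(x):\mathcal I^\alpha_\rho\eta_\xi(x)\,dx=\frac12\int_0^{2\pi}\mathbb C\,\Gamma_\xi(\theta):\Gamma_\xi(\theta)\,d\theta .$$ In particular, there is a constant $c>0$ such that $\psi(\xi)\ge c|\xi|^2$ for all $\xi\in\mathbb R^2$. Moreover, if $(\rho_\alpha)_{\alpha\in(0,1)}\subset(0,1)$ is such that $\alpha\log\rho_\alpha\to0$ as $\alpha\to0$, then $$\lim_{\alpha\to0}\ \sup_{\xi\in\mathbb S^1}\big|2\alpha\,\Psi(\xi,\alpha,\rho_\alpha)-\psi(\xi)\big|=0 .$$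
   Context: $B_r\subset\mathbb R^2$ is the open ball of radius $r$ centered at $0$; $\mathbb S^1=\partial B_1$; $F^{\rm sym}=\frac12(F+F^T)$. For an $\mathbb R^{2\times2}$-valued $\beta\in L^1_{\rm loc}$, $\operatorname{Curl}\beta:=(\partial_1\beta_{12}-\partial_2\beta_{11},\ \partial_1\beta_{22}-\partial_2\beta_{21})$ distributionally; $\operatorname{Div}$ is the row-wise divergence. Functions on subsets of $\mathbb R^2$ are extended by $0$ when needed. Riesz potential with finite horizon: fix $\overline w\in C^\infty([0,\infty))$ with $\operatorname{supp}\overline w\subset[0,1)$, $0\le\overline w\le1$, $\overline w=1$ on $[0,\frac12]$, $\overline w$ nonincreasing; $\overline w_\rho(t)=\overline w(t/\rho)$. For $\alpha\in(0,1)$, $\gamma_\alpha=\frac{\pi2^\alpha\Gamma(\alpha/2)}{\Gamma((2-\alpha)/2)}$ ($\Gamma$ without index is the Gamma function), $Q^{1-\alpha}_\rho(x)=\frac{2-\alpha}{\gamma_\alpha}\int_{|x|}^\infty\frac{\overline w_\rho(r)}{r^{3-\alpha}}dr$ for $x\ne0$ (in $L^1(\mathbb R^2)$, supported in $B_\rho$), and $\mathcal I^\alpha_\rho f=Q^{1-\alpha}_\rho*f$ for $f\in L^1_{\rm loc}(\mathbb R^2)$ (componentwise). $\mathbb C:\mathbb R^{2\times2}\to\mathbb R^{2\times2}$ is linear with $\mathbb CF=\mathbb CF^{\rm sym}\in\mathbb R^{2\times2}_{\rm sym}$, $\mathbb CF_1:F_2=F_1:\mathbb CF_2$, and $\nu_1|F^{\rm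 sym}|^2\le\mathbb CF:F\le\nu_2|F^{\rm sym}|^2$ for some $0<\nu_1\le\nu_2$. Cell problem: for $\xi\in\mathbb R^2$, $\alpha,\rho\in(0,1)$, $\mathcal A(\xi,\rho)=\{\beta\in L^1(B_{2\rho};\mathbb R^{2\times2}):\operatorname{Curl}\beta=\xi\delta_0\text{ in }\mathcal D'(B_{2\rho};\mathbb R^2)\}$ and $\Psi(\xi,\alpha,\rho)=\inf_{\beta\in\mathcal A(\xi,\rho)}\frac12\int_{B_\rho}\mathbb C\,\mathcal I^\alpha_\rho\beta:\mathcal I^\alpha_\rho\beta\,dx$. The field $\eta_\xi$: for $\xi\in\mathbb R^2$, $\eta_\xi:\mathbb R^2\to\mathbb R^{2\times2}$ is the (known to exist) distributional solution of $\operatorname{Curl}\eta_\xi=\xi\delta_0$, $\operatorname{Div}\mathbb C\eta_\xi=0$ in $\mathbb R^2$, which is smooth in $\mathbb R^2\setminus\{0\}$ and has the form $\eta_\xi(r\cos\theta,r\sin\theta)=\frac1r\Gamma_\xi(\theta)$ for $r>0$, $\theta\in[0,2\pi)$, where $\Gamma_\xi$ depends on $\mathbb C$, is linear in $\xi$, and satisfies $|\Gamma_\xi(\theta)|\le K|\xi|$ for all $\theta$ with $K=K(\nu_1,\nu_2)>0$. *)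

theory Defs
  imports "HOL-Analysis.Analysis"
begin

text \<open>
  Matrices are elements of \<open>real^2^2\<close>, with \<open>F $ i $ j\<close> the entry in row \<open>i\<close> and column \<open>j\<close>.
  The library inner product and norm on this type are the Frobenius product \<open>F : G\<close> and its norm.
  Members of \<open>L\<^sup>1\<close> are represented by Borel functions (every class contains one).
\<close>

section \<open>Smooth functions and distributional derivatives in the plane\<close>

definition partial_deriv :: "2 \<Rightarrow> (real^2 \<Rightarrow> 'b::real_normed_vector) \<Rightarrow> real^2 \<Rightarrow> 'b" where
  "partial_deriv i f = (\<lambda>x. frechet_derivative f (at x) (axis i 1))"

text \<open>\<open>C\<^sup>\<infinity>\<close> on an open set: all iterated partial derivatives are (Frechet) differentiable.\<close>

definition smooth_on :: "(real^2) set \<Rightarrow> (real^2 \<Rightarrow> 'b::real_normed_vector) \<Rightarrow> bool" where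
  "smooth_on U f \<longleftrightarrow> (\<forall>is. \<forall>x\<in>U. fold partial_deriv is f differentiable (at x))"

definition test_functions :: "(real^2) set \<Rightarrow> (real^2 \<Rightarrow> real) set" where
  "test_functions U = {\<phi>. smooth_on UNIV \<phi> \<and> compact (closure {x. \<phi> x \<noteq> 0})
                          \<and> closure {x. \<phi> x \<noteq> 0} \<subseteq> U}"

definition locally_integrable :: "(real^2 \<Rightarrow> real^2^2) \<Rightarrow> bool" where
  "locally_integrable f \<longleftrightarrow> (\<forall>S. compact S \<longrightarrow> set_integrable lborel S f)"

text \<open>
  The pairings of the distributions \<open>Curl \<beta> = (\<partial>\<^sub>1 \<beta>\<^sub>i\<^sub>2 - \<partial>\<^sub>2 \<beta>\<^sub>i\<^sub>1)\<^sub>i\<close> and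
  \<open>Div \<sigma> = (\<partial>\<^sub>1 \<sigma>\<^sub>i\<^sub>1 + \<partial>\<^sub>2 \<sigma>\<^sub>i\<^sub>2)\<^sub>i\<close> on \<open>U\<close> with a scalar test function \<open>\<phi>\<close>.
\<close>

definition Curl_pairing :: "(real^2) set \<Rightarrow> (real^2 \<Rightarrow> real^2^2) \<Rightarrow> (real^2 \<Rightarrow> real) \<Rightarrow> real^2" where
  "Curl_pairing U \<beta> \<phi> =
     (\<chi> i. - (LINT x:U|lborel. \<beta> x $ i $ 2 * partial_deriv 1 \<phi> x
                              - \<beta> x $ i $ 1 * partial_deriv 2 \<phi> x))"

definition Div_pairing :: "(real^2) set \<Rightarrow> (real^2 \<Rightarrow> real^2^2) \<Rightarrow> (real^2 \<Rightarrow> real) \<Rightarrow> real^2" where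
  "Div_pairing U \<sigma> \<phi> =
     (\<chi> i. - (LINT x:U|lborel. \<Sum>j\<in>UNIV. \<sigma> x $ i $ j * partial_deriv j \<phi> x))"

definition Curl_eq_dirac :: "(real^2) set \<Rightarrow> (real^2 \<Rightarrow> real^2^2) \<Rightarrow> real^2 \<Rightarrow> bool" where
  "Curl_eq_dirac U \<beta> \<xi> \<longleftrightarrow> (\<forall>\<phi>\<in>test_functions U. Curl_pairing U \<beta> \<phi> = \<phi> 0 *\<^sub>R \<xi>)"

definition Div_eq_zero :: "(real^2) set \<Rightarrow> (real^2 \<Rightarrow> real^2^2) \<Rightarrow> bool" where
  "Div_eq_zero U \<sigma> \<longleftrightarrow> (\<forall>\<phi>\<in>test_functions U. Div_pairing U \<sigma> \<phi> = 0)"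


section \<open>Riesz potential with finite horizon\<close>

text \<open>
  Smoothness on the closed half-line, with one-sided derivatives at \<open>0\<close>: \<open>D k\<close> is the
  \<open>k\<close>-th derivative. The values of \<open>w\<close> on negative numbers are irrelevant.
\<close>

definition smooth_halfline :: "(real \<Rightarrow> real) \<Rightarrow> bool" where
  "smooth_halfline w \<longleftrightarrow>
     (\<exists>D :: nat \<Rightarrow> real \<Rightarrow> real. (\<forall>t\<ge>0. D 0 t = w t) \<and>
        (\<forall>k. \<forall>t\<ge>0. (D k has_real_derivative D (Suc k) t) (at t within {0..})))"

definition horizon_profile :: "(real \<Rightarrow> real) \<Rightarrow> bool" where
  "horizon_profile w \<longleftrightarrow>
     smooth_halfline w \<and>
     closure {t. 0 \<le> t \<and> w t \<noteq> 0} \<subseteq> {0..<1} \<and>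
     (\<forall>t\<ge>0. 0 \<le> w t \<and> w t \<le> 1) \<and>
     (\<forall>t\<in>{0..1/2}. w t = 1) \<and>
     antimono_on {0..} w"

definition riesz_gamma :: "real \<Rightarrow> real" where
  "riesz_gamma \<alpha> = pi * 2 powr \<alpha> * Gamma (\<alpha> / 2) / Gamma ((2 - \<alpha>) / 2)"

text \<open>Only the values at \<open>x \<noteq> 0\<close> matter; at \<open>x = 0\<close> the integral diverges.\<close>

definition Q_kernel :: "(real \<Rightarrow> real) \<Rightarrow> real \<Rightarrow> real \<Rightarrow> real^2 \<Rightarrow> real" where
  "Q_kernel w \<alpha> \<rho> x =
     (2 - \<alpha>) / riesz_gamma \<alpha> * (LINT r:{norm x..}|lborel. w (r / \<rho>) / r powr (3 - \<alpha>))"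

definition riesz_potential ::
    "(real \<Rightarrow> real) \<Rightarrow> real \<Rightarrow> real \<Rightarrow> (real^2 \<Rightarrow> real^2^2) \<Rightarrow> real^2 \<Rightarrow> real^2^2" where
  "riesz_potential w \<alpha> \<rho> f x = (LINT y|lborel. Q_kernel w \<alpha> \<rho> (x - y) *\<^sub>R f y)"


section \<open>Elastic energy and the cell problem\<close>

definition sym_part :: "real^2^2 \<Rightarrow> real^2^2" where
  "sym_part F = (1/2) *\<^sub>R (F + transpose F)"

definition elasticity_tensor :: "(real^2^2 \<Rightarrow> real^2^2) \<Rightarrow> real \<Rightarrow> real \<Rightarrow> bool" where
  "elasticity_tensor C \<nu>\<^sub>1 \<nu>\<^sub>2 \<longleftrightarrow>
     0 < \<nu>\<^sub>1 \<and> \<nu>\<^sub>1 \<le> \<nu>\<^sub>2 \<and> linear C \<and>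
     (\<forall>F. C F = C (sym_part F) \<and> transpose (C F) = C F) \<and>
     (\<forall>F G. C F \<bullet> G = F \<bullet> C G) \<and>
     (\<forall>F. \<nu>\<^sub>1 * (norm (sym_part F))\<^sup>2 \<le> C F \<bullet> F \<and> C F \<bullet> F \<le> \<nu>\<^sub>2 * (norm (sym_part F))\<^sup>2)"

text \<open>
  The integral of \<open>C F : F\<close> over the ball. The integrand is nonnegative for an elasticity
  tensor, and the integral is \<open>\<infinity>\<close> if it is not integrable.
\<close>

definition elastic_integral ::
    "(real^2^2 \<Rightarrow> real^2^2) \<Rightarrow> real \<Rightarrow> (real^2 \<Rightarrow> real^2^2) \<Rightarrow> ennreal" where
  "elastic_integral C \<rho> F = (\<integral>\<^sup>+ x\<in>ball 0 \<rho>. ennreal (C (F x) \<bullet> F x) \<partial>lborel)"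

definition zero_extension :: "(real^2) set \<Rightarrow> (real^2 \<Rightarrow> real^2^2) \<Rightarrow> real^2 \<Rightarrow> real^2^2" where
  "zero_extension U f x = (if x \<in> U then f x else 0)"

definition admissible :: "real^2 \<Rightarrow> real \<Rightarrow> (real^2 \<Rightarrow> real^2^2) set" where
  "admissible \<xi> \<rho> = {\<beta>. set_integrable lborel (ball 0 (2 * \<rho>)) \<beta>
                         \<and> Curl_eq_dirac (ball 0 (2 * \<rho>)) \<beta> \<xi>}"

definition cell_energy ::
    "(real \<Rightarrow> real) \<Rightarrow> (real^2^2 \<Rightarrow> real^2^2) \<Rightarrow> real^2 \<Rightarrow> real \<Rightarrow> real \<Rightarrow> ereal" where
  "cell_energy w C \<xi> \<alpha> \<rho> = enn2ereal
     (INF \<beta>\<in>admissible \<xi> \<rho>.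
        ennreal (1/2) *
        elastic_integral C \<rho> (riesz_potential w \<alpha> \<rho> (zero_extension (ball 0 (2 * \<rho>)) \<beta>)))"


section \<open>The field of a single dislocation\<close>

text \<open>
  \<open>\<eta> \<xi>\<close> is the \<open>(-1)\<close>-homogeneous solution on the whole plane with angular part \<open>\<Gamma> \<xi>\<close>.
  Up to the irrelevant values of \<open>\<eta> \<xi>\<close> at \<open>0\<close> and of \<open>\<Gamma> \<xi>\<close> outside \<open>[0, 2\<pi>)\<close>, such a pair is
  unique: the difference of two solutions would be smooth on the plane by ellipticity, hence \<open>0\<close>
  by homogeneity.
\<close>

definition dislocation_field ::
    "(real^2^2 \<Rightarrow> real^2^2) \<Rightarrow> (real^2 \<Rightarrow> real^2 \<Rightarrow> real^2^2) \<Rightarrow> (real^2 \<Rightarrow> real \<Rightarrow> real^2^2) \<Rightarrow> bool"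
  where
  "dislocation_field C \<eta> \<Gamma> \<longleftrightarrow>
     (\<forall>\<xi>. locally_integrable (\<eta> \<xi>) \<and>
          Curl_eq_dirac UNIV (\<eta> \<xi>) \<xi> \<and>
          Div_eq_zero UNIV (\<lambda>x. C (\<eta> \<xi> x)) \<and>
          smooth_on (UNIV - {0}) (\<eta> \<xi>) \<and>
          (\<forall>r>0. \<forall>\<theta>\<in>{0..<2*pi}.
             \<eta> \<xi> (vector [r * cos \<theta>, r * sin \<theta>]) = (1 / r) *\<^sub>R \<Gamma> \<xi> \<theta>)) \<and>
     (\<forall>\<theta>\<in>{0..<2*pi}. linear (\<lambda>\<xi>. \<Gamma> \<xi> \<theta>)) \<and>
     (\<exists>K>0. \<forall>\<xi>. \<forall>\<theta>\<in>{0..<2*pi}. norm (\<Gamma> \<xi> \<theta>) \<le> K * norm \<xi>)"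

end

theory Submission
  imports Defs
begin

text \<open>
  Upper bound: \<open>\<eta> \<xi>\<close> is a competitor, and near a point \<open>x\<close> the kernel acts on it as multiplication by at most
  about \<open>|x|\<^sup>\<alpha>\<close>, up to errors that are small relative to \<open>|x| powr (\<alpha> - 1)\<close>; so the energy density is at most
  about \<open>|x| powr (2\<alpha> - 2)\<close> times its value on the unit circle, and \<open>\<alpha>\<close> times the radial integral
  \<open>\<integral> r powr (2\<alpha> - 1) dr\<close> tends to \<open>1/2\<close>.

  Lower bound: by duality. A divergence-free symmetric field is the Airy stress of a potential \<open>\<Phi>\<close>; integrating
  by parts against a competitor only sees the gradient of \<open>\<Phi>\<close> convolved with the kernel at the origin, because
  the curl is a Dirac mass. On each annulus of a geometric sequence one tests with a rescaled potential whose
  stress approximates \<open>C (\<eta> \<xi>)\<close>, and the gains form a geometric series with sum of order \<open>1/\<alpha>\<close>.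
  By homogeneity the traction of \<open>C (\<eta> \<xi>)\<close> across rays from the origin is, after scaling by the radius, a constant
  vector; its product with \<open>\<xi>\<close> is the angular energy, so that both bounds agree. Since the lower bound holds on a neighbourhood of each \<open>\<xi>\<close>, it is uniform on the
  circle by compactness.
\<close>

section \<open>Smooth functions on the plane\<close>

text \<open>The obstacle is to find smooth stresses that reproduce the singular field
  \<open>C (\<eta> \<xi>)\<close>. A potential that is homogeneous of degree one has no tangential
  traction across rays, so the constant traction T forces a term \<open>r * ln r\<close> times an
  angular factor linear in T. Dilating such a potential by \<delta> changes it only by ln \<delta>
  times a linear function. A cut-off copy minus its dilate is therefore linear near the origin,
  hence smooth, and its slope there does work ln (1/\<delta>) times T \<bullet> \<xi> on the Dirac
  mass. Its dual energy is, up to small errors, the same number. Since T \<bullet> \<xi> is twice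
  the claimed limit, twice the work minus the energy, divided by the factor 2 ln (1/\<delta>) of the
  geometric series, leaves exactly that limit. The bounded cost of cutting off disappears for small
  \<delta>.

  The traction is constant because testing the divergence with cut-off harmonic polynomials kills
  every nonconstant Fourier mode; the same argument for the curl makes the normal strain constant.
  The test potential is chosen for one \<xi> and the work is linear in the Dirac weight of the
  competitor, which gives the bound on a neighbourhood.\<close>

lemma partial_deriv_cong:
  assumes "open U" "x \<in> U" "\<And>y. y \<in> U \<Longrightarrow> f y = g y"
  shows "partial_deriv i f x = partial_deriv i g x"
proof -
  have "(f has_derivative D) (at x) \<longleftrightarrow> (g has_derivative D) (at x)" for D
    using has_derivative_transform_within_open[OF _ assms(1,2), of f D UNIV g]
      has_derivative_transform_within_open[OF _ assms(1,2), of g D UNIV f] assms(3) by auto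
  then show ?thesis unfolding partial_deriv_def frechet_derivative_def by simp
qed

lemma differentiable_cong_open:
  assumes "open U" "x \<in> U" "\<And>y. y \<in> U \<Longrightarrow> f y = g y" "f differentiable (at x)"
  shows "g differentiable (at x)"
  using assms has_derivative_transform_within_open[OF _ assms(1,2), of f _ UNIV g]
  unfolding differentiable_def by metis

lemma partial_deriv_eqI:
  assumes "(f has_derivative D) (at x)"
  shows "partial_deriv i f x = D (axis i 1)"
  using frechet_derivative_at[OF assms] by (simp add: partial_deriv_def)

lemma vec2_expand: "(h::real^2) = h$1 *\<^sub>R axis 1 1 + h$2 *\<^sub>R axis 2 1"
  by (simp add: vec_eq_iff forall_2 axis_def)

lemma has_derivative_partials:
  fixes f :: "real^2 \<Rightarrow> 'b::real_normed_vector"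
  assumes "f differentiable (at x)"
  shows "(f has_derivative (\<lambda>h. h$1 *\<^sub>R partial_deriv 1 f x + h$2 *\<^sub>R partial_deriv 2 f x)) (at x)"
proof -
  have 1: "(f has_derivative frechet_derivative f (at x)) (at x)"
    using assms frechet_derivative_works by blast
  then have l: "linear (frechet_derivative f (at x))" by (rule has_derivative_linear)
  have "frechet_derivative f (at x) h = h$1 *\<^sub>R partial_deriv 1 f x + h$2 *\<^sub>R partial_deriv 2 f x" for h
    by (subst vec2_expand[of h]) (simp add: linear_add[OF l] linear_cmul[OF l] partial_deriv_def)
  then have "frechet_derivative f (at x) = (\<lambda>h. h$1 *\<^sub>R partial_deriv 1 f x + h$2 *\<^sub>R partial_deriv 2 f x)"
    by blast
  then show ?thesis using 1 by simp
qed

text \<open>\<open>smooth_on\<close> quantifies over lists of derivatives, but the partial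
  derivative of a product is a sum of products. Counting the order turns closure under sums,
  products and composition into inductions on the order with the functions generalised.\<close>

primrec differentiable_upto :: "nat \<Rightarrow> (real^2) set \<Rightarrow> (real^2 \<Rightarrow> real) \<Rightarrow> bool" where
  "differentiable_upto 0 U f \<longleftrightarrow> (\<forall>x\<in>U. f differentiable (at x))"
| "differentiable_upto (Suc n) U f \<longleftrightarrow> (\<forall>x\<in>U. f differentiable (at x)) \<and>
     (\<forall>i. differentiable_upto n U (partial_deriv i f))"

lemma differentiable_upto_Suc: "differentiable_upto (Suc n) U f \<Longrightarrow> differentiable_upto n U f"
  by (induction n arbitrary: f) auto

lemma differentiable_upto_cong:
  assumes "open U"
  shows "\<lbrakk>\<And>x. x \<in> U \<Longrightarrow> f x = g x; differentiable_upto n U f\<rbrakk> \<Longrightarrow> differentiable_upto n U g"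
proof (induction n arbitrary: f g)
  case 0
  then show ?case
    unfolding differentiable_upto.simps by (metis differentiable_cong_open[OF assms])
next
  case (Suc n)
  have "\<forall>x\<in>U. g differentiable (at x)"
    using Suc.prems unfolding differentiable_upto.simps by (metis differentiable_cong_open[OF assms])
  moreover have "differentiable_upto n U (partial_deriv i g)" for i
  proof (rule Suc.IH)
    show "partial_deriv i f x = partial_deriv i g x" if "x \<in> U" for x
      using partial_deriv_cong[OF assms that Suc.prems(1)] .
  qed (use Suc.prems in simp)
  ultimately show ?case by simp
qed

lemma smooth_on_iff_upto:
  "smooth_on U (f :: real^2 \<Rightarrow> real) \<longleftrightarrow> (\<forall>n. differentiable_upto n U f)"
proof
  have *: "(\<forall>is. length is \<le> n \<longrightarrow> (\<forall>x\<in>U. fold partial_deriv is f differentiable (at x)))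
       \<longleftrightarrow> differentiable_upto n U f" for n f
  proof (induction n arbitrary: f)
    case (Suc n)
    have "(\<forall>is. length is \<le> Suc n \<longrightarrow> (\<forall>x\<in>U. fold partial_deriv is f differentiable (at x)))
      \<longleftrightarrow> (\<forall>x\<in>U. f differentiable (at x)) \<and>
       (\<forall>i is. length is \<le> n \<longrightarrow> (\<forall>x\<in>U. fold partial_deriv is (partial_deriv i f) differentiable (at x)))"
      (is "?L \<longleftrightarrow> ?R")
    proof
      assume L: ?L
      show ?R
      proof (intro conjI allI impI)
        show "\<forall>x\<in>U. f differentiable (at x)" using L[rule_format, of "[]"] by simp
        fix i and "is" :: "2 list" assume "length is \<le> n"
        then show "\<forall>x\<in>U. fold partial_deriv is (partial_deriv i f) differentiable (at x)"
          using L[rule_format, of "i # is"] by simp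
      qed
    next
      assume R: ?R
      show ?L
      proof (intro allI impI)
        fix "is" :: "2 list" assume "length is \<le> Suc n"
        then show "\<forall>x\<in>U. fold partial_deriv is f differentiable (at x)"
          using R by (cases "is") auto
      qed
    qed
    then show ?case using Suc by simp
  qed simp
  { assume "smooth_on U f"
    then show "\<forall>n. differentiable_upto n U f" using *[of _ f] unfolding smooth_on_def by blast }
  { assume "\<forall>n. differentiable_upto n U f"
    then show "smooth_on U f" using *[of _ f] unfolding smooth_on_def by blast }
qed

context
  fixes U :: "(real^2) set"
  assumes U: "open U"
begin

lemma differentiable_upto_const: "differentiable_upto n U (\<lambda>x. c)"
proof (induction n arbitrary: c)
  case (Suc n)
  have "partial_deriv i (\<lambda>x::real^2. c) = (\<lambda>x. 0)" for i
    using partial_deriv_eqI[OF has_derivative_const] by blast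
  then show ?case using Suc by auto
qed simp

lemma differentiable_upto_nth: "differentiable_upto n U (\<lambda>x. x $ j)"
proof -
  have d: "((\<lambda>x::real^2. x $ j) has_derivative (\<lambda>h. h $ j)) (at x)" for x
    by (rule bounded_linear_imp_has_derivative[OF bounded_linear_vec_nth])
  then have "partial_deriv i (\<lambda>x::real^2. x $ j) = (\<lambda>x. axis i 1 $ j)" for i
    using partial_deriv_eqI[OF d] by auto
  moreover have "\<forall>x\<in>U. (\<lambda>x::real^2. x $ j) differentiable (at x)" using d differentiableI by blast
  ultimately show ?thesis using differentiable_upto_const by (cases n) simp_all
qed

lemma differentiable_upto_add:
  "\<lbrakk>differentiable_upto n U f; differentiable_upto n U g\<rbrakk> \<Longrightarrow> differentiable_upto n U (\<lambda>x. f x + g x)"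
proof (induction n arbitrary: f g)
  case (Suc n)
  have "partial_deriv i f x + partial_deriv i g x = partial_deriv i (\<lambda>x. f x + g x) x" if "x \<in> U" for i x
  proof -
    have "f differentiable (at x)" "g differentiable (at x)" using Suc that by auto
    from partial_deriv_eqI[OF has_derivative_add[OF this[unfolded frechet_derivative_works]]]
    show ?thesis by (simp add: partial_deriv_def)
  qed
  moreover have "differentiable_upto n U (\<lambda>x. partial_deriv i f x + partial_deriv i g x)" for i
    using Suc.prems by (intro Suc.IH) auto
  ultimately have "differentiable_upto n U (partial_deriv i (\<lambda>x. f x + g x))" for i
    by (rule differentiable_upto_cong[OF U])
  moreover have "\<forall>x\<in>U. (\<lambda>x. f x + g x) differentiable (at x)"
    using Suc.prems by (auto intro!: differentiable_add)
  ultimately show ?case by simp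
qed auto

lemma differentiable_upto_mult:
  "\<lbrakk>differentiable_upto n U f; differentiable_upto n U g\<rbrakk> \<Longrightarrow> differentiable_upto n U (\<lambda>x. f x * g x)"
proof (induction n arbitrary: f g)
  case (Suc n)
  have "f x * partial_deriv i g x + partial_deriv i f x * g x = partial_deriv i (\<lambda>x. f x * g x) x" if "x \<in> U" for i x
  proof -
    have "f differentiable (at x)" "g differentiable (at x)" using Suc that by auto
    from partial_deriv_eqI[OF has_derivative_mult[OF this[unfolded frechet_derivative_works]]]
    show ?thesis by (simp add: partial_deriv_def)
  qed
  moreover have "differentiable_upto n U (\<lambda>x. f x * partial_deriv i g x + partial_deriv i f x * g x)" for i
    using Suc.prems differentiable_upto_Suc[OF Suc.prems(1)] differentiable_upto_Suc[OF Suc.prems(2)]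
    by (intro differentiable_upto_add Suc.IH) simp_all
  ultimately have "differentiable_upto n U (partial_deriv i (\<lambda>x. f x * g x))" for i
    by (rule differentiable_upto_cong[OF U])
  moreover have "\<forall>x\<in>U. (\<lambda>x. f x * g x) differentiable (at x)"
    using Suc.prems by (auto intro!: differentiable_mult)
  ultimately show ?case by simp
qed auto

text \<open>The chain rule replaces \<open>D k\<close> by \<open>D (Suc k)\<close> times a
  derivative of the inner function, so the induction has to treat all members of the chain
  \<open>D\<close> at once. The set T confines the argument to where \<open>D\<close> really is a
  chain of derivatives, as needed for logarithms and powers.\<close>

lemma differentiable_upto_compose:
  assumes D: "\<And>k t. t \<in> T \<Longrightarrow> (D k has_real_derivative D (Suc k) t) (at t)"
    and f: "\<And>x. x \<in> U \<Longrightarrow> f x \<in> T"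
  shows "differentiable_upto n U f \<Longrightarrow> differentiable_upto n U (\<lambda>x. D k (f x))"
proof (induction n arbitrary: k)
  have d: "((\<lambda>x. D k (f x)) has_derivative (\<lambda>h. D (Suc k) (f x) * frechet_derivative f (at x) h)) (at x)"
    if "x \<in> U" "f differentiable (at x)" for x k
    using has_derivative_compose[OF that(2)[unfolded frechet_derivative_works], of "D k"]
      D[OF f[OF that(1)], unfolded has_field_derivative_def] by blast
  { case 0
    then show ?case using d unfolding differentiable_upto.simps differentiable_def by blast }
  case (Suc n)
  have "D (Suc k) (f x) * partial_deriv i f x = partial_deriv i (\<lambda>x. D k (f x)) x" if "x \<in> U" for i x
    using partial_deriv_eqI[OF d[OF that]] Suc.prems that by (auto simp: partial_deriv_def)
  moreover have "differentiable_upto n U (\<lambda>x. D (Suc k) (f x) * partial_deriv i f x)" for i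
    using Suc.prems Suc.IH[OF differentiable_upto_Suc[OF Suc.prems]]
    by (intro differentiable_upto_mult) simp_all
  ultimately have "differentiable_upto n U (partial_deriv i (\<lambda>x. D k (f x)))" for i
    by (rule differentiable_upto_cong[OF U])
  moreover have "\<forall>x\<in>U. (\<lambda>x. D k (f x)) differentiable (at x)"
    using d Suc.prems unfolding differentiable_upto.simps by (metis differentiableI)
  ultimately show ?case by simp
qed

lemma smooth_on_const: "smooth_on U (\<lambda>x. c::real)"
  and smooth_on_nth: "smooth_on U (\<lambda>x. x $ j)"
  and smooth_on_add: "\<lbrakk>smooth_on U f; smooth_on U g\<rbrakk> \<Longrightarrow> smooth_on U (\<lambda>x. f x + g x :: real)"
  and smooth_on_mult: "\<lbrakk>smooth_on U f; smooth_on U g\<rbrakk> \<Longrightarrow> smooth_on U (\<lambda>x. f x * g x :: real)"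
  by (simp_all add: smooth_on_iff_upto differentiable_upto_const differentiable_upto_nth
      differentiable_upto_add differentiable_upto_mult)

lemma smooth_on_compose:
  assumes "\<And>k t. t \<in> T \<Longrightarrow> (D k has_real_derivative D (Suc k) t) (at t)"
    and "\<And>x. x \<in> U \<Longrightarrow> f x \<in> T" "smooth_on U f"
  shows "smooth_on U (\<lambda>x. D k (f x))"
  using differentiable_upto_compose[where D=D and T=T and f=f] assms by (simp add: smooth_on_iff_upto)

lemma smooth_on_cong:
  assumes "\<And>x. x \<in> U \<Longrightarrow> f x = g x" "smooth_on U f"
  shows "smooth_on U (g :: real^2 \<Rightarrow> real)"
  using differentiable_upto_cong[OF U assms(1)] assms(2) by (auto simp: smooth_on_iff_upto)

lemma smooth_on_uminus: "smooth_on U f \<Longrightarrow> smooth_on U (\<lambda>x. - f x :: real)"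
  using smooth_on_mult[OF smooth_on_const[of "-1"]] by (simp add: mult_minus_left)

lemma smooth_on_diff: "\<lbrakk>smooth_on U f; smooth_on U g\<rbrakk> \<Longrightarrow> smooth_on U (\<lambda>x. f x - g x :: real)"
  using smooth_on_add[OF _ smooth_on_uminus, of f g] by simp

lemma smooth_on_ln:
  fixes f :: "real^2 \<Rightarrow> real"
  assumes "smooth_on U f" "\<And>x. x \<in> U \<Longrightarrow> f x > 0"
  shows "smooth_on U (\<lambda>x. ln (f x))"
proof -
  \<comment> \<open>From the first derivative on, the chain of the logarithm consists of powers; the
    derivative of order k has coefficient (-1)(-2)...(-(k-1)), which is
    \<open>c (k-1)\<close>.\<close>
  define c where "c k = (\<Prod>i<k. - real (Suc i))" for k
  define D where "D k t = (if k = 0 then ln t else c (k-1) * t powr (- real k))" for k t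
  have "(D k has_real_derivative D (Suc k) t) (at t)" if "t \<in> {0<..}" for k t
  proof (cases "k = 0")
    case True
    have "D k = ln" using True by (auto simp: D_def)
    moreover have "D (Suc k) t = 1 / t" using True that by (simp add: D_def c_def powr_minus field_simps)
    ultimately show ?thesis using that by (auto intro!: derivative_eq_intros)
  next
    case False
    then obtain m where k: "k = Suc m" by (cases k) auto
    have "D k = (\<lambda>t. c m * t powr (- real k))" using k by (auto simp: D_def)
    moreover have "D (Suc k) t = c m * (- real k * t powr (- real k - 1))"
      using k by (simp add: D_def c_def algebra_simps)
    ultimately show ?thesis using that by (auto intro!: derivative_eq_intros)
  qed
  from smooth_on_compose[of "{0<..}" D f 0, OF this] assms show ?thesis by (simp add: D_def)
qed

lemma smooth_on_powr:
  fixes f :: "real^2 \<Rightarrow> real"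
  assumes "smooth_on U f" "\<And>x. x \<in> U \<Longrightarrow> f x > 0"
  shows "smooth_on U (\<lambda>x. f x powr p)"
proof -
  define D where "D k t = (\<Prod>i<k. p - real i) * t powr (p - real k)" for k t
  have "(D k has_real_derivative D (Suc k) t) (at t)" if "t \<in> {0<..}" for k t
    unfolding D_def using that by (auto intro!: derivative_eq_intros simp: algebra_simps)
  from smooth_on_compose[of "{0<..}" D f 0, OF this] assms show ?thesis by (simp add: D_def)
qed

end

lemma smooth_on_differentiable: "smooth_on U f \<Longrightarrow> x \<in> U \<Longrightarrow> f differentiable (at x)"
  unfolding smooth_on_def by (metis fold_simps(1))

lemma smooth_on_partial_deriv: "smooth_on U f \<Longrightarrow> smooth_on U (partial_deriv i f)"
  unfolding smooth_on_def by (metis fold_simps(2))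

lemma smooth_on_Un: "smooth_on U f \<Longrightarrow> smooth_on V f \<Longrightarrow> smooth_on (U \<union> V) f"
  unfolding smooth_on_def by blast

lemma smooth_on_isCont: "smooth_on U f \<Longrightarrow> x \<in> U \<Longrightarrow> isCont f x"
  using smooth_on_differentiable differentiable_imp_continuous_within by blast

lemma smooth_on_continuous_on: "smooth_on U f \<Longrightarrow> continuous_on U f"
  using smooth_on_isCont continuous_at_imp_continuous_on by blast

text \<open>Partial derivatives of convolutions and of dilated functions are again of the same form.
  For such families smoothness follows from mere differentiability of all members and closure under
  partial derivatives, up to equality on U.\<close>

lemma smooth_on_coinduct:
  fixes f :: "real^2 \<Rightarrow> real"
  assumes U: "open U" and f: "f \<in> S"
    and d: "\<And>f x. f \<in> S \<Longrightarrow> x \<in> U \<Longrightarrow> f differentiable (at x)"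
    and p: "\<And>f i. f \<in> S \<Longrightarrow> \<exists>g\<in>S. \<forall>x\<in>U. partial_deriv i f x = g x"
  shows "smooth_on U f"
proof -
  have "differentiable_upto n U f" if "f \<in> S" for n f
    using that
  proof (induction n arbitrary: f)
    case (Suc n)
    have "differentiable_upto n U (partial_deriv i f)" for i
    proof -
      obtain g where "g \<in> S" "\<forall>x\<in>U. partial_deriv i f x = g x" using p[OF Suc.prems] by blast
      then show ?thesis using Suc.IH[of g] differentiable_upto_cong[OF U, of g "partial_deriv i f"] by auto
    qed
    then show ?case using d Suc by auto
  qed (use d in auto)
  then show ?thesis using f by (simp add: smooth_on_iff_upto)
qed

section \<open>Rules for partial derivatives\<close>

lemma partial_deriv_diff:
  assumes "f differentiable (at x)" "g differentiable (at x)"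
  shows "partial_deriv i (\<lambda>x. f x - g x) x = partial_deriv i f x - partial_deriv i g x"
  using partial_deriv_eqI[OF has_derivative_diff[OF assms[unfolded frechet_derivative_works]]]
  by (simp add: partial_deriv_def)

lemma partial_deriv_cmult:
  fixes f :: "real^2 \<Rightarrow> real"
  assumes "f differentiable (at x)"
  shows "partial_deriv i (\<lambda>x. c * f x) x = c * partial_deriv i f x"
  using partial_deriv_eqI[OF has_derivative_mult_right[OF assms[unfolded frechet_derivative_works], of c]]
  by (simp add: partial_deriv_def)

lemma partial_deriv_scale:
  fixes f :: "real^2 \<Rightarrow> real"
  assumes "f differentiable (at (c *\<^sub>R x))"
  shows "partial_deriv i (\<lambda>x. f (c *\<^sub>R x)) x = c * partial_deriv i f (c *\<^sub>R x)"
    "(\<lambda>x. f (c *\<^sub>R x)) differentiable (at x)"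
proof -
  have d: "(f has_derivative frechet_derivative f (at (c *\<^sub>R x))) (at (c *\<^sub>R x))"
    using assms frechet_derivative_works by blast
  have "((\<lambda>x. c *\<^sub>R x) has_derivative (\<lambda>h. c *\<^sub>R h)) (at x)"
    by (rule bounded_linear_imp_has_derivative) (rule bounded_linear_scaleR_right)
  from has_derivative_compose[OF this d]
  have e: "((\<lambda>x. f (c *\<^sub>R x)) has_derivative (\<lambda>h. frechet_derivative f (at (c *\<^sub>R x)) (c *\<^sub>R h))) (at x)" .
  then show "(\<lambda>x. f (c *\<^sub>R x)) differentiable (at x)" by (auto simp: differentiable_def)
  show "partial_deriv i (\<lambda>x. f (c *\<^sub>R x)) x = c * partial_deriv i f (c *\<^sub>R x)"
    using partial_deriv_eqI[OF e] linear_cmul[OF has_derivative_linear[OF d]]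
    by (simp add: partial_deriv_def)
qed

lemma partial_deriv_zero_outside:
  fixes f :: "real^2 \<Rightarrow> real"
  assumes "x \<notin> closure {x. f x \<noteq> 0}"
  shows "partial_deriv i f x = 0"
proof -
  let ?U = "- closure {x. f x \<noteq> 0}"
  have "f y = 0" if "y \<in> ?U" for y using that closure_subset[of "{x. f x \<noteq> 0}"] by blast
  then have "partial_deriv i f x = partial_deriv i (\<lambda>x. 0) x"
    by (rule partial_deriv_cong[OF open_Compl[OF closed_closure] Compl_iff[THEN iffD2, OF assms]])
  also have "\<dots> = 0" using partial_deriv_eqI[OF has_derivative_const, of i 0 x] by simp
  finally show ?thesis .
qed

section \<open>Polar coordinates\<close>

definition polar :: "real \<Rightarrow> real \<Rightarrow> real^2" where
  "polar r t = vector [r * cos t, r * sin t]"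

lemma polar_nth [simp]: "polar r t $ 1 = r * cos t" "polar r t $ 2 = r * sin t"
  by (simp_all add: polar_def)

lemma norm_vec2: "norm (x::real^2) = sqrt ((x$1)\<^sup>2 + (x$2)\<^sup>2)"
  by (simp add: norm_eq_sqrt_inner inner_vec_def sum_2 power2_eq_square)

lemma norm_polar [simp]: "norm (polar r t) = \<bar>r\<bar>"
proof -
  have "(r * cos t)\<^sup>2 + (r * sin t)\<^sup>2 = r\<^sup>2 * ((cos t)\<^sup>2 + (sin t)\<^sup>2)" by algebra
  then show ?thesis by (simp add: norm_vec2)
qed

lemma polar_nonzero: "r \<noteq> 0 \<Longrightarrow> polar r t \<noteq> 0"
  using norm_polar[of r t] by (metis abs_0_eq norm_zero)

lemma polar_exists:
  assumes "x \<noteq> (0::real^2)"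
  obtains t where "0 \<le> t" "t < 2*pi" "x = polar (norm x) t"
proof -
  have n: "norm x > 0" using assms by simp
  have "(x$1 / norm x)\<^sup>2 + (x$2 / norm x)\<^sup>2 = ((x$1)\<^sup>2 + (x$2)\<^sup>2) / (norm x)\<^sup>2"
    by (simp add: power_divide add_divide_distrib)
  also have "(x$1)\<^sup>2 + (x$2)\<^sup>2 = (norm x)\<^sup>2" by (simp add: norm_vec2)
  also have "(norm x)\<^sup>2 / (norm x)\<^sup>2 = 1" using n by simp
  finally obtain t where t: "0 \<le> t" "t < 2*pi" "x$1 / norm x = cos t" "x$2 / norm x = sin t"
    by (metis sincos_total_2pi)
  have "x$1 = norm x * cos t" "x$2 = norm x * sin t"
    unfolding t(3,4)[symmetric] using assms by simp_all
  then have "x = polar (norm x) t" unfolding vec_eq_iff forall_2 polar_nth by blast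
  then show ?thesis using t that by blast
qed

lemma polar_inj:
  assumes "0 < r" "0 < s" "t \<in> {0..<2*pi}" "u \<in> {0..<2*pi}" "polar r t = polar s u"
  shows "r = s \<and> t = u"
proof -
  have "r = s" using arg_cong[OF assms(5), of norm] assms(1,2) by simp
  moreover have "cos t = cos u" "sin t = sin u"
    using arg_cong[OF assms(5), of "\<lambda>x. x$1"] arg_cong[OF assms(5), of "\<lambda>x. x$2"] \<open>r = s\<close> assms(1) by auto
  then obtain k :: int where k: "t = u + 2 * pi * k" using sin_cos_eq_iff[of t u] by auto
  have "\<bar>2 * pi * real_of_int k\<bar> < 2 * pi * 1" using assms(3,4) k by auto
  then have "\<bar>real_of_int k\<bar> < 1" by (simp add: abs_mult)
  then have "k = 0" by linarith
  ultimately show ?thesis using k by simp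
qed

section \<open>Lebesgue measure in polar coordinates\<close>

lemma vector2_eq: "(vector [s, t] :: real^2) = s *\<^sub>R axis 1 1 + t *\<^sub>R axis 2 1"
  by (simp add: vec_eq_iff forall_2 axis_def)

lemma continuous_polar: "continuous_on A (\<lambda>p. polar (fst p) (snd p))"
  unfolding polar_def vector2_eq by (intro continuous_intros)

lemma vec2_measurable [measurable]: "(\<lambda>p. vector [fst p, snd p] :: real^2) \<in> borel_measurable borel"
  unfolding vector2_eq by (intro borel_measurable_continuous_onI continuous_intros)

text \<open>The change of variables theorem lives on \<open>real^2\<close>, Fubini on pairs of
  reals; this image formula carries integrals from one to the other. Boxes determine Lebesgue
  measure, so it is checked on boxes.\<close>

lemma lborel_vec2: "lborel = distr (lborel \<Otimes>\<^sub>M lborel) borel (\<lambda>p. vector [fst p, snd p] :: real^2)"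
proof (rule lborel_eqI)
  fix l u :: "real^2" assume le: "\<And>b. b \<in> Basis \<Longrightarrow> l \<bullet> b \<le> u \<bullet> b"
  have le': "l$1 \<le> u$1" "l$2 \<le> u$2" using le[of "axis 1 1"] le[of "axis 2 1"]
    by (auto simp: inner_axis axis_in_Basis_iff)
  have "(\<lambda>p. vector [fst p, snd p]) -` box l u = box (l$1) (u$1) \<times> box (l$2) (u$2)"
    by (auto simp: mem_box_cart forall_2 mem_box)
  then have "emeasure (distr (lborel \<Otimes>\<^sub>M lborel) borel (\<lambda>p. vector [fst p, snd p] :: real^2)) (box l u)
     = emeasure (lborel \<Otimes>\<^sub>M lborel) (box (l$1) (u$1) \<times> box (l$2) (u$2))"
    by (subst emeasure_distr) (auto simp: lborel_prod space_pair_measure intro!: measurable_compose[OF _ vec2_measurable])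
  also have "\<dots> = ennreal ((u$1-l$1) * (u$2-l$2))"
    using le' by (subst lborel.emeasure_pair_measure_Times) (auto simp: ennreal_mult[symmetric])
  also have "(u$1-l$1) * (u$2-l$2) = prod ((\<bullet>) (u - l)) Basis"
  proof -
    have B: "(Basis :: (real^2) set) = {axis 1 1, axis 2 1}"
      by (auto simp: Basis_vec_def UNIV_2)
    have "axis 1 (1::real) \<noteq> (axis 2 1 :: real^2)" by (simp add: axis_eq_axis)
    then show ?thesis unfolding B by (simp add: inner_axis)
  qed
  finally show "emeasure (distr (lborel \<Otimes>\<^sub>M lborel) borel (\<lambda>p. vector [fst p, snd p] :: real^2)) (box l u)
     = ennreal (prod ((\<bullet>) (u - l)) Basis)" .
qed simp

definition polar_dom :: "(real \<times> real) set" where "polar_dom = {0<..} \<times> {0..<2*pi}"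

lemma sets_lborel_pair: "sets (lborel \<Otimes>\<^sub>M lborel) = sets (borel :: (real \<times> real) measure)"
  by (metis lborel_prod sets_lborel)

lemma polar_dom_meas: "polar_dom \<in> sets borel"
proof -
  have "polar_dom \<in> sets (borel \<Otimes>\<^sub>M borel)" unfolding polar_dom_def by (rule pair_measureI) simp_all
  then show ?thesis by (metis borel_prod)
qed

lemma polar_measurable [measurable]: "(\<lambda>p. polar (fst p) (snd p)) \<in> borel_measurable borel"
  using continuous_polar by (rule borel_measurable_continuous_onI)

text \<open>The measure formula for images under injective differentiable maps, with Jacobian
  determinant r. The half-open range of angles makes the map injective, and its image misses only
  the origin, a null set. Bounded sets are enough, because the formula is later used for boxes
  only.\<close>

lemma polar_change_of_variables:
  fixes B :: "(real^2) set"
  assumes B: "B \<in> sets borel" "bounded B"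
  shows "emeasure lborel B = (\<integral>\<^sup>+(p::real^2). ennreal (p$1) * indicator {p. 0 < p$1 \<and> 0 \<le> p$2 \<and> p$2 < 2*pi} p
            * indicator B (polar (p$1) (p$2)) \<partial>lborel)"
proof -
  define S where "S = {p::real^2. 0 < p$1 \<and> 0 \<le> p$2 \<and> p$2 < 2*pi}"
  define g where "g p = polar (p$1) (p$2)" for p :: "real^2"
  define g' where "g' p h = (vector [cos (p$2) * h$1 - p$1 * sin (p$2) * h$2,
      sin (p$2) * h$1 + p$1 * cos (p$2) * h$2] :: real^2)" for p h :: "real^2"
  have Sb[measurable]: "S \<in> sets borel" unfolding S_def by measurable
  have gm[measurable]: "g \<in> borel_measurable borel"
    unfolding g_def polar_def vector2_eq by (intro borel_measurable_continuous_onI continuous_intros)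
  have vecder: "((\<lambda>p. vector [a p, b p] :: real^2) has_derivative (\<lambda>h. vector [a' h, b' h])) F"
    if "(a has_derivative a') F" "(b has_derivative b') F" for a b :: "real^2 \<Rightarrow> real" and a' b' F
  proof -
    show ?thesis unfolding vector2_eq using that by (auto intro!: derivative_eq_intros)
  qed
  have nthd: "((\<lambda>p::real^2. p $ i) has_derivative (\<lambda>h. h $ i)) F" for i F
    by (rule bounded_linear_imp_has_derivative[OF bounded_linear_vec_nth])
  have der: "(g has_derivative g' p) (at p within S)" for p
    unfolding g_def g'_def polar_def
    by (rule vecder) (auto intro!: derivative_eq_intros nthd simp: algebra_simps)
  have inj: "inj_on g S"
  proof (rule inj_onI)
    fix p q assume "p \<in> S" "q \<in> S" "g p = g q"
    then have "p$1 = q$1 \<and> p$2 = q$2" by (intro polar_inj) (auto simp: S_def g_def)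
    then show "p = q" by (simp add: vec_eq_iff forall_2)
  qed
  have img: "g ` S = - {0}"
  proof
    show "g ` S \<subseteq> - {0}" 
    proof
      fix y assume "y \<in> g ` S"
      then obtain p where "p \<in> S" "y = g p" by blast
      then have "norm y > 0" by (simp add: g_def S_def)
      then show "y \<in> - {0}" by auto
    qed
    show "- {0} \<subseteq> g ` S"
    proof
      fix x :: "real^2" assume "x \<in> - {0}"
      then obtain t where "0 \<le> t" "t < 2*pi" "x = polar (norm x) t" "norm x > 0" using polar_exists[of x] by auto
      then have "x = g (vector [norm x, t])" "vector [norm x, t] \<in> S" by (auto simp: g_def S_def)
      then show "x \<in> g ` S" by blast
    qed
  qed
  have lin: "linear (g' p)" for p
    using der has_derivative_linear by blast
  have det: "\<bar>det (matrix (g' p))\<bar> = p$1" if "p \<in> S" for p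
  proof -
    have "det (matrix (g' p)) = p$1 * ((cos (p$2))\<^sup>2 + (sin (p$2))\<^sup>2)"
      by (simp add: det_2 matrix_def g'_def axis_def algebra_simps power2_eq_square del: sin_cos_squared_add3)
    then show ?thesis using that by (simp add: S_def)
  qed
  define S' where "S' = S \<inter> g -` (B - {0})"
  have S'[measurable]: "S' \<in> sets borel" 
    unfolding S'_def using measurable_sets[OF gm, of "B - {0}"] B by auto
  have "g ` S' = B - {0}"
  proof
    show "g ` S' \<subseteq> B - {0}" unfolding S'_def by auto
    show "B - {0} \<subseteq> g ` S'"
    proof
      fix y assume y: "y \<in> B - {0}"
      then have "y \<in> g ` S" unfolding img by simp
      then obtain p where "p \<in> S" "y = g p" by (rule imageE) simp
      then show "y \<in> g ` S'" using y unfolding S'_def by simp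
    qed
  qed
  moreover have B0: "B - {0} \<in> sets borel" using B(1) by (intro sets.Diff) simp_all
  have bd: "bounded (B - {0})" using bounded_subset[OF B(2) Diff_subset] .
  have "B - {0} \<in> lmeasurable"
    using B0 by (intro bounded_set_imp_lmeasurable bd) (simp add: sets_completionI_sets)
  moreover have "measure lebesgue (B - {0}) = measure lborel (B - {0})"
    using B0 by (intro measure_completion) simp
  ultimately have "((\<lambda>x. \<bar>det (matrix (g' x))\<bar>) has_integral (measure lborel (B - {0}))) S'"
    using has_measure_differentiable_image[of S' g g' "measure lborel (B - {0})"]
      has_derivative_subset[OF der, of S'] inj_on_subset[OF inj, of S']
    using S' unfolding S'_def by (simp add: sets_completionI_sets)
  then have "((\<lambda>p. p$1) has_integral (measure lborel (B - {0}))) S'"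
    by (rule has_integral_eq[rotated]) (auto simp: S'_def det)
  then have "(\<integral>\<^sup>+p. ennreal (p$1) * indicator S' p \<partial>lborel) = ennreal (measure lborel (B - {0}))"
    by (intro nn_integral_has_integral_lebesgue') (auto simp: S'_def S_def)
  also have "\<dots> = emeasure lborel (B - {0})"
    using emeasure_bounded_finite[OF bd] by (intro emeasure_eq_ennreal_measure[symmetric]) simp
  also have "\<dots> = emeasure lborel B"
    using B(1) by (intro emeasure_Diff_null_set finite_imp_null_set_lborel) simp_all
  also have "(\<integral>\<^sup>+p. ennreal (p$1) * indicator S' p \<partial>lborel) = (\<integral>\<^sup>+p. ennreal (p$1) * indicator S p
            * indicator B (g p) \<partial>lborel)"
  proof (intro nn_integral_cong)
    fix p
    have "p \<in> S \<Longrightarrow> g p \<noteq> 0" using imageI[of p S g] unfolding img by simp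
    then show "ennreal (p$1) * indicator S' p = ennreal (p$1) * indicator S p * indicator B (g p)"
      by (auto simp: S'_def indicator_def)
  qed
  finally show ?thesis by (simp add: S_def g_def)
qed

definition polar_measure :: "(real \<times> real) measure" where
  "polar_measure = density (lborel \<Otimes>\<^sub>M lborel) (\<lambda>p. ennreal (fst p) * indicator polar_dom p)"

lemma sets_polar_measure [measurable_cong, simp]: "sets polar_measure = sets borel"
  unfolding polar_measure_def sets_density by (rule sets_lborel_pair)

text \<open>Writing Lebesgue measure as an image measure gives the polar formula for nonnegative
  integrals and for Bochner integrals at once.\<close>

lemma lborel_polar: "lborel = distr polar_measure borel (\<lambda>p. polar (fst p) (snd p))"
proof (rule lborel_eqI)
  fix l u :: "real^2" assume le: "\<And>b. b \<in> Basis \<Longrightarrow> l \<bullet> b \<le> u \<bullet> b"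
  have [measurable]: "(\<lambda>p. polar (fst p) (snd p)) \<in> polar_measure \<rightarrow>\<^sub>M borel"
     "(\<lambda>p. polar (fst p) (snd p)) \<in> lborel \<Otimes>\<^sub>M lborel \<rightarrow>\<^sub>M borel"
     "polar_dom \<in> sets (lborel \<Otimes>\<^sub>M lborel)"
    using polar_measurable polar_dom_meas
    by (simp_all only: sets_lborel_pair measurable_cong_sets[OF sets_lborel_pair refl]
        measurable_cong_sets[OF sets_polar_measure refl])
  have [measurable]: "(\<lambda>p. vector [fst p, snd p] :: real^2) \<in> lborel \<Otimes>\<^sub>M lborel \<rightarrow>\<^sub>M borel"
    using vec2_measurable by (simp only: measurable_cong_sets[OF sets_lborel_pair refl])
  let ?f = "\<lambda>p::real^2. ennreal (p$1) * indicator {p. 0 < p$1 \<and> 0 \<le> p$2 \<and> p$2 < 2*pi} p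
            * indicator (box l u) (polar (p$1) (p$2))"
  have "emeasure (distr polar_measure borel (\<lambda>p. polar (fst p) (snd p))) (box l u)
    = (\<integral>\<^sup>+p. indicator (box l u) (polar (fst p) (snd p)) \<partial>polar_measure)"
    by (subst nn_integral_indicator[symmetric], simp, subst nn_integral_distr) auto
  also have "\<dots> = (\<integral>\<^sup>+p. (ennreal (fst p) * indicator polar_dom p) * indicator (box l u) (polar (fst p) (snd p)) \<partial>(lborel \<Otimes>\<^sub>M lborel))"
    unfolding polar_measure_def by (subst nn_integral_density) auto
  also have "\<dots> = (\<integral>\<^sup>+p. ?f p \<partial>distr (lborel \<Otimes>\<^sub>M lborel) borel (\<lambda>p. vector [fst p, snd p] :: real^2))"
  proof -
    have "(\<lambda>p::real^2. polar (p$1) (p$2)) \<in> borel_measurable borel"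
      unfolding polar_def vector2_eq by (intro borel_measurable_continuous_onI continuous_intros)
    then have fm: "?f \<in> borel_measurable borel" by measurable
    show ?thesis
      by (subst nn_integral_distr, simp, simp add: fm) (auto simp: polar_dom_def indicator_def intro!: nn_integral_cong)
  qed
  also have "\<dots> = emeasure lborel (box l u)"
    unfolding lborel_vec2[symmetric] by (rule polar_change_of_variables[symmetric]) simp_all
  also have "\<dots> = ennreal (prod ((\<bullet>) (u - l)) Basis)" using le by (simp add: emeasure_lborel_box)
  finally show "emeasure (distr polar_measure borel (\<lambda>p. polar (fst p) (snd p))) (box l u)
     = ennreal (prod ((\<bullet>) (u - l)) Basis)" .
qed simp

lemma polar_density_measurable [measurable]:
  "(\<lambda>p. polar (fst p) (snd p)) \<in> lborel \<Otimes>\<^sub>M lborel \<rightarrow>\<^sub>M borel"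
  "polar_dom \<in> sets (lborel \<Otimes>\<^sub>M lborel)"
  "(\<lambda>p. polar (fst p) (snd p)) \<in> polar_measure \<rightarrow>\<^sub>M borel"
  using polar_measurable polar_dom_meas
  by (simp_all only: sets_lborel_pair measurable_cong_sets[OF sets_lborel_pair refl]
      measurable_cong_sets[OF sets_polar_measure refl])

lemma nn_integral_polar:
  assumes [measurable]: "f \<in> borel_measurable borel"
  shows "(\<integral>\<^sup>+x. f x \<partial>lborel) = (\<integral>\<^sup>+r. \<integral>\<^sup>+t. ennreal r * indicator {0<..} r * indicator {0..<2*pi} t * f (polar r t) \<partial>lborel \<partial>lborel)"
proof -
  have "(\<integral>\<^sup>+x. f x \<partial>lborel) = (\<integral>\<^sup>+p. f (polar (fst p) (snd p)) \<partial>polar_measure)"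
    by (subst lborel_polar, subst nn_integral_distr) auto
  also have "\<dots> = (\<integral>\<^sup>+p. ennreal (fst p) * indicator polar_dom p * f (polar (fst p) (snd p)) \<partial>(lborel \<Otimes>\<^sub>M lborel))"
    unfolding polar_measure_def by (subst nn_integral_density) auto
  also have "\<dots> = (\<integral>\<^sup>+r. \<integral>\<^sup>+t. ennreal (fst (r,t)) * indicator polar_dom (r,t) * f (polar (fst (r,t)) (snd (r,t))) \<partial>lborel \<partial>lborel)"
    by (rule lborel.nn_integral_fst[symmetric]) measurable
  also have "\<dots> = (\<integral>\<^sup>+r. \<integral>\<^sup>+t. ennreal r * indicator {0<..} r * indicator {0..<2*pi} t * f (polar r t) \<partial>lborel \<partial>lborel)"
    by (intro nn_integral_cong) (auto simp: polar_dom_def indicator_def)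
  finally show ?thesis .
qed

lemma integral_polar:
  fixes f :: "real^2 \<Rightarrow> real"
  assumes f: "integrable lborel f"
  shows "integrable (lborel \<Otimes>\<^sub>M lborel) (\<lambda>p. fst p * indicator polar_dom p * f (polar (fst p) (snd p)))"
    "(LINT x|lborel. f x) = (LINT p|(lborel \<Otimes>\<^sub>M lborel). fst p * indicator polar_dom p * f (polar (fst p) (snd p)))"
proof -
  have [measurable]: "f \<in> borel_measurable borel" using f by simp
  have e: "polar_measure = density (lborel \<Otimes>\<^sub>M lborel) (\<lambda>p. ennreal (fst p * indicator polar_dom p))"
    unfolding polar_measure_def by (intro density_cong AE_I2) (auto simp: indicator_def)
  have nn: "AE p in lborel \<Otimes>\<^sub>M lborel. 0 \<le> fst p * indicator polar_dom p"
    by (intro AE_I2) (auto simp: polar_dom_def indicator_def)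
  have "integrable polar_measure (\<lambda>p. f (polar (fst p) (snd p)))"
    using f by (subst (asm) lborel_polar, subst (asm) integrable_distr_eq) auto
  then show "integrable (lborel \<Otimes>\<^sub>M lborel) (\<lambda>p. fst p * indicator polar_dom p * f (polar (fst p) (snd p)))"
    unfolding e by (subst (asm) integrable_real_density) (use nn in auto)
  have "(LINT x|lborel. f x) = (LINT p|polar_measure. f (polar (fst p) (snd p)))"
    by (subst lborel_polar, subst integral_distr) auto
  also have "\<dots> = (LINT p|(lborel \<Otimes>\<^sub>M lborel). fst p * indicator polar_dom p * f (polar (fst p) (snd p)))"
    unfolding e by (subst integral_real_density) (use nn in auto)
  finally show "(LINT x|lborel. f x) = (LINT p|(lborel \<Otimes>\<^sub>M lborel). fst p * indicator polar_dom p * f (polar (fst p) (snd p)))" .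
qed

section \<open>Derivatives along curves and symmetry of mixed derivatives\<close>

lemma has_real_derivative_curve:
  fixes f :: "real^2 \<Rightarrow> real"
  assumes c: "(c has_vector_derivative v) (at s)" and f: "f differentiable (at (c s))"
  shows "((\<lambda>s. f (c s)) has_real_derivative (v$1 * partial_deriv 1 f (c s) + v$2 * partial_deriv 2 f (c s))) (at s)"
proof -
  have "((\<lambda>s. f (c s)) has_derivative (\<lambda>h. (h *\<^sub>R v)$1 *\<^sub>R partial_deriv 1 f (c s) + (h *\<^sub>R v)$2 *\<^sub>R partial_deriv 2 f (c s))) (at s)"
    using has_derivative_compose[OF c[unfolded has_vector_derivative_def] has_derivative_partials[OF f]] .
  then show ?thesis unfolding has_field_derivative_def
    by (rule has_derivative_eq_rhs) (auto simp: algebra_simps fun_eq_iff)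
qed

lemma has_real_derivative_axis:
  fixes f :: "real^2 \<Rightarrow> real"
  assumes f: "f differentiable (at (y + s *\<^sub>R axis i 1))"
  shows "((\<lambda>s. f (y + s *\<^sub>R axis i 1)) has_real_derivative partial_deriv i f (y + s *\<^sub>R axis i 1)) (at s)"
proof -
  have c: "((\<lambda>s. y + s *\<^sub>R axis i 1) has_vector_derivative axis i 1) (at s)"
    by (auto intro!: derivative_eq_intros)
  have "i = 1 \<or> i = 2" using exhaust_2 by blast
  then show ?thesis using has_real_derivative_curve[OF c f] by (auto simp: axis_def)
qed

lemma polar_vector_derivatives:
  "((\<lambda>r. polar r t) has_vector_derivative vector [cos t, sin t]) (at r)"
  "((\<lambda>t. polar r t) has_vector_derivative vector [- r * sin t, r * cos t]) (at t)"
  unfolding polar_def vector2_eq has_vector_derivative_def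
  by (auto intro!: derivative_eq_intros simp: algebra_simps fun_eq_iff)

lemma has_real_derivative_polar:
  fixes f :: "real^2 \<Rightarrow> real"
  assumes f: "f differentiable (at (polar r t))"
  shows "((\<lambda>r. f (polar r t)) has_real_derivative (cos t * partial_deriv 1 f (polar r t) + sin t * partial_deriv 2 f (polar r t))) (at r)"
    "((\<lambda>t. f (polar r t)) has_real_derivative (r * (cos t * partial_deriv 2 f (polar r t) - sin t * partial_deriv 1 f (polar r t)))) (at t)"
  using has_real_derivative_curve[OF polar_vector_derivatives(1)[of t r], of f] f
    has_real_derivative_curve[OF polar_vector_derivatives(2)[of r t], of f]
  by (simp_all add: algebra_simps)

text \<open>Two applications of the mean value theorem: in direction i to the increment in direction
  j, and then in direction j to \<open>partial_deriv i f\<close>. The second difference on the left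
  is symmetric in i and j, which is the reason for stating it.\<close>

lemma mixed_difference_mvt:
  fixes f :: "real^2 \<Rightarrow> real"
  assumes sm: "smooth_on U f" and U: "cball x (2*h) \<subseteq> U" and h: "h > 0"
  shows "\<exists>p\<in>cball x (2*h). f (x + h *\<^sub>R axis i 1 + h *\<^sub>R axis j 1) - f (x + h *\<^sub>R axis i 1) - f (x + h *\<^sub>R axis j 1) + f x
      = h * h * partial_deriv j (partial_deriv i f) p"
proof -
  have inU: "x + s *\<^sub>R axis i 1 + t *\<^sub>R axis j 1 \<in> cball x (2*h)" if "0 \<le> s" "s \<le> h" "0 \<le> t" "t \<le> h" for s t
  proof -
    have "norm (s *\<^sub>R axis i 1 + t *\<^sub>R axis j (1::real)) \<le> norm (s *\<^sub>R axis i (1::real)) + norm (t *\<^sub>R axis j (1::real))"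
      by (rule norm_triangle_ineq)
    also have "\<dots> \<le> 2 * h" using that by simp
    finally show ?thesis by (simp add: dist_norm add.commute norm_minus_commute)
  qed
  have fd: "f differentiable (at p)" if "p \<in> cball x (2*h)" for p
    using smooth_on_differentiable[OF sm] U that by blast
  have fd': "partial_deriv i f differentiable (at p)" if "p \<in> cball x (2*h)" for p
    using smooth_on_differentiable[OF smooth_on_partial_deriv[OF sm]] U that by blast
  define \<phi> where "\<phi> s = f ((x + h *\<^sub>R axis j 1) + s *\<^sub>R axis i 1) - f (x + s *\<^sub>R axis i 1)" for s
  have comm: "(x + t *\<^sub>R axis j 1) + s *\<^sub>R axis i 1 = x + s *\<^sub>R axis i 1 + t *\<^sub>R axis j 1" for s t
    by (simp add: algebra_simps)
  have "\<exists>s. 0 < s \<and> s < h \<and> \<phi> h - \<phi> 0 = (h - 0) *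
      (partial_deriv i f ((x + h *\<^sub>R axis j 1) + s *\<^sub>R axis i 1) - partial_deriv i f (x + s *\<^sub>R axis i 1))"
  proof (rule MVT2[OF h])
    fix s :: real assume s: "0 \<le> s" "s \<le> h"
    show "(\<phi> has_real_derivative partial_deriv i f ((x + h *\<^sub>R axis j 1) + s *\<^sub>R axis i 1) - partial_deriv i f (x + s *\<^sub>R axis i 1)) (at s)"
      unfolding \<phi>_def using inU[of s h] inU[of s 0] s h
      by (intro DERIV_diff has_real_derivative_axis fd) (simp_all add: comm)
  qed
  then obtain s where s: "0 < s" "s < h" "\<phi> h - \<phi> 0 = h *
      (partial_deriv i f (x + s *\<^sub>R axis i 1 + h *\<^sub>R axis j 1) - partial_deriv i f (x + s *\<^sub>R axis i 1))"
    by (auto simp: comm)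
  have "\<exists>t. 0 < t \<and> t < h \<and> partial_deriv i f (x + s *\<^sub>R axis i 1 + h *\<^sub>R axis j 1)
        - partial_deriv i f (x + s *\<^sub>R axis i 1 + 0 *\<^sub>R axis j 1)
      = (h - 0) * partial_deriv j (partial_deriv i f) (x + s *\<^sub>R axis i 1 + t *\<^sub>R axis j 1)"
    using inU s by (intro MVT2[OF h] has_real_derivative_axis fd') simp
  then obtain t where t: "0 < t" "t < h" "partial_deriv i f (x + s *\<^sub>R axis i 1 + h *\<^sub>R axis j 1)
        - partial_deriv i f (x + s *\<^sub>R axis i 1)
      = h * partial_deriv j (partial_deriv i f) (x + s *\<^sub>R axis i 1 + t *\<^sub>R axis j 1)" by auto
  have "f (x + h *\<^sub>R axis i 1 + h *\<^sub>R axis j 1) - f (x + h *\<^sub>R axis i 1) - f (x + h *\<^sub>R axis j 1) + f x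
      = \<phi> h - \<phi> 0" by (simp add: \<phi>_def comm)
  also have "\<dots> = h * h * partial_deriv j (partial_deriv i f) (x + s *\<^sub>R axis i 1 + t *\<^sub>R axis j 1)"
    using s(3) t(3) by simp
  finally show ?thesis using inU[of s t] s t by auto
qed

text \<open>The same second difference equals h squared times one mixed derivative at some nearby
  point and h squared times the other at another nearby point. Continuity of both at x then forbids
  different values.\<close>

lemma partial_deriv_commute:
  fixes f :: "real^2 \<Rightarrow> real"
  assumes sm: "smooth_on U f" and U: "open U" and x: "x \<in> U"
  shows "partial_deriv i (partial_deriv j f) x = partial_deriv j (partial_deriv i f) x"
proof (rule ccontr)
  let ?A = "partial_deriv i (partial_deriv j f)" and ?B = "partial_deriv j (partial_deriv i f)"
  assume ne: "?A x \<noteq> ?B x"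
  \<comment> \<open>A third of the gap: two deviations below e cannot bridge a distance of
    3e.\<close>
  define e where "e = \<bar>?A x - ?B x\<bar> / 3"
  have e: "e > 0" using ne by (simp add: e_def)
  have cA: "isCont ?A x" and cB: "isCont ?B x"
    using sm x smooth_on_isCont smooth_on_partial_deriv by blast+
  obtain d1 where d1: "d1 > 0" "\<And>y. dist y x < d1 \<Longrightarrow> dist (?A y) (?A x) < e"
    using cA e unfolding continuous_at_eps_delta by metis
  obtain d2 where d2: "d2 > 0" "\<And>y. dist y x < d2 \<Longrightarrow> dist (?B y) (?B x) < e"
    using cB e unfolding continuous_at_eps_delta by metis
  obtain r where r: "r > 0" "cball x r \<subseteq> U" using U x open_contains_cball by blast
  define h where "h = min r (min d1 d2) / 4"
  have h: "h > 0" "2*h \<le> r" "2*h < d1" "2*h < d2" using r d1 d2 by (auto simp: h_def)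
  have sub: "cball x (2*h) \<subseteq> U" using r(2) h(2) by (meson order_trans subset_cball)
  obtain p where p: "p \<in> cball x (2*h)" "f (x + h *\<^sub>R axis i 1 + h *\<^sub>R axis j 1) - f (x + h *\<^sub>R axis i 1) - f (x + h *\<^sub>R axis j 1) + f x
      = h * h * ?B p" using mixed_difference_mvt[OF sm sub h(1), of i j] by blast
  obtain q where q: "q \<in> cball x (2*h)" "f (x + h *\<^sub>R axis j 1 + h *\<^sub>R axis i 1) - f (x + h *\<^sub>R axis j 1) - f (x + h *\<^sub>R axis i 1) + f x
      = h * h * ?A q" using mixed_difference_mvt[OF sm sub h(1), of j i] by blast
  have "f (x + h *\<^sub>R axis j 1 + h *\<^sub>R axis i 1) = f (x + h *\<^sub>R axis i 1 + h *\<^sub>R axis j 1)"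
    by (simp only: add.assoc add.commute[of "h *\<^sub>R axis j 1"])
  then have "h * h * ?A q = h * h * ?B p" using p(2) q(2) by linarith
  then have "?A q = ?B p" using h(1) by simp
  moreover have "dist (?A q) (?A x) < e" using d1(2)[of q] q(1) h by (simp add: dist_commute)
  moreover have "dist (?B p) (?B x) < e" using d2(2)[of p] p(1) h by (simp add: dist_commute)
  ultimately have "\<bar>?A x - ?B x\<bar> < 2 * e" by (simp add: dist_real_def)
  then show False using e by (simp add: e_def)
qed

section \<open>Cutoff functions and harmonic polynomials\<close>

text \<open>
  The profile \<open>w\<close> doubles as a radial cutoff; it is modified below \<open>1/4\<close> only because its values at
  negative numbers are arbitrary.
\<close>

definition cutoff :: "(real \<Rightarrow> real) \<Rightarrow> real \<Rightarrow> real" where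
  "cutoff w t = (if t < 1/4 then 1 else w t)"

text \<open>The profile has only one-sided derivatives at 0, but it equals 1 on [0, 1/2], so all its
  derivatives of positive order vanish on the open interval (0, 1/2). The chain can therefore be
  continued by constants to the left of 1/4, inside the region where both descriptions
  agree.\<close>

lemma cutoff_derivatives:
  assumes w: "horizon_profile w"
  obtains D where "\<And>k t. (D k has_real_derivative D (Suc k) t) (at t)" "D 0 = cutoff w"
proof -
  obtain E where E0: "\<And>t. t \<ge> 0 \<Longrightarrow> E 0 t = w t"
    and E: "\<And>k t. t \<ge> 0 \<Longrightarrow> (E k has_real_derivative E (Suc k) t) (at t within {0..})"
    using w unfolding horizon_profile_def smooth_halfline_def by blast
  have E': "(E k has_real_derivative E (Suc k) t) (at t)" if "t > 0" for k t
    using E[of t k] that at_within_interior[of t "{0..}"] by simp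
  have flat: "E k t = (if k = 0 then 1 else 0)" if "t \<in> {0<..<1/2}" for k t
    using that
  proof (induction k arbitrary: t)
    case 0
    then show ?case using E0 w unfolding horizon_profile_def by auto
  next
    case (Suc k)
    have "((\<lambda>t. if k = 0 then 1 else 0 :: real) has_real_derivative E (Suc k) t) (at t)"
    proof (rule has_field_derivative_transform_within_open)
      show "(E k has_real_derivative E (Suc k) t) (at t)" using E'[of t k] Suc.prems by simp
      show "open {0<..<1/2::real}" by simp
      show "t \<in> {0<..<1/2}" by (rule Suc.prems)
      show "E k s = (if k = 0 then 1 else 0)" if "s \<in> {0<..<1/2}" for s using Suc.IH[OF that] .
    qed
    from DERIV_unique[OF this DERIV_const] show ?case by simp
  qed
  define D where "D k t = (if t < 1/4 then (if k = 0 then 1 else 0) else E k t)" for k t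
  have "(D k has_real_derivative D (Suc k) t) (at t)" for k t
  proof (cases "t < 1/2")
    case True
    have "(D k has_real_derivative 0) (at t)"
    proof (rule has_field_derivative_transform_within_open)
      show "((\<lambda>t. if k = 0 then 1 else 0 :: real) has_real_derivative 0) (at t)" by simp
      show "open {..<1/2::real}" by simp
      show "t \<in> {..<1/2}" using True by simp
      fix s :: real assume "s \<in> {..<1/2}"
      then show "(if k = 0 then 1 else 0) = D k s" using flat[of s k] by (simp add: D_def)
    qed
    moreover have "D (Suc k) t = 0" using True flat[of t "Suc k"] by (simp add: D_def)
    ultimately show ?thesis by simp
  next
    case False
    have "(D k has_real_derivative E (Suc k) t) (at t)"
    proof (rule has_field_derivative_transform_within_open)
      show "(E k has_real_derivative E (Suc k) t) (at t)" using E'[of t k] False by simp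
      show "open {1/4::real<..}" by simp
      show "t \<in> {1/4<..}" using False by simp
      show "E k s = D k s" if "s \<in> {1/4<..}" for s using that by (simp add: D_def)
    qed
    then show ?thesis using False by (simp add: D_def)
  qed
  moreover have "D 0 = cutoff w" using E0 by (auto simp: D_def cutoff_def fun_eq_iff)
  ultimately show ?thesis using that by blast
qed

lemma smooth_on_cutoff:
  assumes "horizon_profile w" "open U" "smooth_on U f"
  shows "smooth_on U (\<lambda>x. cutoff w (f x))"
proof -
  obtain D where D: "\<And>k t. (D k has_real_derivative D (Suc k) t) (at t)" "D 0 = cutoff w"
    using cutoff_derivatives[OF assms(1)] by blast
  show ?thesis using smooth_on_compose[OF assms(2), of UNIV D f 0] D assms(3) by simp
qed

text \<open>The closed support is compact in [0, 1) and so has a maximum below 1; \<tau> is the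
  midpoint between this maximum and 1. The strict margin is what later keeps a convolution with the
  kernel compactly supported in the open ball of radius \<open>2 * \<rho>\<close>.\<close>

lemma horizon_profile_vanish:
  assumes w: "horizon_profile w"
  obtains \<tau> where "1/2 \<le> \<tau>" "\<tau> < 1" "\<And>t. \<tau> \<le> t \<Longrightarrow> w t = 0"
proof -
  let ?S = "closure {t. 0 \<le> t \<and> w t \<noteq> 0}"
  have S: "?S \<subseteq> {0..<1}" using w unfolding horizon_profile_def by blast
  have cpt: "compact ?S"
    using S bounded_subset[of "{0..<1::real}" ?S] by (simp add: compact_eq_bounded_closed)
  have w1: "w t = 1" if "t \<in> {0..1/2}" for t using w that unfolding horizon_profile_def by blast
  have half: "1/2 \<in> ?S"
    by (rule subsetD[OF closure_subset]) (use w1[of "1/2"] in simp)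
  then have "?S \<noteq> {}" by (metis empty_iff)
  from compact_attains_sup[OF cpt this]
  obtain s where s: "s \<in> ?S" "\<And>t. t \<in> ?S \<Longrightarrow> t \<le> s" by metis
  have "s < 1" using subsetD[OF S s(1)] by simp
  moreover have "1/2 \<le> s" using s(2)[OF half] .
  moreover have "w t = 0" if "(s+1)/2 \<le> t" for t
  proof (rule ccontr)
    assume "w t \<noteq> 0"
    then have "t \<in> {t. 0 \<le> t \<and> w t \<noteq> 0}" using that \<open>1/2 \<le> s\<close> by simp
    then have "t \<le> s" using s(2) closure_subset by (meson subsetD)
    moreover have "s < (s+1)/2" using \<open>s < 1\<close> by (simp add: field_simps)
    ultimately show False using that by (meson leD order_trans)
  qed
  moreover have "(s+1)/2 < 1" "1/2 \<le> (s+1)/2" using calculation by (simp_all add: field_simps)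
  ultimately show ?thesis using that[of "(s+1)/2"] by blast
qed

lemma cutoff_simps:
  assumes w: "horizon_profile w"
  shows "t \<le> 1/2 \<Longrightarrow> cutoff w t = 1" "0 \<le> cutoff w t" "cutoff w t \<le> 1"
proof -
  show "t \<le> 1/2 \<Longrightarrow> cutoff w t = 1" using w unfolding horizon_profile_def cutoff_def by auto
  have "0 \<le> w t \<and> w t \<le> 1" if "t \<ge> 0" using w that unfolding horizon_profile_def by blast
  then show "0 \<le> cutoff w t" "cutoff w t \<le> 1" unfolding cutoff_def by auto
qed

definition nsq :: "real^2 \<Rightarrow> real" where "nsq x = (x$1)\<^sup>2 + (x$2)\<^sup>2"

lemma nsq_norm: "nsq x = (norm x)\<^sup>2" by (simp add: nsq_def norm_vec2)

lemma nsq_polar [simp]: "nsq (polar r t) = r\<^sup>2" by (simp add: nsq_norm)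

lemma smooth_on_nsq: "open U \<Longrightarrow> smooth_on U nsq"
  unfolding nsq_def[abs_def] power2_eq_square by (intro smooth_on_add smooth_on_mult smooth_on_nth)

text \<open>Real and imaginary parts of the complex power of order k are polynomials, hence smooth
  through the origin, and on circles they are pure modes of frequency k. Multiplied by a cutoff they
  become test functions that isolate one Fourier coefficient.\<close>

definition harm_re :: "nat \<Rightarrow> real^2 \<Rightarrow> real" where "harm_re k x = Re (Complex (x$1) (x$2) ^ k)"
definition harm_im :: "nat \<Rightarrow> real^2 \<Rightarrow> real" where "harm_im k x = Im (Complex (x$1) (x$2) ^ k)"

lemma harm_polar:
  "harm_re k (polar r t) = r ^ k * cos (real k * t)" "harm_im k (polar r t) = r ^ k * sin (real k * t)"
proof -
  have "Complex (r * cos t) (r * sin t) = rcis r t" by (simp add: complex_eq_iff)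
  then show "harm_re k (polar r t) = r ^ k * cos (real k * t)" "harm_im k (polar r t) = r ^ k * sin (real k * t)"
    by (simp_all add: harm_re_def harm_im_def DeMoivre2)
qed

lemma smooth_on_harm:
  assumes U: "open U"
  shows "smooth_on U (harm_re k)" "smooth_on U (harm_im k)"
proof -
  have "smooth_on U (harm_re k) \<and> smooth_on U (harm_im k)"
  proof (induction k)
    case 0
    then show ?case using smooth_on_const[OF U] by (simp add: harm_re_def[abs_def] harm_im_def[abs_def])
  next
    case (Suc k)
    have "harm_re (Suc k) = (\<lambda>x. x$1 * harm_re k x - x$2 * harm_im k x)"
      "harm_im (Suc k) = (\<lambda>x. x$1 * harm_im k x + x$2 * harm_re k x)"
      by (auto simp: harm_re_def harm_im_def)
    then show ?case using Suc
      by (auto intro!: smooth_on_diff[OF U] smooth_on_add[OF U] smooth_on_mult[OF U] smooth_on_nth[OF U])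
  qed
  then show "smooth_on U (harm_re k)" "smooth_on U (harm_im k)" by auto
qed

section \<open>Convolution of test functions with an integrable kernel\<close>

lemma uniformly_continuous_compact_support:
  fixes g :: "'a::euclidean_space \<Rightarrow> real"
  assumes c: "continuous_on UNIV g" and z: "\<And>x. norm x > R \<Longrightarrow> g x = 0"
  shows "uniformly_continuous_on UNIV g"
  unfolding uniformly_continuous_on_def
proof (intro allI impI)
  fix e :: real assume e: "e > 0"
  have "uniformly_continuous_on (cball 0 (R+1)) g"
    by (rule compact_uniformly_continuous[OF continuous_on_subset[OF c]]) simp_all
  then obtain d where d: "d > 0" "\<And>x y. x \<in> cball 0 (R+1) \<Longrightarrow> y \<in> cball 0 (R+1) \<Longrightarrow> dist y x < d \<Longrightarrow> dist (g y) (g x) < e"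
    using e unfolding uniformly_continuous_on_def by metis
  have "dist (g y) (g x) < e" if "dist y x < min d 1" for x y
  proof (cases "norm x \<le> R \<or> norm y \<le> R")
    case True
    have "norm y \<le> norm x + dist y x" "norm x \<le> norm y + dist y x"
      by norm+
    then show ?thesis using d(2)[of x y] True that by auto
  next
    case False
    then show ?thesis using z e by auto
  qed
  then show "\<exists>d>0. \<forall>x\<in>UNIV. \<forall>y\<in>UNIV. dist y x < d \<longrightarrow> dist (g y) (g x) < e"
    using d(1) by (intro exI[of _ "min d 1"]) auto
qed

text \<open>Compact support with an explicit radius, because radii add under convolution and their
  sum has to be compared with \<open>2 * \<rho>\<close>.\<close>

definition supported :: "real \<Rightarrow> (real^2 \<Rightarrow> real) set" where
  "supported R = {f. smooth_on UNIV f \<and> (\<forall>x. norm x > R \<longrightarrow> f x = 0)}"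

lemma supported_closure: "f \<in> supported R \<Longrightarrow> closure {x. f x \<noteq> 0} \<subseteq> cball 0 R"
  by (rule closure_minimal) (auto simp: supported_def not_less[symmetric])

lemma supported_partial_deriv: "f \<in> supported R \<Longrightarrow> partial_deriv i f \<in> supported R"
proof -
  assume f: "f \<in> supported R"
  have "partial_deriv i f x = 0" if "norm x > R" for x
    using supported_closure[OF f] that by (intro partial_deriv_zero_outside) auto
  then show ?thesis using f by (simp add: supported_def smooth_on_partial_deriv)
qed

lemma supported_test_function: "f \<in> supported R \<Longrightarrow> R < S \<Longrightarrow> f \<in> test_functions (ball 0 S)"
proof -
  assume f: "f \<in> supported R" and "R < S"
  then have "closure {x. f x \<noteq> 0} \<subseteq> ball 0 S" using supported_closure[OF f] by auto
  moreover have "compact (closure {x. f x \<noteq> 0})"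
    using bounded_subset[OF bounded_cball supported_closure[OF f]] by (simp add: compact_eq_bounded_closed)
  ultimately show ?thesis using f by (simp add: test_functions_def supported_def)
qed

lemma supported_continuous: "f \<in> supported R \<Longrightarrow> continuous_on UNIV f"
  by (auto simp: supported_def smooth_on_continuous_on)

lemma supported_bounded:
  assumes "f \<in> supported R"
  obtains B where "B > 0" "\<And>x. \<bar>f x\<bar> \<le> B"
proof -
  have "bounded (f ` cball 0 R)"
    by (intro compact_imp_bounded compact_continuous_image
        continuous_on_subset[OF supported_continuous[OF assms]]) simp_all
  then obtain B where B: "B > 0" "\<And>x. x \<in> cball 0 R \<Longrightarrow> \<bar>f x\<bar> \<le> B"
    unfolding bounded_pos real_norm_def by blast
  have "\<bar>f x\<bar> \<le> B" for x
    using B assms by (cases "norm x \<le> R") (auto simp: supported_def)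
  then show ?thesis using that B by blast
qed

text \<open>Continuous partial derivatives with compact support are uniformly continuous, so the
  linearisation error is small uniformly in the base point. This uniformity allows differentiation
  under an integral against a kernel that is merely integrable.\<close>

lemma supported_uniformly_differentiable:
  assumes f: "f \<in> supported R" and e: "e > 0"
  shows "\<exists>d>0. \<forall>y h. norm h < d \<longrightarrow>
     \<bar>f (y + h) - f y - (h$1 * partial_deriv 1 f y + h$2 * partial_deriv 2 f y)\<bar> \<le> e * norm h"
proof -
  have u: "uniformly_continuous_on UNIV (partial_deriv i f)" for i
    using supported_continuous[OF supported_partial_deriv[OF f]] supported_partial_deriv[OF f, of i]
    by (intro uniformly_continuous_compact_support[of _ R]) (auto simp: supported_def)
  have "\<exists>d>0. \<forall>x y. dist y x < d \<longrightarrow> \<bar>partial_deriv i f y - partial_deriv i f x\<bar> < e/2" for i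
    using u[of i] e unfolding uniformly_continuous_on_def dist_real_def by (meson UNIV_I half_gt_zero)
  then obtain d where d: "\<And>i. d i > 0"
      "\<And>i x y. dist y x < d i \<Longrightarrow> \<bar>partial_deriv i f y - partial_deriv i f x\<bar> < e/2"
    by metis
  show ?thesis
  proof (intro exI[of _ "min (d 1) (d 2)"] conjI allI impI)
    show "min (d 1) (d 2) > 0" using d by simp
    fix y h :: "real^2" assume h: "norm h < min (d 1) (d 2)"
    let ?D = "\<lambda>x (h::real^2). h$1 *\<^sub>R partial_deriv 1 f x + h$2 *\<^sub>R partial_deriv 2 f x"
    have "norm (f (y+h) - f y - ?D y ((y+h) - y)) \<le> norm ((y+h) - y) * e"
    proof (rule differentiable_bound_linearization[where S="ball y (min (d 1) (d 2))" and f'="\<lambda>x h. ?D x h" and ?x0.0=y and B=e])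
      show "y + t *\<^sub>R (y + h - y) \<in> ball y (min (d 1) (d 2))" if "t \<in> {0..1}" for t
      proof -
        have "norm (t *\<^sub>R h) \<le> 1 * norm h" using that by (simp add: mult_right_mono mult_left_le_one_le)
        then show ?thesis using h by (simp add: dist_norm)
      qed
      show "(f has_derivative ?D x) (at x within ball y (min (d 1) (d 2)))" for x
        by (rule has_derivative_at_withinI[OF has_derivative_partials[OF smooth_on_differentiable[of UNIV]]])
          (use f in \<open>simp_all add: supported_def\<close>)
      show "y \<in> ball y (min (d 1) (d 2))" using d by simp
      fix x assume x: "x \<in> ball y (min (d 1) (d 2))"
      have on: "norm ((?D x - ?D y) k) \<le> e * norm k" for k :: "real^2"
      proof -
        have "norm ((?D x - ?D y) k) = \<bar>k$1 * (partial_deriv 1 f x - partial_deriv 1 f y) + k$2 * (partial_deriv 2 f x - partial_deriv 2 f y)\<bar>"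
          by (simp add: algebra_simps)
        also have "\<dots> \<le> \<bar>k$1\<bar> * \<bar>partial_deriv 1 f x - partial_deriv 1 f y\<bar> + \<bar>k$2\<bar> * \<bar>partial_deriv 2 f x - partial_deriv 2 f y\<bar>"
          by (metis abs_mult abs_triangle_ineq)
        also have "\<dots> \<le> norm k * (e/2) + norm k * (e/2)"
          using d(2)[of x y] x component_le_norm_cart[of k] by (intro add_mono mult_mono) (auto simp: dist_commute less_imp_le)
        finally show ?thesis by simp
      qed
      show "onorm (?D x - ?D y) \<le> e" by (rule onorm_le[OF on])
    qed
    then show "\<bar>f (y + h) - f y - (h$1 * partial_deriv 1 f y + h$2 * partial_deriv 2 f y)\<bar> \<le> e * norm h"
      by (simp add: mult.commute)
  qed
qed

text \<open>
  The adjoint of convolution with \<open>K\<close>.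
\<close>

definition kconv :: "(real^2 \<Rightarrow> real) \<Rightarrow> (real^2 \<Rightarrow> real) \<Rightarrow> real^2 \<Rightarrow> real" where
  "kconv K f y = (LINT z|lborel. K z * f (y + z))"

lemma kconv_integrable:
  assumes K: "integrable lborel K" and f: "f \<in> supported R"
  shows "integrable lborel (\<lambda>z. K z * f (y + z))"
proof -
  obtain B where B: "B > 0" "\<And>x. \<bar>f x\<bar> \<le> B" using supported_bounded[OF f] by blast
  have m: "f \<in> borel_measurable borel" using supported_continuous[OF f] by (rule borel_measurable_continuous_onI)
  have "(\<lambda>z. f (y + z)) \<in> borel_measurable borel" by (rule measurable_compose[OF _ m]) simp
  then have "(\<lambda>z. K z * f (y + z)) \<in> borel_measurable lborel" using K by simp
  moreover have "AE z in lborel. norm (K z * f (y + z)) \<le> norm (B * K z)"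
  proof (rule AE_I2)
    fix z
    have "\<bar>f (y + z)\<bar> * \<bar>K z\<bar> \<le> B * \<bar>K z\<bar>" by (rule mult_right_mono[OF B(2)]) simp
    then show "norm (K z * f (y + z)) \<le> norm (B * K z)" using B(1) by (simp add: abs_mult mult.commute)
  qed
  ultimately show ?thesis
    by (rule Bochner_Integration.integrable_bound[OF integrable_mult_right[OF K]])
qed

lemma kconv_has_derivative:
  assumes K: "integrable lborel K" and f: "f \<in> supported R"
  shows "(kconv K f has_derivative (\<lambda>h. h$1 * kconv K (partial_deriv 1 f) y + h$2 * kconv K (partial_deriv 2 f) y)) (at y)"
  unfolding has_derivative_at_alt
proof (intro conjI allI impI)
  show "bounded_linear (\<lambda>h. h$1 * kconv K (partial_deriv 1 f) y + h$2 * kconv K (partial_deriv 2 f) y)"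
    by (intro bounded_linear_add bounded_linear_mult_left[THEN bounded_linear_compose] bounded_linear_vec_nth)
  note i0 = kconv_integrable[OF K f]
  note i1 = kconv_integrable[OF K supported_partial_deriv[OF f]]
  fix e :: real assume e: "e > 0"
  \<comment> \<open>The error e is divided by \<open>k + 1\<close>, so that the quotient makes sense
    for a kernel that vanishes almost everywhere and the factor \<open>k / (k+1)\<close> stays below
    1.\<close>
  define k where "k = (LINT z|lborel. \<bar>K z\<bar>)"
  have k: "k \<ge> 0" by (simp add: k_def)
  obtain d where d: "d > 0" "\<And>y h. norm h < d \<Longrightarrow>
     \<bar>f (y + h) - f y - (h$1 * partial_deriv 1 f y + h$2 * partial_deriv 2 f y)\<bar> \<le> e / (k+1) * norm h"
    using supported_uniformly_differentiable[OF f, of "e/(k+1)"] e k by auto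
  have "norm (kconv K f x - kconv K f y - ((x-y)$1 * kconv K (partial_deriv 1 f) y + (x-y)$2 * kconv K (partial_deriv 2 f) y)) \<le> e * norm (x - y)"
    if "norm (x - y) < d" for x
  proof -
    let ?h = "x - y"
    let ?r = "\<lambda>z. f ((y+z) + ?h) - f (y+z) - (?h$1 * partial_deriv 1 f (y+z) + ?h$2 * partial_deriv 2 f (y+z))"
    have xz: "(y+z) + ?h = x + z" for z by simp
    have "kconv K f x - kconv K f y - (?h$1 * kconv K (partial_deriv 1 f) y + ?h$2 * kconv K (partial_deriv 2 f) y)
       = (LINT z|lborel. K z * f (x+z) - K z * f (y+z) - (?h$1 * (K z * partial_deriv 1 f (y+z)) + ?h$2 * (K z * partial_deriv 2 f (y+z))))"
      unfolding kconv_def using i0 i1 by simp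
    also have "\<dots> = (LINT z|lborel. K z * ?r z)" unfolding xz by (simp add: algebra_simps)
    finally have "norm (kconv K f x - kconv K f y - (?h$1 * kconv K (partial_deriv 1 f) y + ?h$2 * kconv K (partial_deriv 2 f) y))
      = norm (LINT z|lborel. K z * ?r z)" by simp
    also have "\<dots> \<le> (LINT z|lborel. norm (K z * ?r z))" by (rule integral_norm_bound)
    also have "\<dots> \<le> (LINT z|lborel. \<bar>K z\<bar> * (e/(k+1) * norm ?h))"
    proof (rule integral_mono)
      have "integrable lborel (\<lambda>z. K z * f (x+z) - K z * f (y+z) - (?h$1 * (K z * partial_deriv 1 f (y+z)) + ?h$2 * (K z * partial_deriv 2 f (y+z))))"
        by (intro Bochner_Integration.integrable_add Bochner_Integration.integrable_diff integrable_mult_right i0 i1)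
      then have "integrable lborel (\<lambda>z. K z * ?r z)" unfolding xz by (simp add: algebra_simps)
      then show "integrable lborel (\<lambda>z. norm (K z * ?r z))" by (rule integrable_norm)
      show "integrable lborel (\<lambda>z. \<bar>K z\<bar> * (e/(k+1) * norm ?h))" using integrable_norm[OF K] by simp
      show "norm (K z * ?r z) \<le> \<bar>K z\<bar> * (e/(k+1) * norm ?h)" for z
        using mult_left_mono[OF d(2)[OF that, of "y+z"], of "\<bar>K z\<bar>"] by (simp only: real_norm_def abs_mult abs_ge_zero)
    qed
    also have "\<dots> = k / (k+1) * (e * norm ?h)" by (simp add: k_def)
    also have "\<dots> \<le> 1 * (e * norm ?h)" using k e by (intro mult_right_mono) auto
    finally show ?thesis by simp
  qed
  then show "\<exists>d>0. \<forall>x. norm (x - y) < d \<longrightarrow> norm (kconv K f x - kconv K f y - ((x-y)$1 * kconv K (partial_deriv 1 f) y + (x-y)$2 * kconv K (partial_deriv 2 f) y)) \<le> e * norm (x - y)"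
    using d(1) by blast
qed

lemma kconv_partial_deriv:
  assumes "integrable lborel K" "f \<in> supported R"
  shows "partial_deriv i (kconv K f) = kconv K (partial_deriv i f)"
proof
  fix y
  have "i = 1 \<or> i = 2" using exhaust_2 by blast
  then show "partial_deriv i (kconv K f) y = kconv K (partial_deriv i f) y"
    using partial_deriv_eqI[OF kconv_has_derivative[OF assms]] by (auto simp: axis_def)
qed

text \<open>Derivatives fall on the smooth factor, so the convolutions with the fixed kernel form a
  family closed under partial derivatives and \<open>smooth_on_coinduct\<close> applies. The
  singularity of the kernel does not enter.\<close>

lemma kconv_supported:
  assumes K: "integrable lborel K" and z: "\<And>z. norm z > S \<Longrightarrow> K z = 0" and f: "f \<in> supported R"
  shows "kconv K f \<in> supported (R + S)"
  unfolding supported_def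
proof (intro CollectI conjI allI impI)
  show "smooth_on UNIV (kconv K f)"
  proof (rule smooth_on_coinduct[where S="kconv K ` supported R"])
    show "\<And>g x. g \<in> kconv K ` supported R \<Longrightarrow> x \<in> UNIV \<Longrightarrow> g differentiable (at x)"
      using kconv_has_derivative[OF K] by (auto intro: differentiableI)
    show "\<And>g i. g \<in> kconv K ` supported R \<Longrightarrow> \<exists>h\<in>kconv K ` supported R. \<forall>x\<in>UNIV. partial_deriv i g x = h x"
      using kconv_partial_deriv[OF K] supported_partial_deriv by blast
  qed (use f in auto)
  fix y :: "real^2" assume y: "norm y > R + S"
  have "K x * f (y + x) = 0" for x
  proof (cases "norm x > S")
    case False
    have "norm y \<le> norm (y + x) + norm x" by norm
    then have "norm (y + x) > R" using False y by simp
    then show ?thesis using f by (simp add: supported_def)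
  qed (simp add: z)
  then have "(\<lambda>x. K x * f (y + x)) = (\<lambda>x. 0)" by blast
  then show "kconv K f y = 0" by (simp only: kconv_def integral_zero)
qed

section \<open>Integrals of powers\<close>

lemma nn_integral_radial:
  fixes f :: "real \<Rightarrow> ennreal"
  assumes [measurable]: "f \<in> borel_measurable borel"
  shows "(\<integral>\<^sup>+x. f (norm (x::real^2)) \<partial>lborel) = (\<integral>\<^sup>+r. ennreal (2*pi*r) * indicator {0<..} r * f r \<partial>lborel)"
proof -
  have "(\<integral>\<^sup>+x. f (norm (x::real^2)) \<partial>lborel)
    = (\<integral>\<^sup>+r. \<integral>\<^sup>+t. ennreal r * indicator {0<..} r * indicator {0..<2*pi} t * f (norm (polar r t)) \<partial>lborel \<partial>lborel)"
    by (rule nn_integral_polar) measurable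
  also have "\<dots> = (\<integral>\<^sup>+r. \<integral>\<^sup>+t. (ennreal r * indicator {0<..} r * f r) * indicator {0..<2*pi} t \<partial>lborel \<partial>lborel)"
    by (intro nn_integral_cong) (auto simp: indicator_def)
  also have "\<dots> = (\<integral>\<^sup>+r. (ennreal r * indicator {0<..} r * f r) * ennreal (2*pi) \<partial>lborel)"
    by (subst nn_integral_cmult_indicator) auto
  also have "\<dots> = (\<integral>\<^sup>+r. ennreal (2*pi*r) * indicator {0<..} r * f r \<partial>lborel)"
    by (intro nn_integral_cong) (auto simp: indicator_def ennreal_mult mult_ac)
  finally show ?thesis .
qed

lemma nn_integral_powr_from_0:
  fixes a c :: real
  assumes "a > -1" "c \<ge> 0"
  shows "(\<integral>\<^sup>+r. ennreal (r powr a) * indicator {0..c} r \<partial>lborel) = ennreal (c powr (a+1) / (a+1))"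
  by (rule nn_integral_has_integral_lebesgue'[OF _ has_integral_powr_from_0[OF assms]]) simp

lemma nn_integral_powr_to_inf:
  fixes a c :: real
  assumes "a < -1" "c > 0"
  shows "(\<integral>\<^sup>+r. ennreal (r powr a) * indicator {c..} r \<partial>lborel) = ennreal (- (c powr (a+1)) / (a+1))"
  by (rule nn_integral_has_integral_lebesgue'[OF _ has_integral_powr_to_inf[OF assms]]) simp

lemma nn_integral_norm_powr:
  assumes "p > -2" "c \<ge> 0"
  shows "(\<integral>\<^sup>+x. ennreal (norm (x::real^2) powr p) * indicator {0..c} (norm x) \<partial>lborel)
      = ennreal (2*pi * c powr (p+2) / (p+2))"
proof -
  have "(\<integral>\<^sup>+x. ennreal (norm (x::real^2) powr p) * indicator {0..c} (norm x) \<partial>lborel)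
    = (\<integral>\<^sup>+r. ennreal (2*pi*r) * indicator {0<..} r * (ennreal (r powr p) * indicator {0..c} r) \<partial>lborel)"
    by (rule nn_integral_radial) measurable
  also have "\<dots> = (\<integral>\<^sup>+r. ennreal (2*pi) * (ennreal (r powr (p+1)) * indicator {0..c} r) \<partial>lborel)"
  proof (intro nn_integral_cong)
    fix r :: real
    have "ennreal (2*pi*r) * ennreal (r powr p) = ennreal (2*pi) * ennreal (r powr (p+1))" if "r > 0"
      using that by (simp add: ennreal_mult[symmetric] powr_add mult_ac)
    then show "ennreal (2*pi*r) * indicator {0<..} r * (ennreal (r powr p) * indicator {0..c} r)
      = ennreal (2*pi) * (ennreal (r powr (p+1)) * indicator {0..c} r)"
      by (cases "r > 0"; cases "r = 0") (auto simp: indicator_def)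
  qed
  also have "\<dots> = ennreal (2*pi) * ennreal (c powr (p+1+1) / (p+1+1))"
    using assms by (subst nn_integral_cmult) (auto simp: nn_integral_powr_from_0)
  also have "\<dots> = ennreal (2*pi * c powr (p+2) / (p+2))"
    using assms by (simp add: ennreal_mult[symmetric] add.assoc)
  finally show ?thesis .
qed

lemma nn_integral_norm_powr_inf:
  assumes "p < -2" "c > 0"
  shows "(\<integral>\<^sup>+x. ennreal (norm (x::real^2) powr p) * indicator {c..} (norm x) \<partial>lborel)
      = ennreal (2*pi * c powr (p+2) / - (p+2))"
proof -
  have "(\<integral>\<^sup>+x. ennreal (norm (x::real^2) powr p) * indicator {c..} (norm x) \<partial>lborel)
    = (\<integral>\<^sup>+r. ennreal (2*pi*r) * indicator {0<..} r * (ennreal (r powr p) * indicator {c..} r) \<partial>lborel)"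
    by (rule nn_integral_radial) measurable
  also have "\<dots> = (\<integral>\<^sup>+r. ennreal (2*pi) * (ennreal (r powr (p+1)) * indicator {c..} r) \<partial>lborel)"
  proof (intro nn_integral_cong)
    fix r :: real
    have "ennreal (2*pi*r) * ennreal (r powr p) = ennreal (2*pi) * ennreal (r powr (p+1))" if "r > 0"
      using that by (simp add: ennreal_mult[symmetric] powr_add mult_ac)
    then show "ennreal (2*pi*r) * indicator {0<..} r * (ennreal (r powr p) * indicator {c..} r)
      = ennreal (2*pi) * (ennreal (r powr (p+1)) * indicator {c..} r)"
      using assms by (cases "r > 0") (auto simp: indicator_def)
  qed
  also have "\<dots> = ennreal (2*pi) * ennreal (- (c powr (p+1+1)) / (p+1+1))"
    using assms by (subst nn_integral_cmult) (auto simp: nn_integral_powr_to_inf)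
  also have "\<dots> = ennreal (2*pi * c powr (p+2) / - (p+2))"
  proof -
    have e: "p + 1 + 1 = p + 2" by simp
    have "2*pi * (- (c powr (p+1+1)) / (p+1+1)) = 2*pi * c powr (p+2) / - (p+2)"
      by (simp only: e minus_divide_left[symmetric] minus_divide_right[symmetric] mult_minus_right times_divide_eq_right)
    moreover have "0 \<le> - (c powr (p+1+1)) / (p+1+1)" using assms by (intro divide_nonpos_neg) auto
    ultimately show ?thesis by (simp only: ennreal_mult[symmetric] pi_ge_zero mult_nonneg_nonneg zero_le_numeral)
  qed
  finally show ?thesis .
qed

section \<open>The Riesz kernel\<close>

lemma riesz_gamma_pos: "0 < \<alpha> \<Longrightarrow> \<alpha> < 1 \<Longrightarrow> riesz_gamma \<alpha> > 0"
  unfolding riesz_gamma_def by (simp add: Gamma_real_pos)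

context
  fixes w :: "real \<Rightarrow> real" and \<alpha> \<rho> :: real
  assumes w: "horizon_profile w" and \<alpha>: "0 < \<alpha>" "\<alpha> < 1" and \<rho>: "\<rho> > 0"
begin

text \<open>
  The indicator hides the arbitrary values of \<open>w\<close> at negative numbers.
\<close>

definition Q_integrand :: "real \<Rightarrow> real" where
  "Q_integrand r = indicator {0..} (r/\<rho>) *\<^sub>R w (r / \<rho>) / r powr (3 - \<alpha>)"

lemma Q_integrand_measurable [measurable]: "Q_integrand \<in> borel_measurable borel"
proof -
  have "continuous_on {0..} w"
  proof -
    obtain D where D: "\<forall>t\<ge>0. D 0 t = w t" "\<forall>k. \<forall>t\<ge>0. (D k has_real_derivative D (Suc k) t) (at t within {0..})"
      using w unfolding horizon_profile_def smooth_halfline_def by blast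
    have "continuous_on {0..} (D 0)"
      using D(2) by (intro DERIV_continuous_on[of _ _ "D (Suc 0)"]) auto
    then show ?thesis by (rule continuous_on_eq) (use D in auto)
  qed
  then have m: "(\<lambda>t. indicator {0..} t *\<^sub>R w t) \<in> borel_measurable borel"
    by (intro borel_measurable_continuous_on_indicator) auto
  have "(\<lambda>r. indicator {0..} (r/\<rho>) *\<^sub>R w (r / \<rho>)) \<in> borel_measurable borel"
    by (rule measurable_compose[OF _ m]) measurable
  then show ?thesis unfolding Q_integrand_def[abs_def] by (intro borel_measurable_divide) auto
qed

lemma Q_integrand_bounds: "0 \<le> Q_integrand r" "r > 0 \<Longrightarrow> Q_integrand r \<le> r powr (\<alpha> - 3)"
proof -
  have w01: "0 \<le> w t" "w t \<le> 1" if "t \<ge> 0" for t using w that unfolding horizon_profile_def by blast+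
  show "0 \<le> Q_integrand r" unfolding Q_integrand_def using w01 by (auto simp: indicator_def)
  assume r: "r > 0"
  have "Q_integrand r \<le> 1 / r powr (3 - \<alpha>)"
    unfolding Q_integrand_def using w01[of "r/\<rho>"] r \<rho> by (auto simp: indicator_def intro!: divide_right_mono)
  also have "\<dots> = r powr (\<alpha> - 3)" by (simp add: powr_minus_divide[symmetric])
  finally show "Q_integrand r \<le> r powr (\<alpha> - 3)" .
qed

lemma Q_kernel_eq:
  "Q_kernel w \<alpha> \<rho> x = (2 - \<alpha>) / riesz_gamma \<alpha> * (LINT r|lborel. indicator {norm x..} r * Q_integrand r)"
proof -
  have "indicator {norm x..} r *\<^sub>R (w (r / \<rho>) / r powr (3 - \<alpha>)) = indicator {norm x..} r * Q_integrand r" for r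
    using \<rho> order_trans[OF norm_ge_zero[of x], of r] by (auto simp: Q_integrand_def indicator_def)
  then show ?thesis unfolding Q_kernel_def set_lebesgue_integral_def by simp
qed

lemma Q_kernel_measurable [measurable]: "Q_kernel w \<alpha> \<rho> \<in> borel_measurable borel"
proof -
  have [measurable]: "Measurable.pred (borel \<Otimes>\<^sub>M lborel) (\<lambda>p::(real^2)\<times>real. snd p \<in> {norm (fst p)..})"
    by simp
  have "(\<lambda>x::real^2. LINT r|lborel. indicator {norm x..} r * Q_integrand r) \<in> borel_measurable borel"
    by (rule lborel.borel_measurable_lebesgue_integral) (unfold split_beta', measurable)
  then show ?thesis unfolding Q_kernel_eq[abs_def] by measurable
qed

lemma Q_kernel_nonneg: "0 \<le> Q_kernel w \<alpha> \<rho> x"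
  unfolding Q_kernel_eq using riesz_gamma_pos[OF \<alpha>] \<alpha> Q_integrand_bounds
  by (intro mult_nonneg_nonneg Bochner_Integration.integral_nonneg) auto

lemma integral_powr_tail:
  fixes s :: real assumes s: "s > 0"
  shows "integrable lborel (\<lambda>r. indicator {s..} r * r powr (\<alpha> - 3))"
    "(LINT r|lborel. indicator {s..} r * r powr (\<alpha> - 3)) = s powr (\<alpha> - 2) / (2 - \<alpha>)"
proof -
  have "(\<integral>\<^sup>+r. ennreal (indicator {s..} r * r powr (\<alpha> - 3)) \<partial>lborel)
      = (\<integral>\<^sup>+r. ennreal (r powr (\<alpha> - 3)) * indicator {s..} r \<partial>lborel)"
    by (intro nn_integral_cong) (auto simp: indicator_def)
  also have "\<dots> = ennreal (- (s powr (\<alpha> - 3 + 1)) / (\<alpha> - 3 + 1))"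
    using s \<alpha> by (intro nn_integral_powr_to_inf) auto
  also have "- (s powr (\<alpha> - 3 + 1)) / (\<alpha> - 3 + 1) = s powr (\<alpha> - 2) / (2 - \<alpha>)"
    using \<alpha> by (simp add: field_simps)
  finally have "(\<integral>\<^sup>+r. ennreal (indicator {s..} r * r powr (\<alpha> - 3)) \<partial>lborel) = ennreal (s powr (\<alpha> - 2) / (2 - \<alpha>))" .
  then have "has_bochner_integral lborel (\<lambda>r. indicator {s..} r * r powr (\<alpha> - 3)) (s powr (\<alpha> - 2) / (2 - \<alpha>))"
    using \<alpha> by (intro has_bochner_integral_nn_integral) auto
  then show "integrable lborel (\<lambda>r. indicator {s..} r * r powr (\<alpha> - 3))"
    "(LINT r|lborel. indicator {s..} r * r powr (\<alpha> - 3)) = s powr (\<alpha> - 2) / (2 - \<alpha>)"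
    by (auto simp: has_bochner_integral_iff)
qed

lemma Q_tail_integrable: "s > 0 \<Longrightarrow> integrable lborel (\<lambda>r. indicator {s..} r * Q_integrand r)"
  using Q_integrand_bounds by (intro Bochner_Integration.integrable_bound[OF integral_powr_tail(1)]) (auto simp: indicator_def)

text \<open>The profile is at most 1, and without the profile the defining integral is the full
  Riesz kernel.\<close>

lemma Q_kernel_le: assumes "x \<noteq> 0" shows "Q_kernel w \<alpha> \<rho> x \<le> norm x powr (\<alpha> - 2) / riesz_gamma \<alpha>"
proof -
  have n: "norm x > 0" using assms by simp
  have "(LINT r|lborel. indicator {norm x..} r * Q_integrand r) \<le> (LINT r|lborel. indicator {norm x..} r * r powr (\<alpha> - 3))"
  proof (intro integral_mono Q_tail_integrable integral_powr_tail(1) n)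
    fix r :: real
    show "indicator {norm x..} r * Q_integrand r \<le> indicator {norm x..} r * r powr (\<alpha> - 3)"
      using Q_integrand_bounds(2)[of r] n by (cases "norm x \<le> r") auto
  qed
  also have "\<dots> = norm x powr (\<alpha> - 2) / (2 - \<alpha>)" by (rule integral_powr_tail(2)[OF n])
  finally have "Q_kernel w \<alpha> \<rho> x \<le> (2 - \<alpha>) / riesz_gamma \<alpha> * (norm x powr (\<alpha> - 2) / (2 - \<alpha>))"
    unfolding Q_kernel_eq using riesz_gamma_pos[OF \<alpha>] \<alpha> by (intro mult_left_mono) auto
  then show ?thesis using \<alpha> by simp
qed

text \<open>The profile equals 1 up to radius \<open>\<rho>/2\<close>. Dropping the contribution of
  all larger radii costs exactly the subtracted constant.\<close>

lemma Q_kernel_ge: 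
  assumes "x \<noteq> 0" "norm x \<le> \<rho>/2" 
  shows "(norm x powr (\<alpha> - 2) - (\<rho>/2) powr (\<alpha> - 2)) / riesz_gamma \<alpha> \<le> Q_kernel w \<alpha> \<rho> x"
proof -
  have n: "norm x > 0" using assms by simp
  let ?f = "\<lambda>s r. indicator {s..} r * r powr (\<alpha> - 3)"
  have "(norm x powr (\<alpha> - 2) - (\<rho>/2) powr (\<alpha> - 2)) / (2 - \<alpha>) = (LINT r|lborel. ?f (norm x) r - ?f (\<rho>/2) r)"
    using n \<rho> integral_powr_tail[of "norm x"] integral_powr_tail[of "\<rho>/2"]
    by (simp add: diff_divide_distrib)
  also have "\<dots> \<le> (LINT r|lborel. indicator {norm x..} r * Q_integrand r)"
  proof (intro integral_mono Q_tail_integrable n)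
    show "integrable lborel (\<lambda>r. ?f (norm x) r - ?f (\<rho>/2) r)"
      using n \<rho> by (intro Bochner_Integration.integrable_diff integral_powr_tail(1)) auto
    fix r :: real
    have "w (r/\<rho>) = 1" if "norm x \<le> r" "r < \<rho>/2"
    proof -
      have "0 \<le> r" using that n by linarith
      then have "r/\<rho> \<in> {0..1/2}" using that \<rho> by (auto simp: field_simps)
      then show ?thesis using w unfolding horizon_profile_def by blast
    qed
    moreover have "1 / r powr (3 - \<alpha>) = r powr (\<alpha> - 3)" by (simp add: powr_minus_divide[symmetric])
    moreover have "norm x \<le> r \<Longrightarrow> 0 \<le> r / \<rho>" using n \<rho> by (intro divide_nonneg_pos) linarith+
    ultimately have eq: "Q_integrand r = r powr (\<alpha> - 3)" if "norm x \<le> r" "r < \<rho>/2"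
      using that by (simp add: Q_integrand_def)
    consider "norm x > r" "r < \<rho>/2" | "norm x \<le> r" "\<rho>/2 \<le> r" | "norm x \<le> r" "r < \<rho>/2"
      using assms(2) by linarith
    then show "?f (norm x) r - ?f (\<rho>/2) r \<le> indicator {norm x..} r * Q_integrand r"
      by cases (use eq Q_integrand_bounds(1)[of r] in simp_all)
  qed
  finally have "(2 - \<alpha>) / riesz_gamma \<alpha> * ((norm x powr (\<alpha> - 2) - (\<rho>/2) powr (\<alpha> - 2)) / (2 - \<alpha>)) \<le> Q_kernel w \<alpha> \<rho> x"
    unfolding Q_kernel_eq using riesz_gamma_pos[OF \<alpha>] \<alpha> by (intro mult_left_mono) auto
  then show ?thesis using \<alpha> by simp
qed

lemma Q_kernel_zero:
  assumes "\<And>t. \<tau> \<le> t \<Longrightarrow> w t = 0" "norm x \<ge> \<tau> * \<rho>"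
  shows "Q_kernel w \<alpha> \<rho> x = 0"
proof -
  have "indicator {norm x..} r * Q_integrand r = 0" for r
  proof (cases "norm x \<le> r")
    case True
    then have "\<tau> \<le> r/\<rho>" using assms(2) \<rho> by (simp add: field_simps)
    then show ?thesis using assms(1) by (simp add: Q_integrand_def)
  qed simp
  then have "(\<lambda>r. indicator {norm x..} r * Q_integrand r) = (\<lambda>r. 0)" by blast
  then show ?thesis unfolding Q_kernel_eq by (simp only: integral_zero mult_zero_right)
qed

text \<open>Domination by the full Riesz kernel on the ball of radius \<rho>; its exponent
  \<open>\<alpha> - 2\<close> exceeds -2 and is therefore integrable at the origin of the
  plane.\<close>

lemma Q_kernel_integrable: "integrable lborel (Q_kernel w \<alpha> \<rho>)"
proof (rule integrableI_nonneg)
  have "(\<integral>\<^sup>+x. ennreal (Q_kernel w \<alpha> \<rho> x) \<partial>lborel)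
    \<le> (\<integral>\<^sup>+(x::real^2). ennreal (1 / riesz_gamma \<alpha>) * (ennreal (norm x powr (\<alpha> - 2)) * indicator {0..\<rho>} (norm x)) \<partial>lborel)"
  proof -
    have le: "ennreal (Q_kernel w \<alpha> \<rho> x) \<le> ennreal (1 / riesz_gamma \<alpha>) * (ennreal (norm x powr (\<alpha> - 2)) * indicator {0..\<rho>} (norm x))"
      if x: "x \<noteq> 0" for x
    proof -
    obtain \<tau> where \<tau>: "\<tau> < 1" "\<And>t. \<tau> \<le> t \<Longrightarrow> w t = 0" using horizon_profile_vanish[OF w] by blast
    show ?thesis
    proof (cases "norm x \<le> \<rho>")
      case True
      then show ?thesis using Q_kernel_le[OF x] riesz_gamma_pos[OF \<alpha>]
        by (simp add: ennreal_mult[symmetric] ennreal_leI)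
    next
      case False
      then have "\<tau> * \<rho> \<le> norm x" using \<tau> \<rho> by (smt (verit) mult_less_cancel_right2)
      then show ?thesis using Q_kernel_zero[OF \<tau>(2)] by simp
    qed
    qed
    have "AE x in lborel. x \<noteq> (0::real^2)" by (rule AE_lborel_singleton)
    then have "AE x in lborel. ennreal (Q_kernel w \<alpha> \<rho> x) \<le> ennreal (1 / riesz_gamma \<alpha>) * (ennreal (norm x powr (\<alpha> - 2)) * indicator {0..\<rho>} (norm x))"
      by (rule eventually_mono) (rule le)
    then show ?thesis by (rule nn_integral_mono_AE)
  qed
  also have "\<dots> = ennreal (1 / riesz_gamma \<alpha>) * ennreal (2*pi * \<rho> powr (\<alpha> - 2 + 2) / (\<alpha> - 2 + 2))"
    using \<alpha> \<rho> by (subst nn_integral_cmult, measurable) (subst nn_integral_norm_powr, auto)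
  also have "\<dots> < \<infinity>" by (simp add: ennreal_mult_less_top)
  finally show "(\<integral>\<^sup>+x. ennreal (Q_kernel w \<alpha> \<rho> x) \<partial>lborel) < \<infinity>" .
qed (use Q_kernel_nonneg in auto)

end

section \<open>Testing against Airy stresses\<close>

text \<open>The cofactor matrix of the Hessian of \<Phi>. Both off-diagonal entries use the mixed
  derivative in the same order, so the matrix is symmetric for every \<Phi>, before any regularity
  is known.\<close>

definition airy :: "(real^2 \<Rightarrow> real) \<Rightarrow> real^2 \<Rightarrow> real^2^2" where
  "airy \<Phi> x = vector
     [vector [partial_deriv 2 (partial_deriv 2 \<Phi>) x, - partial_deriv 1 (partial_deriv 2 \<Phi>) x],
      vector [- partial_deriv 1 (partial_deriv 2 \<Phi>) x, partial_deriv 1 (partial_deriv 1 \<Phi>) x]]"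

lemma inner_mat2: "(A::real^2^2) \<bullet> B = A$1$1 * B$1$1 + A$1$2 * B$1$2 + A$2$1 * B$2$1 + A$2$2 * B$2$2"
  by (simp add: inner_vec_def sum_2)

lemma inner_airy: "airy \<Phi> x \<bullet> B = partial_deriv 2 (partial_deriv 2 \<Phi>) x * B$1$1
   - partial_deriv 1 (partial_deriv 2 \<Phi>) x * (B$1$2 + B$2$1) + partial_deriv 1 (partial_deriv 1 \<Phi>) x * B$2$2"
  by (simp add: airy_def inner_mat2 algebra_simps)

lemma airy_eq: "airy \<Phi> x = partial_deriv 2 (partial_deriv 2 \<Phi>) x *\<^sub>R axis 1 (axis 1 1)
   - partial_deriv 1 (partial_deriv 2 \<Phi>) x *\<^sub>R (axis 1 (axis 2 1) + axis 2 (axis 1 1))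
   + partial_deriv 1 (partial_deriv 1 \<Phi>) x *\<^sub>R axis 2 (axis 2 1)"
  by (simp add: vec_eq_iff forall_2 airy_def axis_def)

lemma norm_airy_le: "norm (airy \<Phi> x) \<le> \<bar>partial_deriv 2 (partial_deriv 2 \<Phi>) x\<bar>
   + 2 * \<bar>partial_deriv 1 (partial_deriv 2 \<Phi>) x\<bar> + \<bar>partial_deriv 1 (partial_deriv 1 \<Phi>) x\<bar>"
proof -
  let ?a = "partial_deriv 2 (partial_deriv 2 \<Phi>) x *\<^sub>R axis 1 (axis 1 1) :: real^2^2"
  let ?b = "partial_deriv 1 (partial_deriv 2 \<Phi>) x *\<^sub>R (axis 1 (axis 2 1) + axis 2 (axis 1 1)) :: real^2^2"
  let ?c = "partial_deriv 1 (partial_deriv 1 \<Phi>) x *\<^sub>R axis 2 (axis 2 1) :: real^2^2"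
  have "norm (axis 1 (axis 2 1) + axis 2 (axis 1 1) :: real^2^2) \<le> 2"
    using norm_triangle_ineq[of "axis 1 (axis 2 1) :: real^2^2" "axis 2 (axis 1 1)"] by simp
  then have "norm ?b \<le> \<bar>partial_deriv 1 (partial_deriv 2 \<Phi>) x\<bar> * 2"
    unfolding norm_scaleR by (rule mult_left_mono) simp
  moreover have "norm (?a - ?b + ?c) \<le> norm ?a + norm ?b + norm ?c"
    by (rule order_trans[OF norm_triangle_ineq add_right_mono[OF norm_triangle_ineq4]])
  ultimately show ?thesis unfolding airy_eq by simp
qed

lemma airy_continuous:
  assumes "\<Phi> \<in> supported R"
  shows "continuous_on A (airy \<Phi>)"
  unfolding airy_eq[abs_def]
  by (intro continuous_intros continuous_on_subset[OF supported_continuous[OF supported_partial_deriv[OF supported_partial_deriv[OF assms]]]]) auto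

lemma integral_shift:
  fixes f :: "'a::euclidean_space \<Rightarrow> 'b::{banach, second_countable_topology}"
  assumes "f \<in> borel_measurable borel"
  shows "(LINT x|lborel. f (x - y)) = (LINT x|lborel. f x)"
    "integrable lborel f \<Longrightarrow> integrable lborel (\<lambda>x. f (x - y))"
proof -
  have "(LINT x|lborel. f x) = (LINT x|distr lborel borel ((+) (-y)). f x)" by (simp only: lborel_distr_plus)
  also have "\<dots> = (LINT x|lborel. f (- y + x))" by (rule integral_distr) (use assms in auto)
  finally show "(LINT x|lborel. f (x - y)) = (LINT x|lborel. f x)" by simp
  assume "integrable lborel f"
  then have "integrable (distr lborel borel ((+) (-y))) f" by (simp only: lborel_distr_plus)
  then have "integrable lborel (\<lambda>x. f (- y + x))" by (subst (asm) integrable_distr_eq) (use assms in auto)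
  then show "integrable lborel (\<lambda>x. f (x - y))" by simp
qed

lemma kconv_shift:
  assumes K: "integrable lborel K" and f: "f \<in> supported R"
  shows "(LINT x|lborel. K (x - y) * f x) = kconv K f y"
    "integrable lborel (\<lambda>x. K (x - y) * f x)"
proof -
  note i = kconv_integrable[OF K f, of y]
  then have m: "(\<lambda>z. K z * f (y + z)) \<in> borel_measurable borel" by simp
  show "(LINT x|lborel. K (x - y) * f x) = kconv K f y"
    using integral_shift(1)[OF m, of y] by (simp add: kconv_def)
  show "integrable lborel (\<lambda>x. K (x - y) * f x)"
    using integral_shift(2)[OF m i, of y] by simp
qed

lemma convolution_integrable:
  fixes b :: "real^2 \<Rightarrow> real^2^2"
  assumes K: "integrable lborel K" and b: "integrable lborel b"
  shows "integrable (lborel \<Otimes>\<^sub>M lborel) (\<lambda>(y, x). K (x - y) *\<^sub>R b y)"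
proof -
  have [measurable]: "K \<in> borel_measurable borel" "b \<in> borel_measurable borel" using K b by auto
  have nK: "integrable lborel (\<lambda>x. \<bar>K (x - y)\<bar>)" "(LINT x|lborel. \<bar>K (x - y)\<bar>) = (LINT x|lborel. \<bar>K x\<bar>)" for y
    using integral_shift[of "\<lambda>x. \<bar>K x\<bar>" y] K by auto
  show ?thesis
  proof (rule lborel_pair.Fubini_integrable)
    show "(\<lambda>(y, x). K (x - y) *\<^sub>R b y) \<in> borel_measurable (lborel \<Otimes>\<^sub>M lborel)" by measurable
    have "(\<lambda>y. LINT x|lborel. norm (case (y, x) of (y, x) \<Rightarrow> K (x - y) *\<^sub>R b y)) = (\<lambda>y. (LINT x|lborel. \<bar>K x\<bar>) * norm (b y))"
      using nK by simp
    then show "integrable lborel (\<lambda>y. LINT x|lborel. norm (case (y, x) of (y, x) \<Rightarrow> K (x - y) *\<^sub>R b y))"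
      using b by simp
    show "AE y in lborel. integrable lborel (\<lambda>x. case (y, x) of (y, x) \<Rightarrow> K (x - y) *\<^sub>R b y)"
      using K integral_shift(2)[of K] by simp
  qed
qed

text \<open>Fubini moves the kernel from the field to the stress. Since \<open>kconv\<close>
  commutes with partial derivatives, the smoothed stress is again an Airy stress, that of the
  smoothed potential.\<close>

lemma airy_duality:
  fixes b :: "real^2 \<Rightarrow> real^2^2"
  assumes K: "integrable lborel K" and Kz: "\<And>z. norm z > S \<Longrightarrow> K z = 0"
    and b: "integrable lborel b" and \<Phi>: "\<Phi> \<in> supported R"
  defines "F \<equiv> \<lambda>x. LINT y|lborel. K (x - y) *\<^sub>R b y"
  shows "integrable lborel (\<lambda>x. airy \<Phi> x \<bullet> F x)"
    "(LINT x|lborel. airy \<Phi> x \<bullet> F x) = (LINT y|lborel. airy (kconv K \<Phi>) y \<bullet> b y)"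
proof -
  note sp = supported_partial_deriv
  have [measurable]: "K \<in> borel_measurable borel" "b \<in> borel_measurable borel" using K b by auto
  have am[measurable]: "airy \<Phi> \<in> borel_measurable borel"
    by (rule borel_measurable_continuous_onI[OF airy_continuous[OF \<Phi>]])
  obtain B where B: "B > 0" "\<And>x. norm (airy \<Phi> x) \<le> B"
  proof -
    obtain B11 where B11: "\<And>x. \<bar>partial_deriv 1 (partial_deriv 1 \<Phi>) x\<bar> \<le> B11" "B11 > 0" using supported_bounded[OF sp[OF sp[OF \<Phi>]]] by metis
    obtain B12 where B12: "\<And>x. \<bar>partial_deriv 1 (partial_deriv 2 \<Phi>) x\<bar> \<le> B12" "B12 > 0" using supported_bounded[OF sp[OF sp[OF \<Phi>]]] by metis
    obtain B22 where B22: "\<And>x. \<bar>partial_deriv 2 (partial_deriv 2 \<Phi>) x\<bar> \<le> B22" "B22 > 0" using supported_bounded[OF sp[OF sp[OF \<Phi>]]] by metis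
    have "norm (airy \<Phi> x) \<le> B11 + B12 + B12 + B22" for x
      using norm_airy_le[of \<Phi> x] B11(1)[of x] B12(1)[of x] B22(1)[of x] by linarith
    then show thesis using that[of "B11 + B12 + B12 + B22"] B11 B12 B22 by auto
  qed
  note i0 = convolution_integrable[OF K b]
  have i1: "integrable (lborel \<Otimes>\<^sub>M lborel) (\<lambda>(y, x). airy \<Phi> x \<bullet> (K (x - y) *\<^sub>R b y))"
  proof (rule Bochner_Integration.integrable_bound[OF integrable_scaleR_right[OF i0, of B]])
    show "(\<lambda>(y, x). airy \<Phi> x \<bullet> (K (x - y) *\<^sub>R b y)) \<in> borel_measurable (lborel \<Otimes>\<^sub>M lborel)" by measurable
    show "AE p in lborel \<Otimes>\<^sub>M lborel. norm (case p of (y, x) \<Rightarrow> airy \<Phi> x \<bullet> (K (x - y) *\<^sub>R b y))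
        \<le> norm (B *\<^sub>R (case p of (y, x) \<Rightarrow> K (x - y) *\<^sub>R b y))"
    proof (rule AE_I2)
      fix p :: "(real^2) \<times> (real^2)"
      obtain y x where p: "p = (y, x)" by (cases p)
      have "norm (airy \<Phi> x \<bullet> (K (x - y) *\<^sub>R b y)) \<le> norm (airy \<Phi> x) * norm (K (x - y) *\<^sub>R b y)"
        by (simp only: real_norm_def Cauchy_Schwarz_ineq2)
      also have "\<dots> \<le> B * norm (K (x - y) *\<^sub>R b y)" by (rule mult_right_mono[OF B(2)]) simp
      finally show "norm (case p of (y, x) \<Rightarrow> airy \<Phi> x \<bullet> (K (x - y) *\<^sub>R b y))
        \<le> norm (B *\<^sub>R (case p of (y, x) \<Rightarrow> K (x - y) *\<^sub>R b y))" using B(1) p by (simp add: abs_mult)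
    qed
  qed
  \<comment> \<open>The convolution integral converges only for almost every x; at the other points
    F carries the default value of a nonintegrable integrand, so the identity can hold almost
    everywhere only.\<close>
  have ae: "AE x in lborel. airy \<Phi> x \<bullet> F x = (LINT y|lborel. airy \<Phi> x \<bullet> (K (x - y) *\<^sub>R b y))"
    using lborel_pair.AE_integrable_snd[OF i0]
    by (rule eventually_mono) (simp only: F_def integral_inner_right[symmetric] prod.case)
  have i2: "integrable lborel (\<lambda>x. LINT y|lborel. airy \<Phi> x \<bullet> (K (x - y) *\<^sub>R b y))"
    by (rule lborel_pair.integrable_snd[OF i1])
  have Fm[measurable]: "F \<in> borel_measurable borel"
    unfolding F_def using lborel.borel_measurable_lebesgue_integral[of "\<lambda>x y. K (x - y) *\<^sub>R b y" borel] by measurable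
  show "integrable lborel (\<lambda>x. airy \<Phi> x \<bullet> F x)"
    by (rule Bochner_Integration.integrable_cong_AE_imp[OF i2]) (measurable, use ae in \<open>auto elim: eventually_mono\<close>)
  have "(LINT x|lborel. airy \<Phi> x \<bullet> F x) = (LINT x|lborel. LINT y|lborel. airy \<Phi> x \<bullet> (K (x - y) *\<^sub>R b y))"
    by (rule integral_cong_AE) (use ae borel_measurable_integrable[OF i2] in auto)
  also have "\<dots> = (LINT y|lborel. LINT x|lborel. airy \<Phi> x \<bullet> (K (x - y) *\<^sub>R b y))"
    by (rule lborel_pair.Fubini_integral[OF i1])
  also have "\<dots> = (LINT y|lborel. airy (kconv K \<Phi>) y \<bullet> b y)"
  proof (rule Bochner_Integration.integral_cong[OF refl])
    fix y
    let ?p = "\<lambda>i j x. K (x - y) * partial_deriv i (partial_deriv j \<Phi>) x"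
    have i: "integrable lborel (?p i j)" for i j by (rule kconv_shift(2)[OF K sp[OF sp[OF \<Phi>]]])
    have k: "(LINT x|lborel. ?p i j x) = partial_deriv i (partial_deriv j (kconv K \<Phi>)) y" for i j
      unfolding kconv_partial_deriv[OF K \<Phi>] kconv_partial_deriv[OF K sp[OF \<Phi>]]
      by (rule kconv_shift(1)[OF K sp[OF sp[OF \<Phi>]]])
    have "(LINT x|lborel. airy \<Phi> x \<bullet> (K (x - y) *\<^sub>R b y))
      = (LINT x|lborel. ?p 2 2 x * b y $1$1 - ?p 1 2 x * (b y $1$2 + b y $2$1) + ?p 1 1 x * b y $2$2)"
      by (simp add: inner_airy algebra_simps)
    also have "\<dots> = (LINT x|lborel. ?p 2 2 x) * b y $1$1 - (LINT x|lborel. ?p 1 2 x) * (b y $1$2 + b y $2$1) + (LINT x|lborel. ?p 1 1 x) * b y $2$2"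
      using i by (simp del: distrib_left)
    finally show "(LINT x|lborel. airy \<Phi> x \<bullet> (K (x - y) *\<^sub>R b y)) = airy (kconv K \<Phi>) y \<bullet> b y"
      unfolding k inner_airy .
  qed
  finally show "(LINT x|lborel. airy \<Phi> x \<bullet> F x) = (LINT y|lborel. airy (kconv K \<Phi>) y \<bullet> b y)" .
qed

lemma integrable_mult_supported:
  assumes f: "f \<in> supported R" and g: "integrable lborel (g :: real^2 \<Rightarrow> real)"
  shows "integrable lborel (\<lambda>x. g x * f x)"
proof -
  obtain B where B: "B > 0" "\<And>x. \<bar>f x\<bar> \<le> B" using supported_bounded[OF f] by blast
  have "f \<in> borel_measurable borel" using supported_continuous[OF f] by (rule borel_measurable_continuous_onI)
  then have "(\<lambda>x. g x * f x) \<in> borel_measurable lborel" using g by simp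
  moreover have "AE x in lborel. norm (g x * f x) \<le> norm (B * g x)"
  proof (rule AE_I2)
    fix x
    have "\<bar>f x\<bar> * \<bar>g x\<bar> \<le> B * \<bar>g x\<bar>" by (rule mult_right_mono[OF B(2)]) simp
    then show "norm (g x * f x) \<le> norm (B * g x)" using B(1) by (simp add: abs_mult mult.commute)
  qed
  ultimately show ?thesis
    by (rule Bochner_Integration.integrable_bound[OF integrable_mult_right[OF g]])
qed

text \<open>The rows of the stress are rotated gradients of \<open>partial_deriv 2 \<Psi>\<close>
  and of minus \<open>partial_deriv 1 \<Psi>\<close>. The integral is therefore the curl of the
  first row of \<beta> tested with the one, minus the curl of the second row tested with
  \<open>partial_deriv 1 \<Psi>\<close>, and the Dirac mass evaluates both at the origin.\<close>

lemma Curl_airy: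
  assumes \<beta>: "\<beta> \<in> admissible \<zeta> \<rho>" and \<Psi>: "\<Psi> \<in> supported R" and R: "R < 2 * \<rho>"
  shows "(LINT y|lborel. airy \<Psi> y \<bullet> zero_extension (ball 0 (2*\<rho>)) \<beta> y)
    = \<zeta>$1 * partial_deriv 2 \<Psi> 0 - \<zeta>$2 * partial_deriv 1 \<Psi> 0"
proof -
  let ?U = "ball (0::real^2) (2*\<rho>)"
  let ?b = "zero_extension ?U \<beta>"
  have zb: "?b = (\<lambda>x. indicator ?U x *\<^sub>R \<beta> x)" by (auto simp: zero_extension_def indicator_def)
  have bi: "integrable lborel ?b" using \<beta> unfolding zb admissible_def set_integrable_def by simp
  have bij: "integrable lborel (\<lambda>x. ?b x $ i $ j)" for i j
    by (rule integrable_bounded_linear[OF bounded_linear_compose[OF bounded_linear_vec_nth bounded_linear_vec_nth] bi])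
  note sp = supported_partial_deriv
  have i: "integrable lborel (\<lambda>x. ?b x $ i $ j * partial_deriv k (partial_deriv l \<Psi>) x)" for i j k l
    by (rule integrable_mult_supported[OF sp[OF sp[OF \<Psi>]] bij])
  have curl: "Curl_pairing ?U \<beta> (partial_deriv i \<Psi>) = partial_deriv i \<Psi> 0 *\<^sub>R \<zeta>" for i
    using \<beta> supported_test_function[OF sp[OF \<Psi>] R] by (simp add: admissible_def Curl_eq_dirac_def)
  have pair: "Curl_pairing ?U \<beta> \<phi> $ i = - (LINT x|lborel. ?b x $ i $ 2 * partial_deriv 1 \<phi> x - ?b x $ i $ 1 * partial_deriv 2 \<phi> x)" for \<phi> i
    unfolding Curl_pairing_def set_lebesgue_integral_def zb by (simp add: algebra_simps)
  have aux: "a - b = - z * p" if "- (a - b) = p * z" for a b p z :: real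
  proof -
    have "a - b = - (p * z)" using that by linarith
    then show ?thesis by simp
  qed
  have 1: "(LINT x|lborel. ?b x $1$2 * partial_deriv 1 (partial_deriv 2 \<Psi>) x) - (LINT x|lborel. ?b x $1$1 * partial_deriv 2 (partial_deriv 2 \<Psi>) x) = - \<zeta>$1 * partial_deriv 2 \<Psi> 0"
  proof -
    have "- ((LINT x|lborel. ?b x $1$2 * partial_deriv 1 (partial_deriv 2 \<Psi>) x) - (LINT x|lborel. ?b x $1$1 * partial_deriv 2 (partial_deriv 2 \<Psi>) x))
      = partial_deriv 2 \<Psi> 0 * \<zeta>$1"
      using arg_cong[OF curl[of 2], of "\<lambda>v. v$1"] i unfolding pair by simp
    then show ?thesis by (rule aux)
  qed
  have 2: "(LINT x|lborel. ?b x $2$2 * partial_deriv 1 (partial_deriv 1 \<Psi>) x) - (LINT x|lborel. ?b x $2$1 * partial_deriv 2 (partial_deriv 1 \<Psi>) x) = - \<zeta>$2 * partial_deriv 1 \<Psi> 0"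
  proof -
    have "- ((LINT x|lborel. ?b x $2$2 * partial_deriv 1 (partial_deriv 1 \<Psi>) x) - (LINT x|lborel. ?b x $2$1 * partial_deriv 2 (partial_deriv 1 \<Psi>) x))
      = partial_deriv 1 \<Psi> 0 * \<zeta>$2"
      using arg_cong[OF curl[of 1], of "\<lambda>v. v$2"] i unfolding pair by simp
    then show ?thesis by (rule aux)
  qed
  have comm: "partial_deriv 2 (partial_deriv 1 \<Psi>) = partial_deriv 1 (partial_deriv 2 \<Psi>)"
    using partial_deriv_commute[of UNIV \<Psi>] \<Psi> by (auto simp: supported_def)
  have "(LINT y|lborel. airy \<Psi> y \<bullet> ?b y) = (LINT x|lborel. ?b x $1$1 * partial_deriv 2 (partial_deriv 2 \<Psi>) x
     - ?b x $1$2 * partial_deriv 1 (partial_deriv 2 \<Psi>) x - ?b x $2$1 * partial_deriv 1 (partial_deriv 2 \<Psi>) x + ?b x $2$2 * partial_deriv 1 (partial_deriv 1 \<Psi>) x)"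
    by (simp add: inner_airy algebra_simps)
  also have "\<dots> = (LINT x|lborel. ?b x $1$1 * partial_deriv 2 (partial_deriv 2 \<Psi>) x)
     - (LINT x|lborel. ?b x $1$2 * partial_deriv 1 (partial_deriv 2 \<Psi>) x) - (LINT x|lborel. ?b x $2$1 * partial_deriv 1 (partial_deriv 2 \<Psi>) x)
     + (LINT x|lborel. ?b x $2$2 * partial_deriv 1 (partial_deriv 1 \<Psi>) x)"
    using i by simp
  also have "\<dots> = \<zeta>$1 * partial_deriv 2 \<Psi> 0 - \<zeta>$2 * partial_deriv 1 \<Psi> 0" using 1 2 comm by simp
  finally show ?thesis .
qed

lemma riesz_airy_duality:
  assumes w: "horizon_profile w" and \<alpha>: "0 < \<alpha>" "\<alpha> < 1" and \<rho>: "0 < \<rho>"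
    and \<beta>: "\<beta> \<in> admissible \<zeta> \<rho>" and \<Phi>: "\<Phi> \<in> supported R" and R: "R \<le> \<rho>"
  defines "F \<equiv> riesz_potential w \<alpha> \<rho> (zero_extension (ball 0 (2*\<rho>)) \<beta>)"
  shows "integrable lborel (\<lambda>x. airy \<Phi> x \<bullet> F x)"
    "(LINT x|lborel. airy \<Phi> x \<bullet> F x) =
      (LINT z|lborel. Q_kernel w \<alpha> \<rho> z * (\<zeta>$1 * partial_deriv 2 \<Phi> z - \<zeta>$2 * partial_deriv 1 \<Phi> z))"
    "F \<in> borel_measurable borel"
proof -
  let ?b = "zero_extension (ball (0::real^2) (2*\<rho>)) \<beta>"
  let ?K = "Q_kernel w \<alpha> \<rho>"
  obtain \<tau> where \<tau>: "1/2 \<le> \<tau>" "\<tau> < 1" "\<And>t. \<tau> \<le> t \<Longrightarrow> w t = 0" using horizon_profile_vanish[OF w] by blast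
  have K: "integrable lborel ?K" by (rule Q_kernel_integrable[OF w \<alpha> \<rho>])
  have Kz: "?K z = 0" if "norm z > \<tau> * \<rho>" for z
    using Q_kernel_zero[OF w \<alpha> \<rho> \<tau>(3)] that by simp
  have zb: "?b = (\<lambda>x. indicator (ball 0 (2*\<rho>)) x *\<^sub>R \<beta> x)" by (auto simp: zero_extension_def indicator_def)
  have bi: "integrable lborel ?b" using \<beta> unfolding zb admissible_def set_integrable_def by simp
  have F: "F = (\<lambda>x. LINT y|lborel. ?K (x - y) *\<^sub>R ?b y)" by (simp add: F_def riesz_potential_def[abs_def])
  show "integrable lborel (\<lambda>x. airy \<Phi> x \<bullet> F x)"
    unfolding F by (rule airy_duality(1)[OF K Kz bi \<Phi>])
  \<comment> \<open>The strict inequality uses \<tau> < 1. It makes the derivatives of the smoothed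
    potential test functions on the open ball where the curl of \<beta> is prescribed.\<close>
  have lt: "R + \<tau> * \<rho> < 2 * \<rho>" using R mult_strict_right_mono[OF \<tau>(2) \<rho>] by linarith
  have p: "partial_deriv i (kconv ?K \<Phi>) 0 = (LINT z|lborel. ?K z * partial_deriv i \<Phi> z)" for i
    unfolding kconv_partial_deriv[OF K \<Phi>] by (simp add: kconv_def)
  have i: "integrable lborel (\<lambda>z. ?K z * partial_deriv i \<Phi> z)" for i
    using kconv_integrable[OF K supported_partial_deriv[OF \<Phi>], where y=0] by simp
  have "(LINT x|lborel. airy \<Phi> x \<bullet> F x) = (LINT y|lborel. airy (kconv ?K \<Phi>) y \<bullet> ?b y)"
    unfolding F by (rule airy_duality(2)[OF K Kz bi \<Phi>])
  also have "\<dots> = \<zeta>$1 * partial_deriv 2 (kconv ?K \<Phi>) 0 - \<zeta>$2 * partial_deriv 1 (kconv ?K \<Phi>) 0"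
    by (rule Curl_airy[OF \<beta> kconv_supported[OF K Kz \<Phi>] lt])
  also have "\<dots> = (LINT z|lborel. \<zeta>$1 * (?K z * partial_deriv 2 \<Phi> z) - \<zeta>$2 * (?K z * partial_deriv 1 \<Phi> z))"
    unfolding p using i by simp
  also have "\<dots> = (LINT z|lborel. ?K z * (\<zeta>$1 * partial_deriv 2 \<Phi> z - \<zeta>$2 * partial_deriv 1 \<Phi> z))"
    by (simp add: algebra_simps)
  finally show "(LINT x|lborel. airy \<Phi> x \<bullet> F x) =
      (LINT z|lborel. ?K z * (\<zeta>$1 * partial_deriv 2 \<Phi> z - \<zeta>$2 * partial_deriv 1 \<Phi> z))" .
  have [measurable]: "?K \<in> borel_measurable borel" "?b \<in> borel_measurable borel" using K bi by auto
  show "F \<in> borel_measurable borel"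
    unfolding F using lborel.borel_measurable_lebesgue_integral[of "\<lambda>x y. ?K (x - y) *\<^sub>R ?b y" borel] by measurable
qed

section \<open>Trigonometric polynomials\<close>

text \<open>Generated by single frequencies and sums, so that linear statements, orthogonality and
  the differential equation for potentials can be proved one mode at a time.\<close>

inductive trig_poly :: "(real \<Rightarrow> real) \<Rightarrow> bool" where
  mono: "trig_poly (\<lambda>t. a * cos (real k * t) + b * sin (real k * t))"
| add: "trig_poly f \<Longrightarrow> trig_poly g \<Longrightarrow> trig_poly (\<lambda>t. f t + g t)"

lemma trig_poly_mono_mult:
  assumes "trig_poly g"
  shows "trig_poly (\<lambda>t. (a * cos (real k * t) + b * sin (real k * t)) * g t)"
  using assms
proof induction
  case (mono c l d)
  \<comment> \<open>The product-to-sum formulas involve the difference of the frequencies, which is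
    a natural number only for \<open>l \<le> k\<close>; the other order follows by exchanging the
    factors.\<close>
  have *: "trig_poly (\<lambda>t. (a * cos (real k * t) + b * sin (real k * t)) * (c * cos (real l * t) + d * sin (real l * t)))"
    if "l \<le> k" for a b c d and k l :: nat
  proof -
    have kl: "real (k - l) * t = real k * t - real l * t" "real (k + l) * t = real k * t + real l * t" for t
      using that by (simp_all add: of_nat_diff algebra_simps)
    have "trig_poly (\<lambda>t. ((a*c+b*d)/2 * cos (real (k-l) * t) + (b*c-a*d)/2 * sin (real (k-l) * t))
        + ((a*c-b*d)/2 * cos (real (k+l) * t) + (b*c+a*d)/2 * sin (real (k+l) * t)))"
      by (intro trig_poly.add trig_poly.mono)
    also have "(\<lambda>t. ((a*c+b*d)/2 * cos (real (k-l) * t) + (b*c-a*d)/2 * sin (real (k-l) * t))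
        + ((a*c-b*d)/2 * cos (real (k+l) * t) + (b*c+a*d)/2 * sin (real (k+l) * t)))
      = (\<lambda>t. (a * cos (real k * t) + b * sin (real k * t)) * (c * cos (real l * t) + d * sin (real l * t)))"
      unfolding kl cos_diff sin_diff cos_add sin_add by (rule ext) (simp add: field_simps)
    finally show ?thesis .
  qed
  show ?case
  proof (cases "l \<le> k")
    case False
    then show ?thesis using *[of k l c d a b] by (simp add: mult.commute)
  qed (rule *)
next
  case (add f g)
  then show ?case by (simp add: distrib_left trig_poly.add)
qed

lemma trig_poly_mult:
  assumes "trig_poly f" "trig_poly g"
  shows "trig_poly (\<lambda>t. f t * g t)"
  using assms(1)
proof induction
  case (add f1 f2)
  then show ?case by (simp add: distrib_right trig_poly.add)
qed (rule trig_poly_mono_mult[OF assms(2)])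

lemma trig_poly_of_polynomial:
  fixes p :: "real^2 \<Rightarrow> real"
  assumes "real_polynomial_function p"
  shows "trig_poly (\<lambda>t. p (polar 1 t))"
  using assms
proof induction
  case (linear f)
  have "f (polar 1 t) = f (axis 1 1) * cos (real 1 * t) + f (axis 2 1) * sin (real 1 * t)" for t
  proof -
    have l: "linear f" using linear by (rule bounded_linear.linear)
    show ?thesis unfolding polar_def vector2_eq by (simp add: linear_add[OF l] linear_cmul[OF l])
  qed
  then show ?case using trig_poly.mono[of "f (axis 1 1)" 1 "f (axis 2 1)"] by (simp add: fun_eq_iff)
next
  case (const c)
  then show ?case using trig_poly.mono[of c 0 0] by simp
qed (auto intro: trig_poly.add trig_poly_mult)

lemma trig_poly_continuous: "trig_poly f \<Longrightarrow> continuous_on A f"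
  by (induction rule: trig_poly.induct) (auto intro!: continuous_intros)

text \<open>Stone-Weierstrass is applied to a function on the unit circle as a subset of the plane,
  so periodicity is built in. Polynomials in x become trigonometric polynomials along the
  circle.\<close>

lemma trig_approximation:
  fixes H :: "real^2 \<Rightarrow> real"
  assumes "continuous_on (sphere 0 1) H" "e > 0"
  obtains g where "trig_poly g" "\<And>t. \<bar>H (polar 1 t) - g t\<bar> < e"
proof -
  obtain p where "real_polynomial_function p" "\<And>x. x \<in> sphere 0 1 \<Longrightarrow> \<bar>H x - p x\<bar> < e"
    using Stone_Weierstrass_real_polynomial_function[OF compact_sphere assms] by blast
  then show ?thesis using that[OF trig_poly_of_polynomial[of p]] by simp
qed

section \<open>Integrals over the circle and Fourier coefficients\<close>

definition circ :: "(real \<Rightarrow> real) \<Rightarrow> real" where "circ f = integral {0..2*pi} f"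

lemma circ_lborel:
  assumes f: "continuous_on {0..2*pi} f"
  shows "integrable lborel (\<lambda>t. indicator {0..<2*pi} t * f t)"
    "(LINT t|lborel. indicator {0..<2*pi} t * f t) = circ f"
proof -
  have i: "set_integrable lborel {0..2*pi} f"
    unfolding set_integrable_def using borel_integrable_compact[OF _ f] by (simp add: indicator_scaleR_eq_if)
  then have i1: "integrable lborel (\<lambda>t. indicator {0..2*pi} t * f t)" by (simp add: set_integrable_def)
  have c: "(LINT t|lborel. indicator {0..2*pi} t * f t) = circ f"
    using set_borel_integral_eq_integral(2)[OF i] by (simp add: set_lebesgue_integral_def circ_def)
  have ae: "AE t in lborel. indicator {0..2*pi} t * f t = indicator {0..<2*pi} t * f t"
  proof -
    have "AE t in lborel. t \<noteq> 2*pi" by (rule AE_lborel_singleton)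
    then show ?thesis by (rule eventually_mono) (auto simp: indicator_def)
  qed
  have m0: "(\<lambda>t. indicator {0..2*pi} t * f t) \<in> borel_measurable borel" using i1 by auto
  have "(\<lambda>t. indicator {0..<2*pi} t * (indicator {0..2*pi} t * f t)) \<in> borel_measurable borel"
    using m0 by measurable
  moreover have "(\<lambda>t. indicator {0..<2*pi} t * (indicator {0..2*pi} t * f t)) = (\<lambda>t. indicator {0..<2*pi} t * f t)"
    by (auto simp: indicator_def)
  ultimately have m: "(\<lambda>t. indicator {0..<2*pi} t * f t) \<in> borel_measurable lborel" by simp
  show "integrable lborel (\<lambda>t. indicator {0..<2*pi} t * f t)"
    using integrable_cong_AE[of _ lborel, OF _ m ae] i1 by auto
  show "(LINT t|lborel. indicator {0..<2*pi} t * f t) = circ f"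
    unfolding c[symmetric] by (rule integral_cong_AE) (use m m0 ae in auto)
qed

lemma circ_linear:
  assumes "continuous_on {0..2*pi} f" "continuous_on {0..2*pi} g"
  shows "circ (\<lambda>t. f t + g t) = circ f + circ g" "circ (\<lambda>t. f t - g t) = circ f - circ g"
    "circ (\<lambda>t. c * f t) = c * circ f"
  using assms unfolding circ_def
  by (simp_all add: Henstock_Kurzweil_Integration.integral_add Henstock_Kurzweil_Integration.integral_diff integrable_continuous_interval)

lemma circ_mono:
  assumes "continuous_on {0..2*pi} f" "continuous_on {0..2*pi} g" "\<And>t. t \<in> {0..2*pi} \<Longrightarrow> f t \<le> g t"
  shows "circ f \<le> circ g"
  unfolding circ_def using assms by (intro integral_le integrable_continuous_interval) auto

lemma circ_const: "circ (\<lambda>t. c) = 2*pi*c" by (simp add: circ_def)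

lemma circ_eq_0:
  assumes "continuous_on {0..2*pi} f" "\<And>t. t \<in> {0..2*pi} \<Longrightarrow> 0 \<le> f t" "circ f = 0" "t \<in> {0..2*pi}"
  shows "f t = 0"
  using integral_eq_0_iff[OF assms(1)] assms unfolding circ_def by auto

lemma circ_cos_sin:
  assumes "k \<ge> 1"
  shows "circ (\<lambda>t. cos (real k * t)) = 0" "circ (\<lambda>t. sin (real k * t)) = 0"
proof -
  have k: "real k \<noteq> 0" using assms by simp
  have "((\<lambda>t. cos (real k * t)) has_integral (sin (real k * (2*pi)) / real k - sin (real k * 0) / real k)) {0..2*pi}"
    by (rule fundamental_theorem_of_calculus)
      (use k in \<open>auto intro!: derivative_eq_intros simp: has_real_derivative_iff_has_vector_derivative[symmetric]\<close>)
  moreover have "sin (real k * (2*pi)) = 0" using sin_npi2[of "2*k"] by (simp add: mult_ac)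
  ultimately show "circ (\<lambda>t. cos (real k * t)) = 0" unfolding circ_def by (simp add: integral_unique)
  have "((\<lambda>t. sin (real k * t)) has_integral (- cos (real k * (2*pi)) / real k - - cos (real k * 0) / real k)) {0..2*pi}"
    by (rule fundamental_theorem_of_calculus)
      (use k in \<open>auto intro!: derivative_eq_intros simp: has_real_derivative_iff_has_vector_derivative[symmetric]\<close>)
  moreover have "cos (real k * (2*pi)) = 1" using cos_npi2[of "2*k"] by (simp add: mult_ac)
  ultimately show "circ (\<lambda>t. sin (real k * t)) = 0" unfolding circ_def by (simp add: integral_unique)
qed

text \<open>After subtracting its mean, H is orthogonal to all trigonometric polynomials. A uniform
  approximation within e then bounds the integral of the square of the difference by e times the
  integral of its absolute value, for every e, so the square integrates to 0 and continuity gives 0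
  pointwise.\<close>

lemma orthogonal_trig_constant:
  fixes H :: "real^2 \<Rightarrow> real"
  assumes H: "continuous_on (sphere 0 1) H"
    and orth: "\<And>k. k \<ge> 1 \<Longrightarrow> circ (\<lambda>t. H (polar 1 t) * cos (real k * t)) = 0"
      "\<And>k. k \<ge> 1 \<Longrightarrow> circ (\<lambda>t. H (polar 1 t) * sin (real k * t)) = 0"
  shows "t \<in> {0..2*pi} \<Longrightarrow> H (polar 1 t) = circ (\<lambda>t. H (polar 1 t)) / (2*pi)"
proof -
  define h where "h t = H (polar 1 t) - circ (\<lambda>t. H (polar 1 t)) / (2*pi)" for t
  have cp: "continuous_on A (\<lambda>t. polar 1 t)" for A
    unfolding polar_def vector2_eq by (intro continuous_intros)
  have Hc: "continuous_on {0..2*pi} (\<lambda>t. H (polar 1 t))"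
    by (rule continuous_on_compose2[OF H cp]) auto
  have hc: "continuous_on {0..2*pi} h" unfolding h_def by (intro continuous_intros Hc)
  have cc: "continuous_on {0..2*pi} (\<lambda>t. cos (real k * t))" "continuous_on {0..2*pi} (\<lambda>t. sin (real k * t))" for k
    by (intro continuous_intros)+
  let ?m = "circ (\<lambda>t. H (polar 1 t)) / (2*pi)"
  have h0: "circ h = 0" unfolding h_def using circ_linear(2)[OF Hc, of "\<lambda>t. ?m"] by (simp add: circ_const)
  have hcos: "circ (\<lambda>t. h t * cos (real k * t)) = 0" for k
  proof (cases "k \<ge> 1")
    case True
    have "circ (\<lambda>t. h t * cos (real k * t)) = circ (\<lambda>t. H (polar 1 t) * cos (real k * t) - ?m * cos (real k * t))"
      unfolding h_def by (simp add: left_diff_distrib)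
    also have "\<dots> = circ (\<lambda>t. H (polar 1 t) * cos (real k * t)) - circ (\<lambda>t. ?m * cos (real k * t))"
      by (rule circ_linear(2)) (intro continuous_intros Hc)+
    also have "\<dots> = 0" using orth(1)[OF True] circ_linear(3)[OF cc(1) cc(1), of ?m k] circ_cos_sin[OF True] by simp
    finally show ?thesis .
  qed (use h0 in \<open>simp add: not_le\<close>)
  have hsin: "circ (\<lambda>t. h t * sin (real k * t)) = 0" for k
  proof (cases "k \<ge> 1")
    case True
    have "circ (\<lambda>t. h t * sin (real k * t)) = circ (\<lambda>t. H (polar 1 t) * sin (real k * t) - ?m * sin (real k * t))"
      unfolding h_def by (simp add: left_diff_distrib)
    also have "\<dots> = circ (\<lambda>t. H (polar 1 t) * sin (real k * t)) - circ (\<lambda>t. ?m * sin (real k * t))"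
      by (rule circ_linear(2)) (intro continuous_intros Hc)+
    also have "\<dots> = 0" using orth(2)[OF True] circ_linear(3)[OF cc(2) cc(2), of ?m k] circ_cos_sin[OF True] by simp
    finally show ?thesis .
  next
    case False
    then show ?thesis using circ_const[of 0] by (simp add: not_le)
  qed
  have hp: "circ (\<lambda>t. h t * g t) = 0" if "trig_poly g" for g
    using that
  proof induction
    case (mono a k b)
    have "circ (\<lambda>t. h t * (a * cos (real k * t) + b * sin (real k * t)))
      = circ (\<lambda>t. a * (h t * cos (real k * t)) + b * (h t * sin (real k * t)))"
      by (simp add: algebra_simps)
    also have "\<dots> = circ (\<lambda>t. a * (h t * cos (real k * t))) + circ (\<lambda>t. b * (h t * sin (real k * t)))"
      by (rule circ_linear(1)) (intro continuous_intros hc)+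
    also have "\<dots> = a * circ (\<lambda>t. h t * cos (real k * t)) + b * circ (\<lambda>t. h t * sin (real k * t))"
      using hc by (intro arg_cong2[where f="(+)"] circ_linear(3)) (auto intro!: continuous_intros)
    finally show ?case by (simp add: hcos hsin)
  next
    case (add f g)
    have "circ (\<lambda>t. h t * (f t + g t)) = circ (\<lambda>t. h t * f t + h t * g t)" by (simp add: distrib_left)
    also have "\<dots> = circ (\<lambda>t. h t * f t) + circ (\<lambda>t. h t * g t)"
      by (rule circ_linear(1)) (intro continuous_intros hc trig_poly_continuous add.hyps)+
    finally show ?case using add by simp
  qed
  have h2c: "continuous_on {0..2*pi} (\<lambda>t. h t * h t)" by (intro continuous_intros hc)
  have ahc: "continuous_on {0..2*pi} (\<lambda>t. \<bar>h t\<bar>)" by (intro continuous_intros hc)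
  have "circ (\<lambda>t. h t * h t) \<le> e * circ (\<lambda>t. \<bar>h t\<bar>)" if e: "e > 0" for e
  proof -
    obtain g where g: "trig_poly g" "\<And>t. \<bar>H (polar 1 t) - g t\<bar> < e" using trig_approximation[OF H e] by blast
    \<comment> \<open>The mean is subtracted in the form of a mode of frequency 0, so that
      \<open>g'\<close> is visibly a trigonometric polynomial approximating h.\<close>
    define g' where "g' t = g t + (- ?m * cos (real 0 * t) + 0 * sin (real 0 * t))" for t
    have g': "trig_poly g'" unfolding g'_def by (intro trig_poly.add g trig_poly.mono)
    have gc: "continuous_on {0..2*pi} g'" by (rule trig_poly_continuous[OF g'])
    have "circ (\<lambda>t. h t * h t) = circ (\<lambda>t. h t * (h t - g' t)) + circ (\<lambda>t. h t * g' t)"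
    proof -
      have "circ (\<lambda>t. h t * (h t - g' t) + h t * g' t) = circ (\<lambda>t. h t * (h t - g' t)) + circ (\<lambda>t. h t * g' t)"
        by (rule circ_linear(1)) (intro continuous_intros hc gc)+
      then show ?thesis by (simp add: algebra_simps)
    qed
    also have "\<dots> = circ (\<lambda>t. h t * (h t - g' t))" using hp[OF g'] by simp
    also have "\<dots> \<le> circ (\<lambda>t. e * \<bar>h t\<bar>)"
    proof (rule circ_mono)
      fix t
      have "h t * (h t - g' t) \<le> \<bar>h t\<bar> * \<bar>h t - g' t\<bar>" by (metis abs_ge_self abs_mult)
      also have "\<dots> \<le> \<bar>h t\<bar> * e" using g(2)[of t] by (intro mult_left_mono) (auto simp: h_def g'_def)
      finally show "h t * (h t - g' t) \<le> e * \<bar>h t\<bar>" by (simp add: mult.commute)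
    qed (intro continuous_intros hc gc)+
    also have "\<dots> = e * circ (\<lambda>t. \<bar>h t\<bar>)" by (rule circ_linear(3)[OF ahc ahc])
    finally show ?thesis .
  qed
  note small = this
  have ah: "0 \<le> circ (\<lambda>t. \<bar>h t\<bar>)" using circ_mono[OF continuous_on_const ahc, of 0] circ_const[of 0] by simp
  have nn: "0 \<le> circ (\<lambda>t. h t * h t)" using circ_mono[OF continuous_on_const h2c, of 0] circ_const[of 0] by simp
  have "circ (\<lambda>t. h t * h t) \<le> 0"
  proof (rule ccontr)
    assume "\<not> circ (\<lambda>t. h t * h t) \<le> 0"
    then have p: "circ (\<lambda>t. h t * h t) > 0" by simp
    define e where "e = circ (\<lambda>t. h t * h t) / (2 * (circ (\<lambda>t. \<bar>h t\<bar>) + 1))"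
    have "e > 0" using p ah by (simp add: e_def)
    have "e * circ (\<lambda>t. \<bar>h t\<bar>) \<le> e * (circ (\<lambda>t. \<bar>h t\<bar>) + 1)" using \<open>e > 0\<close> by simp
    also have "\<dots> = circ (\<lambda>t. h t * h t) / 2" using ah by (simp add: e_def field_simps)
    finally show False using small[OF \<open>e > 0\<close>] p by linarith
  qed
  then have z: "circ (\<lambda>t. h t * h t) = 0" using nn by simp
  show "t \<in> {0..2*pi} \<Longrightarrow> H (polar 1 t) = ?m"
    using circ_eq_0[OF h2c _ z, of t] by (simp add: h_def)
qed

section \<open>Homogeneous fields with a Dirac divergence\<close>

text \<open>The radial profile of the test functions. The cutoff is evaluated at the square of the
  radius because \<open>nsq\<close>, unlike the norm, is smooth at the origin.\<close>

lemma cutoff_radial: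
  assumes w: "horizon_profile w"
  shows "\<exists>g'. (\<forall>r. ((\<lambda>r. cutoff w (r\<^sup>2) * r ^ k) has_real_derivative g' r) (at r)) \<and>
    continuous_on UNIV g' \<and> (\<forall>r>1. g' r = 0)"
proof -
  obtain D where D: "\<And>k t. (D k has_real_derivative D (Suc k) t) (at t)" "D 0 = cutoff w"
    using cutoff_derivatives[OF w] by blast
  obtain \<tau> where \<tau>: "1/2 \<le> \<tau>" "\<tau> < 1" "\<And>t. \<tau> \<le> t \<Longrightarrow> w t = 0" using horizon_profile_vanish[OF w] by blast
  define g' where "g' r = D 1 (r\<^sup>2) * (2 * r) * r ^ k + cutoff w (r\<^sup>2) * (real k * r ^ (k - 1))" for r
  have d0: "((\<lambda>r. D 0 (r\<^sup>2)) has_real_derivative D 1 (r\<^sup>2) * (2 * r)) (at r)" for r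
  proof -
    have "((\<lambda>r. r\<^sup>2) has_real_derivative 2 * r) (at r)" by (auto intro!: derivative_eq_intros)
    from DERIV_chain2[where f="D 0" and g="\<lambda>r. r\<^sup>2" and x=r, OF D(1) this] show ?thesis by simp
  qed
  have d: "((\<lambda>r. cutoff w (r\<^sup>2) * r ^ k) has_real_derivative g' r) (at r)" for r
    unfolding g'_def D(2)[symmetric] by (rule derivative_eq_intros d0 refl)+ simp
  have cD: "continuous_on UNIV (D k)" for k
    by (rule DERIV_continuous_on) (use D in \<open>auto intro: has_field_derivative_at_within\<close>)
  have "continuous_on UNIV g'"
    unfolding g'_def D(2)[symmetric]
    by (intro continuous_intros continuous_on_compose2[OF cD]) auto
  moreover have "g' r = 0" if "r > 1" for r
  proof -
    have r2: "t\<^sup>2 \<ge> \<tau>" if "t \<in> {1<..}" for t :: real using that \<tau>(2) power2_eq_square[of t] by (smt (verit) greaterThan_iff one_le_power)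
    have "((\<lambda>r. 0) has_real_derivative g' r) (at r)"
    proof (rule has_field_derivative_transform_within_open[OF d])
      show "open {1::real<..}" "r \<in> {1<..}" using that by auto
      fix t :: real assume "t \<in> {1<..}"
      then show "cutoff w (t\<^sup>2) * t ^ k = 0" using r2[of t] \<tau> by (simp add: cutoff_def)
    qed
    then show ?thesis using DERIV_unique[OF _ DERIV_const] by blast
  qed
  ultimately show ?thesis using d by blast
qed

lemma cutoff_supported:
  assumes w: "horizon_profile w"
  shows "(\<lambda>x. cutoff w (nsq x) * harm_re k x) \<in> supported 1" "(\<lambda>x. cutoff w (nsq x) * harm_im k x) \<in> supported 1"
proof -
  obtain \<tau> where \<tau>: "1/2 \<le> \<tau>" "\<tau> < 1" "\<And>t. \<tau> \<le> t \<Longrightarrow> w t = 0" using horizon_profile_vanish[OF w] by blast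
  have "cutoff w (nsq x) = 0" if "norm x > 1" for x
  proof -
    have "nsq x \<ge> 1" using that by (simp add: nsq_norm)
    then show ?thesis using \<tau> by (simp add: cutoff_def)
  qed
  moreover have "smooth_on UNIV (\<lambda>x. cutoff w (nsq x) * harm_re k x)" "smooth_on UNIV (\<lambda>x. cutoff w (nsq x) * harm_im k x)"
    by (auto intro!: smooth_on_mult smooth_on_harm smooth_on_cutoff[OF w] smooth_on_nsq)
  ultimately show "(\<lambda>x. cutoff w (nsq x) * harm_re k x) \<in> supported 1" "(\<lambda>x. cutoff w (nsq x) * harm_im k x) \<in> supported 1"
    by (auto simp: supported_def)
qed

lemma integral_polar_iterated:
  fixes f :: "real^2 \<Rightarrow> real"
  assumes f: "integrable lborel f"
  shows "(LINT x|lborel. f x) = (LINT r|lborel. LINT t|lborel. r * indicator {0<..} r * (indicator {0..<2*pi} t * f (polar r t)))"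
proof -
  define F where "F = (\<lambda>(r, t). r * indicator {0<..} r * (indicator {0..<2*pi} t * f (polar r t)))"
  have e: "(\<lambda>p. fst p * indicator polar_dom p * f (polar (fst p) (snd p))) = F"
    by (auto simp: polar_dom_def indicator_def F_def)
  have i: "integrable (lborel \<Otimes>\<^sub>M lborel) F" using integral_polar(1)[OF f] unfolding e .
  have "(LINT x|lborel. f x) = integral\<^sup>L (lborel \<Otimes>\<^sub>M lborel) F" using integral_polar(2)[OF f] unfolding e .
  also have "\<dots> = (LINT r|lborel. LINT t|lborel. F (r, t))" by (rule lborel_pair.integral_fst'[OF i, symmetric])
  finally show ?thesis by (simp add: F_def)
qed

text \<open>For a test function \<open>g r * e t\<close> the integral splits into a radial part,
  where \<open>g'\<close> integrates to \<open>- g 0\<close> and multiplies the mean of the normal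
  component against e, and an angular part with the tangential component against \<open>e'\<close>.
  A mode of frequency at least 1 vanishes at the origin, so the corresponding Fourier coefficients
  of the tangential component are 0 and that component is constant. The radial cutoff alone yields
  the flux.\<close>

lemma homogeneous_divergence:
  fixes m :: "real^2 \<Rightarrow> real^2" and c :: real
  assumes w: "horizon_profile w"
    and hom: "\<And>r t. r > 0 \<Longrightarrow> m (polar r t) = (1/r) *\<^sub>R m (polar 1 t)"
    and cont: "continuous_on (sphere 0 1) m"
    and int: "\<And>\<phi>. \<phi> \<in> supported 1 \<Longrightarrow> integrable lborel (\<lambda>x. m x $ 1 * partial_deriv 1 \<phi> x + m x $ 2 * partial_deriv 2 \<phi> x)"
    and div: "\<And>\<phi>. \<phi> \<in> supported 1 \<Longrightarrow> (LINT x|lborel. m x $ 1 * partial_deriv 1 \<phi> x + m x $ 2 * partial_deriv 2 \<phi> x) = - c * \<phi> 0"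
  shows "circ (\<lambda>t. m (polar 1 t) $ 1 * cos t + m (polar 1 t) $ 2 * sin t) = c"
    "\<exists>T. \<forall>t\<in>{0..2*pi}. m (polar 1 t) $ 2 * cos t - m (polar 1 t) $ 1 * sin t = T"
proof -
  define mn where "mn t = m (polar 1 t) $ 1 * cos t + m (polar 1 t) $ 2 * sin t" for t
  define mt where "mt t = m (polar 1 t) $ 2 * cos t - m (polar 1 t) $ 1 * sin t" for t
  have cp: "continuous_on A (\<lambda>t. polar 1 t)" for A
    unfolding polar_def vector2_eq by (intro continuous_intros)
  have mc: "continuous_on A (\<lambda>t. m (polar 1 t))" for A
    by (rule continuous_on_compose2[OF cont cp]) auto
  have mnc: "continuous_on A mn" and mtc: "continuous_on A mt" for A
    unfolding mn_def mt_def by (intro continuous_intros mc)+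
  \<comment> \<open>The alternative at the end is needed because \<open>g r / r\<close> is
    integrable at 0 only if g vanishes there. For the purely radial test function it is not, but
    then \<open>e' = 0\<close> and the angular term is absent.\<close>
  have key: "- g 0 * circ (\<lambda>t. e t * mn t) + (LINT r|lborel. indicator {0<..} r * (g r / r)) * circ (\<lambda>t. e' t * mt t) = - c * \<phi> 0"
    if \<phi>: "\<phi> \<in> supported 1" and pol: "\<And>r t. \<phi> (polar r t) = g r * e t"
      and g: "\<And>r. (g has_real_derivative g' r) (at r)" "continuous_on UNIV g'" "\<And>r. r > 1 \<Longrightarrow> g' r = 0" "g 1 = 0"
      and e: "\<And>t. (e has_real_derivative e' t) (at t)" "continuous_on UNIV e" "continuous_on UNIV e'"
      and gi: "integrable lborel (\<lambda>r. indicator {0<..} r * (g r / r)) \<or> circ (\<lambda>t. e' t * mt t) = 0"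
    for \<phi> g g' e e'
  proof -
    let ?f = "\<lambda>x. m x $ 1 * partial_deriv 1 \<phi> x + m x $ 2 * partial_deriv 2 \<phi> x"
    have d: "\<phi> differentiable (at x)" for x using \<phi> smooth_on_differentiable[of UNIV \<phi> x] by (simp add: supported_def)
    have A: "continuous_on {0..2*pi} (\<lambda>t. e t * mn t)" and B: "continuous_on {0..2*pi} (\<lambda>t. e' t * mt t)"
      by (intro continuous_on_mult mnc mtc continuous_on_subset[OF e(2)] continuous_on_subset[OF e(3)] subset_UNIV)+
    have grad: "r * ?f (polar r t) = g' r * (e t * mn t) + (g r / r) * (e' t * mt t)" if r: "r > 0" for r t
    proof -
      let ?p = "\<lambda>i. partial_deriv i \<phi> (polar r t)"
      have "((\<lambda>r. \<phi> (polar r t)) has_real_derivative g' r * e t) (at r)"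
        unfolding pol by (rule DERIV_cmult_right[OF g(1)])
      from DERIV_unique[OF has_real_derivative_polar(1)[OF d[of "polar r t"]] this]
      have 1: "cos t * ?p 1 + sin t * ?p 2 = g' r * e t" .
      have "((\<lambda>t. \<phi> (polar r t)) has_real_derivative g r * e' t) (at t)"
        unfolding pol by (rule DERIV_cmult[OF e(1)])
      from DERIV_unique[OF has_real_derivative_polar(2)[OF d[of "polar r t"]] this]
      have 2: "r * (cos t * ?p 2 - sin t * ?p 1) = g r * e' t" .
      have 3: "cos t * ?p 2 - sin t * ?p 1 = (g r / r) * e' t"
      proof -
        have "(r * (cos t * ?p 2 - sin t * ?p 1)) / r = (g r * e' t) / r" using 2 by (rule arg_cong)
        then show ?thesis using r by simp
      qed
      have p1: "?p 1 = cos t * (cos t * ?p 1 + sin t * ?p 2) - sin t * (cos t * ?p 2 - sin t * ?p 1)"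
        using sin_cos_squared_add[of t] by algebra
      have p2: "?p 2 = sin t * (cos t * ?p 1 + sin t * ?p 2) + cos t * (cos t * ?p 2 - sin t * ?p 1)"
        using sin_cos_squared_add[of t] by algebra
      have "r * ?f (polar r t) = m (polar 1 t) $ 1 * ?p 1 + m (polar 1 t) $ 2 * ?p 2"
        unfolding hom[OF r, of t] using r by (simp add: field_simps)
      also have "\<dots> = mn t * (cos t * ?p 1 + sin t * ?p 2) + mt t * (cos t * ?p 2 - sin t * ?p 1)"
        unfolding mn_def mt_def using sin_cos_squared_add[of t] by algebra
      finally show ?thesis unfolding 1 3 by (simp add: algebra_simps)
    qed
    have "- c * \<phi> 0 = (LINT x|lborel. ?f x)" using div[OF \<phi>] by simp
    also have "\<dots> = (LINT r|lborel. LINT t|lborel. r * indicator {0<..} r * (indicator {0..<2*pi} t * ?f (polar r t)))"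
      by (rule integral_polar_iterated[OF int[OF \<phi>]])
    also have "\<dots> = (LINT r|lborel. indicator {0<..} r * g' r * circ (\<lambda>t. e t * mn t) + indicator {0<..} r * (g r / r) * circ (\<lambda>t. e' t * mt t))"
    proof (rule Bochner_Integration.integral_cong[OF refl])
      fix r :: real
      have "r * indicator {0<..} r * (indicator {0..<2*pi} t * ?f (polar r t))
        = indicator {0<..} r * g' r * (indicator {0..<2*pi} t * (e t * mn t)) + indicator {0<..} r * (g r / r) * (indicator {0..<2*pi} t * (e' t * mt t))" for t
        using grad[of r t] by (cases "r > 0") (simp_all add: algebra_simps indicator_def)
      then show "(LINT t|lborel. r * indicator {0<..} r * (indicator {0..<2*pi} t * ?f (polar r t)))
        = indicator {0<..} r * g' r * circ (\<lambda>t. e t * mn t) + indicator {0<..} r * (g r / r) * circ (\<lambda>t. e' t * mt t)"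
        using circ_lborel[OF A] circ_lborel[OF B] by simp
    qed
    also have "\<dots> = - g 0 * circ (\<lambda>t. e t * mn t) + (LINT r|lborel. indicator {0<..} r * (g r / r)) * circ (\<lambda>t. e' t * mt t)"
    proof -
      have hb: "has_bochner_integral lborel (\<lambda>x. g' x * indicator {0..1} x) (g 1 - g 0)"
        by (rule has_bochner_integral_FTC_Icc_real) (use g in \<open>auto simp: continuous_on_eq_continuous_at\<close>)
      have ae: "AE r in lborel. g' r * indicator {0..1} r = indicator {0<..} r * g' r"
      proof -
        have "AE r in lborel. r \<noteq> (0::real)" by (rule AE_lborel_singleton)
        then show ?thesis by (rule eventually_mono) (use g(3) in \<open>auto simp: indicator_def\<close>)
      qed
      have gm: "(\<lambda>r. indicator {0<..} r * g' r) \<in> borel_measurable lborel"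
        using borel_measurable_continuous_onI[OF g(2)] by simp
      have "integrable lborel (\<lambda>r. indicator {0<..} r * g' r)" "(LINT r|lborel. indicator {0<..} r * g' r) = - g 0"
        using hb gm ae integrable_cong_AE[OF _ gm ae] integral_cong_AE[OF _ gm ae] g(4)
        by (auto simp: has_bochner_integral_iff)
      note i1 = this
      let ?A = "circ (\<lambda>t. e t * mn t)" and ?B = "circ (\<lambda>t. e' t * mt t)"
      from gi show ?thesis
      proof
        assume i2: "integrable lborel (\<lambda>r. indicator {0<..} r * (g r / r))"
        have "(LINT r|lborel. indicator {0<..} r * g' r * ?A + indicator {0<..} r * (g r / r) * ?B)
          = (LINT r|lborel. indicator {0<..} r * g' r * ?A) + (LINT r|lborel. indicator {0<..} r * (g r / r) * ?B)"
          by (intro Bochner_Integration.integral_add integrable_mult_left i1 i2)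
        then show ?thesis by (simp only: integral_mult_left_zero i1(2))
      qed (simp add: i1)
    qed
    finally show ?thesis by simp
  qed
  let ?g = "\<lambda>k r. cutoff w (r\<^sup>2) * r ^ k"
  have g1: "?g k 1 = 0" for k
  proof -
    obtain \<tau> where "\<tau> < 1" "\<And>t. \<tau> \<le> t \<Longrightarrow> w t = 0" using horizon_profile_vanish[OF w] by blast
    then show ?thesis by (simp add: cutoff_def)
  qed
  have ceq: "(\<lambda>x. cutoff w (nsq x) * harm_re 0 x) (polar r t) = ?g 0 r * 1" for r t by (simp add: harm_polar)
  have gcont: "continuous_on UNIV (\<lambda>r. cutoff w (r\<^sup>2))"
  proof -
    obtain g' where g': "\<And>r. (?g 0 has_real_derivative g' r) (at r)"
      "continuous_on UNIV g'" "\<And>r. r > 1 \<Longrightarrow> g' r = 0" using cutoff_radial[OF w, of 0] by metis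
    have "continuous_on UNIV (?g 0)"
      by (rule DERIV_continuous_on[OF has_field_derivative_at_within[OF g'(1)]])
    then show ?thesis by simp
  qed
  have g0: "cutoff w (r\<^sup>2) = 0" if "r > 1" for r
  proof -
    obtain \<tau> where \<tau>: "\<tau> < 1" "\<And>t. \<tau> \<le> t \<Longrightarrow> w t = 0" using horizon_profile_vanish[OF w] by blast
    have "r\<^sup>2 > 1" using that by (simp add: one_less_power)
    then show ?thesis using \<tau> by (simp add: cutoff_def)
  qed
  \<comment> \<open>For positive k the quotient is the cutoff times a lower power of r, hence
    continuous. Strict positivity of its integral allows it to be divided out of the identities for
    the Fourier coefficients.\<close>
  have gi: "integrable lborel (\<lambda>r. indicator {0<..} r * (?g k r / r))"
    and gp: "(LINT r|lborel. indicator {0<..} r * (?g k r / r)) > 0" if k: "k \<ge> 1" for k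
  proof -
    obtain j where j: "k = Suc j" using k by (cases k) auto
    let ?h = "\<lambda>r. cutoff w (r\<^sup>2) * r ^ j"
    have c: "continuous_on {0..1} ?h" using gcont by (intro continuous_intros continuous_on_subset[OF gcont]) auto
    have i: "set_integrable lborel {0..1} ?h"
      unfolding set_integrable_def using borel_integrable_compact[OF _ c] by (simp add: indicator_scaleR_eq_if)
    have ae: "AE r in lborel. indicator {0..1} r *\<^sub>R ?h r = indicator {0<..} r * (?g k r / r)"
    proof -
      have "AE r in lborel. r \<noteq> (0::real)" by (rule AE_lborel_singleton)
      then show ?thesis by (rule eventually_mono) (auto simp: indicator_def j g0)
    qed
    have cm: "(\<lambda>r. cutoff w (r\<^sup>2)) \<in> borel_measurable borel" by (rule borel_measurable_continuous_onI[OF gcont])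
    have m: "(\<lambda>r. indicator {0<..} r * (?g k r / r)) \<in> borel_measurable lborel" using cm by measurable
    have m': "(\<lambda>r. indicator {0..1} r *\<^sub>R ?h r) \<in> borel_measurable lborel" using cm by measurable
    show "integrable lborel (\<lambda>r. indicator {0<..} r * (?g k r / r))"
      using i integrable_cong_AE[OF m' m ae] by (simp add: set_integrable_def)
    have "(LINT r|lborel. indicator {0<..} r * (?g k r / r)) = (LINT r:{0..1}|lborel. ?h r)"
      unfolding set_lebesgue_integral_def by (rule integral_cong_AE[OF m' m ae, symmetric])
    also have "\<dots> = integral {0..1} ?h" by (rule set_borel_integral_eq_integral(2)[OF i])
    also have "\<dots> > 0"
    proof (rule ccontr)
      have nn: "0 \<le> ?h r" if "r \<in> {0..1}" for r using that cutoff_simps(2)[OF w] by simp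
      assume "\<not> integral {0..1} ?h > 0"
      moreover have "integral {0..1} ?h \<ge> 0" by (intro integral_nonneg integrable_continuous_interval c nn)
      ultimately have "integral {0..1} ?h = 0" by simp
      then have "\<forall>x\<in>{0..1}. ?h x = 0" using integral_eq_0_iff[OF c zero_less_one nn] by blast
      then have "?h (1/2) = 0" by (rule bspec) simp
      moreover have "cutoff w ((1/2)\<^sup>2) = 1" by (rule cutoff_simps(1)[OF w]) (simp add: power2_eq_square)
      ultimately show False by simp
    qed
    finally show "(LINT r|lborel. indicator {0<..} r * (?g k r / r)) > 0" .
  qed
  have orth: "circ (\<lambda>t. mt t * cos (real k * t)) = 0" "circ (\<lambda>t. mt t * sin (real k * t)) = 0" if k: "k \<ge> 1" for k
  proof -
    obtain g' where g': "\<And>r. (?g k has_real_derivative g' r) (at r)"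
      "continuous_on UNIV g'" "\<And>r. r > 1 \<Longrightarrow> g' r = 0" using cutoff_radial[OF w, of k] by metis
    have z: "?g k 0 = 0" using k by simp
    have h0: "harm_re k 0 = 0" "harm_im k 0 = 0"
      using harm_polar[of k 0 0] k by (simp_all add: polar_def vector2_eq)
    have cs: "continuous_on {0..2*pi} (\<lambda>t. mt t * cos (real k * t))" "continuous_on {0..2*pi} (\<lambda>t. mt t * sin (real k * t))"
      by (intro continuous_intros mtc)+
    have cd: "((\<lambda>t. cos (real k * t)) has_real_derivative - real k * sin (real k * t)) (at t)"
      "((\<lambda>t. sin (real k * t)) has_real_derivative real k * cos (real k * t)) (at t)" for t
      by (auto intro!: derivative_eq_intros)
    have cc: "continuous_on UNIV (\<lambda>t. cos (real k * t))" "continuous_on UNIV (\<lambda>t. sin (real k * t))"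
      "continuous_on UNIV (\<lambda>t. - real k * sin (real k * t))" "continuous_on UNIV (\<lambda>t. real k * cos (real k * t))"
      by (intro continuous_intros)+
    have pol: "cutoff w (nsq (polar r t)) * harm_re k (polar r t) = ?g k r * cos (real k * t)"
      "cutoff w (nsq (polar r t)) * harm_im k (polar r t) = ?g k r * sin (real k * t)" for r t
      by (simp_all add: harm_polar)
    have "(LINT r|lborel. indicator {0<..} r * (?g k r / r)) * circ (\<lambda>t. (- real k * sin (real k * t)) * mt t) = 0"
      using key[OF cutoff_supported(1)[OF w, of k] pol(1) g' g1 cd(1) cc(1) cc(3) disjI1[OF gi[OF k]]] z h0
      by simp
    then have "circ (\<lambda>t. (- real k) * (mt t * sin (real k * t))) = 0" using gp[OF k] by (simp add: mult_ac)
    then show "circ (\<lambda>t. mt t * sin (real k * t)) = 0" using circ_linear(3)[OF cs(2) cs(2), of "- real k"] k by simp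
    have "(LINT r|lborel. indicator {0<..} r * (?g k r / r)) * circ (\<lambda>t. (real k * cos (real k * t)) * mt t) = 0"
      using key[OF cutoff_supported(2)[OF w, of k] pol(2) g' g1 cd(2) cc(2) cc(4) disjI1[OF gi[OF k]]] z h0
      by simp
    then have "circ (\<lambda>t. (real k) * (mt t * cos (real k * t))) = 0" using gp[OF k] by (simp add: mult_ac)
    then show "circ (\<lambda>t. mt t * cos (real k * t)) = 0" using circ_linear(3)[OF cs(1) cs(1), of "real k"] k by simp
  qed
  show "\<exists>T. \<forall>t\<in>{0..2*pi}. m (polar 1 t) $ 2 * cos t - m (polar 1 t) $ 1 * sin t = T"
  proof -
    define H where "H x = m x $ 2 * x $ 1 - m x $ 1 * x $ 2" for x
    have Hc: "continuous_on (sphere 0 1) H" unfolding H_def by (intro continuous_intros cont)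
    have Hp: "H (polar 1 t) = mt t" for t by (simp add: H_def mt_def)
    show ?thesis
      using orthogonal_trig_constant[OF Hc] orth unfolding Hp mt_def by blast
  qed
  obtain g' where g': "\<And>r. (?g 0 has_real_derivative g' r) (at r)"
      "continuous_on UNIV g'" "\<And>r. r > 1 \<Longrightarrow> g' r = 0" using cutoff_radial[OF w, of 0] by metis
  have "- ?g 0 0 * circ (\<lambda>t. 1 * mn t) + (LINT r|lborel. indicator {0<..} r * (?g 0 r / r)) * circ (\<lambda>t. 0 * mt t)
      = - c * (cutoff w (nsq 0) * harm_re 0 0)"
    by (rule key[OF cutoff_supported(1)[OF w, of 0] ceq g' g1]) (auto simp: circ_const[of 0, simplified])
  moreover have "cutoff w 0 = 1" by (rule cutoff_simps(1)[OF w]) simp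
  ultimately have "circ mn = c"
    using circ_const[of 0] by (simp add: nsq_def harm_re_def)
  then show "circ (\<lambda>t. m (polar 1 t) $ 1 * cos t + m (polar 1 t) $ 2 * sin t) = c" unfolding mn_def[abs_def] .
qed

section \<open>The elastic field of a dislocation\<close>

lemma integrable_locally_integrable:
  fixes f :: "real^2 \<Rightarrow> real^2^2"
  assumes f: "locally_integrable f" and \<phi>: "\<phi> \<in> supported R"
  shows "integrable lborel (\<lambda>x. f x $ i $ j * \<phi> x)"
proof -
  have "integrable lborel (\<lambda>x. indicator (cball 0 R) x *\<^sub>R f x)"
    using f compact_cball[of "0::real^2" R] by (simp add: locally_integrable_def set_integrable_def)
  then have "integrable lborel (\<lambda>x. (indicator (cball 0 R) x *\<^sub>R f x) $ i $ j)"
    by (rule integrable_bounded_linear[OF bounded_linear_compose[OF bounded_linear_vec_nth bounded_linear_vec_nth]])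
  from integrable_mult_supported[OF \<phi> this]
  have "integrable lborel (\<lambda>x. (indicator (cball 0 R) x *\<^sub>R f x) $ i $ j * \<phi> x)" .
  moreover have "(indicator (cball 0 R) x *\<^sub>R f x) $ i $ j * \<phi> x = f x $ i $ j * \<phi> x" for x
    using \<phi> by (cases "norm x \<le> R") (auto simp: supported_def)
  then have "(\<lambda>x. (indicator (cball 0 R) x *\<^sub>R f x) $ i $ j * \<phi> x) = (\<lambda>x. f x $ i $ j * \<phi> x)" by blast
  ultimately show ?thesis by (simp only:)
qed

text \<open>\<open>nrm F t\<close> and \<open>tng F t\<close> are the columns of F in the polar
  frame, F applied to n = (cos t, sin t) and to its rotation (- sin t, cos t). For a stress,
  \<open>tng\<close> is the traction across the ray of angle t.\<close>

definition nrm :: "real^2^2 \<Rightarrow> real \<Rightarrow> 2 \<Rightarrow> real" where "nrm F t i = F$i$1 * cos t + F$i$2 * sin t"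
definition tng :: "real^2^2 \<Rightarrow> real \<Rightarrow> 2 \<Rightarrow> real" where "tng F t i = F$i$2 * cos t - F$i$1 * sin t"

lemma inner_frame: "F \<bullet> G = nrm F t 1 * nrm G t 1 + tng F t 1 * tng G t 1 + nrm F t 2 * nrm G t 2 + tng F t 2 * tng G t 2"
proof -
  have *: "a * c + b * d = (a * cos t + b * sin t) * (c * cos t + d * sin t) + (b * cos t - a * sin t) * (d * cos t - c * sin t)" for a b c d :: real
    using sin_cos_squared_add[of t] by algebra
  show ?thesis unfolding inner_mat2 nrm_def tng_def
    using *[of "F$1$1" "G$1$1" "F$1$2" "G$1$2"] *[of "F$2$1" "G$2$1" "F$2$2" "G$2$2"] by linarith
qed

lemma polar_form:
  assumes "x \<noteq> 0"
  obtains r t where "r > 0" "0 \<le> t" "t < 2*pi" "x = polar r t" "norm x = r"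
proof -
  obtain t where "0 \<le> t" "t < 2*pi" "x = polar (norm x) t" by (rule polar_exists[OF assms])
  then show ?thesis using assms that[of "norm x" t] by (metis zero_less_norm_iff)
qed

section \<open>The dislocation field on the unit circle and its energy\<close>

locale cell_setting =
  fixes w :: "real \<Rightarrow> real" and C :: "real^2^2 \<Rightarrow> real^2^2" and \<nu>\<^sub>1 \<nu>\<^sub>2 :: real
    and \<eta> :: "real^2 \<Rightarrow> real^2 \<Rightarrow> real^2^2" and \<Gamma> :: "real^2 \<Rightarrow> real \<Rightarrow> real^2^2"
  assumes w: "horizon_profile w" and C: "elasticity_tensor C \<nu>\<^sub>1 \<nu>\<^sub>2" and \<eta>: "dislocation_field C \<eta> \<Gamma>"
begin

lemma C_linear: "linear C" and C_adjoint: "C F \<bullet> G = F \<bullet> C G" and \<nu>: "0 < \<nu>\<^sub>1" "\<nu>\<^sub>1 \<le> \<nu>\<^sub>2"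
  and C_coercive: "\<nu>\<^sub>1 * (norm (sym_part F))\<^sup>2 \<le> C F \<bullet> F" 
  using C unfolding elasticity_tensor_def by blast+

lemma C_symmetric: "C F $ 2 $ 1 = C F $ 1 $ 2"
proof -
  have "transpose (C F) = C F" using C unfolding elasticity_tensor_def by blast
  then have "transpose (C F) $ 1 $ 2 = C F $ 1 $ 2" by simp
  then show ?thesis by (simp add: transpose_def)
qed

lemma C_nonneg: "0 \<le> C F \<bullet> F"
proof -
  have "0 \<le> \<nu>\<^sub>1 * (norm (sym_part F))\<^sup>2" using \<nu>(1) by (intro mult_nonneg_nonneg) simp_all
  then show ?thesis using C_coercive[of F] by linarith
qed

lemma C_continuous:
  fixes f :: "'a::euclidean_space \<Rightarrow> real^2^2"
  assumes "continuous_on A f"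
  shows "continuous_on A (\<lambda>x. C (f x))"
  using linear_continuous_on_compose[OF assms C_linear] .

lemma C_bound: obtains B where "B > 0" "\<And>F. norm (C F) \<le> B * norm F"
  using linear_bounded_pos[OF C_linear] by blast

text \<open>The homogeneous form is prescribed for angles in \<open>{0..<2*pi}\<close> only;
  reduction to this range makes it available for all real angles, in particular for
  \<open>2*pi\<close>.\<close>

lemma polar_periodic:
  obtains t' where "t' \<in> {0..<2*pi}" "\<And>r. polar r t = polar r t'"
proof -
  obtain r t' where t': "0 \<le> t'" "t' < 2*pi" "polar 1 t = polar r t'" "norm (polar 1 t) = r"
    by (rule polar_form[OF polar_nonzero[OF zero_neq_one[symmetric]]])
  have "r = 1" using t'(4) unfolding norm_polar by simp
  then have "polar 1 t = polar 1 t'" using t'(3) by (simp only:)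
  moreover have "polar r t = r *\<^sub>R polar 1 t" "polar r t' = r *\<^sub>R polar 1 t'" for r
    by (simp_all add: vec_eq_iff forall_2)
  ultimately have "polar r t = polar r t'" for r by metis
  then show ?thesis using that[of t'] t' by simp
qed

lemma eta_Gamma: "r > 0 \<Longrightarrow> t \<in> {0..<2*pi} \<Longrightarrow> \<eta> \<xi> (polar r t) = (1/r) *\<^sub>R \<Gamma> \<xi> t"
  using \<eta> unfolding dislocation_field_def polar_def by blast

lemma eta_polar: assumes "r > 0" shows "\<eta> \<xi> (polar r t) = (1/r) *\<^sub>R \<eta> \<xi> (polar 1 t)"
proof -
  obtain t' where t': "t' \<in> {0..<2*pi}" "\<And>r. polar r t = polar r t'" using polar_periodic[of t] by blast
  show ?thesis unfolding t'(2) using eta_Gamma[OF assms t'(1)] eta_Gamma[OF zero_less_one t'(1)] by simp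
qed

lemma eta_scale: assumes "s > 0" "x \<noteq> 0" shows "\<eta> \<xi> (s *\<^sub>R x) = (1/s) *\<^sub>R \<eta> \<xi> x"
proof -
  obtain r t where t: "r > 0" "x = polar r t" by (rule polar_form[OF assms(2)])
  have "s *\<^sub>R x = polar (s * r) t" unfolding t(2) by (simp add: vec_eq_iff forall_2)
  then have "\<eta> \<xi> (s *\<^sub>R x) = (1 / (s * r)) *\<^sub>R \<eta> \<xi> (polar 1 t)" using eta_polar[of "s * r" \<xi> t] assms t(1) by simp
  also have "\<dots> = (1/s) *\<^sub>R ((1 / r) *\<^sub>R \<eta> \<xi> (polar 1 t))" by simp
  also have "(1 / r) *\<^sub>R \<eta> \<xi> (polar 1 t) = \<eta> \<xi> x" unfolding t(2) by (rule eta_polar[OF t(1), symmetric])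
  finally show ?thesis .
qed

lemma eta_linear: assumes "x \<noteq> 0" shows "linear (\<lambda>\<xi>. \<eta> \<xi> x)"
proof -
  obtain r t where t: "r > 0" "0 \<le> t" "t < 2*pi" "x = polar r t" by (rule polar_form[OF assms])
  have "\<eta> \<xi> x = (1 / r) *\<^sub>R \<Gamma> \<xi> t" for \<xi> unfolding t(4) using eta_Gamma[of r t \<xi>] t by simp
  moreover have "linear (\<lambda>\<xi>. \<Gamma> \<xi> t)" using \<eta> t unfolding dislocation_field_def by simp
  ultimately show ?thesis by (simp add: linear_compose_scale_right)
qed

text \<open>Reduces uniformity in \<xi> to the two basis fields and makes the energy a quadratic
  form.\<close>

lemma eta_expand: assumes "x \<noteq> 0" shows "\<eta> \<xi> x = \<xi>$1 *\<^sub>R \<eta> (axis 1 1) x + \<xi>$2 *\<^sub>R \<eta> (axis 2 1) x"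
  using linear_add[OF eta_linear[OF assms], of "\<xi>$1 *\<^sub>R axis 1 1" "\<xi>$2 *\<^sub>R axis 2 1"]
    linear_cmul[OF eta_linear[OF assms]] vec2_expand[of \<xi>] by simp

lemma eta_bound: obtains K where "K > 0" "\<And>\<xi> x. x \<noteq> 0 \<Longrightarrow> norm (\<eta> \<xi> x) \<le> K * norm \<xi> / norm x"
proof -
  obtain K where K: "K > 0" "\<And>\<xi> t. t \<in> {0..<2*pi} \<Longrightarrow> norm (\<Gamma> \<xi> t) \<le> K * norm \<xi>"
    using \<eta> unfolding dislocation_field_def by blast
  have "norm (\<eta> \<xi> x) \<le> K * norm \<xi> / norm x" if x0: "x \<noteq> 0" for \<xi> x
  proof -
    obtain r t where t: "r > 0" "0 \<le> t" "t < 2*pi" "x = polar r t" "norm x = r" by (rule polar_form[OF x0])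
    have "\<eta> \<xi> x = (1 / r) *\<^sub>R \<Gamma> \<xi> t" unfolding t(4) using eta_Gamma[of r t \<xi>] t by simp
    then have "norm (\<eta> \<xi> x) = norm (\<Gamma> \<xi> t) / norm x" using t(1,5) by simp
    also have "\<dots> \<le> K * norm \<xi> / norm x" using K(2)[of t \<xi>] t by (intro divide_right_mono) auto
    finally show ?thesis .
  qed
  then show ?thesis using that K(1) by blast
qed

lemma eta_continuous: "continuous_on (- {0}) (\<eta> \<xi>)"
proof -
  have "smooth_on (UNIV - {0}) (\<eta> \<xi>)" using \<eta> unfolding dislocation_field_def by blast
  from smooth_on_continuous_on[OF this] show ?thesis by (simp add: Compl_eq_Diff_UNIV)
qed

lemma eta_measurable [measurable]: "\<eta> \<xi> \<in> borel_measurable borel"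
  by (rule borel_measurable_continuous_countable_exceptions[of "{0}"]) (simp_all add: eta_continuous)

lemma eta_sphere: "continuous_on (sphere 0 1) (\<eta> \<xi>)"
  by (rule continuous_on_subset[OF eta_continuous]) (metis ComplI mem_sphere_0 norm_zero singletonD subsetI zero_neq_one)

lemma eta_circle: "continuous_on A (\<lambda>t. \<eta> \<xi> (polar 1 t))"
proof (rule continuous_on_compose2[OF eta_sphere])
  show "continuous_on A (\<lambda>t. polar 1 t)" unfolding polar_def vector2_eq by (intro continuous_intros)
qed auto

lemma eta_locally_integrable: "locally_integrable (\<eta> \<xi>)"
  using \<eta> unfolding dislocation_field_def by blast

text \<open>Stated with \<eta> on the circle: \<eta> is continuous along the closed interval of
  angles, whereas the value of \<Gamma> at the end point \<open>2*pi\<close> is arbitrary.\<close>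

definition \<psi> :: "real^2 \<Rightarrow> real" where
  "\<psi> \<xi> = 1/2 * circ (\<lambda>t. C (\<eta> \<xi> (polar 1 t)) \<bullet> \<eta> \<xi> (polar 1 t))"

lemma energy_continuous: "continuous_on A (\<lambda>t. C (\<eta> \<xi> (polar 1 t)) \<bullet> \<eta> \<zeta> (polar 1 t))"
  by (intro continuous_intros C_continuous eta_circle)

lemma supported_test_UNIV: "\<phi> \<in> supported R \<Longrightarrow> \<phi> \<in> test_functions UNIV"
  using supported_test_function[of \<phi> R "R+1"] unfolding test_functions_def mem_Collect_eq
  by (simp only: subset_UNIV simp_thms less_add_one)

text \<open>The curl of row i is the divergence of the rotated row. The rotation exchanges the roles
  of the two frame components up to sign: the flux, here the Dirac weight \<xi>, belongs to the
  tangential strain, and the constant component is the normal strain.\<close>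

lemma strain_structure:
  "circ (\<lambda>t. tng (\<eta> \<xi> (polar 1 t)) t i) = \<xi> $ i"
  "\<exists>N. \<forall>t\<in>{0..2*pi}. nrm (\<eta> \<xi> (polar 1 t)) t i = N"
proof -
  define m where "m x = (vector [\<eta> \<xi> x $ i $ 2, - (\<eta> \<xi> x $ i $ 1)] :: real^2)" for x
  have mn: "m x $ 1 = \<eta> \<xi> x $ i $ 2" "m x $ 2 = - (\<eta> \<xi> x $ i $ 1)" for x by (simp_all add: m_def)
  have hom: "m (polar r t) = (1/r) *\<^sub>R m (polar 1 t)" if "r > 0" for r t
    by (simp add: vec_eq_iff forall_2 mn eta_polar[OF that, of \<xi> t])
  have cont: "continuous_on (sphere 0 1) m"
    unfolding m_def vector2_eq by (intro continuous_intros eta_sphere)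
  have int: "integrable lborel (\<lambda>x. m x $ 1 * partial_deriv 1 \<phi> x + m x $ 2 * partial_deriv 2 \<phi> x)" if "\<phi> \<in> supported 1" for \<phi>
    using integrable_locally_integrable[OF eta_locally_integrable supported_partial_deriv[OF that]]
    unfolding mn mult_minus_left by (intro Bochner_Integration.integrable_add Bochner_Integration.integrable_minus)
  have div: "(LINT x|lborel. m x $ 1 * partial_deriv 1 \<phi> x + m x $ 2 * partial_deriv 2 \<phi> x) = - (\<xi>$i) * \<phi> 0" if "\<phi> \<in> supported 1" for \<phi>
  proof -
    have "Curl_pairing UNIV (\<eta> \<xi>) \<phi> = \<phi> 0 *\<^sub>R \<xi>"
      using \<eta> supported_test_UNIV[OF that] unfolding dislocation_field_def Curl_eq_dirac_def by blast
    from arg_cong[OF this, of "\<lambda>v. v $ i"]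
    have "- (LINT x|lborel. \<eta> \<xi> x $ i $ 2 * partial_deriv 1 \<phi> x - \<eta> \<xi> x $ i $ 1 * partial_deriv 2 \<phi> x) = \<phi> 0 * \<xi> $ i"
      by (simp add: Curl_pairing_def set_lebesgue_integral_def)
    then have "(LINT x|lborel. \<eta> \<xi> x $ i $ 2 * partial_deriv 1 \<phi> x - \<eta> \<xi> x $ i $ 1 * partial_deriv 2 \<phi> x) = - (\<phi> 0 * \<xi> $ i)"
      by linarith
    then show ?thesis unfolding mn mult_minus_left diff_conv_add_uminus[symmetric]
      by (simp only: mult.commute[of "\<phi> 0"])
  qed
  note h = homogeneous_divergence[OF w hom cont int div]
  show "circ (\<lambda>t. tng (\<eta> \<xi> (polar 1 t)) t i) = \<xi> $ i"
    using h(1) by (simp add: mn tng_def)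
  obtain T where "\<forall>t\<in>{0..2*pi}. m (polar 1 t) $ 2 * cos t - m (polar 1 t) $ 1 * sin t = T" using h(2) by blast
  then have "\<forall>t\<in>{0..2*pi}. nrm (\<eta> \<xi> (polar 1 t)) t i = - T" by (auto simp: mn nrm_def)
  then show "\<exists>N. \<forall>t\<in>{0..2*pi}. nrm (\<eta> \<xi> (polar 1 t)) t i = N" by blast
qed

text \<open>The divergence of the stress vanishes across the origin as well, so the total flux of
  each row is 0. Writing C in matrix entries lets local integrability pass from \<eta> to the
  stress.\<close>

lemma stress_structure:
  "circ (\<lambda>t. nrm (C (\<eta> \<xi> (polar 1 t))) t i) = 0"
  "\<exists>T. \<forall>t\<in>{0..2*pi}. tng (C (\<eta> \<xi> (polar 1 t))) t i = T"
proof -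
  define m where "m x = C (\<eta> \<xi> x) $ i" for x
  define c where "c k l j = C (axis k (axis l 1)) $ i $ j" for k l j
  have Csum: "C F $ i $ j = (\<Sum>k\<in>UNIV. \<Sum>l\<in>UNIV. F$k$l * c k l j)" for F j
  proof -
    have F: "F = (\<Sum>k\<in>UNIV. \<Sum>l\<in>UNIV. F$k$l *\<^sub>R axis k (axis l 1))"
      by (simp add: vec_eq_iff forall_2 sum_2 axis_def)
    have "C F = (\<Sum>k\<in>UNIV. \<Sum>l\<in>UNIV. F$k$l *\<^sub>R C (axis k (axis l 1)))"
      by (subst F) (simp only: linear_sum[OF C_linear] linear_cmul[OF C_linear])
    then show ?thesis by (simp add: sum_2 c_def)
  qed
  have hom: "m (polar r t) = (1/r) *\<^sub>R m (polar 1 t)" if "r > 0" for r t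
    unfolding m_def eta_polar[OF that, of \<xi> t] by (simp add: linear_cmul[OF C_linear])
  have cont: "continuous_on (sphere 0 1) m"
    unfolding m_def by (intro continuous_intros C_continuous eta_sphere)
  have int1: "integrable lborel (\<lambda>x. m x $ j * partial_deriv k \<phi> x)" if "\<phi> \<in> supported 1" for \<phi> j k
    unfolding m_def Csum sum_distrib_right
  proof (intro Bochner_Integration.integrable_sum)
    fix k' l
    have "integrable lborel (\<lambda>x. (\<eta> \<xi> x $ k' $ l * partial_deriv k \<phi> x) * c k' l j)"
      by (intro integrable_mult_left integrable_locally_integrable[OF eta_locally_integrable supported_partial_deriv[OF that]])
    then show "integrable lborel (\<lambda>x. \<eta> \<xi> x $ k' $ l * c k' l j * partial_deriv k \<phi> x)"
      by (simp add: mult_ac)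
  qed
  have int: "integrable lborel (\<lambda>x. m x $ 1 * partial_deriv 1 \<phi> x + m x $ 2 * partial_deriv 2 \<phi> x)" if "\<phi> \<in> supported 1" for \<phi>
    by (intro Bochner_Integration.integrable_add int1 that)
  have div: "(LINT x|lborel. m x $ 1 * partial_deriv 1 \<phi> x + m x $ 2 * partial_deriv 2 \<phi> x) = - 0 * \<phi> 0" if "\<phi> \<in> supported 1" for \<phi>
  proof -
    have "Div_pairing UNIV (\<lambda>x. C (\<eta> \<xi> x)) \<phi> = 0"
      using \<eta> supported_test_UNIV[OF that] unfolding dislocation_field_def Div_eq_zero_def by blast
    from arg_cong[OF this, of "\<lambda>v. v $ i"]
    show ?thesis by (simp add: Div_pairing_def set_lebesgue_integral_def m_def sum_2)
  qed
  note h = homogeneous_divergence[OF w hom cont int div]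
  show "circ (\<lambda>t. nrm (C (\<eta> \<xi> (polar 1 t))) t i) = 0"
    using h(1) by (simp add: m_def nrm_def)
  show "\<exists>T. \<forall>t\<in>{0..2*pi}. tng (C (\<eta> \<xi> (polar 1 t))) t i = T"
    using h(2) by (simp add: m_def tng_def)
qed

text \<open>In the polar frame the energy density is normal stress times normal strain plus
  tangential stress times tangential strain. In each product one factor is constant along the
  circle: the normal stress has mean 0, and the tangential strain integrates to \<xi>.\<close>

lemma traction:
  obtains T :: "real^2" where "\<And>t i. t \<in> {0..2*pi} \<Longrightarrow> tng (C (\<eta> \<xi> (polar 1 t))) t i = T $ i"
    "2 * \<psi> \<xi> = T \<bullet> \<xi>"
proof -
  let ?e = "\<lambda>t. \<eta> \<xi> (polar 1 t)"
  obtain T1 where T1: "\<And>t. t\<in>{0..2*pi} \<Longrightarrow> tng (C (?e t)) t 1 = T1" using stress_structure(2)[of \<xi> 1] by blast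
  obtain T2 where T2: "\<And>t. t\<in>{0..2*pi} \<Longrightarrow> tng (C (?e t)) t 2 = T2" using stress_structure(2)[of \<xi> 2] by blast
  obtain N1 where N1: "\<And>t. t\<in>{0..2*pi} \<Longrightarrow> nrm (?e t) t 1 = N1" using strain_structure(2)[of \<xi> 1] by blast
  obtain N2 where N2: "\<And>t. t\<in>{0..2*pi} \<Longrightarrow> nrm (?e t) t 2 = N2" using strain_structure(2)[of \<xi> 2] by blast
  have c: "continuous_on {0..2*pi} (\<lambda>t. nrm (C (?e t)) t i)" "continuous_on {0..2*pi} (\<lambda>t. tng (?e t) t i)" for i
    unfolding nrm_def tng_def by (intro continuous_intros C_continuous eta_circle)+
  have "circ (\<lambda>t. C (?e t) \<bullet> ?e t) = circ (\<lambda>t. (N1 * nrm (C (?e t)) t 1 + T1 * tng (?e t) t 1) + (N2 * nrm (C (?e t)) t 2 + T2 * tng (?e t) t 2))"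
    unfolding circ_def
  proof (rule integral_cong)
    fix t assume t: "t \<in> {0..2*pi}"
    show "C (?e t) \<bullet> ?e t = (N1 * nrm (C (?e t)) t 1 + T1 * tng (?e t) t 1) + (N2 * nrm (C (?e t)) t 2 + T2 * tng (?e t) t 2)"
      unfolding inner_frame[of _ _ t] T1[OF t] T2[OF t] N1[OF t] N2[OF t] by simp
  qed
  also have "\<dots> = circ (\<lambda>t. N1 * nrm (C (?e t)) t 1 + T1 * tng (?e t) t 1) + circ (\<lambda>t. N2 * nrm (C (?e t)) t 2 + T2 * tng (?e t) t 2)"
    by (rule circ_linear(1)) (intro continuous_intros c)+
  also have "\<dots> = (circ (\<lambda>t. N1 * nrm (C (?e t)) t 1) + circ (\<lambda>t. T1 * tng (?e t) t 1)) + (circ (\<lambda>t. N2 * nrm (C (?e t)) t 2) + circ (\<lambda>t. T2 * tng (?e t) t 2))"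
    by (intro arg_cong2[where f="(+)"] circ_linear(1)) (intro continuous_intros c)+
  also have "\<dots> = T1 * \<xi>$1 + T2 * \<xi>$2"
    unfolding circ_linear(3)[OF c(1) c(1)] circ_linear(3)[OF c(2) c(2)] strain_structure(1) stress_structure(1) by simp
  finally have "2 * \<psi> \<xi> = vector [T1, T2] \<bullet> \<xi>" by (simp add: \<psi>_def inner_vec_def sum_2)
  moreover have "tng (C (?e t)) t i = vector [T1, T2] $ i" if "t \<in> {0..2*pi}" for t i
    using T1[OF that] T2[OF that] exhaust_2[of i] by auto
  ultimately show ?thesis using that[of "vector [T1, T2]"] by blast
qed

lemma psi_nonneg: "0 \<le> \<psi> \<xi>"
  using circ_mono[OF continuous_on_const energy_continuous, of 0 \<xi> \<xi>] C_nonneg by (simp add: \<psi>_def circ_const)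

text \<open>Zero energy makes the field skew on the whole circle by coercivity. The constant normal
  strains are then read off at the angles 0 and pi/2, where a skew matrix gives 0; hence the field
  vanishes on the circle, and so does its circulation \<xi>.\<close>

lemma psi_pos: assumes "\<xi> \<noteq> 0" shows "0 < \<psi> \<xi>"
proof (rule ccontr)
  assume "\<not> 0 < \<psi> \<xi>"
  then have z: "circ (\<lambda>t. C (\<eta> \<xi> (polar 1 t)) \<bullet> \<eta> \<xi> (polar 1 t)) = 0"
    using psi_nonneg[of \<xi>] by (simp add: \<psi>_def)
  let ?e = "\<lambda>t. \<eta> \<xi> (polar 1 t)"
  obtain N1 where N1: "\<And>t. t\<in>{0..2*pi} \<Longrightarrow> nrm (?e t) t 1 = N1" using strain_structure(2)[of \<xi> 1] by blast
  obtain N2 where N2: "\<And>t. t\<in>{0..2*pi} \<Longrightarrow> nrm (?e t) t 2 = N2" using strain_structure(2)[of \<xi> 2] by blast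
  have skew: "?e t $1$1 = 0" "?e t $2$2 = 0" "?e t $2$1 = - ?e t $1$2" if t: "t \<in> {0..2*pi}" for t
  proof -
    have "C (?e t) \<bullet> ?e t = 0"
      by (rule circ_eq_0[OF energy_continuous _ z t]) (rule C_nonneg)
    then have "\<nu>\<^sub>1 * (norm (sym_part (?e t)))\<^sup>2 \<le> 0" using C_coercive[of "?e t"] by simp
    then have "(norm (sym_part (?e t)))\<^sup>2 \<le> 0" using \<nu>(1) by (simp add: mult_le_0_iff)
    then have s: "sym_part (?e t) = 0" by simp
    have "sym_part (?e t) $1$1 = 0" "sym_part (?e t) $2$2 = 0" "sym_part (?e t) $1$2 = 0" unfolding s by simp_all
    then show "?e t $1$1 = 0" "?e t $2$2 = 0" "?e t $2$1 = - ?e t $1$2" by (simp_all add: sym_part_def transpose_def)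
  qed
  have p: "pi/2 \<in> {0..2*pi}" "0 \<in> {0..2*pi}" by auto
  have "N1 = 0" using N1[OF p(2)] skew[OF p(2)] by (simp add: nrm_def)
  have "N2 = 0" using N2[OF p(1)] skew[OF p(1)] by (simp add: nrm_def)
  have "tng (?e t) t i = 0" if t: "t \<in> {0..2*pi}" for t i
  proof -
    have a: "?e t $1$2 * sin t = 0" using N1[OF t] \<open>N1 = 0\<close> skew[OF t] by (simp add: nrm_def)
    have b: "?e t $1$2 * cos t = 0" using N2[OF t] \<open>N2 = 0\<close> skew[OF t] by (simp add: nrm_def)
    have "?e t $1$2 = 0" using a b sin_cos_squared_add[of t] by (metis mult_eq_0_iff power_zero_numeral add_0 zero_neq_one)
    then have "?e t $ i $ 1 = 0 \<and> ?e t $ i $ 2 = 0" using skew[OF t] exhaust_2[of i] by auto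
    then show ?thesis by (simp add: tng_def)
  qed
  then have "circ (\<lambda>t. tng (?e t) t i) = circ (\<lambda>t. 0)" for i unfolding circ_def by (intro integral_cong) auto
  then have "\<xi> $ i = 0" for i unfolding strain_structure(1) by (simp add: circ_const)
  then show False using assms by (simp add: vec_eq_iff)
qed

lemma psi_quadratic:
  obtains a b c where "\<And>\<xi>. \<psi> \<xi> = a * (\<xi>$1)\<^sup>2 + b * (\<xi>$1 * \<xi>$2) + c * (\<xi>$2)\<^sup>2"
proof -
  let ?e = "\<lambda>i t. \<eta> (axis i 1) (polar 1 t)"
  let ?q = "\<lambda>i j t. C (?e i t) \<bullet> ?e j t"
  have c: "continuous_on {0..2*pi} (?q i j)" for i j by (rule energy_continuous)
  have p0: "polar 1 t \<noteq> 0" for t by (rule polar_nonzero) simp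
  have "\<psi> \<xi> = (1/2 * circ (?q 1 1)) * (\<xi>$1)\<^sup>2 + (circ (?q 1 2)) * (\<xi>$1 * \<xi>$2) + (1/2 * circ (?q 2 2)) * (\<xi>$2)\<^sup>2" for \<xi>
  proof -
    have "C (\<eta> \<xi> (polar 1 t)) \<bullet> \<eta> \<xi> (polar 1 t) = (\<xi>$1)\<^sup>2 * ?q 1 1 t + (2 * \<xi>$1 * \<xi>$2) * ?q 1 2 t + (\<xi>$2)\<^sup>2 * ?q 2 2 t" for t
    proof -
      have "?q 2 1 t = ?q 1 2 t" using C_adjoint[of "?e 2 t" "?e 1 t"] by (simp add: inner_commute)
      then show ?thesis unfolding eta_expand[OF p0[of t], of \<xi>]
        by (simp add: linear_add[OF C_linear] linear_cmul[OF C_linear] inner_add_left inner_add_right power2_eq_square algebra_simps)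
    qed
    then have "circ (\<lambda>t. C (\<eta> \<xi> (polar 1 t)) \<bullet> \<eta> \<xi> (polar 1 t)) = circ (\<lambda>t. ((\<xi>$1)\<^sup>2 * ?q 1 1 t + (2 * \<xi>$1 * \<xi>$2) * ?q 1 2 t) + (\<xi>$2)\<^sup>2 * ?q 2 2 t)"
      by simp
    also have "\<dots> = circ (\<lambda>t. (\<xi>$1)\<^sup>2 * ?q 1 1 t + (2 * \<xi>$1 * \<xi>$2) * ?q 1 2 t) + circ (\<lambda>t. (\<xi>$2)\<^sup>2 * ?q 2 2 t)"
      by (rule circ_linear(1)) (intro continuous_intros energy_continuous)+
    also have "circ (\<lambda>t. (\<xi>$1)\<^sup>2 * ?q 1 1 t + (2 * \<xi>$1 * \<xi>$2) * ?q 1 2 t) = circ (\<lambda>t. (\<xi>$1)\<^sup>2 * ?q 1 1 t) + circ (\<lambda>t. (2 * \<xi>$1 * \<xi>$2) * ?q 1 2 t)"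
      by (rule circ_linear(1)) (intro continuous_intros energy_continuous)+
    finally show ?thesis unfolding \<psi>_def circ_linear(3)[OF c c] by (simp add: algebra_simps)
  qed
  then show ?thesis using that by blast
qed

lemma psi_continuous: "continuous_on A \<psi>"
proof -
  obtain a b c where "\<And>\<xi>. \<psi> \<xi> = a * (\<xi>$1)\<^sup>2 + b * (\<xi>$1 * \<xi>$2) + c * (\<xi>$2)\<^sup>2" using psi_quadratic by blast
  then have "\<psi> = (\<lambda>\<xi>. a * (\<xi>$1)\<^sup>2 + b * (\<xi>$1 * \<xi>$2) + c * (\<xi>$2)\<^sup>2)" by blast
  moreover have "continuous_on A (\<lambda>\<xi>::real^2. a * (\<xi>$1)\<^sup>2 + b * (\<xi>$1 * \<xi>$2) + c * (\<xi>$2)\<^sup>2)"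
    by (intro continuous_intros)
  ultimately show ?thesis by simp
qed

text \<open>A quadratic form that is positive off the origin; the constant is its minimum over the
  unit circle.\<close>

lemma psi_coercive: "\<exists>c>0. \<forall>\<xi>. \<psi> \<xi> \<ge> c * (norm \<xi>)\<^sup>2"
proof -
  have ne: "sphere (0::real^2) 1 \<noteq> {}" using norm_polar[of 1 0] by (auto intro: exI[of _ "polar 1 0"])
  obtain \<zeta> where \<zeta>: "\<zeta> \<in> sphere 0 1" "\<And>\<xi>. \<xi> \<in> sphere 0 1 \<Longrightarrow> \<psi> \<zeta> \<le> \<psi> \<xi>"
    using continuous_attains_inf[OF compact_sphere ne psi_continuous] by blast
  have "\<psi> \<zeta> > 0" using \<zeta>(1) by (intro psi_pos) auto
  moreover have "\<psi> \<zeta> * (norm \<xi>)\<^sup>2 \<le> \<psi> \<xi>" for \<xi>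
  proof (cases "\<xi> = 0")
    case False
    obtain a b c where q: "\<And>\<xi>. \<psi> \<xi> = a * (\<xi>$1)\<^sup>2 + b * (\<xi>$1 * \<xi>$2) + c * (\<xi>$2)\<^sup>2" using psi_quadratic by blast
    have "\<psi> (s *\<^sub>R x) = s\<^sup>2 * \<psi> x" for s x unfolding q by (simp add: power2_eq_square algebra_simps)
    then have "\<psi> \<xi> = (norm \<xi>)\<^sup>2 * \<psi> ((1 / norm \<xi>) *\<^sub>R \<xi>)" using False by (simp add: power_divide)
    moreover have "\<psi> \<zeta> \<le> \<psi> ((1 / norm \<xi>) *\<^sub>R \<xi>)" using False by (intro \<zeta>(2)) simp
    ultimately show ?thesis using mult_left_mono[of "\<psi> \<zeta>" "\<psi> ((1 / norm \<xi>) *\<^sub>R \<xi>)" "(norm \<xi>)\<^sup>2"]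
      by (simp add: mult.commute)
  qed (use psi_nonneg in simp)
  ultimately show ?thesis by blast
qed

end

section \<open>Test fields for the lower bound\<close>

lemma open_punctured: "open (- {0::real^2})"
  by (rule open_Compl) simp

lemma circ_cos_nat: "circ (\<lambda>t. cos (real m * t)) = (if m = 0 then 2*pi else 0)"
  and circ_sin_nat: "circ (\<lambda>t. sin (real m * t)) = 0"
  using circ_cos_sin[of m] circ_const[of 1] circ_const[of 0] by (cases "m = 0"; simp)+

lemma circ_mode_products:
  "circ (\<lambda>t. cos (real k * t) * cos t) = (if k = 1 then pi else 0)"
  "circ (\<lambda>t. sin (real k * t) * cos t) = 0"
  "circ (\<lambda>t. cos (real k * t) * sin t) = 0"
  "circ (\<lambda>t. sin (real k * t) * sin t) = (if k = 1 then pi else 0)"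
proof -
  have cc: "continuous_on {0..2*pi} (\<lambda>t. cos (real m * t))" "continuous_on {0..2*pi} (\<lambda>t. sin (real m * t))" for m
    by (intro continuous_intros)+
  have "circ (\<lambda>t. cos (real k * t) * cos t) = (if k = 1 then pi else 0) \<and> circ (\<lambda>t. sin (real k * t) * cos t) = 0
    \<and> circ (\<lambda>t. cos (real k * t) * sin t) = 0 \<and> circ (\<lambda>t. sin (real k * t) * sin t) = (if k = 1 then pi else 0)"
  proof (cases k)
    case 0
    then show ?thesis using circ_cos_sin[of 1] circ_const[of 0] by simp
  next
    case (Suc m)
    have r: "real (Suc k) * t = real k * t + t" "real m * t = real k * t - t" for t using Suc by (simp_all add: algebra_simps)
    have e: "cos (real k * t) * cos t = 1/2 * (cos (real (Suc k) * t) + cos (real m * t))"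
      "sin (real k * t) * cos t = 1/2 * (sin (real (Suc k) * t) + sin (real m * t))"
      "cos (real k * t) * sin t = 1/2 * (sin (real (Suc k) * t) - sin (real m * t))"
      "sin (real k * t) * sin t = 1/2 * (cos (real m * t) - cos (real (Suc k) * t))" for t
      unfolding r cos_add sin_add cos_diff sin_diff by simp_all
    have a: "continuous_on {0..2*pi} (\<lambda>t. cos (real (Suc k) * t) + cos (real m * t))"
      "continuous_on {0..2*pi} (\<lambda>t. sin (real (Suc k) * t) + sin (real m * t))"
      "continuous_on {0..2*pi} (\<lambda>t. sin (real (Suc k) * t) - sin (real m * t))"
      "continuous_on {0..2*pi} (\<lambda>t. cos (real m * t) - cos (real (Suc k) * t))"
      by (intro continuous_intros)+
    show ?thesis
      unfolding e circ_linear(3)[OF a(1) a(1)] circ_linear(3)[OF a(2) a(2)] circ_linear(3)[OF a(3) a(3)] circ_linear(3)[OF a(4) a(4)]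
        circ_linear(1)[OF cc(1) cc(1)] circ_linear(1)[OF cc(2) cc(2)] circ_linear(2)[OF cc(1) cc(1)] circ_linear(2)[OF cc(2) cc(2)]
        circ_cos_nat circ_sin_nat using Suc by simp
  qed
  then show "circ (\<lambda>t. cos (real k * t) * cos t) = (if k = 1 then pi else 0)"
  "circ (\<lambda>t. sin (real k * t) * cos t) = 0"
  "circ (\<lambda>t. cos (real k * t) * sin t) = 0"
  "circ (\<lambda>t. sin (real k * t) * sin t) = (if k = 1 then pi else 0)" by blast+
qed

text \<open>
  A 1-homogeneous function \<open>r u(t)\<close> has Airy stress \<open>(u'' + u) n \<otimes> n / r\<close>; the equation
  \<open>u'' + u = g\<close> is solvable up to the first Fourier mode of \<open>g\<close>.
\<close>

definition airy_profile :: "(real \<Rightarrow> real) \<Rightarrow> (real^2 \<Rightarrow> real) \<Rightarrow> (real \<Rightarrow> real) \<Rightarrow> (real \<Rightarrow> real) \<Rightarrow> (real \<Rightarrow> real) \<Rightarrow> bool" where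
  "airy_profile g V u u' u'' \<longleftrightarrow> smooth_on (- {0}) V \<and> (\<forall>r>0. \<forall>t. V (polar r t) = r * u t) \<and>
     (\<forall>t. (u has_real_derivative u' t) (at t)) \<and> (\<forall>t. (u' has_real_derivative u'' t) (at t)) \<and>
     (\<forall>t. u'' t + u t = g t - circ (\<lambda>t. g t * cos t) / pi * cos t - circ (\<lambda>t. g t * sin t) / pi * sin t)"

lemma smooth_on_radial_powr: "smooth_on (- {0}) (\<lambda>x. nsq x powr p)"
proof (rule smooth_on_powr)
  show "open (- {0::real^2})" by (rule open_punctured)
  show "smooth_on (- {0}) nsq" by (rule smooth_on_nsq[OF open_punctured])
  show "nsq x > 0" if "x \<in> - {0}" for x using that by (simp add: nsq_norm)
qed

text \<open>A mode of frequency k other than 1 is solved by division by 1 minus k squared. Frequency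
  1 solves the homogeneous equation; it is exactly what the two projections in
  \<open>airy_profile\<close> remove, so its solution is 0. The mode is extended to a function
  homogeneous of degree one by multiplying the harmonic polynomial with the power 1 - k of the
  radius.\<close>

lemma trig_solution:
  assumes "trig_poly g"
  shows "\<exists>V u u' u''. airy_profile g V u u' u''"
  using assms
proof induction
  case (mono a k b)
  have cc: "continuous_on {0..2*pi} (\<lambda>t. cos (real k * t) * cos t)" "continuous_on {0..2*pi} (\<lambda>t. sin (real k * t) * cos t)"
    "continuous_on {0..2*pi} (\<lambda>t. cos (real k * t) * sin t)" "continuous_on {0..2*pi} (\<lambda>t. sin (real k * t) * sin t)"
    by (intro continuous_intros)+
  let ?g = "\<lambda>t. a * cos (real k * t) + b * sin (real k * t)"
  have c1: "circ (\<lambda>t. ?g t * cos t) = (if k = 1 then a * pi else 0)"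
  proof -
    have "circ (\<lambda>t. ?g t * cos t) = circ (\<lambda>t. a * (cos (real k * t) * cos t) + b * (sin (real k * t) * cos t))"
      by (simp add: algebra_simps)
    also have "\<dots> = circ (\<lambda>t. a * (cos (real k * t) * cos t)) + circ (\<lambda>t. b * (sin (real k * t) * cos t))"
      by (rule circ_linear(1)) (intro continuous_intros)+
    finally show ?thesis unfolding circ_linear(3)[OF cc(1) cc(1)] circ_linear(3)[OF cc(2) cc(2)] circ_mode_products by simp
  qed
  have c2: "circ (\<lambda>t. ?g t * sin t) = (if k = 1 then b * pi else 0)"
  proof -
    have "circ (\<lambda>t. ?g t * sin t) = circ (\<lambda>t. a * (cos (real k * t) * sin t) + b * (sin (real k * t) * sin t))"
      by (simp add: algebra_simps)
    also have "\<dots> = circ (\<lambda>t. a * (cos (real k * t) * sin t)) + circ (\<lambda>t. b * (sin (real k * t) * sin t))"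
      by (rule circ_linear(1)) (intro continuous_intros)+
    finally show ?thesis unfolding circ_linear(3)[OF cc(3) cc(3)] circ_linear(3)[OF cc(4) cc(4)] circ_mode_products by simp
  qed
  show ?case
  proof (cases "k = 1")
    case True
    have "airy_profile ?g (\<lambda>x. 0) (\<lambda>t. 0) (\<lambda>t. 0) (\<lambda>t. 0)"
      unfolding airy_profile_def c1 c2 using True smooth_on_const[OF open_punctured, of 0] by simp
    then show ?thesis by blast
  next
    case False
    define d where "d = 1 - (real k)\<^sup>2"
    have d: "d \<noteq> 0" using False unfolding d_def by (simp add: power2_eq_1_iff)
    define A B where "A = a/d" and "B = b/d"
    have AB: "d * A = a" "d * B = b" using d by (simp_all add: A_def B_def)
    define V where "V x = A * (nsq x powr ((1 - real k)/2) * harm_re k x) + B * (nsq x powr ((1 - real k)/2) * harm_im k x)" for x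
    define u where "u t = A * cos (real k * t) + B * sin (real k * t)" for t
    define u' where "u' t = A * (- real k * sin (real k * t)) + B * (real k * cos (real k * t))" for t
    define u'' where "u'' t = A * (- real k * (real k * cos (real k * t))) + B * (real k * (- real k * sin (real k * t)))" for t
    have "airy_profile ?g V u u' u''"
      unfolding airy_profile_def c1 c2
    proof (intro conjI allI impI)
      have o: "open (- {0::real^2})" by (rule open_punctured)
      show "smooth_on (- {0}) V" unfolding V_def
        by (intro smooth_on_add[OF o] smooth_on_mult[OF o] smooth_on_const[OF o] smooth_on_radial_powr smooth_on_harm[OF o])
      fix t
      show "(u has_real_derivative u' t) (at t)" unfolding u_def u'_def by (auto intro!: derivative_eq_intros)
      show "(u' has_real_derivative u'' t) (at t)" unfolding u'_def u''_def by (auto intro!: derivative_eq_intros)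
      have "u'' t + u t = (1 - (real k)\<^sup>2) * A * cos (real k * t) + (1 - (real k)\<^sup>2) * B * sin (real k * t)"
        unfolding u''_def u_def by (simp add: algebra_simps power2_eq_square)
      also have "\<dots> = ?g t" unfolding d_def[symmetric] AB ..
      finally show "u'' t + u t = ?g t - (if k = 1 then a * pi else 0) / pi * cos t - (if k = 1 then b * pi else 0) / pi * sin t"
        using False by simp
      fix r :: real assume r: "r > 0"
      have "nsq (polar r t) powr ((1 - real k)/2) * r ^ k = r"
      proof -
        have "(r\<^sup>2) powr p = r powr (2 * p)" for p
          using r by (simp add: powr_powr powr_numeral[symmetric] del: powr_numeral)
        from this[of "(1 - real k)/2"] have "nsq (polar r t) powr ((1 - real k)/2) = r powr (1 - real k)"
          by (simp only: nsq_polar) (simp add: diff_divide_distrib)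
        moreover have "r powr (1 - real k) * r ^ k = r powr (1 - real k) * r powr real k" using r by (simp add: powr_realpow)
        moreover have "\<dots> = r" using r by (simp add: powr_add[symmetric])
        ultimately show ?thesis by simp
      qed
      then have *: "nsq (polar r t) powr ((1 - real k)/2) * r ^ k * u t = r * u t" by simp
      show "V (polar r t) = r * u t"
        unfolding *[symmetric] unfolding V_def u_def harm_polar by (simp only: algebra_simps)
    qed
    then show ?thesis by blast
  qed
next
  case (add f g)
  then obtain V u u' u'' W v v' v'' where 1: "airy_profile f V u u' u''" and 2: "airy_profile g W v v' v''" by blast
  have c: "circ (\<lambda>t. (f t + g t) * cos t) = circ (\<lambda>t. f t * cos t) + circ (\<lambda>t. g t * cos t)"
    "circ (\<lambda>t. (f t + g t) * sin t) = circ (\<lambda>t. f t * sin t) + circ (\<lambda>t. g t * sin t)"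
    unfolding distrib_right by (rule circ_linear(1); intro continuous_intros trig_poly_continuous add.hyps)+
  have "airy_profile (\<lambda>t. f t + g t) (\<lambda>x. V x + W x) (\<lambda>t. u t + v t) (\<lambda>t. u' t + v' t) (\<lambda>t. u'' t + v'' t)"
    unfolding airy_profile_def c
  proof (intro conjI allI impI)
    show "smooth_on (- {0}) (\<lambda>x. V x + W x)" using 1 2 smooth_on_add[OF open_punctured, of V W] by (simp add: airy_profile_def)
    fix t
    show "((\<lambda>t. u t + v t) has_real_derivative u' t + v' t) (at t)" using 1 2 by (simp add: airy_profile_def DERIV_add)
    show "((\<lambda>t. u' t + v' t) has_real_derivative u'' t + v'' t) (at t)" using 1 2 by (simp add: airy_profile_def DERIV_add)
    have "u'' t + u t = f t - circ (\<lambda>t. f t * cos t) / pi * cos t - circ (\<lambda>t. f t * sin t) / pi * sin t"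
      "v'' t + v t = g t - circ (\<lambda>t. g t * cos t) / pi * cos t - circ (\<lambda>t. g t * sin t) / pi * sin t"
      using 1 2 unfolding airy_profile_def by blast+
    then show "u'' t + v'' t + (u t + v t) = f t + g t - (circ (\<lambda>t. f t * cos t) + circ (\<lambda>t. g t * cos t)) / pi * cos t
        - (circ (\<lambda>t. f t * sin t) + circ (\<lambda>t. g t * sin t)) / pi * sin t"
      by (simp add: add_divide_distrib distrib_right)
    fix r :: real assume "r > 0"
    then show "V (polar r t) + W (polar r t) = r * (u t + v t)" using 1 2 by (simp add: airy_profile_def distrib_left)
  qed
  then show ?case by blast
qed

text \<open>Both components of the gradient are computed along circles and rays, and differentiating
  them once more along the same curves gives the columns of the stress. The angular part u
  contributes to the normal column only; the whole tangential column, constant up to 1/r, comes from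
  the logarithmic term.\<close>

lemma airy_frame:
  assumes V: "smooth_on (- {0}) V" and profile: "\<forall>r>0. \<forall>t. V (polar r t) = r * u t + r * ln r * (b1 * cos t + b2 * sin t)"
    and u: "\<And>t. (u has_real_derivative u' t) (at t)" "\<And>t. (u' has_real_derivative u'' t) (at t)"
    and r: "r > 0"
  shows "tng (airy V (polar r t)) t 1 = (1/r) * (- b2)" "tng (airy V (polar r t)) t 2 = (1/r) * b1"
    "nrm (airy V (polar r t)) t 1 = (1/r) * ((u'' t + u t + (b1 * cos t + b2 * sin t)) * cos t + (b2 * cos t - b1 * sin t) * sin t)"
    "nrm (airy V (polar r t)) t 2 = (1/r) * ((u'' t + u t + (b1 * cos t + b2 * sin t)) * sin t - (b2 * cos t - b1 * sin t) * cos t)"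
proof -
  note pol = profile[rule_format]
  have o: "open (- {0::real^2})" by (rule open_punctured)
  have p0: "polar s t \<in> - {0}" if "s > 0" for s t using polar_nonzero[of s t] that by simp
  have d: "V differentiable (at (polar s t))" if "s > 0" for s t
    using smooth_on_differentiable[OF V p0[OF that]] .
  have d': "partial_deriv i V differentiable (at (polar s t))" if "s > 0" for s t i
    using smooth_on_differentiable[OF smooth_on_partial_deriv[OF V] p0[OF that]] .
  \<comment> \<open>\<open>?P\<close> and \<open>?Q\<close> below are the radial derivative of V and
    its angular derivative divided by the radius.\<close>
  let ?B = "\<lambda>t. b1 * cos t + b2 * sin t" and ?B' = "\<lambda>t. b2 * cos t - b1 * sin t"
  let ?P = "\<lambda>s t. u t + (ln s + 1) * ?B t" and ?Q = "\<lambda>s t. u' t + ln s * ?B' t"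
  have grad1: "cos t * partial_deriv 1 V (polar s t) + sin t * partial_deriv 2 V (polar s t) = ?P s t" if s: "s > 0" for s t
  proof (rule DERIV_unique[OF has_real_derivative_polar(1)[OF d[OF s]]])
    have "((\<lambda>r. r * u t + r * ln r * ?B t) has_real_derivative ?P s t) (at s)"
      using s by (auto intro!: derivative_eq_intros simp: algebra_simps)
    then show "((\<lambda>r. V (polar r t)) has_real_derivative ?P s t) (at s)"
      by (rule has_field_derivative_transform_within_open[of _ _ _ "{0<..}"]) (use s pol in auto)
  qed
  have grad2: "cos t * partial_deriv 2 V (polar s t) - sin t * partial_deriv 1 V (polar s t) = ?Q s t" if s: "s > 0" for s t
  proof -
    have "((\<lambda>t. s * u t + s * ln s * ?B t) has_real_derivative s * ?Q s t) (at t)"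
      using s by (auto intro!: derivative_eq_intros u(1) simp: algebra_simps)
    then have "((\<lambda>t. V (polar s t)) has_real_derivative s * ?Q s t) (at t)" unfolding pol[OF s] .
    from DERIV_unique[OF has_real_derivative_polar(2)[OF d[OF s]] this] show ?thesis using s by simp
  qed
  have V1: "partial_deriv 1 V (polar s t) = cos t * ?P s t - sin t * ?Q s t" if s: "s > 0" for s t
    using grad1[OF s, of t] grad2[OF s, of t] sin_cos_squared_add[of t] by algebra
  have V2: "partial_deriv 2 V (polar s t) = sin t * ?P s t + cos t * ?Q s t" if s: "s > 0" for s t
    using grad1[OF s, of t] grad2[OF s, of t] sin_cos_squared_add[of t] by algebra
  let ?w = "u'' t + u t + ?B t"
  have t1: "((\<lambda>t. cos t * ?P r t - sin t * ?Q r t) has_real_derivative - sin t * ?w + cos t * ?B' t) (at t)"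
    by (auto intro!: derivative_eq_intros u simp: algebra_simps)
  have t2: "((\<lambda>t. sin t * ?P r t + cos t * ?Q r t) has_real_derivative cos t * ?w + sin t * ?B' t) (at t)"
    by (auto intro!: derivative_eq_intros u simp: algebra_simps)
  have r1: "((\<lambda>s. partial_deriv 1 V (polar s t)) has_real_derivative (1/r) * (cos t * ?B t - sin t * ?B' t)) (at r)"
  proof (rule has_field_derivative_transform_within_open[of "\<lambda>s. cos t * ?P s t - sin t * ?Q s t" _ _ "{0<..}"])
    show "((\<lambda>s. cos t * ?P s t - sin t * ?Q s t) has_real_derivative (1/r) * (cos t * ?B t - sin t * ?B' t)) (at r)"
      using r by (auto intro!: derivative_eq_intros simp: field_simps)
  qed (use r V1 in auto)
  have r2: "((\<lambda>s. partial_deriv 2 V (polar s t)) has_real_derivative (1/r) * (sin t * ?B t + cos t * ?B' t)) (at r)"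
  proof (rule has_field_derivative_transform_within_open[of "\<lambda>s. sin t * ?P s t + cos t * ?Q s t" _ _ "{0<..}"])
    show "((\<lambda>s. sin t * ?P s t + cos t * ?Q s t) has_real_derivative (1/r) * (sin t * ?B t + cos t * ?B' t)) (at r)"
      using r by (auto intro!: derivative_eq_intros simp: field_simps)
  qed (use r V2 in auto)
  have comm: "partial_deriv 2 (partial_deriv 1 V) (polar r t) = partial_deriv 1 (partial_deriv 2 V) (polar r t)"
    by (rule partial_deriv_commute[OF V o p0[OF r]])
  have T1: "r * (cos t * partial_deriv 2 (partial_deriv 1 V) (polar r t) - sin t * partial_deriv 1 (partial_deriv 1 V) (polar r t)) = - sin t * ?w + cos t * ?B' t"
    by (rule DERIV_unique[OF has_real_derivative_polar(2)[OF d'[OF r]]]) (unfold V1[OF r], rule t1)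
  have T2: "r * (cos t * partial_deriv 2 (partial_deriv 2 V) (polar r t) - sin t * partial_deriv 1 (partial_deriv 2 V) (polar r t)) = cos t * ?w + sin t * ?B' t"
    by (rule DERIV_unique[OF has_real_derivative_polar(2)[OF d'[OF r]]]) (unfold V2[OF r], rule t2)
  have R1: "cos t * partial_deriv 1 (partial_deriv 1 V) (polar r t) + sin t * partial_deriv 2 (partial_deriv 1 V) (polar r t) = (1/r) * (cos t * ?B t - sin t * ?B' t)"
    by (rule DERIV_unique[OF has_real_derivative_polar(1)[OF d'[OF r]] r1])
  have R2: "cos t * partial_deriv 1 (partial_deriv 2 V) (polar r t) + sin t * partial_deriv 2 (partial_deriv 2 V) (polar r t) = (1/r) * (sin t * ?B t + cos t * ?B' t)"
    by (rule DERIV_unique[OF has_real_derivative_polar(1)[OF d'[OF r]] r2])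
  have b: "cos t * ?B t - sin t * ?B' t = b1" "sin t * ?B t + cos t * ?B' t = b2"
    using sin_cos_squared_add[of t] by algebra+
  show "tng (airy V (polar r t)) t 1 = (1/r) * (- b2)"
    using R2 unfolding b by (simp add: tng_def airy_def algebra_simps)
  show "tng (airy V (polar r t)) t 2 = (1/r) * b1"
    using R1 unfolding b comm by (simp add: tng_def airy_def algebra_simps)
  show "nrm (airy V (polar r t)) t 1 = (1/r) * (?w * cos t + ?B' t * sin t)"
    using T2 r by (simp add: nrm_def airy_def field_simps)
  show "nrm (airy V (polar r t)) t 2 = (1/r) * (?w * sin t - ?B' t * cos t)"
    using T1 r unfolding comm by (simp add: nrm_def airy_def field_simps)
qed

lemma nrm_tng_inject:
  assumes "nrm F t 1 = nrm G t 1" "nrm F t 2 = nrm G t 2" "tng F t 1 = tng G t 1" "tng F t 2 = tng G t 2"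
  shows "F = G"
proof -
  have "(F - G) \<bullet> (F - G) = 0"
    unfolding inner_frame[of _ _ t] using assms by (simp add: nrm_def tng_def algebra_simps)
  then show ?thesis by simp
qed

context cell_setting
begin

text \<open>The logarithmic term reproduces the constant traction T exactly, and symmetry of the
  stress then fixes the shear part of the normal column too. Only the radial component is left to be
  matched by the solution u. It is met approximately, through a trigonometric polynomial, since the
  equation for u can be solved explicitly mode by mode.\<close>

lemma test_potential:
  assumes \<epsilon>: "\<epsilon> > 0"
    and T: "\<And>t i. t \<in> {0..2*pi} \<Longrightarrow> tng (C (\<eta> \<xi> (polar 1 t))) t i = T $ i"
  obtains V u where "smooth_on (- {0}) V"
    "\<And>r t. r > 0 \<Longrightarrow> V (polar r t) = r * u t + r * ln r * (T$2 * cos t - T$1 * sin t)"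
    "\<And>r t. r > 0 \<Longrightarrow> airy V (polar r t) = (1/r) *\<^sub>R airy V (polar 1 t)"
    "\<And>t. t \<in> {0..2*pi} \<Longrightarrow> norm (airy V (polar 1 t) - C (\<eta> \<xi> (polar 1 t))) \<le> \<epsilon>"
proof -
  let ?S = "\<lambda>t. C (\<eta> \<xi> (polar 1 t))"
  \<comment> \<open>On the unit circle this is the radial component of the stress minus the part
    already produced by the logarithmic term. It is written as a function of the plane so that
    \<open>trig_approximation\<close> applies.\<close>
  define p where "p x = (\<Sum>i\<in>UNIV. \<Sum>j\<in>UNIV. C (\<eta> \<xi> x) $ i $ j * x $ i * x $ j) - (T$2 * x$1 - T$1 * x$2)" for x
  have pc: "continuous_on (sphere 0 1) p"
    unfolding p_def by (intro continuous_intros C_continuous eta_sphere)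
  define q where "q t = p (polar 1 t)" for t
  have q: "q t = nrm (?S t) t 1 * cos t + nrm (?S t) t 2 * sin t - (T$2 * cos t - T$1 * sin t)" for t
    by (simp add: q_def p_def nrm_def sum_2 algebra_simps)
  \<comment> \<open>For a symmetric stress the tangential component of the normal column equals the
    normal component of the tangential column, which is known to be given by T.\<close>
  have shear: "nrm (?S t) t 2 * cos t - nrm (?S t) t 1 * sin t = T$1 * cos t + T$2 * sin t" if "t \<in> {0..2*pi}" for t
  proof -
    have "nrm (?S t) t 2 * cos t - nrm (?S t) t 1 * sin t = tng (?S t) t 1 * cos t + tng (?S t) t 2 * sin t"
      by (simp add: nrm_def tng_def C_symmetric[of "\<eta> \<xi> (polar 1 t)"] algebra_simps)
    then show ?thesis using T[OF that] by simp
  qed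
  have pcirc: "continuous_on {0..2*pi} q"
  proof -
    have "continuous_on {0..2*pi} (\<lambda>t. polar 1 t)" unfolding polar_def vector2_eq by (intro continuous_intros)
    then show ?thesis unfolding q_def by (rule continuous_on_compose2[OF pc]) auto
  qed
  have nc: "continuous_on {0..2*pi} (\<lambda>t. nrm (?S t) t i)" for i
    unfolding nrm_def by (intro continuous_intros C_continuous eta_circle)
  have cs: "continuous_on {0..2*pi} (\<lambda>t. cos (2 * t))" "continuous_on {0..2*pi} (\<lambda>t. sin (2 * t))"
    by (intro continuous_intros)+
  have c0: "circ (\<lambda>t. cos (2 * t)) = 0" "circ (\<lambda>t. sin (2 * t)) = 0" using circ_cos_sin[of 2] by simp_all
  \<comment> \<open>The solvability condition for u. Times cos t, the remaining radial component is
    the first entry of the normal traction plus modes of frequency 2, and the total flux is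
    0.\<close>
  have qcos: "circ (\<lambda>t. q t * cos t) = 0"
  proof -
    have "q t * cos t = nrm (?S t) t 1 + (T$1 * sin (2*t) - T$2 * cos (2*t))" if t: "t \<in> {0..2*pi}" for t
      unfolding q sin_double cos_double using shear[OF t] sin_cos_squared_add[of t] by algebra
    then have "circ (\<lambda>t. q t * cos t) = circ (\<lambda>t. nrm (?S t) t 1 + (T$1 * sin (2*t) - T$2 * cos (2*t)))"
      unfolding circ_def by (rule integral_cong)
    also have "\<dots> = circ (\<lambda>t. nrm (?S t) t 1) + circ (\<lambda>t. T$1 * sin (2*t) - T$2 * cos (2*t))"
      by (rule circ_linear(1)) (intro continuous_intros nc)+
    also have "circ (\<lambda>t. T$1 * sin (2*t) - T$2 * cos (2*t)) = circ (\<lambda>t. T$1 * sin (2*t)) - circ (\<lambda>t. T$2 * cos (2*t))"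
      by (rule circ_linear(2)) (intro continuous_intros)+
    finally show ?thesis unfolding circ_linear(3)[OF cs(1) cs(1)] circ_linear(3)[OF cs(2) cs(2)] c0 stress_structure(1) by simp
  qed
  have qsin: "circ (\<lambda>t. q t * sin t) = 0"
  proof -
    have "q t * sin t = nrm (?S t) t 2 + ((- T$1) * cos (2*t) - T$2 * sin (2*t))" if t: "t \<in> {0..2*pi}" for t
      unfolding q sin_double cos_double using shear[OF t] sin_cos_squared_add[of t] by algebra
    then have "circ (\<lambda>t. q t * sin t) = circ (\<lambda>t. nrm (?S t) t 2 + ((- T$1) * cos (2*t) - T$2 * sin (2*t)))"
      unfolding circ_def by (rule integral_cong)
    also have "\<dots> = circ (\<lambda>t. nrm (?S t) t 2) + circ (\<lambda>t. (- T$1) * cos (2*t) - T$2 * sin (2*t))"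
      by (rule circ_linear(1)) (intro continuous_intros nc)+
    also have "circ (\<lambda>t. (- T$1) * cos (2*t) - T$2 * sin (2*t)) = circ (\<lambda>t. (- T$1) * cos (2*t)) - circ (\<lambda>t. T$2 * sin (2*t))"
      by (rule circ_linear(2)) (intro continuous_intros)+
    finally show ?thesis unfolding circ_linear(3)[OF cs(1) cs(1)] circ_linear(3)[OF cs(2) cs(2)] c0 stress_structure(1) by simp
  qed
  \<comment> \<open>The approximation costs one fifth of \<epsilon>; each of the two first Fourier
    modes of g, which vanish for q but not for g, costs two fifths.\<close>
  obtain g where g: "trig_poly g" "\<And>t. \<bar>p (polar 1 t) - g t\<bar> < \<epsilon>/5"
    using trig_approximation[OF pc, of "\<epsilon>/5"] \<epsilon> by auto
  have gc: "continuous_on {0..2*pi} g" by (rule trig_poly_continuous[OF g(1)])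
  have small: "\<bar>circ (\<lambda>t. g t * h t) / pi\<bar> \<le> 2 * (\<epsilon>/5)"
    if h: "continuous_on {0..2*pi} h" "\<And>t. \<bar>h t\<bar> \<le> 1" "circ (\<lambda>t. q t * h t) = 0" for h
  proof -
    have "circ (\<lambda>t. g t * h t - q t * h t) = circ (\<lambda>t. g t * h t)"
      using h(3) circ_linear(2)[of "\<lambda>t. g t * h t" "\<lambda>t. q t * h t"] by (simp add: continuous_on_mult gc pcirc h(1))
    then have e: "circ (\<lambda>t. g t * h t) = circ (\<lambda>t. (g t - q t) * h t)" by (simp add: left_diff_distrib)
    have b: "\<bar>(g t - q t) * h t\<bar> \<le> \<epsilon>/5" for t
    proof -
      have "\<bar>g t - q t\<bar> * \<bar>h t\<bar> \<le> (\<epsilon>/5) * 1"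
      proof (rule mult_mono[OF _ h(2)])
        show "\<bar>g t - q t\<bar> \<le> \<epsilon>/5" using g(2)[of t] unfolding q_def by linarith
      qed (use \<epsilon> in simp_all)
      then show ?thesis by (simp add: abs_mult)
    qed
    have c: "continuous_on {0..2*pi} (\<lambda>t. (g t - q t) * h t)" by (intro continuous_intros gc pcirc h(1))
    have "circ (\<lambda>t. (g t - q t) * h t) \<le> circ (\<lambda>t. \<epsilon>/5)"
    proof (rule circ_mono[OF c continuous_on_const])
      show "(g t - q t) * h t \<le> \<epsilon>/5" for t using b[of t] by linarith
    qed
    moreover have "circ (\<lambda>t. - (\<epsilon>/5)) \<le> circ (\<lambda>t. (g t - q t) * h t)"
    proof (rule circ_mono[OF continuous_on_const c])
      show "- (\<epsilon>/5) \<le> (g t - q t) * h t" for t using b[of t] by linarith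
    qed
    ultimately have "circ (\<lambda>t. g t * h t) \<le> (2 * (\<epsilon>/5)) * pi" "- ((2 * (\<epsilon>/5)) * pi) \<le> circ (\<lambda>t. g t * h t)"
      unfolding e circ_const by (simp_all add: mult.commute mult.left_commute)
    then have "\<bar>circ (\<lambda>t. g t * h t)\<bar> \<le> (2 * (\<epsilon>/5)) * pi" by linarith
    then show ?thesis using pos_divide_le_eq[OF pi_gt_zero, of "\<bar>circ (\<lambda>t. g t * h t)\<bar>" "2 * (\<epsilon>/5)"]
      by (simp add: abs_divide)
  qed
  have a1: "\<bar>circ (\<lambda>t. g t * cos t) / pi\<bar> \<le> 2 * (\<epsilon>/5)" by (rule small[OF _ _ qcos]) (auto intro: continuous_intros)
  have a2: "\<bar>circ (\<lambda>t. g t * sin t) / pi\<bar> \<le> 2 * (\<epsilon>/5)" by (rule small[OF _ _ qsin]) (auto intro: continuous_intros)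
  obtain V0 u u' u'' where "airy_profile g V0 u u' u''" using trig_solution[OF g(1)] by blast
  then have V0: "smooth_on (- {0}) V0" "\<And>r t. r > 0 \<Longrightarrow> V0 (polar r t) = r * u t"
    and u: "\<And>t. (u has_real_derivative u' t) (at t)" "\<And>t. (u' has_real_derivative u'' t) (at t)"
    and eq: "\<And>t. u'' t + u t = g t - circ (\<lambda>t. g t * cos t) / pi * cos t - circ (\<lambda>t. g t * sin t) / pi * sin t"
    unfolding airy_profile_def by blast+
  have near: "\<bar>u'' t + u t - q t\<bar> \<le> \<epsilon>" for t
  proof -
    have m: "\<bar>a * c\<bar> \<le> 2 * (\<epsilon>/5)" if "\<bar>a\<bar> \<le> 2 * (\<epsilon>/5)" "\<bar>c\<bar> \<le> 1" for a c :: real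
      using mult_mono[OF that] \<epsilon> by (simp add: abs_mult)
    have "\<bar>circ (\<lambda>t. g t * cos t) / pi * cos t\<bar> \<le> 2 * (\<epsilon>/5)" "\<bar>circ (\<lambda>t. g t * sin t) / pi * sin t\<bar> \<le> 2 * (\<epsilon>/5)"
      by (rule m[OF a1 abs_cos_le_one], rule m[OF a2 abs_sin_le_one])
    then show ?thesis unfolding eq using g(2)[of t, folded q_def] by linarith
  qed
  \<comment> \<open>Half the logarithm of \<open>nsq\<close> is the logarithm of the radius, written
    so that smoothness off the origin is immediate. The coefficients T$2 and -T$1 are those for
    which \<open>airy_frame\<close> returns the traction T.\<close>
  define V where "V x = V0 x + (T$2 * x$1 + (- T$1) * x$2) * (1/2 * ln (nsq x))" for x
  have o: "open (- {0::real^2})" by (rule open_punctured)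
  have lnsm: "smooth_on (- {0}) (\<lambda>x. ln (nsq x))"
    by (rule smooth_on_ln[OF o smooth_on_nsq[OF o]]) (simp add: nsq_norm)
  have V: "smooth_on (- {0}) V" unfolding V_def
    by (intro smooth_on_add[OF o] smooth_on_mult[OF o] smooth_on_const[OF o] smooth_on_nth[OF o] V0(1) lnsm)
  have pol: "V (polar r t) = r * u t + r * ln r * (T$2 * cos t + (- T$1) * sin t)" if "r > 0" for r t
  proof -
    have "ln (r\<^sup>2) = 2 * ln r" using that by (simp add: ln_realpow)
    then show ?thesis unfolding V_def V0(2)[OF that] by (simp add: algebra_simps)
  qed
  have "\<forall>r>0. \<forall>t. V (polar r t) = r * u t + r * ln r * (T$2 * cos t + (- T$1) * sin t)" using pol by blast
  note fr = airy_frame[OF V this u]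
  have frame1: "airy V (polar r t) = (1/r) *\<^sub>R airy V (polar 1 t)" if "r > 0" for r t
  proof (rule nrm_tng_inject[where t=t])
    have n: "nrm (c *\<^sub>R F) t i = c * nrm F t i" "tng (c *\<^sub>R F) t i = c * tng F t i" for c F i
      by (simp_all add: nrm_def tng_def algebra_simps)
    show "nrm (airy V (polar r t)) t 1 = nrm ((1/r) *\<^sub>R airy V (polar 1 t)) t 1"
      "nrm (airy V (polar r t)) t 2 = nrm ((1/r) *\<^sub>R airy V (polar 1 t)) t 2"
      "tng (airy V (polar r t)) t 1 = tng ((1/r) *\<^sub>R airy V (polar 1 t)) t 1"
      "tng (airy V (polar r t)) t 2 = tng ((1/r) *\<^sub>R airy V (polar 1 t)) t 2"
      unfolding n fr[OF that] fr[OF zero_less_one] by simp_all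
  qed
  have frame2: "norm (airy V (polar 1 t) - ?S t) \<le> \<epsilon>" if t: "t \<in> {0..2*pi}" for t
  proof -
    let ?X = "airy V (polar 1 t) - ?S t" and ?d = "u'' t + u t - q t"
    have x: "nrm ?X t i = nrm (airy V (polar 1 t)) t i - nrm (?S t) t i" "tng ?X t i = tng (airy V (polar 1 t)) t i - tng (?S t) t i" for i
      by (simp_all add: nrm_def tng_def algebra_simps)
    have t1: "tng ?X t 1 = 0" "tng ?X t 2 = 0" unfolding x fr[OF zero_less_one] T[OF t] by simp_all
    have n1: "nrm ?X t 1 = ?d * cos t"
      unfolding x fr[OF zero_less_one] q using shear[OF t] sin_cos_squared_add[of t] by (simp only: div_by_1 mult_1_left) algebra
    have n2: "nrm ?X t 2 = ?d * sin t"
      unfolding x fr[OF zero_less_one] q using shear[OF t] sin_cos_squared_add[of t] by (simp only: div_by_1 mult_1_left) algebra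
    have "?X \<bullet> ?X = ?d\<^sup>2"
      unfolding inner_frame[of _ _ t] t1 n1 n2 using sin_cos_squared_add[of t] by algebra
    then have "(norm ?X)\<^sup>2 = ?d\<^sup>2" by (simp add: power2_norm_eq_inner)
    then have "norm ?X = \<bar>?d\<bar>" by (metis norm_ge_zero real_sqrt_abs real_sqrt_unique)
    then show ?thesis using near[of t] by simp
  qed
  show ?thesis using that[OF V _ frame1 frame2, of u] pol by simp
qed

end

section \<open>Airy stresses under localisation and dilation\<close>

lemma airy_cong_open:
  assumes "open U" "x \<in> U" "\<And>y. y \<in> U \<Longrightarrow> f y = g y"
  shows "airy f x = airy g x"
proof -
  have 1: "partial_deriv i f y = partial_deriv i g y" if "y \<in> U" for i y
    by (rule partial_deriv_cong[OF assms(1) that assms(3)])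
  have "partial_deriv j (partial_deriv i f) x = partial_deriv j (partial_deriv i g) x" for i j
    by (rule partial_deriv_cong[OF assms(1,2) 1])
  then show ?thesis unfolding airy_def by simp
qed

lemma airy_diff:
  assumes U: "open U" "x \<in> U" and f: "smooth_on U f" and g: "smooth_on U g"
  shows "airy (\<lambda>x. f x - g x) x = airy f x - airy g x"
proof -
  have 1: "partial_deriv i (\<lambda>x. f x - g x) y = partial_deriv i f y - partial_deriv i g y" if "y \<in> U" for i y
    by (rule partial_deriv_diff[OF smooth_on_differentiable[OF f that] smooth_on_differentiable[OF g that]])
  have 2: "partial_deriv j (partial_deriv i (\<lambda>x. f x - g x)) x = partial_deriv j (partial_deriv i f) x - partial_deriv j (partial_deriv i g) x" for i j
    by (rule trans[OF partial_deriv_cong[OF U 1]]) ((assumption | rule partial_deriv_diff[OF smooth_on_differentiable[OF smooth_on_partial_deriv[OF f] U(2)] smooth_on_differentiable[OF smooth_on_partial_deriv[OF g] U(2)]])+)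
  show ?thesis unfolding airy_eq 2 by (simp add: algebra_simps)
qed

lemma partial_deriv_dilate:
  fixes f :: "real^2 \<Rightarrow> real"
  assumes c: "c > 0" and f: "f differentiable (at ((1/c) *\<^sub>R x))"
  shows "partial_deriv i (\<lambda>x. c * f ((1/c) *\<^sub>R x)) x = partial_deriv i f ((1/c) *\<^sub>R x)"
  using partial_deriv_cmult[OF partial_deriv_scale(2)[OF f], of i c] partial_deriv_scale(1)[OF f, of i] c by simp

text \<open>The dilation that preserves gradients divides the stress by c. In the plane a quadratic
  energy of the stress is then independent of the scale, which is why every annulus can carry the
  same test field.\<close>

lemma airy_dilate:
  assumes c: "c > 0" and U: "open U" and f: "smooth_on U f" and x: "x \<in> V" "open V" "\<And>y. y \<in> V \<Longrightarrow> (1/c) *\<^sub>R y \<in> U"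
  shows "airy (\<lambda>x. c * f ((1/c) *\<^sub>R x)) x = (1/c) *\<^sub>R airy f ((1/c) *\<^sub>R x)"
proof -
  have 1: "partial_deriv i (\<lambda>x. c * f ((1/c) *\<^sub>R x)) y = partial_deriv i f ((1/c) *\<^sub>R y)" if "y \<in> V" for i y
    by (rule partial_deriv_dilate[OF c smooth_on_differentiable[OF f x(3)[OF that]]])
  have 2: "partial_deriv j (partial_deriv i (\<lambda>x. c * f ((1/c) *\<^sub>R x))) x = (1/c) * partial_deriv j (partial_deriv i f) ((1/c) *\<^sub>R x)" for i j
    by (rule trans[OF partial_deriv_cong[OF x(2,1) 1]]) ((assumption | rule partial_deriv_scale(1)[OF smooth_on_differentiable[OF smooth_on_partial_deriv[OF f] x(3)[OF x(1)]]])+)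
  show ?thesis unfolding airy_eq 2 by (simp add: algebra_simps)
qed

lemma airy_symmetric: "transpose (airy \<Phi> x) = airy \<Phi> x"
  by (simp add: vec_eq_iff forall_2 transpose_def airy_def)

lemma nn_integral_inverse:
  assumes "0 < a" "a \<le> b"
  shows "(\<integral>\<^sup>+r. ennreal (1/r) * indicator {a..b} r \<partial>lborel) = ennreal (ln b - ln a)"
proof (rule nn_integral_has_integral_lebesgue')
  show "((\<lambda>r. 1/r) has_integral (ln b - ln a)) {a..b}"
    by (rule fundamental_theorem_of_calculus[OF assms(2)])
      (use assms in \<open>auto intro!: derivative_eq_intros simp: has_real_derivative_iff_has_vector_derivative[symmetric]\<close>)
qed (use assms in auto)

lemma nn_integral_circ:
  assumes "continuous_on {0..2*pi} f" "\<And>t. 0 \<le> f t"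
  shows "(\<integral>\<^sup>+t. indicator {0..<2*pi} t * ennreal (f t) \<partial>lborel) = ennreal (circ f)"
proof -
  have "(\<integral>\<^sup>+t. indicator {0..<2*pi} t * ennreal (f t) \<partial>lborel) = (\<integral>\<^sup>+t. ennreal (indicator {0..<2*pi} t * f t) \<partial>lborel)"
    by (intro nn_integral_cong) (auto simp: indicator_def)
  also have "\<dots> = ennreal (LINT t|lborel. indicator {0..<2*pi} t * f t)"
    by (rule nn_integral_eq_integral[OF circ_lborel(1)[OF assms(1)]]) (use assms(2) in auto)
  finally show ?thesis unfolding circ_lborel(2)[OF assms(1)] .
qed

section \<open>The dual energy and the test field\<close>

context cell_setting
begin

text \<open>
  The inverse of \<open>C\<close> on symmetric matrices, which exists by coercivity.
\<close>

definition dual :: "real^2^2 \<Rightarrow> real^2^2" where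
  "dual = (SOME D. linear D \<and> (\<forall>\<sigma>. transpose \<sigma> = \<sigma> \<longrightarrow> C (D \<sigma>) = \<sigma>))"

text \<open>Adding the skew part to C makes it injective on all matrices, hence invertible. A
  symmetric image forces a symmetric preimage, on which the added term is 0.\<close>

lemma dual: "linear dual" "transpose \<sigma> = \<sigma> \<Longrightarrow> C (dual \<sigma>) = \<sigma>"
proof -
  define E where "E F = C F + (F - sym_part F)" for F
  have sp: "sym_part F $1$1 = F$1$1" "sym_part F $2$2 = F$2$2" "sym_part F $1$2 = (F$1$2 + F$2$1)/2" "sym_part F $2$1 = (F$1$2 + F$2$1)/2" for F
    by (simp_all add: sym_part_def transpose_def field_simps)
  have lE: "linear E"
  proof (rule linearI)
    show "E (a + b) = E a + E b" for a b
      by (simp add: vec_eq_iff forall_2 E_def sp linear_add[OF C_linear] field_simps)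
    show "E (c *\<^sub>R a) = c *\<^sub>R E a" for c a
      by (simp add: vec_eq_iff forall_2 E_def sp linear_cmul[OF C_linear] field_simps)
  qed
  have key: "C F = \<sigma> \<and> F = sym_part F" if "E F = \<sigma>" "\<sigma>$1$2 = \<sigma>$2$1" for F \<sigma>
  proof -
    have "E F $1$2 = E F $2$1" using that by simp
    then have "F$1$2 = F$2$1" using C_symmetric[of F] by (simp add: E_def sp field_simps)
    then have "F = sym_part F" by (simp add: vec_eq_iff forall_2 sp)
    then show ?thesis using that(1) by (simp add: E_def)
  qed
  have "inj E"
    unfolding linear_injective_0[OF lE]
  proof (intro allI impI)
    fix F assume "E F = 0"
    then have F: "C F = 0" "F = sym_part F" using key[of F 0] by simp_all
    have "\<nu>\<^sub>1 * (norm (sym_part F))\<^sup>2 \<le> 0" using C_coercive[of F] F(1) by simp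
    then have "sym_part F = 0" using \<nu>(1) by (simp add: mult_le_0_iff)
    then show "F = 0" using F(2) by simp
  qed
  then obtain D where D: "linear D" "\<And>x. E (D x) = x" using linear_injective_isomorphism[OF lE] by blast
  have "C (D \<sigma>) = \<sigma>" if "transpose \<sigma> = \<sigma>" for \<sigma>
  proof -
    have "transpose \<sigma> $1$2 = \<sigma>$1$2" using that by simp
    then show ?thesis using key[OF D(2)] by (simp add: transpose_def)
  qed
  then have "\<exists>D. linear D \<and> (\<forall>\<sigma>. transpose \<sigma> = \<sigma> \<longrightarrow> C (D \<sigma>) = \<sigma>)" using D(1) by blast
  from someI_ex[OF this] show "linear dual" "transpose \<sigma> = \<sigma> \<Longrightarrow> C (dual \<sigma>) = \<sigma>"
    unfolding dual_def by blast+
qed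

lemma dual_nonneg: assumes "transpose \<sigma> = \<sigma>" shows "0 \<le> \<sigma> \<bullet> dual \<sigma>"
  using C_nonneg[of "dual \<sigma>"] unfolding dual(2)[OF assms] .

text \<open>Nonnegativity of the energy of F minus m times \<open>dual \<sigma>\<close>, expanded
  with \<open>C (dual \<sigma>) = \<sigma>\<close>.\<close>

lemma dual_young:
  assumes s: "transpose \<sigma> = \<sigma>"
  shows "m * (\<sigma> \<bullet> F) \<le> 1/2 * (C F \<bullet> F) + m\<^sup>2 / 2 * (\<sigma> \<bullet> dual \<sigma>)"
proof -
  let ?G = "m *\<^sub>R dual \<sigma>"
  have CG: "C ?G = m *\<^sub>R \<sigma>" by (simp add: linear_cmul[OF C_linear] dual(2)[OF s])
  have "0 \<le> C (F - ?G) \<bullet> (F - ?G)" by (rule C_nonneg)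
  also have "\<dots> = C F \<bullet> F - 2 * m * (\<sigma> \<bullet> F) + m\<^sup>2 * (\<sigma> \<bullet> dual \<sigma>)"
  proof -
    have "C F \<bullet> dual \<sigma> = \<sigma> \<bullet> F" using C_adjoint[of F "dual \<sigma>"] dual(2)[OF s] by (simp add: inner_commute)
    then show ?thesis
      by (simp add: linear_diff[OF C_linear] CG inner_diff_left inner_diff_right power2_eq_square algebra_simps)
  qed
  finally show ?thesis by simp
qed

lemma dual_bound: obtains B where "B > 0" "\<And>\<sigma>. \<sigma> \<bullet> dual \<sigma> \<le> B * (norm \<sigma>)\<^sup>2"
proof -
  obtain B where B: "B > 0" "\<And>\<sigma>. norm (dual \<sigma>) \<le> B * norm \<sigma>" using linear_bounded_pos[OF dual(1)] by blast
  have "\<sigma> \<bullet> dual \<sigma> \<le> B * (norm \<sigma>)\<^sup>2" for \<sigma>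
  proof -
    have "\<sigma> \<bullet> dual \<sigma> \<le> norm \<sigma> * norm (dual \<sigma>)" by (rule norm_cauchy_schwarz)
    also have "\<dots> \<le> norm \<sigma> * (B * norm \<sigma>)" by (rule mult_left_mono[OF B(2)]) simp
    finally show ?thesis by (simp add: power2_eq_square mult_ac)
  qed
  then show ?thesis using that B(1) by blast
qed

text \<open>\<open>dual (C e)\<close> need not be e, because C ignores skew parts. Only its pairings
  with symmetric matrices occur, and for these the two may be exchanged by adjointness.\<close>

lemma dual_perturb:
  assumes X: "transpose X = X"
  shows "(C e + X) \<bullet> dual (C e + X) = C e \<bullet> e + 2 * (X \<bullet> e) + X \<bullet> dual X"
proof -
  let ?G = "dual (C e)"
  have tC: "transpose (C e) = C e" using C unfolding elasticity_tensor_def by blast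
  have G: "C ?G = C e" by (rule dual(2)[OF tC])
  have DX: "C (dual X) = X" by (rule dual(2)[OF X])
  have 1: "C e \<bullet> ?G = C e \<bullet> e" using C_adjoint[of e ?G] G by (simp add: inner_commute)
  have 2: "C e \<bullet> dual X = X \<bullet> e" using C_adjoint[of e "dual X"] DX by (simp add: inner_commute)
  have 3: "X \<bullet> ?G = X \<bullet> e"
    using C_adjoint[of "dual X" ?G] C_adjoint[of "dual X" e] G DX by simp
  show ?thesis by (simp add: linear_add[OF dual(1)] inner_add_left inner_add_right 1 2 3)
qed

lemma energy_near:
  assumes e: "\<epsilon> > 0"
  obtains \<epsilon>' where "\<epsilon>' > 0" "\<And>\<sigma>. \<lbrakk>\<And>t. continuous_on {0..2*pi} \<sigma>; \<And>t. transpose (\<sigma> t) = \<sigma> t;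
      \<And>t. t \<in> {0..2*pi} \<Longrightarrow> norm (\<sigma> t - C (\<eta> \<xi> (polar 1 t))) \<le> \<epsilon>'\<rbrakk> \<Longrightarrow> circ (\<lambda>t. \<sigma> t \<bullet> dual (\<sigma> t)) \<le> 2 * \<psi> \<xi> + \<epsilon>"
proof -
  obtain B where B: "B > 0" "\<And>\<sigma>. \<sigma> \<bullet> dual \<sigma> \<le> B * (norm \<sigma>)\<^sup>2" using dual_bound by blast
  obtain K where K: "K > 0" "\<And>\<xi> x. x \<noteq> 0 \<Longrightarrow> norm (\<eta> \<xi> x) \<le> K * norm \<xi> / norm x" using eta_bound by blast
  \<comment> \<open>L bounds the change of the dual energy per unit of perturbation: the cross term
    gives twice the bound on \<eta>, and the quadratic term counts as linear because
    \<open>\<epsilon>' \<le> 1\<close>. An error of \<epsilon>/(2 pi) at each angle integrates to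
    \<epsilon>.\<close>
  define L where "L = 2 * (K * norm \<xi>) + B"
  have L: "L > 0" using K(1) B(1) by (simp add: L_def add_nonneg_pos)
  define \<epsilon>' where "\<epsilon>' = min 1 (\<epsilon> / (2*pi*L))"
  have e': "\<epsilon>' > 0" "\<epsilon>' \<le> 1" "L * \<epsilon>' \<le> \<epsilon> / (2*pi)" 
    using e L by (auto simp: \<epsilon>'_def min_def field_simps)
  have tC: "transpose (C F) = C F" for F using C unfolding elasticity_tensor_def by blast
  have "circ (\<lambda>t. \<sigma> t \<bullet> dual (\<sigma> t)) \<le> 2 * \<psi> \<xi> + \<epsilon>"
    if s: "continuous_on {0..2*pi} \<sigma>" "\<And>t. transpose (\<sigma> t) = \<sigma> t"
      "\<And>t. t \<in> {0..2*pi} \<Longrightarrow> norm (\<sigma> t - C (\<eta> \<xi> (polar 1 t))) \<le> \<epsilon>'" for \<sigma>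
  proof -
    let ?e = "\<lambda>t. \<eta> \<xi> (polar 1 t)"
    have dc: "continuous_on {0..2*pi} (\<lambda>t. dual (\<sigma> t))" using linear_continuous_on_compose[OF s(1) dual(1)] .
    have "circ (\<lambda>t. \<sigma> t \<bullet> dual (\<sigma> t)) \<le> circ (\<lambda>t. C (?e t) \<bullet> ?e t + \<epsilon> / (2*pi))"
    proof (rule circ_mono)
      show "continuous_on {0..2*pi} (\<lambda>t. \<sigma> t \<bullet> dual (\<sigma> t))" by (intro continuous_on_inner s(1) dc)
      show "continuous_on {0..2*pi} (\<lambda>t. C (?e t) \<bullet> ?e t + \<epsilon> / (2*pi))" by (intro continuous_on_add energy_continuous continuous_on_const)
      fix t assume t: "t \<in> {0..2*pi}"
      define X where "X = \<sigma> t - C (?e t)"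
      have X: "norm X \<le> \<epsilon>'" unfolding X_def by (rule s(3)[OF t])
      have tX: "transpose X = X"
      proof -
        have "transpose X = transpose (\<sigma> t) - transpose (C (?e t))" by (simp add: X_def transpose_def vec_eq_iff)
        then show ?thesis unfolding s(2) tC X_def .
      qed
      have ke: "norm (?e t) \<le> K * norm \<xi>" using K(2)[of "polar 1 t" \<xi>] polar_nonzero[of 1 t] by simp
      have "\<sigma> t = C (?e t) + X" by (simp add: X_def)
      then have "\<sigma> t \<bullet> dual (\<sigma> t) = C (?e t) \<bullet> ?e t + 2 * (X \<bullet> ?e t) + X \<bullet> dual X" using dual_perturb[OF tX] by simp
      also have "X \<bullet> ?e t \<le> \<epsilon>' * (K * norm \<xi>)"
        by (rule order_trans[OF norm_cauchy_schwarz mult_mono[OF X ke]]) (use e' in simp_all)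
      also have "X \<bullet> dual X \<le> B * \<epsilon>'"
      proof -
        have "(norm X)\<^sup>2 \<le> \<epsilon>'\<^sup>2" by (rule power_mono[OF X]) simp
        also have "\<dots> \<le> \<epsilon>'" using e' by (simp add: power2_eq_square mult_left_le_one_le)
        finally show ?thesis using B by (meson mult_left_mono less_imp_le order_trans)
      qed
      also have "C (?e t) \<bullet> ?e t + 2 * (\<epsilon>' * (K * norm \<xi>)) + B * \<epsilon>' = C (?e t) \<bullet> ?e t + L * \<epsilon>'" by (simp add: L_def algebra_simps)
      also have "\<dots> \<le> C (?e t) \<bullet> ?e t + \<epsilon> / (2*pi)" using e'(3) by simp
      finally show "\<sigma> t \<bullet> dual (\<sigma> t) \<le> C (?e t) \<bullet> ?e t + \<epsilon> / (2*pi)" by simp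
    qed
    also have "\<dots> = 2 * \<psi> \<xi> + \<epsilon>"
      unfolding circ_linear(1)[OF energy_continuous continuous_on_const] circ_const \<psi>_def by simp
    finally show ?thesis .
  qed
  then show ?thesis using that[OF e'(1)] by blast
qed


text \<open>
  The potential is affine near the origin, with a slope of size \<open>ln \<delta>\<close>, and equals the homogeneous-logarithmic
  potential between radius \<open>\<delta>\<close> and \<open>1/2\<close>; the two transition layers cost only the bounded energy \<open>\<kappa>\<close>.
\<close>

lemma lower_test_field:
  assumes \<epsilon>: "\<epsilon> > 0"
  shows "\<exists>T \<kappa>. T \<bullet> \<xi> = 2 * \<psi> \<xi> \<and> 0 \<le> \<kappa> \<and> (\<forall>\<delta>\<in>{0<..<1/2}. \<exists>\<Phi>\<in>supported 1.
     (\<forall>x. norm x < \<delta>/2 \<longrightarrow> partial_deriv 1 \<Phi> x = ln \<delta> * T$2 \<and> partial_deriv 2 \<Phi> x = - ln \<delta> * T$1 \<and> airy \<Phi> x = 0) \<and>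
     (\<integral>\<^sup>+x. ennreal (airy \<Phi> x \<bullet> dual (airy \<Phi> x)) \<partial>lborel) \<le> ennreal (ln (1/\<delta>) * (2 * \<psi> \<xi> + \<epsilon>) + \<kappa>))"
proof -
  obtain \<epsilon>' where \<epsilon>': "\<epsilon>' > 0" "\<And>\<sigma>. \<lbrakk>\<And>t. continuous_on {0..2*pi} \<sigma>; \<And>t. transpose (\<sigma> t) = \<sigma> t;
      \<And>t. t \<in> {0..2*pi} \<Longrightarrow> norm (\<sigma> t - C (\<eta> \<xi> (polar 1 t))) \<le> \<epsilon>'\<rbrakk> \<Longrightarrow> circ (\<lambda>t. \<sigma> t \<bullet> dual (\<sigma> t)) \<le> 2 * \<psi> \<xi> + \<epsilon>"
    by (rule energy_near[OF \<epsilon>]) blast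
  obtain T where T: "\<And>t i. t \<in> {0..2*pi} \<Longrightarrow> tng (C (\<eta> \<xi> (polar 1 t))) t i = T $ i" and T\<xi>: "2 * \<psi> \<xi> = T \<bullet> \<xi>"
    by (rule traction) blast
  obtain V u where V: "smooth_on (- {0}) V"
    and pol: "\<And>r t. r > 0 \<Longrightarrow> V (polar r t) = r * u t + r * ln r * (T$2 * cos t - T$1 * sin t)"
    and hom: "\<And>r t. r > 0 \<Longrightarrow> airy V (polar r t) = (1/r) *\<^sub>R airy V (polar 1 t)"
    and near: "\<And>t. t \<in> {0..2*pi} \<Longrightarrow> norm (airy V (polar 1 t) - C (\<eta> \<xi> (polar 1 t))) \<le> \<epsilon>'"
    by (rule test_potential[OF \<epsilon>'(1) T]) ((assumption | (rule that; assumption))+)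
  define \<l> where "\<l> x = T$2 * x$1 - T$1 * x$2" for x :: "real^2"
  have o: "open (- {0::real^2})" by (rule open_punctured)
  have lsm: "smooth_on U \<l>" if "open U" for U
    unfolding \<l>_def by (intro smooth_on_diff[OF that] smooth_on_mult[OF that] smooth_on_const[OF that] smooth_on_nth[OF that])
  \<comment> \<open>Only the logarithmic term fails to be homogeneous, and its defect under dilation
    is a multiple of the linear function \<open>\<l>\<close>.\<close>
  have Vs: "V ((1/s) *\<^sub>R x) = (1/s) * (V x - ln s * \<l> x)" if s: "s > 0" and x0: "x \<noteq> 0" for s x
  proof -
    obtain r t where t: "r > 0" "x = polar r t" by (rule polar_form[OF x0])
    have "(1/s) *\<^sub>R x = polar (r/s) t" unfolding t(2) by (simp add: vec_eq_iff forall_2)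
    then have "V ((1/s) *\<^sub>R x) = (r/s) * u t + (r/s) * (ln r - ln s) * (T$2 * cos t - T$1 * sin t)"
      using pol[of "r/s" t] s t(1) by (simp add: ln_div)
    also have "\<dots> = (1/s) * (V x - ln s * \<l> x)"
      unfolding t(2) pol[OF t(1)] by (simp add: \<l>_def algebra_simps diff_divide_distrib add_divide_distrib)
    finally show ?thesis .
  qed
  have axis_l: "airy \<l> x = 0" for x
  proof -
    have d: "(\<l> has_derivative \<l>) (at y)" for y
      unfolding \<l>_def by (auto intro!: derivative_eq_intros bounded_linear_imp_has_derivative[OF bounded_linear_vec_nth])
    have p: "partial_deriv i \<l> = (\<lambda>y. \<l> (axis i 1))" for i using partial_deriv_eqI[OF d] by blast
    have "partial_deriv j (partial_deriv i \<l>) x = 0" for i j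
      unfolding p using partial_deriv_eqI[OF has_derivative_const] by blast
    then show ?thesis by (simp add: airy_eq)
  qed
  have dl: "partial_deriv 1 \<l> x = T$2" "partial_deriv 2 \<l> x = - T$1" "\<l> differentiable (at x)" for x
  proof -
    have d: "(\<l> has_derivative \<l>) (at x)"
      unfolding \<l>_def by (auto intro!: derivative_eq_intros bounded_linear_imp_has_derivative[OF bounded_linear_vec_nth])
    show "partial_deriv 1 \<l> x = T$2" "partial_deriv 2 \<l> x = - T$1"
      using partial_deriv_eqI[OF d] by (simp_all add: \<l>_def axis_def)
    show "\<l> differentiable (at x)" using d differentiableI by blast
  qed
  \<comment> \<open>V is arbitrary at the origin; the value 0 there makes the difference of S and
    its dilate agree with a linear function at the origin as well.\<close>
  define S where "S x = (if x = 0 then 0 else cutoff w (nsq x) * V x)" for x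
  have S: "smooth_on (- {0}) S"
  proof (rule smooth_on_cong[OF o])
    show "smooth_on (- {0}) (\<lambda>x. cutoff w (nsq x) * V x)"
      by (intro smooth_on_mult[OF o] smooth_on_cutoff[OF w o] smooth_on_nsq[OF o] V)
  qed (simp add: S_def)
  have cut0: "cutoff w t = 0" if "t \<ge> 1" for t
  proof -
    obtain \<tau> where \<tau>: "\<tau> < 1" "\<And>t. \<tau> \<le> t \<Longrightarrow> w t = 0" using horizon_profile_vanish[OF w] by blast
    then show ?thesis using that by (simp add: cutoff_def)
  qed
  have S0: "S x = 0" if "norm x \<ge> 1" for x
  proof -
    have "nsq x \<ge> 1" using that by (simp add: nsq_norm)
    then show ?thesis by (simp add: S_def cut0)
  qed
  \<comment> \<open>The square of 2/3 is below 1/2, so the cutoff is still 1 there. The room beyond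
    radius 1/2 gives open neighbourhoods in which derivatives of S and V can be compared.\<close>
  have SV: "S x = V x" if "norm x < 2/3" "x \<noteq> 0" for x
  proof -
    have "(norm x)\<^sup>2 \<le> (2/3)\<^sup>2" using that(1) by (intro power_mono) auto
    then have "nsq x \<le> 1/2" by (simp add: nsq_norm power2_eq_square)
    then show ?thesis using cutoff_simps(1)[OF w, of "nsq x"] that(2) by (simp add: S_def)
  qed
  have aS0: "airy S x = 0" if "norm x > 1" for x
  proof -
    have "airy S x = airy (\<lambda>x. 0) x"
      by (rule airy_cong_open[of "- cball 0 1"]) (use that S0 in \<open>auto simp: open_Compl\<close>)
    also have "\<dots> = 0"
    proof -
      have p: "partial_deriv i (\<lambda>x::real^2. 0::real) = (\<lambda>x. 0)" for i
        using partial_deriv_eqI[OF has_derivative_const] by blast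
      show ?thesis by (simp add: airy_eq p)
    qed
    finally show ?thesis .
  qed
  have aSV: "airy S x = airy V x" if "norm x < 2/3" "x \<noteq> 0" for x
    by (rule airy_cong_open[of "ball 0 (2/3) \<inter> - {0}"]) (use that SV o in \<open>auto intro: open_Int\<close>)
  have asc: "continuous_on (- {0}) (airy f)" if "smooth_on (- {0}) f" for f
    unfolding airy_eq[abs_def]
    by (intro continuous_intros smooth_on_continuous_on smooth_on_partial_deriv that)
  \<comment> \<open>Homogeneity covers the inner disc, compactness the annulus from 1/2 to 1, and
    outside the stress is 0.\<close>
  obtain K where K: "K > 0" "\<And>x. x \<noteq> 0 \<Longrightarrow> norm (airy S x) \<le> K / norm x"
  proof -
    have c1: "compact ((airy V) ` sphere 0 1)"
      by (intro compact_continuous_image continuous_on_subset[OF asc[OF V]]) auto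
    obtain K1 where K1: "K1 > 0" "\<And>x. x \<in> sphere 0 1 \<Longrightarrow> norm (airy V x) \<le> K1"
      using compact_imp_bounded[OF c1] unfolding bounded_pos by (metis image_eqI)
    have c2: "compact ((airy S) ` (cball 0 1 - ball 0 (1/2)))"
      by (intro compact_continuous_image continuous_on_subset[OF asc[OF S]] compact_diff) auto
    obtain K2 where K2: "K2 > 0" "\<And>x. x \<in> cball 0 1 - ball 0 (1/2) \<Longrightarrow> norm (airy S x) \<le> K2"
      using compact_imp_bounded[OF c2] unfolding bounded_pos by (metis image_eqI)
    have "norm (airy S x) \<le> (K1 + K2) / norm x" if x: "x \<noteq> 0" for x
    proof -
      have n: "norm x > 0" using x by simp
      consider "norm x < 1/2" | "norm x \<in> {1/2..1}" | "norm x > 1" by fastforce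
      then show ?thesis
      proof cases
        case 1
        obtain r t where t: "r > 0" "x = polar r t" "norm x = r" by (rule polar_form[OF x])
        have "norm (airy S x) = norm (airy V (polar 1 t)) / norm x"
          using aSV[OF _ x] 1 hom[OF t(1), of t] t by simp
        also have "\<dots> \<le> K1 / norm x" using K1(2)[of "polar 1 t"] n by (intro divide_right_mono) auto
        also have "\<dots> \<le> (K1 + K2) / norm x" using K2(1) n by (intro divide_right_mono) auto
        finally show ?thesis .
      next
        case 2
        have "norm (airy S x) \<le> K2" using 2 by (intro K2(2)) auto
        also have "\<dots> \<le> (K1 + K2) / norm x"
        proof -
          have "K2 * norm x \<le> K2 * 1" using 2 K2(1) by (intro mult_left_mono) auto
          then show ?thesis using K1(1) n by (simp add: field_simps)
        qed
        finally show ?thesis .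
      next
        case 3
        then show ?thesis using aS0[of x] K1(1) K2(1) n by simp
      qed
    qed
    then show thesis using that[of "K1 + K2"] K1(1) K2(1) by auto
  qed
  obtain B where B: "B > 0" "\<And>\<sigma>. \<sigma> \<bullet> dual \<sigma> \<le> B * (norm \<sigma>)\<^sup>2" using dual_bound by blast
  \<comment> \<open>Bounds the dual energy density times the squared radius, with
    \<open>2 * K\<close> for the two terms S and its dilate. Each transition layer has ratio of
    radii 2, so it costs at most \<open>ln 2 * (2*pi*k)\<close>.\<close>
  define k where "k = B * (2 * K)\<^sup>2"
  have k: "k > 0" using B(1) K(1) by (simp add: k_def)
  define E where "E = circ (\<lambda>t. airy V (polar 1 t) \<bullet> dual (airy V (polar 1 t)))"
  have pc: "continuous_on {0..2*pi} (\<lambda>t. polar 1 t)" unfolding polar_def vector2_eq by (intro continuous_intros)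
  have aVc: "continuous_on {0..2*pi} (\<lambda>t. airy V (polar 1 t))"
    by (rule continuous_on_compose2[OF asc[OF V] pc]) (use polar_nonzero[of 1] in auto)
  have E: "E \<le> 2 * \<psi> \<xi> + \<epsilon>" unfolding E_def by (rule \<epsilon>'(2)[OF aVc airy_symmetric near])
  have Ec: "continuous_on {0..2*pi} (\<lambda>t. airy V (polar 1 t) \<bullet> dual (airy V (polar 1 t)))"
    by (intro continuous_on_inner aVc linear_continuous_on_compose[OF aVc dual(1)])
  have En: "0 \<le> airy V (polar 1 t) \<bullet> dual (airy V (polar 1 t))" for t by (rule dual_nonneg[OF airy_symmetric])
  have E0: "0 \<le> E" unfolding E_def using circ_mono[OF continuous_on_const Ec, of 0] En circ_const[of 0] by simp
  have test: "\<exists>\<Phi>\<in>supported 1.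
     (\<forall>x. norm x < \<delta>/2 \<longrightarrow> partial_deriv 1 \<Phi> x = ln \<delta> * T$2 \<and> partial_deriv 2 \<Phi> x = - ln \<delta> * T$1 \<and> airy \<Phi> x = 0) \<and>
     (\<integral>\<^sup>+x. ennreal (airy \<Phi> x \<bullet> dual (airy \<Phi> x)) \<partial>lborel) \<le> ennreal (ln (1/\<delta>) * (2 * \<psi> \<xi> + \<epsilon>) + 2 * (ln 2 * (2*pi*k)))"
    if \<delta>: "\<delta> \<in> {0<..<1/2}" for \<delta>
  proof -
    have d0: "\<delta> > 0" "\<delta> < 1/2" using \<delta> by auto
    define S\<delta> where "S\<delta> x = \<delta> * S ((1/\<delta>) *\<^sub>R x)" for x
    \<comment> \<open>Near the origin the two singular terms cancel up to \<open>ln \<delta>\<close>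
      times the linear function; beyond radius \<delta> the dilate is 0 and S alone remains.\<close>
    define \<Phi> where "\<Phi> x = S x - S\<delta> x" for x
    have dil: "(1/\<delta>) *\<^sub>R y \<in> - {0}" if "y \<in> - {0}" for y :: "real^2" using that d0 by simp
    have Sds: "smooth_on (- {0}) S\<delta>"
    proof -
      have e: "S\<delta> x = cutoff w ((1/\<delta>)\<^sup>2 * nsq x) * (V x - ln \<delta> * \<l> x)" if "x \<in> - {0}" for x
        using Vs[of \<delta> x] that d0 by (simp add: S\<delta>_def S_def nsq_def power_mult_distrib distrib_left power_divide)
      show ?thesis
      proof (rule smooth_on_cong[OF o])
        show "smooth_on (- {0}) (\<lambda>x. cutoff w ((1/\<delta>)\<^sup>2 * nsq x) * (V x - ln \<delta> * \<l> x))"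
          by (intro smooth_on_mult[OF o] smooth_on_diff[OF o] smooth_on_cutoff[OF w o] smooth_on_nsq[OF o] smooth_on_const[OF o] V lsm[OF o])
        show "cutoff w ((1/\<delta>)\<^sup>2 * nsq x) * (V x - ln \<delta> * \<l> x) = S\<delta> x" if "x \<in> - {0}" for x
          using e[OF that] by simp
      qed
    qed
    have \<Phi>0: "\<Phi> x = ln \<delta> * \<l> x" if "norm x < 2*\<delta>/3" for x
    proof (cases "x = 0")
      case True
      then show ?thesis by (simp add: \<Phi>_def S\<delta>_def S_def \<l>_def)
    next
      case False
      have "norm ((1/\<delta>) *\<^sub>R x) < 2/3" using that d0 by (simp add: field_simps)
      then have "S\<delta> x = \<delta> * V ((1/\<delta>) *\<^sub>R x)" using SV[of "(1/\<delta>) *\<^sub>R x"] False d0 by (simp add: S\<delta>_def)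
      also have "\<dots> = V x - ln \<delta> * \<l> x" using Vs[OF d0(1) False] d0(1) by simp
      finally show ?thesis using SV[OF _ False] that d0 by (simp add: \<Phi>_def)
    qed
    \<comment> \<open>Neither term is smooth at the origin; smoothness there comes from the linear
      form of the difference, and elsewhere from the two terms separately.\<close>
    have sm: "smooth_on UNIV \<Phi>"
    proof -
      have 1: "smooth_on (- {0}) \<Phi>" unfolding \<Phi>_def[abs_def] by (rule smooth_on_diff[OF o S Sds])
      have 2: "smooth_on (ball 0 (2*\<delta>/3)) \<Phi>"
        by (rule smooth_on_cong[OF open_ball, of _ _ "\<lambda>x. ln \<delta> * \<l> x"])
          (use \<Phi>0 in \<open>auto intro!: smooth_on_mult smooth_on_const lsm\<close>)
      have "- {0} \<union> ball (0::real^2) (2*\<delta>/3) = UNIV" using d0 by auto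
      then show ?thesis using smooth_on_Un[OF 1 2] by simp
    qed
    have "S\<delta> x = 0" if "norm x \<ge> \<delta>" for x
      unfolding S\<delta>_def using S0[of "(1/\<delta>) *\<^sub>R x"] that d0 by (simp add: field_simps)
    then have sup: "\<Phi> \<in> supported 1"
      using sm S0 d0 by (auto simp: supported_def \<Phi>_def)
    have lin: "partial_deriv 1 \<Phi> x = ln \<delta> * T$2 \<and> partial_deriv 2 \<Phi> x = - ln \<delta> * T$1 \<and> airy \<Phi> x = 0" if x: "norm x < \<delta>/2" for x
    proof -
      have xb: "x \<in> ball 0 (2*\<delta>/3)" using x d0 by simp
      have c: "\<Phi> y = ln \<delta> * \<l> y" if "y \<in> ball 0 (2*\<delta>/3)" for y using \<Phi>0 that by simp
      have "partial_deriv i \<Phi> x = ln \<delta> * partial_deriv i \<l> x" for i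
      proof -
        have "partial_deriv i \<Phi> x = partial_deriv i (\<lambda>y. ln \<delta> * \<l> y) x" by (rule partial_deriv_cong[OF open_ball xb c])
        also have "\<dots> = ln \<delta> * partial_deriv i \<l> x" by (rule partial_deriv_cmult[OF dl(3)])
        finally show ?thesis .
      qed
      moreover have "airy \<Phi> x = 0"
      proof -
        have p: "partial_deriv i (\<lambda>y. ln \<delta> * \<l> y) = (\<lambda>y. ln \<delta> * partial_deriv i \<l> y)" for i
          by (rule ext) (rule partial_deriv_cmult[OF dl(3)])
        have q: "partial_deriv j (\<lambda>y. ln \<delta> * partial_deriv i \<l> y) x = ln \<delta> * partial_deriv j (partial_deriv i \<l>) x" for i j
          by (rule partial_deriv_cmult[OF smooth_on_differentiable[OF smooth_on_partial_deriv[OF lsm[OF open_UNIV]] UNIV_I]])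
        have "airy \<Phi> x = airy (\<lambda>y. ln \<delta> * \<l> y) x" by (rule airy_cong_open[OF open_ball xb c])
        also have "\<dots> = ln \<delta> *\<^sub>R airy \<l> x" unfolding airy_eq p q by (simp add: algebra_simps)
        finally show ?thesis by (simp add: axis_l)
      qed
      ultimately show ?thesis by (simp add: dl)
    qed
    have aSd: "airy S\<delta> x = (1/\<delta>) *\<^sub>R airy S ((1/\<delta>) *\<^sub>R x)" if "x \<noteq> 0" for x
      unfolding S\<delta>_def[abs_def] by (rule airy_dilate[OF d0(1) o S _ o dil]) (use that in simp)
    have a\<Phi>: "airy \<Phi> x = airy S x - airy S\<delta> x" if "x \<noteq> 0" for x
      unfolding \<Phi>_def[abs_def] by (rule airy_diff[OF o _ S Sds]) (use that in simp)
    have bd: "norm (airy \<Phi> x) \<le> 2 * K / norm x" if x: "x \<noteq> 0" for x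
    proof -
      have "norm (airy S\<delta> x) = (1/\<delta>) * norm (airy S ((1/\<delta>) *\<^sub>R x))" using aSd[OF x] d0(1) by simp
      also have "\<dots> \<le> (1/\<delta>) * (K / norm ((1/\<delta>) *\<^sub>R x))" using x d0(1) by (intro mult_left_mono K(2)) auto
      also have "\<dots> = K / norm x" using d0(1) by simp
      finally have "norm (airy S x - airy S\<delta> x) \<le> K / norm x + K / norm x"
        using K(2)[OF x] norm_triangle_ineq4[of "airy S x" "airy S\<delta> x"] by linarith
      then show ?thesis unfolding a\<Phi>[OF x] by simp
    qed
    have mid: "airy \<Phi> x = airy V x" if "\<delta> < norm x" "norm x < 2/3" for x
    proof -
      have x0: "x \<noteq> 0" using that d0 by auto
      have "norm ((1/\<delta>) *\<^sub>R x) > 1" using that d0 by (simp add: field_simps)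
      then have "airy S\<delta> x = 0" unfolding aSd[OF x0] by (simp add: aS0)
      then show ?thesis unfolding a\<Phi>[OF x0] using aSV[OF that(2) x0] by simp
    qed
    have out: "airy \<Phi> x = 0" if "norm x > 1" for x
    proof -
      have x0: "x \<noteq> 0" using that by auto
      have "norm ((1/\<delta>) *\<^sub>R x) > 1" using that d0 by (simp add: field_simps)
      then have "airy S\<delta> x = 0" unfolding aSd[OF x0] by (simp add: aS0)
      then show ?thesis unfolding a\<Phi>[OF x0] using aS0[OF that] by simp
    qed
    let ?q = "\<lambda>x. airy \<Phi> x \<bullet> dual (airy \<Phi> x)"
    let ?v = "\<lambda>t. airy V (polar 1 t) \<bullet> dual (airy V (polar 1 t))"
    have qc: "continuous_on UNIV ?q"
      using airy_continuous[OF sup] linear_continuous_on_compose[OF airy_continuous[OF sup] dual(1)]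
      by (intro continuous_on_inner) auto
    \<comment> \<open>The factor r is the polar Jacobian. The sharp density is kept only between
      \<delta> and 1/2, where the stress is that of V; the two layers get the crude constant k, and
      everywhere else the stress is 0.\<close>
    have pt: "ennreal r * ennreal (?q (polar r t)) \<le> ennreal (1/r) * indicator {\<delta>..1/2} r * ennreal (?v t)
        + (ennreal (1/r) * indicator {\<delta>/2..\<delta>} r * ennreal k + ennreal (1/r) * indicator {1/2..1} r * ennreal k)" (is "?L \<le> ?R") if r: "r > 0" for r t
    proof -
      have p0: "polar r t \<noteq> 0" using r by (intro polar_nonzero) simp
      have kb: "r * ?q (polar r t) \<le> (1/r) * k"
      proof -
        have "?q (polar r t) \<le> B * (norm (airy \<Phi> (polar r t)))\<^sup>2" by (rule B(2))
        also have "\<dots> \<le> B * (2 * K / r)\<^sup>2"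
          using bd[OF p0] r B(1) by (intro mult_left_mono power_mono) auto
        also have "\<dots> = k / r\<^sup>2" by (simp add: k_def power_divide)
        finally have "r * ?q (polar r t) \<le> r * (k / r\<^sup>2)" using r by (intro mult_left_mono) auto
        then show ?thesis using r by (simp add: power2_eq_square)
      qed
      have L: "?L = ennreal (r * ?q (polar r t))" using r dual_nonneg[OF airy_symmetric] by (simp add: ennreal_mult)
      have n: "norm (polar r t) = r" using r by simp
      have K': "ennreal (1/r) * ennreal k = ennreal ((1/r) * k)" using r k by (simp add: ennreal_mult[symmetric])
      consider "r < \<delta>/2" | "r \<in> {\<delta>/2..\<delta>}" | "\<delta> < r" "r < 1/2" | "r \<in> {1/2..1}" | "r > 1" by fastforce
      then show ?thesis
      proof cases
        case 1
        then have "airy \<Phi> (polar r t) = 0" using lin[of "polar r t"] n by simp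
        then show ?thesis by simp
      next
        case 2
        then have "?L \<le> ennreal (1/r) * indicator {\<delta>/2..\<delta>} r * ennreal k" unfolding L using kb by (simp add: K' ennreal_leI)
        also have "\<dots> \<le> ?R" by (simp add: add_increasing add_increasing2)
        finally show ?thesis .
      next
        case 3
        then have "airy \<Phi> (polar r t) = (1/r) *\<^sub>R airy V (polar 1 t)" using mid[of "polar r t"] n hom[OF r] by simp
        then have "?q (polar r t) = (1/r) * (1/r) * ?v t" by (simp add: linear_cmul[OF dual(1)])
        then have "r * ?q (polar r t) = (1/r) * ?v t" using r by simp
        then have "?L = ennreal ((1/r) * ?v t)" unfolding L by simp
        also have "\<dots> = ennreal (1/r) * ennreal (?v t)" by (rule ennreal_mult) (use r En in simp_all)
        finally have "?L = ennreal (1/r) * indicator {\<delta>..1/2} r * ennreal (?v t)" using 3 by simp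
        also have "\<dots> \<le> ?R" by (simp add: add_increasing2)
        finally show ?thesis .
      next
        case 4
        then have "?L \<le> ennreal (1/r) * indicator {1/2..1} r * ennreal k" unfolding L using kb by (simp add: K' ennreal_leI)
        also have "\<dots> \<le> ?R" by (simp add: add_increasing add_increasing2)
        finally show ?thesis .
      next
        case 5
        then have "airy \<Phi> (polar r t) = 0" using out[of "polar r t"] n by simp
        then show ?thesis by simp
      qed
    qed
    have vm: "(\<lambda>t. indicator {0..<2*pi} t * ennreal (?v t)) \<in> borel_measurable borel" 
    proof -
      have "continuous_on UNIV (\<lambda>t. airy V (polar 1 t))"
      proof (rule continuous_on_compose2[OF asc[OF V]])
        show "continuous_on UNIV (\<lambda>t. polar 1 t)" unfolding polar_def vector2_eq by (intro continuous_intros)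
      qed (use polar_nonzero[of 1] in auto)
      then have "continuous_on UNIV ?v" using linear_continuous_on_compose[OF _ dual(1)] by (intro continuous_on_inner) auto
      then have "?v \<in> borel_measurable borel" by (rule borel_measurable_continuous_onI)
      then show ?thesis by measurable
    qed
    have i2: "(\<integral>\<^sup>+t. indicator {0..<2*pi} t * c \<partial>lborel) = ennreal (2*pi) * c" for c
      by (subst nn_integral_multc) (auto simp: nn_integral_indicator)
    have "(\<integral>\<^sup>+x. ennreal (?q x) \<partial>lborel) = (\<integral>\<^sup>+r. \<integral>\<^sup>+t. ennreal r * indicator {0<..} r * indicator {0..<2*pi} t * ennreal (?q (polar r t)) \<partial>lborel \<partial>lborel)"
      by (rule nn_integral_polar) (use borel_measurable_continuous_onI[OF qc] in measurable)
    also have "\<dots> \<le> (\<integral>\<^sup>+r. \<integral>\<^sup>+t. ennreal (1/r) * indicator {\<delta>..1/2} r * (indicator {0..<2*pi} t * ennreal (?v t))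
        + ((ennreal (1/r) * indicator {\<delta>/2..\<delta>} r * ennreal k + ennreal (1/r) * indicator {1/2..1} r * ennreal k) * indicator {0..<2*pi} t) \<partial>lborel \<partial>lborel)"
    proof (intro nn_integral_mono)
      fix r t :: real
      show "ennreal r * indicator {0<..} r * indicator {0..<2*pi} t * ennreal (?q (polar r t))
        \<le> ennreal (1/r) * indicator {\<delta>..1/2} r * (indicator {0..<2*pi} t * ennreal (?v t))
        + ((ennreal (1/r) * indicator {\<delta>/2..\<delta>} r * ennreal k + ennreal (1/r) * indicator {1/2..1} r * ennreal k) * indicator {0..<2*pi} t)"
      proof (cases "r > 0 \<and> t \<in> {0..<2*pi}")
        case True
        then show ?thesis using pt[of r t] by simp
      next
        case False
        then show ?thesis by auto
      qed
    qed
    also have "\<dots> = (\<integral>\<^sup>+r. ennreal (1/r) * indicator {\<delta>..1/2} r * ennreal E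
        + (ennreal (1/r) * indicator {\<delta>/2..\<delta>} r * ennreal (2*pi*k) + ennreal (1/r) * indicator {1/2..1} r * ennreal (2*pi*k)) \<partial>lborel)"
    proof (rule nn_integral_cong)
      fix r :: real
      have "(\<integral>\<^sup>+t. ennreal (1/r) * indicator {\<delta>..1/2} r * (indicator {0..<2*pi} t * ennreal (?v t))
        + ((ennreal (1/r) * indicator {\<delta>/2..\<delta>} r * ennreal k + ennreal (1/r) * indicator {1/2..1} r * ennreal k) * indicator {0..<2*pi} t) \<partial>lborel)
        = ennreal (1/r) * indicator {\<delta>..1/2} r * ennreal E + (ennreal (1/r) * indicator {\<delta>/2..\<delta>} r * ennreal k + ennreal (1/r) * indicator {1/2..1} r * ennreal k) * ennreal (2*pi)"
        using vm by (subst nn_integral_add) (auto simp: nn_integral_cmult nn_integral_cmult_indicator nn_integral_circ[OF Ec En] E_def)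
      also have "\<dots> = ennreal (1/r) * indicator {\<delta>..1/2} r * ennreal E
        + (ennreal (1/r) * indicator {\<delta>/2..\<delta>} r * ennreal (2*pi*k) + ennreal (1/r) * indicator {1/2..1} r * ennreal (2*pi*k))"
      proof -
        have kk: "ennreal (2*pi*k) = ennreal k * ennreal (2*pi)"
          using k by (subst ennreal_mult[symmetric]) (auto simp: mult.commute)
        show ?thesis unfolding kk by (simp only: distrib_right mult.assoc)
      qed
      finally show "(\<integral>\<^sup>+t. ennreal (1/r) * indicator {\<delta>..1/2} r * (indicator {0..<2*pi} t * ennreal (?v t))
        + ((ennreal (1/r) * indicator {\<delta>/2..\<delta>} r * ennreal k + ennreal (1/r) * indicator {1/2..1} r * ennreal k) * indicator {0..<2*pi} t) \<partial>lborel)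
        = ennreal (1/r) * indicator {\<delta>..1/2} r * ennreal E
        + (ennreal (1/r) * indicator {\<delta>/2..\<delta>} r * ennreal (2*pi*k) + ennreal (1/r) * indicator {1/2..1} r * ennreal (2*pi*k))" .
    qed
    also have "\<dots> = ennreal (ln (1/2) - ln \<delta>) * ennreal E + (ennreal (ln \<delta> - ln (\<delta>/2)) * ennreal (2*pi*k) + ennreal (ln 1 - ln (1/2)) * ennreal (2*pi*k))"
      using d0 by (subst nn_integral_add nn_integral_multc, measurable)+ (simp add: nn_integral_inverse)
    also have "\<dots> = ennreal ((ln (1/2) - ln \<delta>) * E + ((ln \<delta> - ln (\<delta>/2)) * (2*pi*k) + (ln 1 - ln (1/2)) * (2*pi*k)))"
    proof -
      have "ln \<delta> \<le> ln (1/2)" "ln (\<delta>/2) \<le> ln \<delta>" "ln (1/2) \<le> ln (1::real)"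
        using d0 by (intro ln_mono; simp)+
      then have a: "0 \<le> ln (1/2) - ln \<delta>" and b: "0 \<le> ln \<delta> - ln (\<delta>/2)" and c: "0 \<le> ln 1 - ln (1/2::real)"
        by linarith+
      have k': "0 \<le> 2*pi*k" using k by simp
      show ?thesis
        by (simp only: ennreal_mult[OF a E0] ennreal_mult[OF b k'] ennreal_mult[OF c k']
          ennreal_plus[OF mult_nonneg_nonneg[OF a E0] add_nonneg_nonneg[OF mult_nonneg_nonneg[OF b k'] mult_nonneg_nonneg[OF c k']]]
          ennreal_plus[OF mult_nonneg_nonneg[OF b k'] mult_nonneg_nonneg[OF c k']])
    qed
    also have "\<dots> \<le> ennreal (ln (1/\<delta>) * (2 * \<psi> \<xi> + \<epsilon>) + 2 * (ln 2 * (2*pi*k)))"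
    proof (rule ennreal_leI)
      have 1: "ln (1/2) - ln \<delta> \<le> ln (1/\<delta>)" "ln \<delta> - ln (\<delta>/2) = ln 2" "ln 1 - ln (1/2) = ln (2::real)" "0 \<le> ln (1/\<delta>)"
        using d0 by (simp_all add: ln_div)
      have "(ln (1/2) - ln \<delta>) * E \<le> ln (1/\<delta>) * (2 * \<psi> \<xi> + \<epsilon>)"
        using mult_right_mono[OF 1(1) E0] mult_left_mono[OF E 1(4)] by linarith
      then show "(ln (1/2) - ln \<delta>) * E + ((ln \<delta> - ln (\<delta>/2)) * (2*pi*k) + (ln 1 - ln (1/2)) * (2*pi*k))
        \<le> ln (1/\<delta>) * (2 * \<psi> \<xi> + \<epsilon>) + 2 * (ln 2 * (2*pi*k))" unfolding 1(2,3) by linarith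
    qed
    finally show ?thesis using sup lin by blast
  qed
  show ?thesis
    by (intro exI[of _ T] exI[of _ "2 * (ln 2 * (2*pi*k))"] conjI ballI test) (use T\<xi> k in auto)
qed

end

section \<open>The lower bound\<close>

lemma has_bochner_integral_norm_powr:
  assumes "p > -2" "c \<ge> 0"
  shows "has_bochner_integral lborel (\<lambda>x::real^2. norm x powr p * indicator (cball 0 c) x) (2*pi * c powr (p+2) / (p+2))"
proof (rule has_bochner_integral_nn_integral)
  have "(\<integral>\<^sup>+x. ennreal (norm (x::real^2) powr p * indicator (cball 0 c) x) \<partial>lborel)
    = (\<integral>\<^sup>+x. ennreal (norm (x::real^2) powr p) * indicator {0..c} (norm x) \<partial>lborel)"
    by (intro nn_integral_cong) (auto simp: indicator_def)
  then show "(\<integral>\<^sup>+x. ennreal (norm (x::real^2) powr p * indicator (cball 0 c) x) \<partial>lborel) = ennreal (2*pi * c powr (p+2) / (p+2))"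
    using nn_integral_norm_powr[OF assms] by simp
  show "(\<lambda>x::real^2. norm x powr p * indicator (cball 0 c) x) \<in> borel_measurable lborel"
    by (intro borel_measurable_times borel_measurable_indicator) (auto simp: borel_closed)
qed (use assms in auto)

text \<open>\<open>ennreal\<close> truncates negative values to 0, so the right-hand side integrates
  the positive part.\<close>

lemma ennreal_integral_le_nn_integral:
  fixes f :: "'a \<Rightarrow> real"
  assumes "integrable M f"
  shows "ennreal (integral\<^sup>L M f) \<le> (\<integral>\<^sup>+x. ennreal (f x) \<partial>M)"
proof -
  have fin: "(\<integral>\<^sup>+x. ennreal (f x) \<partial>M) < \<infinity>"
    using assms unfolding real_integrable_def by (simp add: less_top)
  have "integral\<^sup>L M f \<le> enn2real (\<integral>\<^sup>+x. ennreal (f x) \<partial>M)"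
    unfolding real_lebesgue_integral_def[OF assms] by simp
  then have "ennreal (integral\<^sup>L M f) \<le> ennreal (enn2real (\<integral>\<^sup>+x. ennreal (f x) \<partial>M))" by (rule ennreal_leI)
  also have "\<dots> = (\<integral>\<^sup>+x. ennreal (f x) \<partial>M)" using fin by (simp add: ennreal_enn2real)
  finally show ?thesis .
qed

lemma nn_integral_dilate:
  fixes f :: "real^2 \<Rightarrow> ennreal"
  assumes c: "c > 0" and [measurable]: "f \<in> borel_measurable borel"
  shows "(\<integral>\<^sup>+x. f ((1/c) *\<^sub>R x) \<partial>lborel) = ennreal (c\<^sup>2) * (\<integral>\<^sup>+x. f x \<partial>lborel)"
proof -
  have "lborel = density (distr lborel borel (\<lambda>x::real^2. 0 + c *\<^sub>R x)) (\<lambda>_. \<bar>c\<bar> ^ DIM(real^2))"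
    using c by (intro lborel_affine) simp
  then have e: "lborel = density (distr lborel borel (\<lambda>x::real^2. c *\<^sub>R x)) (\<lambda>_. ennreal (c\<^sup>2))"
    using c by (simp add: ennreal_power)
  have "(\<integral>\<^sup>+x. f ((1/c) *\<^sub>R x) \<partial>lborel) = (\<integral>\<^sup>+x. f ((1/c) *\<^sub>R x) \<partial>density (distr lborel borel (\<lambda>x::real^2. c *\<^sub>R x)) (\<lambda>_. ennreal (c\<^sup>2)))"
    using e by simp
  also have "\<dots> = (\<integral>\<^sup>+x. ennreal (c\<^sup>2) * f ((1/c) *\<^sub>R x) \<partial>distr lborel borel (\<lambda>x::real^2. c *\<^sub>R x))"
    by (subst nn_integral_density) auto
  also have "\<dots> = (\<integral>\<^sup>+x. ennreal (c\<^sup>2) * f ((1/c) *\<^sub>R (c *\<^sub>R x)) \<partial>lborel)"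
    by (subst nn_integral_distr) auto
  also have "\<dots> = ennreal (c\<^sup>2) * (\<integral>\<^sup>+x. f x \<partial>lborel)"
    using c by (subst nn_integral_cmult[symmetric]) auto
  finally show ?thesis .
qed

text \<open>
  The integral of the full kernel \<open>|x| powr (\<alpha> - 2) / \<gamma>\<^sub>\<alpha>\<close> over the unit disc; it tends to \<open>1\<close> as
  \<open>\<alpha> \<rightarrow> 0\<close>.
\<close>

definition kernel_mass :: "real \<Rightarrow> real" where
  "kernel_mass \<alpha> = 2 * pi / (\<alpha> * riesz_gamma \<alpha>)"

lemma kernel_mass_pos: "0 < \<alpha> \<Longrightarrow> \<alpha> < 1 \<Longrightarrow> 0 < kernel_mass \<alpha>"
  unfolding kernel_mass_def using riesz_gamma_pos[of \<alpha>] by simp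

text \<open>In the application h is the directional derivative of a test potential: known near the
  origin, merely bounded up to R. For small \<alpha> most of the kernel mass up to R sits in the
  inner ball, and the annulus keeps only the fraction \<open>1 - \<kappa> powr \<alpha>\<close>,
  which tends to 0.\<close>

lemma kernel_gain:
  assumes w: "horizon_profile w" and \<alpha>: "0 < \<alpha>" "\<alpha> < 1" and \<rho>: "0 < \<rho>" and R: "0 < R" "R \<le> \<rho>" and \<kappa>: "0 < \<kappa>" "\<kappa> \<le> 1/2"
    and h: "h \<in> borel_measurable borel" "\<And>z. norm z \<le> \<kappa> * R \<Longrightarrow> h z = g" "\<And>z. \<bar>h z\<bar> \<le> M" "\<And>z. norm z > R \<Longrightarrow> h z = 0"
    and g: "0 \<le> g"
  shows "R powr \<alpha> * kernel_mass \<alpha> * (\<kappa> powr \<alpha> * (1 - \<alpha>/2) * g - M * (1 - \<kappa> powr \<alpha>)) \<le> (LINT z|lborel. Q_kernel w \<alpha> \<rho> z * h z)"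
proof -
  let ?Q = "Q_kernel w \<alpha> \<rho>" and ?\<gamma> = "riesz_gamma \<alpha>"
  let ?P = "\<lambda>p c (x::real^2). norm x powr p * indicator (cball 0 c) x"
  have \<gamma>: "?\<gamma> > 0" by (rule riesz_gamma_pos[OF \<alpha>])
  have M: "0 \<le> M" using h(3)[of 0] by linarith
  define a where "a = \<kappa> * R"
  have a: "0 < a" "a \<le> \<rho>/2" "a \<le> R"
  proof -
    have "\<kappa> * R \<le> (1/2) * \<rho>" using R \<kappa> by (intro mult_mono) auto
    then show "a \<le> \<rho>/2" by (simp add: a_def)
    show "0 < a" using R \<kappa> by (simp add: a_def)
    show "a \<le> R" using R \<kappa> unfolding a_def by (simp add: mult_le_cancel_right1)
  qed
  have P: "integrable lborel (?P p c)" "(LINT x|lborel. ?P p c x) = 2*pi * c powr (p+2) / (p+2)" if "p > -2" "c \<ge> 0" for p c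
    using has_bochner_integral_norm_powr[OF that] by (auto simp: has_bochner_integral_iff)
  \<comment> \<open>A minorant with explicit integral: the lower kernel bound times g on the inner
    ball, minus M times the upper kernel bound on the annulus.\<close>
  define lo where "lo x = (g / ?\<gamma>) * (?P (\<alpha> - 2) a x - (\<rho>/2) powr (\<alpha> - 2) * ?P 0 a x) - (M / ?\<gamma>) * (?P (\<alpha> - 2) R x - ?P (\<alpha> - 2) a x)" for x
  have loi: "integrable lborel lo"
    unfolding lo_def using \<alpha> a(1) R(1)
    by (intro Bochner_Integration.integrable_diff integrable_mult_right P) auto
  have Qh: "integrable lborel (\<lambda>z. ?Q z * h z)"
  proof (rule Bochner_Integration.integrable_bound[OF integrable_mult_right[OF Q_kernel_integrable[OF w \<alpha> \<rho>], of M]])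
    show "(\<lambda>z. ?Q z * h z) \<in> borel_measurable lborel"
      using h(1) Q_kernel_measurable[OF w \<alpha> \<rho>] by simp
    show "AE z in lborel. norm (?Q z * h z) \<le> norm (M * ?Q z)"
    proof (rule AE_I2)
      fix z
      have "?Q z * \<bar>h z\<bar> \<le> ?Q z * M" by (rule mult_left_mono[OF h(3) Q_kernel_nonneg[OF w \<alpha> \<rho>]])
      then show "norm (?Q z * h z) \<le> norm (M * ?Q z)"
        using M Q_kernel_nonneg[OF w \<alpha> \<rho>, of z] by (simp add: abs_mult mult.commute)
    qed
  qed
  have pt: "lo z \<le> ?Q z * h z" if z: "z \<noteq> 0" for z
  proof -
    have n: "norm z > 0" using z by simp
    have Q0: "0 \<le> ?Q z" by (rule Q_kernel_nonneg[OF w \<alpha> \<rho>])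
    consider "norm z \<le> a" | "a < norm z" "norm z \<le> R" | "norm z > R" by linarith
    then show ?thesis
    proof cases
      case 1
      then have i: "z \<in> cball 0 a" "z \<in> cball 0 R" using a by auto
      have "lo z = g * ((norm z powr (\<alpha> - 2) - (\<rho>/2) powr (\<alpha> - 2)) / ?\<gamma>)"
        unfolding lo_def using i z by simp
      also have "\<dots> \<le> g * ?Q z"
        using 1 a by (intro mult_left_mono[OF Q_kernel_ge[OF w \<alpha> \<rho> z] g]) simp
      finally show ?thesis using h(2)[of z] 1 by (simp add: a_def mult.commute)
    next
      case 2
      then have i: "z \<notin> cball 0 a" "z \<in> cball 0 R" by auto
      have "lo z = - (M * (norm z powr (\<alpha> - 2) / ?\<gamma>))" unfolding lo_def using i by simp
      also have "\<dots> \<le> - (M * ?Q z)" using mult_left_mono[OF Q_kernel_le[OF w \<alpha> \<rho> z] M] by simp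
      also have "\<dots> \<le> ?Q z * h z"
      proof -
        have "- M \<le> h z" using h(3)[of z] by linarith
        from mult_left_mono[OF this Q0] show ?thesis by (simp add: mult.commute)
      qed
      finally show ?thesis .
    next
      case 3
      then have i: "z \<notin> cball 0 a" "z \<notin> cball 0 R" using a by auto
      show ?thesis unfolding lo_def using i h(4)[OF 3] by simp
    qed
  qed
  have ae: "AE z in lborel. lo z \<le> ?Q z * h z"
  proof -
    have "AE z in lborel. z \<noteq> (0::real^2)" by (rule AE_lborel_singleton)
    then show ?thesis by (rule eventually_mono) (rule pt)
  qed
  have I1: "(LINT x|lborel. ?P (\<alpha> - 2) a x) = 2*pi * a powr \<alpha> / \<alpha>" "(LINT x|lborel. ?P (\<alpha> - 2) R x) = 2*pi * R powr \<alpha> / \<alpha>"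
    "(LINT x|lborel. ?P 0 a x) = pi * a\<^sup>2"
    using \<alpha> a R by (subst P(2); simp add: powr_numeral)+
  have "(LINT x|lborel. lo x) = (g / ?\<gamma>) * (2*pi * a powr \<alpha> / \<alpha> - (\<rho>/2) powr (\<alpha> - 2) * (pi * a\<^sup>2)) - (M / ?\<gamma>) * (2*pi * R powr \<alpha> / \<alpha> - 2*pi * a powr \<alpha> / \<alpha>)"
  proof -
    have i: "integrable lborel (?P (\<alpha> - 2) a)" "integrable lborel (?P (\<alpha> - 2) R)" "integrable lborel (?P 0 a)"
      using \<alpha> a R by (intro P(1); simp)+
    show ?thesis unfolding lo_def I1[symmetric]
      by (simp only: i integrable_mult_right Bochner_Integration.integrable_diff Bochner_Integration.integral_diff integral_mult_right_zero)
  qed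
  \<comment> \<open>The loss from the finite horizon. Since \<open>a \<le> \<rho>/2\<close> and the
    exponent \<open>\<alpha> - 2\<close> is negative, the constant is at most
    \<open>a powr (\<alpha> - 2)\<close>; relative to the mass of the inner ball this is the factor
    \<open>1 - \<alpha>/2\<close>.\<close>
  moreover have "(\<rho>/2) powr (\<alpha> - 2) * (pi * a\<^sup>2) \<le> pi * a powr \<alpha>"
  proof -
    have "(\<rho>/2) powr (\<alpha> - 2) \<le> a powr (\<alpha> - 2)" using a \<alpha> by (intro powr_mono2') auto
    then have "(\<rho>/2) powr (\<alpha> - 2) * (pi * a\<^sup>2) \<le> a powr (\<alpha> - 2) * (pi * a\<^sup>2)" by (rule mult_right_mono) simp
    also have "\<dots> = pi * (a powr (\<alpha> - 2) * a powr 2)" using a by (simp add: powr_numeral)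
    also have "\<dots> = pi * a powr \<alpha>" unfolding powr_add[symmetric] by simp
    finally show ?thesis .
  qed
  then have "(g / ?\<gamma>) * (2*pi * a powr \<alpha> / \<alpha> - pi * a powr \<alpha>) \<le> (g / ?\<gamma>) * (2*pi * a powr \<alpha> / \<alpha> - (\<rho>/2) powr (\<alpha> - 2) * (pi * a\<^sup>2))"
    using g \<gamma> by (intro mult_left_mono) auto
  ultimately have "(g / ?\<gamma>) * (2*pi * a powr \<alpha> / \<alpha> - pi * a powr \<alpha>) - (M / ?\<gamma>) * (2*pi * R powr \<alpha> / \<alpha> - 2*pi * a powr \<alpha> / \<alpha>) \<le> (LINT x|lborel. lo x)"
    by linarith
  also have "\<dots> \<le> (LINT z|lborel. ?Q z * h z)" by (rule integral_mono_AE[OF loi Qh ae])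
  also have "(g / ?\<gamma>) * (2*pi * a powr \<alpha> / \<alpha> - pi * a powr \<alpha>) - (M / ?\<gamma>) * (2*pi * R powr \<alpha> / \<alpha> - 2*pi * a powr \<alpha> / \<alpha>)
     = R powr \<alpha> * kernel_mass \<alpha> * (\<kappa> powr \<alpha> * (1 - \<alpha>/2) * g - M * (1 - \<kappa> powr \<alpha>))"
  proof -
    have ap: "a powr \<alpha> = \<kappa> powr \<alpha> * R powr \<alpha>" using \<kappa> R by (simp add: a_def powr_mult)
    show ?thesis unfolding ap kernel_mass_def using \<alpha> \<gamma> by (simp add: field_simps)
  qed
  finally show ?thesis .
qed

context cell_setting
begin

text \<open>
  Young's inequality against the potential dilated to radius \<open>R\<close> and weighted by \<open>R\<^sup>\<alpha>\<close>: the energy of the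
  dilated stress does not depend on \<open>R\<close>, whereas the work done on the Dirac mass scales like \<open>R\<^sup>\<alpha>\<close>.
\<close>

lemma annulus_energy:
  assumes \<alpha>: "0 < \<alpha>" "\<alpha> < 1" and \<rho>: "0 < \<rho>" and \<beta>: "\<beta> \<in> admissible \<zeta> \<rho>" and R: "0 < R" "R \<le> \<rho>" and \<kappa>: "0 < \<kappa>" "\<kappa> \<le> 1/2"
    and \<Phi>: "\<Phi> \<in> supported 1" "\<And>x. norm x \<le> \<kappa> \<Longrightarrow> partial_deriv 1 \<Phi> x = g1 \<and> partial_deriv 2 \<Phi> x = g2 \<and> airy \<Phi> x = 0"
    and M: "\<And>x. \<bar>partial_deriv 1 \<Phi> x\<bar> \<le> M" "\<And>x. \<bar>partial_deriv 2 \<Phi> x\<bar> \<le> M"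
    and e: "(\<integral>\<^sup>+x. ennreal (airy \<Phi> x \<bullet> dual (airy \<Phi> x)) \<partial>lborel) \<le> ennreal e" "0 \<le> e"
    and g: "0 \<le> \<zeta>$1 * g2 - \<zeta>$2 * g1"
  defines "F \<equiv> riesz_potential w \<alpha> \<rho> (zero_extension (ball 0 (2*\<rho>)) \<beta>)"
  shows "ennreal (R powr (2*\<alpha>) * (2 * (kernel_mass \<alpha> * (\<kappa> powr \<alpha> * (1 - \<alpha>/2) * (\<zeta>$1 * g2 - \<zeta>$2 * g1) - (2 * M * norm \<zeta>) * (1 - \<kappa> powr \<alpha>))) - e))
    \<le> (\<integral>\<^sup>+x. ennreal (C (F x) \<bullet> F x) * indicator {x. \<kappa> * R < norm x \<and> norm x \<le> R} x \<partial>lborel)"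
proof -
  let ?A = "{x::real^2. \<kappa> * R < norm x \<and> norm x \<le> R}"
  \<comment> \<open>This normalisation keeps the gradient, hence the work on the Dirac mass, and by
    planar scaling also keeps the dual energy.\<close>
  define \<Phi>R where "\<Phi>R x = R * \<Phi> ((1/R) *\<^sub>R x)" for x
  have sm: "smooth_on UNIV \<Phi>" using \<Phi>(1) by (simp add: supported_def)
  have dd: "\<Phi> differentiable (at x)" for x by (rule smooth_on_differentiable[OF sm]) simp
  have p: "partial_deriv i \<Phi>R x = partial_deriv i \<Phi> ((1/R) *\<^sub>R x)" for i x
    unfolding \<Phi>R_def[abs_def] by (rule partial_deriv_dilate[OF R(1) dd])
  have ar: "airy \<Phi>R x = (1/R) *\<^sub>R airy \<Phi> ((1/R) *\<^sub>R x)" for x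
    unfolding \<Phi>R_def[abs_def] by (rule airy_dilate[OF R(1) open_UNIV sm UNIV_I open_UNIV UNIV_I])
  have nr: "norm ((1/R) *\<^sub>R x) = norm x / R" for x :: "real^2" using R(1) by simp
  have \<Phi>Rs: "\<Phi>R \<in> supported R"
  proof -
    have "smooth_on UNIV \<Phi>R"
    proof (rule smooth_on_coinduct[where S="{\<lambda>x. c * f ((1/R) *\<^sub>R x) |c f. smooth_on UNIV f}"])
      show "\<Phi>R \<in> {\<lambda>x. c * f ((1/R) *\<^sub>R x) |c f. smooth_on UNIV f}" unfolding \<Phi>R_def[abs_def] using sm by blast
      fix f :: "real^2 \<Rightarrow> real" assume "f \<in> {\<lambda>x. c * f ((1/R) *\<^sub>R x) |c f. smooth_on UNIV f}"
      then obtain c k where f: "f = (\<lambda>x. c * k ((1/R) *\<^sub>R x))" and k: "smooth_on UNIV k" by blast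
      have kd: "k differentiable (at y)" for y by (rule smooth_on_differentiable[OF k]) simp
      show "f differentiable (at x)" for x
        unfolding f by (rule differentiable_mult[OF differentiable_const partial_deriv_scale(2)[OF kd]])
      have "partial_deriv i f x = (c * (1/R)) * partial_deriv i k ((1/R) *\<^sub>R x)" for i x
        unfolding f partial_deriv_cmult[OF partial_deriv_scale(2)[OF kd]] partial_deriv_scale(1)[OF kd] by simp
      then show "\<exists>g\<in>{\<lambda>x. c * f ((1/R) *\<^sub>R x) |c f. smooth_on UNIV f}. \<forall>x\<in>UNIV. partial_deriv i f x = g x" for i
        using smooth_on_partial_deriv[OF k, of i] by blast
    qed simp
    moreover have "\<Phi>R x = 0" if "norm x > R" for x
    proof -
      have "norm ((1/R) *\<^sub>R x) > 1" unfolding nr using that R(1) by simp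
      then show ?thesis using \<Phi>(1) by (simp add: \<Phi>R_def supported_def)
    qed
    ultimately show ?thesis by (simp add: supported_def)
  qed
  have ps: "partial_deriv i \<Phi> x = 0" "airy \<Phi> x = 0" if "norm x > 1" for i x
    using supported_partial_deriv[OF \<Phi>(1)] supported_partial_deriv[OF supported_partial_deriv[OF \<Phi>(1)]] that
    by (auto simp: supported_def airy_eq)
  define G where "G = (LINT z|lborel. Q_kernel w \<alpha> \<rho> z * (\<zeta>$1 * partial_deriv 2 \<Phi>R z - \<zeta>$2 * partial_deriv 1 \<Phi>R z))"
  let ?g = "\<zeta>$1 * g2 - \<zeta>$2 * g1"
  define b where "b = kernel_mass \<alpha> * (\<kappa> powr \<alpha> * (1 - \<alpha>/2) * ?g - (2 * M * norm \<zeta>) * (1 - \<kappa> powr \<alpha>))"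
  have G: "R powr \<alpha> * b \<le> G"
  proof -
    have "R powr \<alpha> * kernel_mass \<alpha> * (\<kappa> powr \<alpha> * (1 - \<alpha>/2) * ?g - (2 * M * norm \<zeta>) * (1 - \<kappa> powr \<alpha>)) \<le> G"
    unfolding G_def
  proof (rule kernel_gain[OF w \<alpha> \<rho> R \<kappa> _ _ _ _ g])
    have c: "continuous_on UNIV (partial_deriv i \<Phi>R)" for i by (rule supported_continuous[OF supported_partial_deriv[OF \<Phi>Rs]])
    show "(\<lambda>z. \<zeta>$1 * partial_deriv 2 \<Phi>R z - \<zeta>$2 * partial_deriv 1 \<Phi>R z) \<in> borel_measurable borel"
      by (intro borel_measurable_continuous_onI continuous_intros c)
    show "\<zeta>$1 * partial_deriv 2 \<Phi>R z - \<zeta>$2 * partial_deriv 1 \<Phi>R z = ?g" if "norm z \<le> \<kappa> * R" for z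
    proof -
      have "norm ((1/R) *\<^sub>R z) \<le> \<kappa>" unfolding nr using that R(1) by (simp add: field_simps)
      then show ?thesis using \<Phi>(2) unfolding p by simp
    qed
    show "\<bar>\<zeta>$1 * partial_deriv 2 \<Phi>R z - \<zeta>$2 * partial_deriv 1 \<Phi>R z\<bar> \<le> 2 * M * norm \<zeta>" for z
    proof -
      let ?z = "(1/R) *\<^sub>R z"
      have "\<bar>\<zeta>$1 * partial_deriv 2 \<Phi> ?z - \<zeta>$2 * partial_deriv 1 \<Phi> ?z\<bar> \<le> \<bar>\<zeta>$1\<bar> * \<bar>partial_deriv 2 \<Phi> ?z\<bar> + \<bar>\<zeta>$2\<bar> * \<bar>partial_deriv 1 \<Phi> ?z\<bar>"
        using abs_triangle_ineq4[of "\<zeta>$1 * partial_deriv 2 \<Phi> ?z" "\<zeta>$2 * partial_deriv 1 \<Phi> ?z"] by (simp add: abs_mult)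
      also have "\<dots> \<le> norm \<zeta> * M + norm \<zeta> * M"
        by (intro add_mono mult_mono M component_le_norm_cart) auto
      finally show ?thesis unfolding p by (simp add: mult_ac)
    qed
    show "\<zeta>$1 * partial_deriv 2 \<Phi>R z - \<zeta>$2 * partial_deriv 1 \<Phi>R z = 0" if "norm z > R" for z
    proof -
      have "norm ((1/R) *\<^sub>R z) > 1" unfolding nr using that R(1) by simp
      then show ?thesis unfolding p using ps(1) by simp
    qed
  qed
    then show ?thesis unfolding b_def by (simp only: mult.assoc)
  qed
  note du = riesz_airy_duality[OF w \<alpha> \<rho> \<beta> \<Phi>Rs R(2), folded F_def]
  let ?m = "R powr \<alpha>"
  let ?q = "\<lambda>x. airy \<Phi>R x \<bullet> dual (airy \<Phi>R x)"
  have qe: "(\<integral>\<^sup>+x. ennreal (?q x) \<partial>lborel) \<le> ennreal e"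
  proof -
    let ?q1 = "\<lambda>x. ennreal (airy \<Phi> x \<bullet> dual (airy \<Phi> x))"
    have "continuous_on UNIV (\<lambda>x. airy \<Phi> x \<bullet> dual (airy \<Phi> x))"
      by (intro continuous_on_inner airy_continuous[OF \<Phi>(1)] linear_continuous_on_compose[OF airy_continuous[OF \<Phi>(1)] dual(1)])
    then have q1m: "?q1 \<in> borel_measurable borel"
      by (rule measurable_compose[OF borel_measurable_continuous_onI measurable_ennreal])
    have "ennreal (?q x) = ennreal (1/R\<^sup>2) * ?q1 ((1/R) *\<^sub>R x)" for x
    proof -
      have "?q x = (1/R\<^sup>2) * (airy \<Phi> ((1/R) *\<^sub>R x) \<bullet> dual (airy \<Phi> ((1/R) *\<^sub>R x)))"
        unfolding ar by (simp add: linear_cmul[OF dual(1)] power2_eq_square)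
      then show ?thesis by (simp only: ennreal_mult[OF _ dual_nonneg[OF airy_symmetric]] zero_le_divide_1_iff zero_le_power2)
    qed
    then have "(\<integral>\<^sup>+x. ennreal (?q x) \<partial>lborel) = ennreal (1/R\<^sup>2) * (\<integral>\<^sup>+x. ?q1 ((1/R) *\<^sub>R x) \<partial>lborel)"
      using measurable_compose[OF _ q1m, of "\<lambda>x. (1/R) *\<^sub>R x" lborel] by (simp add: nn_integral_cmult)
    also have "\<dots> = ennreal (1/R\<^sup>2) * (ennreal (R\<^sup>2) * (\<integral>\<^sup>+x. ?q1 x \<partial>lborel))" by (simp only: nn_integral_dilate[OF R(1) q1m])
    also have "\<dots> = (ennreal (1/R\<^sup>2) * ennreal (R\<^sup>2)) * (\<integral>\<^sup>+x. ?q1 x \<partial>lborel)" by (simp only: mult.assoc)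
    also have "ennreal (1/R\<^sup>2) * ennreal (R\<^sup>2) = 1" using R(1) by (simp add: ennreal_mult[symmetric])
    finally show ?thesis using e(1) by simp
  qed
  have Fm: "F \<in> borel_measurable borel" by (rule du(3))
  have cm: "(\<lambda>x. C (F x) \<bullet> F x) \<in> borel_measurable borel"
  proof -
    have "continuous_on UNIV (\<lambda>A. C A \<bullet> A)" by (intro continuous_on_inner C_continuous continuous_on_id)
    then show ?thesis using measurable_compose[OF Fm borel_measurable_continuous_onI] by blast
  qed
  have qm: "?q \<in> borel_measurable borel"
    by (intro borel_measurable_continuous_onI continuous_on_inner airy_continuous[OF \<Phi>Rs] linear_continuous_on_compose[OF airy_continuous[OF \<Phi>Rs] dual(1)])
  have q0: "0 \<le> ?q x" for x by (rule dual_nonneg[OF airy_symmetric])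
  define a where "a = (\<integral>\<^sup>+x. ennreal (C (F x) \<bullet> F x) * indicator ?A x \<partial>lborel)"
  have Am: "?A \<in> sets borel" by measurable
  have "ennreal (?m * G) = ennreal (LINT x|lborel. ?m * (airy \<Phi>R x \<bullet> F x))" using du(2) by (simp add: G_def)
  also have "\<dots> \<le> (\<integral>\<^sup>+x. ennreal (?m * (airy \<Phi>R x \<bullet> F x)) \<partial>lborel)"
    by (rule ennreal_integral_le_nn_integral[OF integrable_mult_right[OF du(1)]])
  \<comment> \<open>Young's inequality is used only on the annulus. Elsewhere the dilated stress
    vanishes, so the energy of F outside does not enter and the annuli of different scales can be
    added.\<close>
  also have "\<dots> \<le> (\<integral>\<^sup>+x. ennreal (1/2) * (ennreal (C (F x) \<bullet> F x) * indicator ?A x) + ennreal (?m\<^sup>2/2) * ennreal (?q x) \<partial>lborel)"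
  proof (rule nn_integral_mono)
    fix x
    show "ennreal (?m * (airy \<Phi>R x \<bullet> F x)) \<le> ennreal (1/2) * (ennreal (C (F x) \<bullet> F x) * indicator ?A x) + ennreal (?m\<^sup>2/2) * ennreal (?q x)"
    proof (cases "x \<in> ?A")
      case True
      have "ennreal (?m * (airy \<Phi>R x \<bullet> F x)) \<le> ennreal (1/2 * (C (F x) \<bullet> F x) + ?m\<^sup>2/2 * ?q x)"
        by (rule ennreal_leI[OF dual_young[OF airy_symmetric]])
      also have "\<dots> = ennreal (1/2 * (C (F x) \<bullet> F x)) + ennreal (?m\<^sup>2/2 * ?q x)"
        using q0[of x] C_nonneg[of "F x"] by (intro ennreal_plus mult_nonneg_nonneg) auto
      also have "ennreal (1/2 * (C (F x) \<bullet> F x)) = ennreal (1/2) * ennreal (C (F x) \<bullet> F x)"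
        using C_nonneg by (intro ennreal_mult) auto
      also have "ennreal (?m\<^sup>2/2 * ?q x) = ennreal (?m\<^sup>2/2) * ennreal (?q x)"
        using q0 by (intro ennreal_mult) auto
      finally show ?thesis using True by simp
    next
      case False
      have "airy \<Phi>R x = 0"
      proof (cases "norm x \<le> \<kappa> * R")
        case True
        then have "norm ((1/R) *\<^sub>R x) \<le> \<kappa>" unfolding nr using R(1) by (simp add: field_simps)
        then show ?thesis unfolding ar using \<Phi>(2) by simp
      next
        case f: False
        then have "norm x > R" using False by auto
        then have "norm ((1/R) *\<^sub>R x) > 1" unfolding nr using R(1) by simp
        then show ?thesis unfolding ar using ps(2) by simp
      qed
      then show ?thesis by simp
    qed
  qed
  also have "\<dots> = ennreal (1/2) * a + ennreal (?m\<^sup>2/2) * (\<integral>\<^sup>+x. ennreal (?q x) \<partial>lborel)"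
    unfolding a_def using cm qm Am by (subst nn_integral_add) (auto simp: nn_integral_cmult)
  also have "\<dots> \<le> ennreal (1/2) * a + ennreal (?m\<^sup>2/2) * ennreal e"
    by (intro add_left_mono mult_left_mono qe) simp
  finally have main: "ennreal (?m * G) \<le> ennreal (1/2) * a + ennreal (?m\<^sup>2/2) * ennreal e" .
  have "ennreal (R powr (2*\<alpha>) * (2 * b - e)) \<le> a"
  proof (cases "a = \<infinity>")
    case False
    then obtain a' where a': "a = ennreal a'" "0 \<le> a'" by (cases a) auto
    have n: "0 \<le> 1/2 * a'" "0 \<le> ?m\<^sup>2/2 * e" using a'(2) e(2) by auto
    have "ennreal (1/2 * a' + ?m\<^sup>2/2 * e) = ennreal (1/2) * ennreal a' + ennreal (?m\<^sup>2/2) * ennreal e"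
      unfolding ennreal_plus[OF n] using a'(2) e(2) by (intro arg_cong2[of _ _ _ _ "(+)"] ennreal_mult) auto
    then have "ennreal (?m * G) \<le> ennreal (1/2 * a' + ?m\<^sup>2/2 * e)" using main a'(1) by metis
    then have "?m * G \<le> 1/2 * a' + ?m\<^sup>2/2 * e" by (rule ennreal_le_iff[THEN iffD1, rotated]) (use n in linarith)
    moreover have "?m * (?m * b) \<le> ?m * G" by (rule mult_left_mono[OF G]) simp
    moreover have "R powr (2*\<alpha>) = ?m\<^sup>2" using powr_add[of R \<alpha> \<alpha>] by (simp add: power2_eq_square)
    ultimately have "R powr (2*\<alpha>) * (2 * b - e) \<le> a'" by (simp add: power2_eq_square algebra_simps)
    then show ?thesis unfolding a'(1) by (rule ennreal_leI)
  qed simp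
  then show ?thesis unfolding a_def b_def .
qed

text \<open>
  Summation over the annuli \<open>\<kappa> R < |x| \<le> R\<close> with \<open>R = \<rho> \<kappa>\<^sup>k\<^sup>+\<^sup>1\<close>.
\<close>

lemma total_energy:
  assumes \<alpha>: "0 < \<alpha>" "\<alpha> < 1" and \<rho>: "0 < \<rho>" and \<beta>: "\<beta> \<in> admissible \<zeta> \<rho>" and \<kappa>: "0 < \<kappa>" "\<kappa> \<le> 1/2"
    and \<Phi>: "\<Phi> \<in> supported 1" "\<And>x. norm x \<le> \<kappa> \<Longrightarrow> partial_deriv 1 \<Phi> x = g1 \<and> partial_deriv 2 \<Phi> x = g2 \<and> airy \<Phi> x = 0"
    and M: "\<And>x. \<bar>partial_deriv 1 \<Phi> x\<bar> \<le> M" "\<And>x. \<bar>partial_deriv 2 \<Phi> x\<bar> \<le> M"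
    and e: "(\<integral>\<^sup>+x. ennreal (airy \<Phi> x \<bullet> dual (airy \<Phi> x)) \<partial>lborel) \<le> ennreal e" "0 \<le> e"
    and g: "0 \<le> \<zeta>$1 * g2 - \<zeta>$2 * g1"
  defines "F \<equiv> riesz_potential w \<alpha> \<rho> (zero_extension (ball 0 (2*\<rho>)) \<beta>)"
    and "Y \<equiv> 2 * (kernel_mass \<alpha> * (\<kappa> powr \<alpha> * (1 - \<alpha>/2) * (\<zeta>$1 * g2 - \<zeta>$2 * g1) - (2 * M * norm \<zeta>) * (1 - \<kappa> powr \<alpha>))) - e"
  shows "ennreal ((\<rho> * \<kappa>) powr (2*\<alpha>) / (1 - \<kappa> powr (2*\<alpha>)) * Y) \<le> elastic_integral C \<rho> F"
\<comment> \<open>For negative Y the left-hand side is truncated to 0. For the remaining case all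
  summands are nonnegative, as the passage from real sums to \<open>ennreal\<close> sums
  requires.\<close>
proof (cases "Y \<ge> 0")
  case False
  have "\<kappa> powr (2*\<alpha>) < 1" using powr_less_mono2[of "2*\<alpha>" \<kappa> 1] \<kappa> \<alpha> by simp
  then have "(\<rho> * \<kappa>) powr (2*\<alpha>) / (1 - \<kappa> powr (2*\<alpha>)) * Y \<le> 0" using False by (intro mult_nonneg_nonpos) auto
  then show ?thesis by (simp add: ennreal_neg)
next
  case True
  \<comment> \<open>The exponent starts at 1, so that even the outermost closed radius lies strictly
    inside the open ball over which the energy is taken.\<close>
  define R where "R k = \<rho> * \<kappa> ^ Suc k" for k
  have kp: "\<kappa> ^ n \<le> 1" for n using \<kappa> by (intro power_le_one) auto
  have R: "0 < R k" "R k < \<rho>" "R (Suc k) = \<kappa> * R k" for k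
  proof -
    show "0 < R k" using \<rho> \<kappa> by (simp add: R_def)
    have "\<kappa> * \<kappa> ^ k \<le> (1/2) * 1" using \<kappa> kp[of k] by (intro mult_mono) auto
    then have "\<kappa> ^ Suc k < 1" by simp
    then show "R k < \<rho>" using \<rho> by (simp add: R_def mult_less_cancel_left2 del: power_Suc)
    show "R (Suc k) = \<kappa> * R k" by (simp add: R_def)
  qed
  define A where "A k = {x::real^2. \<kappa> * R k < norm x \<and> norm x \<le> R k}" for k
  have Am[measurable]: "A k \<in> sets borel" for k unfolding A_def by measurable
  have Rmono: "R l \<le> \<kappa> * R k" if "k < l" for k l
  proof -
    have "R l \<le> R (Suc k)" using that
    proof -
      have "R (Suc n) \<le> R n" for n using R(1)[of n] \<kappa> by (simp add: R(3) mult_le_cancel_right1)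
      then show ?thesis using lift_Suc_antimono_le[of R "Suc k" l] that by simp
    qed
    then show ?thesis by (simp add: R(3))
  qed
  have disj: "A k \<inter> A l = {}" if "k \<noteq> l" for k l
    using that
  proof (induction k l rule: linorder_wlog)
    case (le k l)
    then have "R l \<le> \<kappa> * R k" using Rmono[of k l] by simp
    then show ?case unfolding A_def by auto
  qed (simp add: Int_commute)
  \<comment> \<open>The zero potential serves only to extract the measurability of F from the
    duality lemma.\<close>
  have z0: "(\<lambda>x. 0) \<in> supported \<rho>" by (simp add: supported_def smooth_on_const)
  have Fm: "F \<in> borel_measurable borel"
    unfolding F_def by (rule riesz_airy_duality(3)[OF w \<alpha> \<rho> \<beta> z0 order_refl])
  let ?q = "\<lambda>x. ennreal (C (F x) \<bullet> F x)"
  have qm: "?q \<in> borel_measurable borel"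
  proof -
    have "continuous_on UNIV (\<lambda>A. C A \<bullet> A)" by (intro continuous_on_inner C_continuous continuous_on_id)
    from measurable_compose[OF Fm borel_measurable_continuous_onI[OF this]] show ?thesis by simp
  qed
  have part: "ennreal ((\<Sum>k<n. (\<rho> * \<kappa>) powr (2*\<alpha>) * (\<kappa> powr (2*\<alpha>)) ^ k) * Y) \<le> elastic_integral C \<rho> F" for n
  proof -
    have "(\<rho> * \<kappa>) powr (2*\<alpha>) * (\<kappa> powr (2*\<alpha>)) ^ k = R k powr (2*\<alpha>)" for k
    proof -
      have "(\<kappa> powr (2*\<alpha>)) ^ k = (\<kappa> ^ k) powr (2*\<alpha>)"
        using \<kappa> by (simp add: powr_realpow[symmetric] powr_powr mult.commute)
      then show ?thesis using \<rho> \<kappa> by (simp add: R_def powr_mult mult.assoc)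
    qed
    then have "ennreal ((\<Sum>k<n. (\<rho> * \<kappa>) powr (2*\<alpha>) * (\<kappa> powr (2*\<alpha>)) ^ k) * Y) = ennreal (\<Sum>k<n. R k powr (2*\<alpha>) * Y)"
      by (simp add: sum_distrib_right)
    also have "\<dots> = (\<Sum>k<n. ennreal (R k powr (2*\<alpha>) * Y))" using True by (intro sum_ennreal[symmetric]) auto
    also have "\<dots> \<le> (\<Sum>k<n. \<integral>\<^sup>+x. ?q x * indicator (A k) x \<partial>lborel)"
      unfolding A_def Y_def F_def
      by (intro sum_mono annulus_energy[OF \<alpha> \<rho> \<beta> R(1) less_imp_le[OF R(2)] \<kappa> \<Phi> M e g])
    also have "\<dots> = (\<integral>\<^sup>+x. (\<Sum>k<n. ?q x * indicator (A k) x) \<partial>lborel)"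
      using qm by (intro nn_integral_sum[symmetric]) auto
    also have "\<dots> \<le> (\<integral>\<^sup>+x. ?q x * indicator (ball 0 \<rho>) x \<partial>lborel)"
    proof (rule nn_integral_mono)
      fix x
      have s: "(\<Sum>k<n. indicator (A k) x) = (indicator (\<Union>k<n. A k) x :: ennreal)"
        by (rule indicator_UN_disjoint[symmetric]) (auto simp: disjoint_family_on_def disj)
      have "(\<Sum>k<n. ?q x * indicator (A k) x) = ?q x * indicator (\<Union>k<n. A k) x" unfolding s[symmetric] by (simp add: sum_distrib_left)
      also have "\<dots> \<le> ?q x * indicator (ball 0 \<rho>) x"
      proof (intro mult_left_mono)
        have "norm y < \<rho>" if "y \<in> A k" for y k using that R(2)[of k] unfolding A_def by auto
        then show "indicator (\<Union>k<n. A k) x \<le> (indicator (ball 0 \<rho>) x :: ennreal)" by (auto simp: indicator_def)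
      qed simp
      finally show "(\<Sum>k<n. ?q x * indicator (A k) x) \<le> ?q x * indicator (ball 0 \<rho>) x" .
    qed
    finally show ?thesis unfolding elastic_integral_def .
  qed
  have k1: "\<bar>\<kappa> powr (2*\<alpha>)\<bar> < 1" using powr_less_mono2[of "2*\<alpha>" \<kappa> 1] \<kappa> \<alpha> by simp
  \<comment> \<open>The partial sums are those of a geometric series with ratio
    \<open>\<kappa> powr (2*\<alpha>)\<close>; the bound for each of them passes to the
    limit.\<close>
  have "(\<lambda>n. (\<Sum>k<n. (\<rho> * \<kappa>) powr (2*\<alpha>) * (\<kappa> powr (2*\<alpha>)) ^ k) * Y) \<longlonglongrightarrow> (\<rho> * \<kappa>) powr (2*\<alpha>) / (1 - \<kappa> powr (2*\<alpha>)) * Y"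
  proof (rule tendsto_mult_right)
    have "(\<lambda>k. (\<kappa> powr (2*\<alpha>)) ^ k) sums (1 / (1 - \<kappa> powr (2*\<alpha>)))" using k1 by (intro geometric_sums) simp
    from sums_mult[OF this, of "(\<rho> * \<kappa>) powr (2*\<alpha>)"]
    show "(\<lambda>n. \<Sum>k<n. (\<rho> * \<kappa>) powr (2*\<alpha>) * (\<kappa> powr (2*\<alpha>)) ^ k) \<longlonglongrightarrow> (\<rho> * \<kappa>) powr (2*\<alpha>) / (1 - \<kappa> powr (2*\<alpha>))"
      unfolding sums_def by simp
  qed
  then have "(\<lambda>n. ennreal ((\<Sum>k<n. (\<rho> * \<kappa>) powr (2*\<alpha>) * (\<kappa> powr (2*\<alpha>)) ^ k) * Y)) \<longlonglongrightarrow> ennreal ((\<rho> * \<kappa>) powr (2*\<alpha>) / (1 - \<kappa> powr (2*\<alpha>)) * Y)"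
    by (rule tendsto_ennrealI)
  then show ?thesis by (rule LIMSEQ_le_const2) (use part in auto)
qed

end

section \<open>Limits of the constants as \<alpha> tends to 0\<close>

lemma kernel_mass_tendsto: "(kernel_mass \<longlongrightarrow> 1) (at_right 0)"
proof -
  have "((\<lambda>x::real. Gamma ((2 - x)/2)) \<longlongrightarrow> Gamma ((2 - 0)/2)) (at_right 0)"
    by (rule tendsto_Gamma, (rule tendsto_intros)+) simp_all
  moreover have "((\<lambda>x::real. Gamma (x/2 + 1)) \<longlongrightarrow> Gamma (0/2 + 1)) (at_right 0)"
    by (rule tendsto_Gamma, (rule tendsto_intros)+) simp_all
  moreover have "((\<lambda>x::real. 2 powr x) \<longlongrightarrow> 2 powr 0) (at_right 0)" by (intro tendsto_intros) simp
  ultimately have "((\<lambda>x::real. Gamma ((2 - x)/2) / (2 powr x * Gamma (x/2 + 1))) \<longlongrightarrow> Gamma ((2 - 0)/2) / (2 powr 0 * Gamma (0/2 + 1))) (at_right 0)"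
    by (intro tendsto_divide tendsto_mult) simp_all
  then have "((\<lambda>x::real. Gamma ((2 - x)/2) / (2 powr x * Gamma (x/2 + 1))) \<longlongrightarrow> 1) (at_right 0)" by simp
  moreover have "\<forall>\<^sub>F x in at_right 0. Gamma ((2 - x)/2) / (2 powr x * Gamma (x/2 + 1)) = kernel_mass x"
    using eventually_at_right_real[of 0 1, simplified]
  proof eventually_elim
    case (elim x)
    then have x: "0 < x" "x < 1" by auto
    have "x/2 \<notin> \<int>\<^sub>\<le>\<^sub>0" using x by (auto dest: nonpos_Ints_nonpos)
    \<comment> \<open>The functional equation absorbs the factor \<alpha> into the pole of the Gamma
      function at 0 and leaves a quotient that is continuous at 0.\<close>
    then have G: "Gamma (x/2 + 1) = x/2 * Gamma (x/2)" by (rule Gamma_plus1)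
    have "Gamma (x/2) > 0" "Gamma ((2 - x)/2) > 0" using x by (intro Gamma_real_pos; simp)+
    then show ?case using x unfolding kernel_mass_def riesz_gamma_def G by (simp add: field_simps)
  qed
  ultimately show ?thesis by (rule Lim_transform_eventually)
qed

text \<open>The reciprocal of a difference quotient at 0 of
  \<open>1 - \<kappa> powr (2*\<alpha>)\<close>, whose derivative there is
  \<open>2 * ln (1/\<kappa>)\<close>.\<close>

lemma geometric_factor_tendsto:
  fixes \<kappa> :: real
  assumes \<kappa>: "0 < \<kappa>" "\<kappa> < 1"
  shows "((\<lambda>\<alpha>. \<alpha> / (1 - \<kappa> powr (2*\<alpha>))) \<longlongrightarrow> 1 / (2 * ln (1/\<kappa>))) (at_right 0)"
proof -
  have "((\<lambda>\<alpha>. 1 - \<kappa> powr (2*\<alpha>)) has_real_derivative 2 * ln (1/\<kappa>)) (at 0)"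
    using \<kappa> by (auto intro!: derivative_eq_intros simp: ln_div)
  then have "((\<lambda>h. (1 - \<kappa> powr (2*h)) / h) \<longlongrightarrow> 2 * ln (1/\<kappa>)) (at 0)"
    unfolding DERIV_def using \<kappa> by simp
  then have "((\<lambda>h. (1 - \<kappa> powr (2*h)) / h) \<longlongrightarrow> 2 * ln (1/\<kappa>)) (at_right 0)"
    by (rule filterlim_mono[OF _ order_refl at_le]) simp
  moreover have "2 * ln (1/\<kappa>) \<noteq> 0" using \<kappa> by (simp add: ln_div)
  ultimately have "((\<lambda>h. inverse ((1 - \<kappa> powr (2*h)) / h)) \<longlongrightarrow> inverse (2 * ln (1/\<kappa>))) (at_right 0)"
    by (rule tendsto_inverse)
  then show ?thesis by (simp add: inverse_eq_divide)
qed

text \<open>In exponential form the power contains exactly the product of \<alpha> and the logarithm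
  of the horizon, which tends to 0 by assumption; a fixed \<kappa> has the same effect.\<close>

lemma horizon_factor_tendsto:
  fixes \<kappa> :: real
  assumes \<kappa>: "0 < \<kappa>" and \<rho>: "\<And>\<alpha>. \<alpha> \<in> {0<..<1} \<Longrightarrow> \<rho> \<alpha> \<in> {0<..<1}" "((\<lambda>\<alpha>. \<alpha> * ln (\<rho> \<alpha>)) \<longlongrightarrow> 0) (at_right 0)"
  shows "((\<lambda>\<alpha>. (\<rho> \<alpha> * \<kappa>) powr (2*\<alpha>)) \<longlongrightarrow> 1) (at_right 0)"
proof -
  have "((\<lambda>\<alpha>. exp (2 * (\<alpha> * ln (\<rho> \<alpha>)) + 2 * (\<alpha> * ln \<kappa>))) \<longlongrightarrow> exp (2 * 0 + 2 * (0 * ln \<kappa>))) (at_right 0)"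
    by (intro tendsto_intros \<rho>)
  moreover have "\<forall>\<^sub>F \<alpha> in at_right 0. exp (2 * (\<alpha> * ln (\<rho> \<alpha>)) + 2 * (\<alpha> * ln \<kappa>)) = (\<rho> \<alpha> * \<kappa>) powr (2*\<alpha>)"
    using eventually_at_right_real[of 0 1, simplified]
  proof eventually_elim
    case (elim \<alpha>)
    then show ?case using \<rho>(1)[of \<alpha>] \<kappa> by (simp add: powr_def ln_mult algebra_simps)
  qed
  ultimately show ?thesis by (simp add: Lim_transform_eventually)
qed

context cell_setting
begin

text \<open>The bound for a competitor depends on it only through \<zeta>, so it passes to the
  infimum. A negative bound is covered by nonnegativity of the cell energy.\<close>

lemma cell_energy_lower:
  assumes \<alpha>: "0 < \<alpha>" "\<alpha> < 1" and \<rho>: "0 < \<rho>" and \<kappa>: "0 < \<kappa>" "\<kappa> \<le> 1/2"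
    and \<Phi>: "\<Phi> \<in> supported 1" "\<And>x. norm x \<le> \<kappa> \<Longrightarrow> partial_deriv 1 \<Phi> x = g1 \<and> partial_deriv 2 \<Phi> x = g2 \<and> airy \<Phi> x = 0"
    and M: "\<And>x. \<bar>partial_deriv 1 \<Phi> x\<bar> \<le> M" "\<And>x. \<bar>partial_deriv 2 \<Phi> x\<bar> \<le> M"
    and e: "(\<integral>\<^sup>+x. ennreal (airy \<Phi> x \<bullet> dual (airy \<Phi> x)) \<partial>lborel) \<le> ennreal e" "0 \<le> e"
    and g: "0 \<le> \<zeta>$1 * g2 - \<zeta>$2 * g1"
  defines "Y \<equiv> 2 * (kernel_mass \<alpha> * (\<kappa> powr \<alpha> * (1 - \<alpha>/2) * (\<zeta>$1 * g2 - \<zeta>$2 * g1) - (2 * M * norm \<zeta>) * (1 - \<kappa> powr \<alpha>))) - e"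
  shows "ereal ((\<rho> * \<kappa>) powr (2*\<alpha>) * (\<alpha> / (1 - \<kappa> powr (2*\<alpha>))) * Y) \<le> ereal (2*\<alpha>) * cell_energy w C \<zeta> \<alpha> \<rho>"
proof -
  define X where "X = (\<rho> * \<kappa>) powr (2*\<alpha>) / (1 - \<kappa> powr (2*\<alpha>)) * Y"
  have "ennreal X \<le> elastic_integral C \<rho> (riesz_potential w \<alpha> \<rho> (zero_extension (ball 0 (2 * \<rho>)) \<beta>))" if "\<beta> \<in> admissible \<zeta> \<rho>" for \<beta>
    unfolding X_def Y_def by (rule total_energy[OF \<alpha> \<rho> that \<kappa> \<Phi> M e g])
  then have "ennreal (1/2) * ennreal X \<le> (INF \<beta>\<in>admissible \<zeta> \<rho>.
        ennreal (1/2) * elastic_integral C \<rho> (riesz_potential w \<alpha> \<rho> (zero_extension (ball 0 (2 * \<rho>)) \<beta>)))"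
    by (intro INF_greatest mult_left_mono) auto
  then have c: "enn2ereal (ennreal (1/2) * ennreal X) \<le> cell_energy w C \<zeta> \<alpha> \<rho>"
    unfolding cell_energy_def by (simp only: less_eq_ennreal.rep_eq)
  have "ereal (\<alpha> * X) \<le> ereal (2*\<alpha>) * cell_energy w C \<zeta> \<alpha> \<rho>"
  proof (cases "0 \<le> X")
    case True
    have "enn2ereal (ennreal (1/2) * ennreal X) = ereal (1/2 * X)"
      using True by (subst ennreal_mult[symmetric]) (simp_all add: enn2ereal_ennreal)
    then have "ereal (2*\<alpha>) * ereal (1/2 * X) \<le> ereal (2*\<alpha>) * cell_energy w C \<zeta> \<alpha> \<rho>"
      using c \<alpha> by (intro ereal_mult_left_mono) auto
    then show ?thesis by simp
  next
    case False
    then have "\<alpha> * X \<le> 0" using \<alpha> by (intro mult_nonneg_nonpos) auto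
    moreover have "0 \<le> ereal (2*\<alpha>) * cell_energy w C \<zeta> \<alpha> \<rho>"
      using \<alpha> unfolding cell_energy_def by (intro ereal_0_le_mult) auto
    ultimately show ?thesis by (metis ereal_less_eq(4) order_trans)
  qed
  then show ?thesis unfolding X_def by (simp add: mult_ac)
qed

text \<open>The test field is fixed for \<xi>; then \<alpha> tends to 0 and \<zeta> to \<xi>
  jointly. A limit along the product filter separates into an event in \<alpha> and a neighbourhood
  of \<xi>, which is the form that compactness needs.\<close>

lemma lower_bound:
  assumes \<xi>: "\<xi> \<noteq> 0" and \<epsilon>: "\<epsilon> > 0"
    and \<rho>: "\<And>\<alpha>. \<alpha> \<in> {0<..<1} \<Longrightarrow> \<rho> \<alpha> \<in> {0<..<1}" "((\<lambda>\<alpha>. \<alpha> * ln (\<rho> \<alpha>)) \<longlongrightarrow> 0) (at_right 0)"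
  obtains U where "open U" "\<xi> \<in> U"
    "\<forall>\<^sub>F \<alpha> in at_right 0. \<forall>\<zeta>\<in>U. ereal (\<psi> \<zeta> - \<epsilon>) \<le> ereal (2*\<alpha>) * cell_energy w C \<zeta> \<alpha> (\<rho> \<alpha>)"
proof -
  obtain T k where T: "T \<bullet> \<xi> = 2 * \<psi> \<xi>" "0 \<le> k" and tst: "\<And>\<delta>. \<delta> \<in> {0<..<1/2} \<Longrightarrow> \<exists>\<Phi>\<in>supported 1. (\<forall>x. norm x < \<delta>/2 \<longrightarrow> partial_deriv 1 \<Phi> x = ln \<delta> * T$2 \<and> partial_deriv 2 \<Phi> x = - ln \<delta> * T$1 \<and> airy \<Phi> x = 0)
      \<and> (\<integral>\<^sup>+x. ennreal (airy \<Phi> x \<bullet> dual (airy \<Phi> x)) \<partial>lborel) \<le> ennreal (ln (1/\<delta>) * (2 * \<psi> \<xi> + \<epsilon>) + k)"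
    using lower_test_field[OF \<epsilon>, of \<xi>] by blast
  have p0: "0 \<le> \<psi> \<xi>" by (rule psi_nonneg)
  \<comment> \<open>\<open>l\<close> is the logarithm of \<open>1/\<delta>\<close>. It is chosen so
    large that the fixed cost k of the transition layers and the loss \<open>ln 4\<close> from
    taking \<kappa> below \<delta> together stay below \<open>l * \<epsilon>\<close>.\<close>
  define l where "l = (k + 2 * \<psi> \<xi> * ln 4 + 1) / \<epsilon> + 2"
  have l: "l \<ge> 2" "k + 2 * \<psi> \<xi> * ln 4 < l * \<epsilon>"
  proof -
    have "l * \<epsilon> = k + 2 * \<psi> \<xi> * ln 4 + 1 + 2 * \<epsilon>" using \<epsilon> by (simp add: l_def field_simps)
    then show "k + 2 * \<psi> \<xi> * ln 4 < l * \<epsilon>" using \<epsilon> by linarith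
    show "l \<ge> 2" using T(2) p0 \<epsilon> by (simp add: l_def)
  qed
  define \<delta> where "\<delta> = exp (- l)"
  have ld: "ln (1/\<delta>) = l" "ln \<delta> = - l" by (simp_all add: \<delta>_def ln_div)
  have \<delta>: "\<delta> \<in> {0<..<1/2}"
  proof -
    have "exp l > 2" using exp_ge_add_one_self[of l] l(1) by linarith
    then show ?thesis by (simp add: \<delta>_def exp_minus field_simps)
  qed
  \<comment> \<open>The potential is linear on the open disc of radius \<open>\<delta>/2\<close>; a
    quarter of \<delta> puts the closed disc of radius \<kappa> inside.\<close>
  define \<kappa> where "\<kappa> = \<delta>/4"
  have \<kappa>: "0 < \<kappa>" "\<kappa> \<le> 1/2" "\<kappa> < 1" "\<kappa> < \<delta>/2" using \<delta> by (auto simp: \<kappa>_def)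
  have lk: "ln (1/\<kappa>) = l + ln 4" using \<delta> ld(2) by (simp add: \<kappa>_def ln_div)
  obtain \<Phi> where \<Phi>: "\<Phi> \<in> supported 1"
    "\<forall>x. norm x < \<delta>/2 \<longrightarrow> partial_deriv 1 \<Phi> x = ln \<delta> * T$2 \<and> partial_deriv 2 \<Phi> x = - ln \<delta> * T$1 \<and> airy \<Phi> x = 0"
    "(\<integral>\<^sup>+x. ennreal (airy \<Phi> x \<bullet> dual (airy \<Phi> x)) \<partial>lborel) \<le> ennreal (ln (1/\<delta>) * (2 * \<psi> \<xi> + \<epsilon>) + k)"
    using tst[OF \<delta>] by blast
  have \<Phi>2: "partial_deriv 1 \<Phi> x = ln \<delta> * T$2 \<and> partial_deriv 2 \<Phi> x = - ln \<delta> * T$1 \<and> airy \<Phi> x = 0" if "norm x \<le> \<kappa>" for x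
    using \<Phi>(2) that \<kappa>(4) by simp
  define e where "e = ln (1/\<delta>) * (2 * \<psi> \<xi> + \<epsilon>) + k"
  have e0: "0 \<le> e" unfolding e_def ld using l(1) p0 \<epsilon> T(2) by simp
  obtain M1 where M1: "\<And>x. \<bar>partial_deriv 1 \<Phi> x\<bar> \<le> M1" using supported_bounded[OF supported_partial_deriv[OF \<Phi>(1)]] by metis
  obtain M2 where M2: "\<And>x. \<bar>partial_deriv 2 \<Phi> x\<bar> \<le> M2" using supported_bounded[OF supported_partial_deriv[OF \<Phi>(1)]] by metis
  define M where "M = max M1 M2"
  have M: "\<bar>partial_deriv 1 \<Phi> x\<bar> \<le> M" "\<bar>partial_deriv 2 \<Phi> x\<bar> \<le> M" for x
    using M1[of x] M2[of x] by (auto simp: M_def)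
  define g where "g \<zeta> = \<zeta>$1 * (- ln \<delta> * T$1) - \<zeta>$2 * (ln \<delta> * T$2)" for \<zeta> :: "real^2"
  have g\<xi>: "g \<xi> = l * (2 * \<psi> \<xi>)"
    unfolding T(1)[symmetric] by (simp add: g_def ld inner_vec_def sum_2 algebra_simps)
  define A where "A \<alpha> = (\<rho> \<alpha> * \<kappa>) powr (2*\<alpha>) * (\<alpha> / (1 - \<kappa> powr (2*\<alpha>)))" for \<alpha>
  define Y where "Y \<alpha> \<zeta> = 2 * (kernel_mass \<alpha> * (\<kappa> powr \<alpha> * (1 - \<alpha>/2) * g \<zeta> - (2 * M * norm \<zeta>) * (1 - \<kappa> powr \<alpha>))) - e" for \<alpha> \<zeta>
  let ?F = "at_right (0::real) \<times>\<^sub>F nhds \<xi>"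
  have fs: "(fst \<longlongrightarrow> 0) ?F" "(snd \<longlongrightarrow> \<xi>) ?F"
    using filterlim_fst[of "at_right (0::real)" "nhds \<xi>"] filterlim_snd[of "nhds \<xi>" "at_right (0::real)"]
    by (auto simp: filterlim_at)
  have lift: "((\<lambda>p. f (fst p)) \<longlongrightarrow> c) ?F" if "(f \<longlongrightarrow> c) (at_right 0)" for f :: "real \<Rightarrow> real" and c
    by (rule filterlim_compose[OF that filterlim_fst])
  have gT: "((\<lambda>p. g (snd p)) \<longlongrightarrow> g \<xi>) ?F"
    unfolding g_def by (intro tendsto_intros fs)
  have At: "((\<lambda>p. A (fst p)) \<longlongrightarrow> 1 * (1 / (2 * ln (1/\<kappa>)))) ?F"
    unfolding A_def by (intro tendsto_mult lift horizon_factor_tendsto geometric_factor_tendsto \<kappa> \<rho>)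
  have Yt: "((\<lambda>p. Y (fst p) (snd p)) \<longlongrightarrow> 2 * (1 * (\<kappa> powr 0 * (1 - 0/2) * g \<xi> - (2 * M * norm \<xi>) * (1 - \<kappa> powr 0))) - e) ?F"
    unfolding Y_def using \<kappa>(1) by (intro tendsto_intros lift[OF kernel_mass_tendsto] gT fs) auto
  have "((\<lambda>p. A (fst p) * Y (fst p) (snd p) - (\<psi> (snd p) - \<epsilon>)) \<longlongrightarrow>
      1 * (1 / (2 * ln (1/\<kappa>))) * (2 * (1 * (\<kappa> powr 0 * (1 - 0/2) * g \<xi> - (2 * M * norm \<xi>) * (1 - \<kappa> powr 0))) - e) - (\<psi> \<xi> - \<epsilon>)) ?F"
  proof (intro tendsto_diff tendsto_mult At Yt tendsto_const)
    have "isCont \<psi> \<xi>" using psi_continuous[of UNIV] by (simp add: continuous_on_eq_continuous_at)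
    then show "((\<lambda>p. \<psi> (snd p)) \<longlongrightarrow> \<psi> \<xi>) ?F" by (rule isCont_tendsto_compose[OF _ fs(2)])
  qed
  \<comment> \<open>The limit is (2 g - e) / (2 (l + ln 4)). The work g is l times twice the energy
    \<psi>, while e is l times twice \<psi> plus small terms, so 2 g - e is about 2 l times
    \<psi>.\<close>
  moreover have "1 * (1 / (2 * ln (1/\<kappa>))) * (2 * (1 * (\<kappa> powr 0 * (1 - 0/2) * g \<xi> - (2 * M * norm \<xi>) * (1 - \<kappa> powr 0))) - e) - (\<psi> \<xi> - \<epsilon>) > 0"
  proof -
    have L: "0 < l + ln 4" using l(1) by (simp add: add_pos_nonneg)
    have "(\<psi> \<xi> - \<epsilon>) * (2 * (l + ln 4)) < 2 * g \<xi> - e"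
    proof -
      have "2 * g \<xi> - e - (\<psi> \<xi> - \<epsilon>) * (2 * (l + ln 4)) = l * \<epsilon> - (k + 2 * \<psi> \<xi> * ln 4) + 2 * \<epsilon> * ln 4"
        unfolding g\<xi> e_def ld by (simp add: algebra_simps)
      moreover have "0 \<le> 2 * \<epsilon> * ln 4" using \<epsilon> by simp
      ultimately show ?thesis using l(2) by linarith
    qed
    then have "\<psi> \<xi> - \<epsilon> < (2 * g \<xi> - e) / (2 * (l + ln 4))" using L by (subst pos_less_divide_eq) auto
    then show ?thesis unfolding lk using \<kappa>(1) by simp
  qed
  ultimately have ev1: "\<forall>\<^sub>F p in ?F. 0 < A (fst p) * Y (fst p) (snd p) - (\<psi> (snd p) - \<epsilon>)"
    by (rule order_tendstoD(1))
  \<comment> \<open>Strict positivity, from \<xi> being nonzero, persists for \<zeta> near \<xi> and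
    supplies the sign condition of \<open>cell_energy_lower\<close>.\<close>
  have "0 < g \<xi>" unfolding g\<xi> using psi_pos[OF \<xi>] l(1) by simp
  then have ev2: "\<forall>\<^sub>F p in ?F. 0 < g (snd p)" by (rule order_tendstoD(1)[OF gT])
  have ev3: "\<forall>\<^sub>F p in ?F. fst p \<in> {0<..<1}"
    using eventually_at_right_real[of 0 "1::real", simplified] by (intro eventually_compose_filterlim[OF _ filterlim_fst]) simp
  have "\<forall>\<^sub>F p in ?F. ereal (\<psi> (snd p) - \<epsilon>) \<le> ereal (2 * fst p) * cell_energy w C (snd p) (fst p) (\<rho> (fst p))"
    using ev1 ev2 ev3
  proof eventually_elim
    case (elim p)
    have a: "0 < fst p" "fst p < 1" and r: "0 < \<rho> (fst p)" using elim(3) \<rho>(1)[of "fst p"] by auto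
    have g0: "0 \<le> snd p $ 1 * (- ln \<delta> * T$1) - snd p $ 2 * (ln \<delta> * T$2)" using elim(2) by (simp add: g_def)
    have "ereal (\<psi> (snd p) - \<epsilon>) \<le> ereal (A (fst p) * Y (fst p) (snd p))" using elim(1) by simp
    also have "\<dots> \<le> ereal (2 * fst p) * cell_energy w C (snd p) (fst p) (\<rho> (fst p))"
      unfolding A_def Y_def g_def
      by (rule cell_energy_lower[OF a r \<kappa>(1,2) \<Phi>(1) \<Phi>2 M \<Phi>(3)[folded e_def] e0 g0])
    finally show ?case .
  qed
  then obtain P Q where PQ: "eventually P (at_right (0::real))" "eventually Q (nhds \<xi>)"
    "\<And>\<alpha> \<zeta>. P \<alpha> \<Longrightarrow> Q \<zeta> \<Longrightarrow> ereal (\<psi> \<zeta> - \<epsilon>) \<le> ereal (2 * \<alpha>) * cell_energy w C \<zeta> \<alpha> (\<rho> \<alpha>)"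
    unfolding eventually_prod_filter by auto
  from PQ(2) obtain U where U: "open U" "\<xi> \<in> U" "\<And>\<zeta>. \<zeta> \<in> U \<Longrightarrow> Q \<zeta>" unfolding eventually_nhds by blast
  have "\<forall>\<^sub>F \<alpha> in at_right 0. \<forall>\<zeta>\<in>U. ereal (\<psi> \<zeta> - \<epsilon>) \<le> ereal (2*\<alpha>) * cell_energy w C \<zeta> \<alpha> (\<rho> \<alpha>)"
    using PQ(1) by eventually_elim (use PQ(3) U(3) in blast)
  with U(1,2) show thesis by (rule that)
qed

end

section \<open>The upper bound\<close>

lemma has_bochner_integral_norm_powr_inf:
  assumes "p < -2" "c > 0"
  shows "has_bochner_integral lborel (\<lambda>x::real^2. norm x powr p * indicator {c..} (norm x)) (2*pi * c powr (p+2) / - (p+2))"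
proof (rule has_bochner_integral_nn_integral)
  have "(\<integral>\<^sup>+x. ennreal (norm (x::real^2) powr p * indicator {c..} (norm x)) \<partial>lborel)
    = (\<integral>\<^sup>+x. ennreal (norm (x::real^2) powr p) * indicator {c..} (norm x) \<partial>lborel)"
    by (intro nn_integral_cong) (auto simp: indicator_def)
  then show "(\<integral>\<^sup>+x. ennreal (norm (x::real^2) powr p * indicator {c..} (norm x)) \<partial>lborel) = ennreal (2*pi * c powr (p+2) / - (p+2))"
    using nn_integral_norm_powr_inf[OF assms] by simp
  show "(\<lambda>x::real^2. norm x powr p * indicator {c..} (norm x)) \<in> borel_measurable lborel" by measurable
qed (use assms in \<open>auto intro!: divide_nonneg_pos mult_nonneg_nonneg\<close>)

lemma kernel_near_integral:
  fixes x :: "real^2"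
  assumes w: "horizon_profile w" and \<alpha>: "0 < \<alpha>" "\<alpha> < 1" and \<rho>: "0 < \<rho>" and s: "0 \<le> s"
  defines "c \<equiv> (LINT y|lborel. Q_kernel w \<alpha> \<rho> (x - y) * indicator (cball x s) y)"
  shows "integrable lborel (\<lambda>y. Q_kernel w \<alpha> \<rho> (x - y) * indicator (cball x s) y)" "0 \<le> c" "c \<le> kernel_mass \<alpha> * s powr \<alpha>"
proof -
  let ?Q = "Q_kernel w \<alpha> \<rho>"
  let ?P = "\<lambda>z::real^2. norm z powr (\<alpha> - 2) * indicator (cball 0 s) z"
  have Qm[measurable]: "?Q \<in> borel_measurable borel" by (rule Q_kernel_measurable[OF w \<alpha> \<rho>])
  have i: "integrable lborel (\<lambda>z. ?Q z * indicator (cball 0 s) z)"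
    by (rule integrable_real_mult_indicator[OF _ Q_kernel_integrable[OF w \<alpha> \<rho>]]) (simp add: borel_closed)
  have P: "integrable lborel ?P" "(LINT z|lborel. ?P z) = 2*pi * s powr \<alpha> / \<alpha>"
    using has_bochner_integral_norm_powr[of "\<alpha> - 2" s] \<alpha> s by (auto simp: has_bochner_integral_iff)
  have m: "(\<lambda>z. ?Q z * indicator (cball 0 s) z) \<in> borel_measurable borel"
    by (intro borel_measurable_times Qm borel_measurable_indicator) (simp add: borel_closed)
  have eq: "?Q (x - y) * indicator (cball x s) y = (\<lambda>z. ?Q z * indicator (cball 0 s) z) (y - x)" for y
    by (simp add: Q_kernel_def norm_minus_commute indicator_def dist_norm)
  show "integrable lborel (\<lambda>y. ?Q (x - y) * indicator (cball x s) y)"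
    unfolding eq by (rule integral_shift(2)[OF m i])
  have c: "c = (LINT z|lborel. ?Q z * indicator (cball 0 s) z)"
    unfolding c_def eq by (rule integral_shift(1)[OF m])
  show "0 \<le> c" unfolding c using Q_kernel_nonneg[OF w \<alpha> \<rho>] by (intro Bochner_Integration.integral_nonneg) auto
  have "c \<le> (LINT z|lborel. ?P z / riesz_gamma \<alpha>)"
    unfolding c
  proof (rule integral_mono_AE[OF i integrable_divide_zero])
    show "integrable lborel ?P" by (rule P(1))
    have "AE z in lborel. z \<noteq> (0::real^2)" by (rule AE_lborel_singleton)
    then show "AE z in lborel. ?Q z * indicator (cball 0 s) z \<le> ?P z / riesz_gamma \<alpha>"
    proof eventually_elim
      case (elim z)
      show ?case using Q_kernel_le[OF w \<alpha> \<rho> elim] by (simp add: indicator_def)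
    qed
  qed
  also have "\<dots> = kernel_mass \<alpha> * s powr \<alpha>"
    using \<alpha> riesz_gamma_pos[OF \<alpha>] by (simp add: P kernel_mass_def)
  finally show "c \<le> kernel_mass \<alpha> * s powr \<alpha>" .
qed

text \<open>If y is at most twice as long as x, the distance to x is at least
  \<open>\<delta> * norm x\<close> and the kernel is bounded by a constant; for longer y the
  distance is at least half of \<open>norm y\<close>. Both majorants integrate explicitly.\<close>

lemma kernel_far:
  assumes w: "horizon_profile w" and \<alpha>: "0 < \<alpha>" "\<alpha> < 1" and \<rho>: "0 < \<rho>" and \<delta>: "0 < \<delta>"
    and x: "x \<noteq> 0" and y: "y \<noteq> 0" "norm (x - y) > \<delta> * norm x"
  shows "Q_kernel w \<alpha> \<rho> (x - y) * (1 / norm y) \<le> 1 / riesz_gamma \<alpha> *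
    ((\<delta> * norm x) powr (\<alpha> - 2) * (norm y powr -1 * indicator (cball 0 (2 * norm x)) y) + 4 * (norm y powr (\<alpha> - 3) * indicator {2 * norm x..} (norm y)))"
proof -
  have \<gamma>: "riesz_gamma \<alpha> > 0" by (rule riesz_gamma_pos[OF \<alpha>])
  have "0 \<le> \<delta> * norm x" using \<delta> by simp
  then have "0 < norm (x - y)" using y(2) by linarith
  then have xy: "x - y \<noteq> 0" by simp
  have r: "norm x > 0" "norm y > 0" using x y by auto
  have "norm (x - y) powr (\<alpha> - 2) * (1 / norm y) \<le>
    (\<delta> * norm x) powr (\<alpha> - 2) * (norm y powr -1 * indicator (cball 0 (2 * norm x)) y) + 4 * (norm y powr (\<alpha> - 3) * indicator {2 * norm x..} (norm y))"
  proof (cases "norm y \<le> 2 * norm x")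
    case True
    have "norm (x - y) powr (\<alpha> - 2) \<le> (\<delta> * norm x) powr (\<alpha> - 2)"
      using \<delta> r y(2) \<alpha> by (intro powr_mono2') auto
    then have "norm (x - y) powr (\<alpha> - 2) * (1 / norm y) \<le> (\<delta> * norm x) powr (\<alpha> - 2) * (1 / norm y)"
      by (rule mult_right_mono) simp
    moreover have "norm y powr -1 = 1 / norm y" using r by (simp add: powr_minus_divide)
    moreover have "0 \<le> 4 * (norm y powr (\<alpha> - 3) * indicator {2 * norm x..} (norm y))" by simp
    moreover have "indicator (cball 0 (2 * norm x)) y = (1::real)" using True by simp
    ultimately show ?thesis by (simp only: mult_1_right)
  next
    case False
    have "norm y / 2 \<le> norm (x - y)" using False norm_triangle_ineq2[of y x] by (simp add: norm_minus_commute)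
    then have "norm (x - y) powr (\<alpha> - 2) \<le> (norm y / 2) powr (\<alpha> - 2)"
      using r \<alpha> by (intro powr_mono2') auto
    also have "\<dots> = norm y powr (\<alpha> - 2) * 2 powr (2 - \<alpha>)"
      using r by (simp add: powr_divide powr_diff)
    \<comment> \<open>Halving the length costs a power of 2 with exponent
      \<open>2 - \<alpha>\<close>, at most 4.\<close>
    also have "\<dots> \<le> norm y powr (\<alpha> - 2) * 4"
    proof (rule mult_left_mono)
      have "(2::real) powr (2 - \<alpha>) \<le> 2 powr 2" using \<alpha> by (intro powr_mono) auto
      then show "(2::real) powr (2 - \<alpha>) \<le> 4" by simp
    qed simp
    finally have "norm (x - y) powr (\<alpha> - 2) * (1 / norm y) \<le> norm y powr (\<alpha> - 2) * 4 * (1 / norm y)"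
      by (rule mult_right_mono) simp
    also have "\<dots> = 4 * norm y powr (\<alpha> - 3)"
      using r by (simp add: powr_diff power2_eq_square power3_eq_cube powr_numeral)
    finally show ?thesis using False by simp
  qed
  then have "1 / riesz_gamma \<alpha> * (norm (x - y) powr (\<alpha> - 2) * (1 / norm y)) \<le> 1 / riesz_gamma \<alpha> *
    ((\<delta> * norm x) powr (\<alpha> - 2) * (norm y powr -1 * indicator (cball 0 (2 * norm x)) y) + 4 * (norm y powr (\<alpha> - 3) * indicator {2 * norm x..} (norm y)))"
    using \<gamma> by (intro mult_left_mono) auto
  moreover have "Q_kernel w \<alpha> \<rho> (x - y) * (1 / norm y) \<le> norm (x - y) powr (\<alpha> - 2) / riesz_gamma \<alpha> * (1 / norm y)"
    by (rule mult_right_mono[OF Q_kernel_le[OF w \<alpha> \<rho> xy]]) simp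
  ultimately show ?thesis by simp
qed

text \<open>The bound \<open>\<alpha> \<le> 1/2\<close> keeps the tail constant
  \<open>1 / (1 - \<alpha>)\<close> below 2. No factor \<open>1/\<alpha>\<close> appears, so after
  division by \<open>riesz_gamma \<alpha>\<close>, which blows up, the far field becomes
  negligible.\<close>

lemma far_integral:
  fixes r :: real
  assumes \<alpha>: "0 < \<alpha>" "\<alpha> \<le> 1/2" and \<delta>: "0 < \<delta>" "\<delta> \<le> 1" and r: "r > 0"
  defines "H \<equiv> \<lambda>y::real^2. (\<delta> * r) powr (\<alpha> - 2) * (norm y powr -1 * indicator (cball 0 (2 * r)) y) + 4 * (norm y powr (\<alpha> - 3) * indicator {2 * r..} (norm y))"
  shows "integrable lborel H" "(LINT y|lborel. H y) \<le> r powr (\<alpha> - 1) * (4 * pi / \<delta>\<^sup>2 + 16 * pi)"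
proof -
  have a: "has_bochner_integral lborel (\<lambda>x::real^2. norm x powr -1 * indicator (cball 0 (2 * r)) x) (4*pi*r)"
    using has_bochner_integral_norm_powr[of "-1" "2*r"] r by (simp add: mult.assoc)
  have b: "has_bochner_integral lborel (\<lambda>x::real^2. norm x powr (\<alpha> - 3) * indicator {2 * r..} (norm x)) (2*pi * (2*r) powr (\<alpha> - 1) / (1 - \<alpha>))"
    using has_bochner_integral_norm_powr_inf[of "\<alpha> - 3" "2*r"] \<alpha> r by simp
  have h: "has_bochner_integral lborel H ((\<delta> * r) powr (\<alpha> - 2) * (4*pi*r) + 4 * (2*pi * (2*r) powr (\<alpha> - 1) / (1 - \<alpha>)))"
    unfolding H_def by (intro has_bochner_integral_add has_bochner_integral_mult_right a b)
  then show "integrable lborel H" by (rule integrable.intros)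
  have "(\<delta> * r) powr (\<alpha> - 2) * (4*pi*r) \<le> r powr (\<alpha> - 1) * (4 * pi / \<delta>\<^sup>2)"
  proof -
    have "\<delta> powr (\<alpha> - 2) \<le> \<delta> powr (-2)" using \<delta> \<alpha> by (intro powr_mono') auto
    then have d: "\<delta> powr (\<alpha> - 2) \<le> 1 / \<delta>\<^sup>2" using \<delta> by (simp add: powr_minus_divide powr_numeral)
    have "r powr (\<alpha> - 2) * r = r powr (\<alpha> - 1)" using r powr_add[of r "\<alpha> - 2" 1] by simp
    then have "(\<delta> * r) powr (\<alpha> - 2) * (4*pi*r) = r powr (\<alpha> - 1) * (4 * pi * \<delta> powr (\<alpha> - 2))"
      using \<delta> r by (simp add: powr_mult mult_ac)
    also have "\<dots> \<le> r powr (\<alpha> - 1) * (4 * pi * (1 / \<delta>\<^sup>2))" using d by (intro mult_left_mono) auto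
    finally show ?thesis by simp
  qed
  moreover have "4 * (2*pi * (2*r) powr (\<alpha> - 1) / (1 - \<alpha>)) \<le> r powr (\<alpha> - 1) * (16 * pi)"
  proof -
    have "(2*r) powr (\<alpha> - 1) \<le> r powr (\<alpha> - 1)" using r \<alpha> by (intro powr_mono2') auto
    then have "(2*r) powr (\<alpha> - 1) / (1 - \<alpha>) \<le> r powr (\<alpha> - 1) / (1/2)" using \<alpha> by (intro frac_le) auto
    then have "8 * pi * ((2*r) powr (\<alpha> - 1) / (1 - \<alpha>)) \<le> 8 * pi * (r powr (\<alpha> - 1) / (1/2))" by (rule mult_left_mono) simp
    then show ?thesis by (simp add: mult_ac)
  qed
  ultimately show "(LINT y|lborel. H y) \<le> r powr (\<alpha> - 1) * (4 * pi / \<delta>\<^sup>2 + 16 * pi)"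
    unfolding has_bochner_integral_integral_eq[OF h] by (simp add: distrib_left)
qed

section \<open>The dislocation field as competitor\<close>

context cell_setting
begin

text \<open>Uniform continuity on the annulus between 1/2 and 3/2, transported to all scales by
  homogeneity and to all \<zeta> by linearity. The bound \<open>\<delta> \<le> 1/2\<close> keeps the
  rescaled y in the annulus.\<close>

lemma eta_modulus:
  assumes \<omega>: "\<omega> > 0"
  obtains \<delta> where "0 < \<delta>" "\<delta> \<le> 1/2"
    "\<And>\<zeta> x y. x \<noteq> 0 \<Longrightarrow> norm (x - y) \<le> \<delta> * norm x \<Longrightarrow> norm (\<eta> \<zeta> y - \<eta> \<zeta> x) \<le> \<omega> * norm \<zeta> / norm x"
proof -
  let ?S = "cball 0 (3/2) - ball (0::real^2) (1/2)"
  have S: "compact ?S" by (rule compact_diff) auto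
  have "\<exists>d>0. \<forall>x\<in>?S. \<forall>y\<in>?S. dist y x < d \<longrightarrow> dist (\<eta> (axis i 1) y) (\<eta> (axis i 1) x) < \<omega>/2" for i
  proof -
    have "continuous_on ?S (\<eta> (axis i 1))" by (rule continuous_on_subset[OF eta_continuous]) auto
    from compact_uniformly_continuous[OF this S] show ?thesis
      unfolding uniformly_continuous_on_def using \<omega> half_gt_zero by blast
  qed
  then obtain d where d: "\<And>i. d i > 0"
    "\<And>i x y. x \<in> ?S \<Longrightarrow> y \<in> ?S \<Longrightarrow> dist y x < d i \<Longrightarrow> dist (\<eta> (axis i 1) y) (\<eta> (axis i 1) x) < \<omega>/2"
    by metis
  define \<delta> where "\<delta> = min (1/2) (min (d 1) (d 2) / 2)"
  have \<delta>: "0 < \<delta>" "\<delta> \<le> 1/2" "\<delta> < d 1" "\<delta> < d 2" using d(1)[of 1] d(1)[of 2] by (auto simp: \<delta>_def min_def)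
  show thesis
  proof (rule that[OF \<delta>(1,2)])
    fix \<zeta> x y :: "real^2" assume x: "x \<noteq> 0" and xy: "norm (x - y) \<le> \<delta> * norm x"
    define r where "r = norm x"
    have r: "r > 0" using x by (simp add: r_def)
    define x' y' where "x' = (1/r) *\<^sub>R x" and "y' = (1/r) *\<^sub>R y"
    have nx: "norm x' = 1" using r by (simp add: x'_def r_def)
    have "norm (x' - y') = norm (x - y) / r"
      unfolding x'_def y'_def scaleR_diff_right[symmetric] using r by simp
    also have "\<dots> \<le> \<delta>" using xy r by (simp add: r_def[symmetric] pos_divide_le_eq)
    finally have dxy: "norm (x' - y') \<le> \<delta>" .
    have ny: "1/2 \<le> norm y'" "norm y' \<le> 3/2"
      using dxy \<delta>(2) nx norm_triangle_ineq2[of x' y'] norm_triangle_ineq3[of x' y'] by linarith+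
    have y0: "y' \<noteq> 0" and x0: "x' \<noteq> 0" using ny nx by auto
    have xS: "x' \<in> ?S" "y' \<in> ?S" using nx ny by auto
    have "dist y' x' = norm (x' - y')" by (simp add: dist_norm norm_minus_commute)
    then have c: "norm (\<eta> (axis 1 1) y' - \<eta> (axis 1 1) x') \<le> \<omega>/2" "norm (\<eta> (axis 2 1) y' - \<eta> (axis 2 1) x') \<le> \<omega>/2"
      using d(2)[OF xS, of 1] d(2)[OF xS, of 2] dxy \<delta> by (simp_all add: dist_norm less_imp_le)
    have "\<eta> \<zeta> y' - \<eta> \<zeta> x' = \<zeta>$1 *\<^sub>R (\<eta> (axis 1 1) y' - \<eta> (axis 1 1) x') + \<zeta>$2 *\<^sub>R (\<eta> (axis 2 1) y' - \<eta> (axis 2 1) x')"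
      using eta_expand[OF x0, of \<zeta>] eta_expand[OF y0, of \<zeta>] by (simp add: algebra_simps)
    then have "norm (\<eta> \<zeta> y' - \<eta> \<zeta> x') \<le> \<bar>\<zeta>$1\<bar> * norm (\<eta> (axis 1 1) y' - \<eta> (axis 1 1) x') + \<bar>\<zeta>$2\<bar> * norm (\<eta> (axis 2 1) y' - \<eta> (axis 2 1) x')"
      by (metis norm_scaleR norm_triangle_ineq)
    also have "\<dots> \<le> norm \<zeta> * (\<omega>/2) + norm \<zeta> * (\<omega>/2)"
      by (intro add_mono mult_mono c component_le_norm_cart) auto
    finally have "norm (\<eta> \<zeta> y' - \<eta> \<zeta> x') \<le> \<omega> * norm \<zeta>" by simp
    moreover have "\<eta> \<zeta> x' = r *\<^sub>R \<eta> \<zeta> x" unfolding x'_def using eta_scale[of "1/r" x \<zeta>] r x by simp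
    moreover have "\<eta> \<zeta> y' = r *\<^sub>R \<eta> \<zeta> y" unfolding y'_def using eta_scale[of "1/r" y \<zeta>] r y0 by (auto simp: y'_def)
    ultimately have "norm (r *\<^sub>R (\<eta> \<zeta> y - \<eta> \<zeta> x)) \<le> \<omega> * norm \<zeta>" by (simp only: scaleR_diff_right)
    then have "r * norm (\<eta> \<zeta> y - \<eta> \<zeta> x) \<le> \<omega> * norm \<zeta>" using r by simp
    then show "norm (\<eta> \<zeta> y - \<eta> \<zeta> x) \<le> \<omega> * norm \<zeta> / norm x"
      using r unfolding r_def[symmetric] by (simp add: pos_le_divide_eq mult.commute)
  qed
qed

text \<open>The multiplier c is the kernel mass of the ball of radius \<delta> |x| around x. Inside,
  the error is the oscillation of \<eta>; outside, it is the decay of \<eta> against the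
  kernel.\<close>

lemma potential_near_field:
  assumes \<alpha>: "0 < \<alpha>" "\<alpha> \<le> 1/2" and \<rho>: "0 < \<rho>" and \<delta>: "0 < \<delta>" "\<delta> \<le> 1/2"
    and mod: "\<And>\<zeta> x y. x \<noteq> 0 \<Longrightarrow> norm (x - y) \<le> \<delta> * norm x \<Longrightarrow> norm (\<eta> \<zeta> y - \<eta> \<zeta> x) \<le> \<omega> * norm \<zeta> / norm x"
    and K: "K > 0" "\<And>\<xi> x. x \<noteq> 0 \<Longrightarrow> norm (\<eta> \<xi> x) \<le> K * norm \<xi> / norm x"
    and x: "x \<noteq> 0" and \<omega>: "0 < \<omega>"
  obtains c where "0 \<le> c" "c \<le> kernel_mass \<alpha> * norm x powr \<alpha>"
    "norm (riesz_potential w \<alpha> \<rho> (\<eta> \<zeta>) x - c *\<^sub>R \<eta> \<zeta> x)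
      \<le> norm \<zeta> * norm x powr (\<alpha> - 1) * (kernel_mass \<alpha> * \<omega> + K / riesz_gamma \<alpha> * (4 * pi / \<delta>\<^sup>2 + 16 * pi))"
proof -
  have \<alpha>1: "\<alpha> < 1" using \<alpha> by simp
  let ?Q = "\<lambda>y. Q_kernel w \<alpha> \<rho> (x - y)" and ?\<gamma> = "riesz_gamma \<alpha>" and ?r = "norm x"
  let ?A = "cball x (\<delta> * norm x)"
  let ?D = "4 * pi / \<delta>\<^sup>2 + 16 * pi"
  let ?km = "kernel_mass \<alpha>"
  have \<gamma>: "?\<gamma> > 0" by (rule riesz_gamma_pos[OF \<alpha>(1) \<alpha>1])
  have km: "?km > 0" by (rule kernel_mass_pos[OF \<alpha>(1) \<alpha>1])
  have r: "?r > 0" using x by simp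
  define H where "H = (\<lambda>y::real^2. (\<delta> * ?r) powr (\<alpha> - 2) * (norm y powr -1 * indicator (cball 0 (2 * ?r)) y) + 4 * (norm y powr (\<alpha> - 3) * indicator {2 * ?r..} (norm y)))"
  have H: "integrable lborel H" "(LINT y|lborel. H y) \<le> ?r powr (\<alpha> - 1) * ?D"
    unfolding H_def using \<delta> by (intro far_integral \<alpha> \<delta> r; simp)+
  have H0: "0 \<le> H y" for y unfolding H_def by (intro add_nonneg_nonneg mult_nonneg_nonneg) auto
  have s: "0 \<le> \<delta> * ?r" using \<delta> by simp
  define q where "q = (\<lambda>y. ?Q y * indicator ?A y)"
  define c where "c = (LINT y|lborel. q y)"
  note cn = kernel_near_integral[OF w \<alpha>(1) \<alpha>1 \<rho> s, of x, folded q_def, folded c_def]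
  have Qm[measurable]: "?Q \<in> borel_measurable borel"
    using measurable_compose[OF _ Q_kernel_measurable[OF w \<alpha>(1) \<alpha>1 \<rho>], of "\<lambda>y. x - y" borel] by simp
  have Q0: "0 \<le> ?Q y" for y by (rule Q_kernel_nonneg[OF w \<alpha>(1) \<alpha>1 \<rho>])
  have sm: "(\<delta> * ?r) powr \<alpha> \<le> ?r powr \<alpha>" using \<delta> r \<alpha> by (intro powr_mono2) (auto simp: mult_le_cancel_right1)
  have cle: "c \<le> ?km * ?r powr \<alpha>"
    using cn(3) mult_left_mono[OF sm less_imp_le[OF km]] by linarith
  \<comment> \<open>The value at x is subtracted on the near ball only, where q equals the kernel;
    far from x all of \<eta> counts as error.\<close>
  define f where "f y = ?Q y *\<^sub>R \<eta> \<zeta> y - q y *\<^sub>R \<eta> \<zeta> x" for y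
  define b where "b y = q y * (\<omega> * norm \<zeta> / ?r) + (K * norm \<zeta> / ?\<gamma>) * H y" for y
  have qm[measurable]: "q \<in> borel_measurable borel" using cn(1) by (simp add: borel_measurable_integrable)
  have fm: "f \<in> borel_measurable lborel" unfolding f_def by measurable
  have bi: "integrable lborel b" unfolding b_def by (intro Bochner_Integration.integrable_add integrable_mult_left integrable_mult_right cn(1) H(1))
  have fb: "norm (f y) \<le> b y" if y: "y \<noteq> 0" for y
  proof (cases "y \<in> ?A")
    case True
    then have "f y = ?Q y *\<^sub>R (\<eta> \<zeta> y - \<eta> \<zeta> x)" by (simp add: f_def q_def scaleR_diff_right)
    then have "norm (f y) = ?Q y * norm (\<eta> \<zeta> y - \<eta> \<zeta> x)" using Q0[of y] by simp
    also have "\<dots> \<le> ?Q y * (\<omega> * norm \<zeta> / ?r)"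
      using True by (intro mult_left_mono mod x Q0) (simp add: dist_norm)
    also have "\<dots> \<le> b y" using True H0[of y] K(1) \<gamma> by (simp add: b_def q_def)
    finally show ?thesis .
  next
    case False
    then have d: "norm (x - y) > \<delta> * ?r" by (simp add: dist_norm)
    have "norm (f y) = ?Q y * norm (\<eta> \<zeta> y)" using False Q0[of y] by (simp add: f_def q_def)
    also have "\<dots> \<le> ?Q y * (K * norm \<zeta> / norm y)" by (intro mult_left_mono K(2) y Q0)
    also have "\<dots> = (?Q y * (1 / norm y)) * (K * norm \<zeta>)" by simp
    also have "\<dots> \<le> (1 / ?\<gamma> * H y) * (K * norm \<zeta>)"
      unfolding H_def using K(1) by (intro mult_right_mono kernel_far[OF w \<alpha>(1) \<alpha>1 \<rho> \<delta>(1) x y d]) auto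
    also have "\<dots> = b y" using False by (simp add: b_def q_def)
    finally show ?thesis .
  qed
  have AEf: "AE y in lborel. norm (f y) \<le> b y"
    using AE_lborel_singleton[of "0::real^2"] by eventually_elim (rule fb)
  have b0: "0 \<le> b y" for y unfolding b_def q_def
    using Q0 H0 K(1) \<gamma> \<omega> by (intro add_nonneg_nonneg mult_nonneg_nonneg divide_nonneg_nonneg) (auto simp: less_imp_le)
  have fi: "integrable lborel f"
    by (rule Bochner_Integration.integrable_bound[OF bi fm]) (use AEf b0 in \<open>auto elim: eventually_mono\<close>)
  have qi: "integrable lborel (\<lambda>y. q y *\<^sub>R \<eta> \<zeta> x)" using cn(1) by simp
  have "riesz_potential w \<alpha> \<rho> (\<eta> \<zeta>) x = (LINT y|lborel. f y + q y *\<^sub>R \<eta> \<zeta> x)"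
    unfolding riesz_potential_def f_def by simp
  also have "\<dots> = (LINT y|lborel. f y) + c *\<^sub>R \<eta> \<zeta> x"
    unfolding c_def by (subst Bochner_Integration.integral_add[OF fi qi]) (simp add: cn(1))
  finally have "norm (riesz_potential w \<alpha> \<rho> (\<eta> \<zeta>) x - c *\<^sub>R \<eta> \<zeta> x) = norm (LINT y|lborel. f y)" by simp
  also have "\<dots> \<le> (LINT y|lborel. b y)"
    by (rule order_trans[OF integral_norm_bound integral_mono_AE[OF integrable_norm[OF fi] bi AEf]])
  also have "\<dots> = c * (\<omega> * norm \<zeta> / ?r) + (K * norm \<zeta> / ?\<gamma>) * (LINT y|lborel. H y)"
    unfolding b_def c_def using cn(1) H(1) by simp
  also have "\<dots> \<le> (?km * ?r powr \<alpha>) * (\<omega> * norm \<zeta> / ?r) + (K * norm \<zeta> / ?\<gamma>) * (?r powr (\<alpha> - 1) * ?D)"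
    using cle H(2) \<omega> K(1) \<gamma> r by (intro add_mono mult_right_mono mult_left_mono) auto
  also have "\<dots> = norm \<zeta> * ?r powr (\<alpha> - 1) * (?km * \<omega> + K / ?\<gamma> * ?D)"
    using r by (simp add: powr_diff algebra_simps)
  finally show thesis by (rule that[OF cn(2) cle])
qed


text \<open>The quadratic form is expanded around c times \<eta>. Main term and errors all scale
  like \<open>norm x powr (2*\<alpha> - 2)\<close>, whose integral over the disc is of order
  \<open>1/\<alpha>\<close> and is compensated by the factor \<alpha>.\<close>

lemma energy_upper:
  assumes \<alpha>: "0 < \<alpha>" "\<alpha> \<le> 1/2" and \<rho>: "0 < \<rho>" "\<rho> < 1" and \<delta>: "0 < \<delta>" "\<delta> \<le> 1/2"
    and mod: "\<And>\<zeta> x y. x \<noteq> 0 \<Longrightarrow> norm (x - y) \<le> \<delta> * norm x \<Longrightarrow> norm (\<eta> \<zeta> y - \<eta> \<zeta> x) \<le> \<omega> * norm \<zeta> / norm x"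
    and K: "K > 0" "\<And>\<xi> x. x \<noteq> 0 \<Longrightarrow> norm (\<eta> \<xi> x) \<le> K * norm \<xi> / norm x"
    and \<omega>: "0 < \<omega>" and B: "B > 0" "\<And>F. norm (C F) \<le> B * norm F"
  defines "\<epsilon> \<equiv> kernel_mass \<alpha> * \<omega> + K / riesz_gamma \<alpha> * (4 * pi / \<delta>\<^sup>2 + 16 * pi)"
  shows "ennreal \<alpha> * elastic_integral C \<rho> (riesz_potential w \<alpha> \<rho> (\<eta> \<zeta>))
    \<le> ennreal ((kernel_mass \<alpha>)\<^sup>2 * \<psi> \<zeta> + pi * (B * (norm \<zeta>)\<^sup>2 * (2 * kernel_mass \<alpha> * K * \<epsilon> + \<epsilon>\<^sup>2)))"
proof -
  have \<alpha>1: "\<alpha> < 1" using \<alpha> by simp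
  let ?km = "kernel_mass \<alpha>" and ?I = "riesz_potential w \<alpha> \<rho> (\<eta> \<zeta>)" and ?v = "\<lambda>x. C (\<eta> \<zeta> x) \<bullet> \<eta> \<zeta> x"
  have km: "?km > 0" by (rule kernel_mass_pos[OF \<alpha>(1) \<alpha>1])
  have \<epsilon>0: "0 \<le> \<epsilon>"
    unfolding \<epsilon>_def using km \<omega> K(1) riesz_gamma_pos[OF \<alpha>(1) \<alpha>1]
    by (intro add_nonneg_nonneg mult_nonneg_nonneg divide_nonneg_nonneg) auto
  define b where "b = B * (norm \<zeta>)\<^sup>2 * (2 * ?km * K * \<epsilon> + \<epsilon>\<^sup>2)"
  have b0: "0 \<le> b" unfolding b_def using B(1) km K(1) \<epsilon>0 by (intro mult_nonneg_nonneg add_nonneg_nonneg) auto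
  have pt: "C (?I x) \<bullet> ?I x \<le> ?km\<^sup>2 * norm x powr (2*\<alpha>) * ?v x + norm x powr (2*\<alpha> - 2) * b" if x: "x \<noteq> 0" for x
  proof -
    define r where "r = norm x"
    define s where "s = r powr \<alpha>"
    have r: "r > 0" using x by (simp add: r_def)
    have s: "s > 0" using r by (simp add: s_def)
    obtain c where c: "0 \<le> c" "c \<le> ?km * s"
      and Dn: "norm (?I x - c *\<^sub>R \<eta> \<zeta> x) \<le> norm \<zeta> * norm x powr (\<alpha> - 1) * \<epsilon>"
      unfolding s_def r_def \<epsilon>_def by (rule potential_near_field[OF \<alpha> \<rho>(1) \<delta> mod K x \<omega>])
    define D where "D = ?I x - c *\<^sub>R \<eta> \<zeta> x"
    let ?e = "\<eta> \<zeta> x"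
    define p where "p = norm \<zeta> * (s / r) * \<epsilon>"
    have Dp: "norm D \<le> p" using Dn r by (simp add: D_def p_def s_def r_def powr_diff)
    have p0: "0 \<le> p" using s r \<epsilon>0 by (simp add: p_def)
    have en: "norm ?e \<le> K * norm \<zeta> / r" using K(2)[OF x] by (simp add: r_def)
    have I: "?I x = c *\<^sub>R ?e + D" by (simp add: D_def)
    have sy: "C D \<bullet> ?e = C ?e \<bullet> D" using C_adjoint[of D ?e] by (simp add: inner_commute)
    have "C (?I x) \<bullet> ?I x = c\<^sup>2 * ?v x + 2 * c * (C ?e \<bullet> D) + C D \<bullet> D"
      unfolding I linear_add[OF C_linear] linear_cmul[OF C_linear]
      by (simp add: inner_add_left inner_add_right sy power2_eq_square algebra_simps)
    also have "\<dots> \<le> (?km * s)\<^sup>2 * ?v x + 2 * (?km * s) * (B * (K * norm \<zeta> / r) * p) + B * p * p"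
    proof (intro add_mono)
      show "c\<^sup>2 * ?v x \<le> (?km * s)\<^sup>2 * ?v x" using c by (intro mult_right_mono power_mono C_nonneg) auto
      have "C ?e \<bullet> D \<le> norm (C ?e) * norm D" by (rule norm_cauchy_schwarz)
      also have "\<dots> \<le> (B * norm ?e) * p" using Dp B by (intro mult_mono) auto
      also have "\<dots> \<le> (B * (K * norm \<zeta> / r)) * p" using en B p0 by (intro mult_right_mono mult_left_mono) auto
      finally have "2 * c * (C ?e \<bullet> D) \<le> 2 * c * (B * (K * norm \<zeta> / r) * p)" using c by (intro mult_left_mono) auto
      also have "\<dots> \<le> 2 * (?km * s) * (B * (K * norm \<zeta> / r) * p)"
        using c B(1) K(1) r p0 by (intro mult_right_mono mult_left_mono mult_nonneg_nonneg divide_nonneg_nonneg) auto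
      finally show "2 * c * (C ?e \<bullet> D) \<le> 2 * (?km * s) * (B * (K * norm \<zeta> / r) * p)" .
      have "C D \<bullet> D \<le> norm (C D) * norm D" by (rule norm_cauchy_schwarz)
      also have "\<dots> \<le> (B * norm D) * norm D" using B by (intro mult_right_mono) auto
      also have "\<dots> \<le> (B * p) * p" using B(1) Dp p0 by (intro mult_mono) auto
      finally show "C D \<bullet> D \<le> B * p * p" .
    qed
    \<comment> \<open>Every error term contains two factors of size 1/r, one from \<eta> or the
      error field and one from the error field, hence the common power.\<close>
    also have "\<dots> = ?km\<^sup>2 * s\<^sup>2 * ?v x + (s\<^sup>2 / r\<^sup>2) * b"
      using r by (simp add: p_def b_def power2_eq_square field_simps)
    also have "s\<^sup>2 = r powr (2*\<alpha>)" unfolding s_def using powr_add[of r \<alpha> \<alpha>] by (simp add: power2_eq_square)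
    also have "r powr (2*\<alpha>) / r\<^sup>2 = r powr (2*\<alpha> - 2)" using r by (simp add: powr_diff powr_numeral)
    finally show ?thesis unfolding r_def .
  qed
  have vm: "?v \<in> borel_measurable borel"
  proof -
    have "continuous_on UNIV (\<lambda>A. C A \<bullet> A)" by (intro continuous_on_inner C_continuous continuous_on_id)
    from measurable_compose[OF eta_measurable borel_measurable_continuous_onI[OF this]] show ?thesis .
  qed
  define f where "f x = ennreal (?km\<^sup>2 * norm x powr (2*\<alpha>) * ?v x) * indicator {0..\<rho>} (norm x)" for x
  define h where "h x = ennreal (norm x powr (2*\<alpha> - 2)) * indicator {0..\<rho>} (norm x)" for x :: "real^2"
  have fm: "f \<in> borel_measurable borel" unfolding f_def using vm by measurable
  have hm: "h \<in> borel_measurable borel" unfolding h_def by measurable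
  let ?t = "\<rho> powr (2*\<alpha>) / (2*\<alpha>)"
  have t0: "0 \<le> ?t" using \<alpha> by simp
  have hI: "(\<integral>\<^sup>+x. h x \<partial>lborel) = ennreal (2 * pi * ?t)"
    unfolding h_def using nn_integral_norm_powr[of "2*\<alpha> - 2" \<rho>] \<alpha> \<rho> by simp
  have fI: "(\<integral>\<^sup>+x. f x \<partial>lborel) = ennreal (?km\<^sup>2 * ?t * (2 * \<psi> \<zeta>))"
  proof -
    let ?u = "\<lambda>t. ?v (polar 1 t)"
    have uc: "continuous_on {0..2*pi} ?u" by (rule energy_continuous)
    have um: "(\<lambda>t. ?u t) \<in> borel_measurable borel"
      by (intro borel_measurable_continuous_onI energy_continuous)
    have "(\<integral>\<^sup>+x. f x \<partial>lborel) = (\<integral>\<^sup>+r. \<integral>\<^sup>+t. ennreal r * indicator {0<..} r * indicator {0..<2*pi} t * f (polar r t) \<partial>lborel \<partial>lborel)"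
      by (rule nn_integral_polar[OF fm])
    also have "\<dots> = (\<integral>\<^sup>+r. \<integral>\<^sup>+t. (ennreal (?km\<^sup>2) * (ennreal (r powr (2*\<alpha> - 1)) * indicator {0..\<rho>} r)) * (indicator {0..<2*pi} t * ennreal (?u t)) \<partial>lborel \<partial>lborel)"
    proof (intro nn_integral_cong)
      fix r t :: real
      show "ennreal r * indicator {0<..} r * indicator {0..<2*pi} t * f (polar r t)
        = (ennreal (?km\<^sup>2) * (ennreal (r powr (2*\<alpha> - 1)) * indicator {0..\<rho>} r)) * (indicator {0..<2*pi} t * ennreal (?u t))"
      proof (cases "r > 0")
        case True
        have "?v (polar r t) = (1/r\<^sup>2) * ?u t"
          using eta_polar[OF True, of \<zeta> t] by (simp add: linear_cmul[OF C_linear] power2_eq_square)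
        then have "r * (?km\<^sup>2 * norm (polar r t) powr (2*\<alpha>) * ?v (polar r t)) = ?km\<^sup>2 * (r powr (2*\<alpha> - 1) * ?u t)"
          using True by (simp add: powr_diff power2_eq_square)
        moreover have "ennreal r * ennreal (?km\<^sup>2 * norm (polar r t) powr (2*\<alpha>) * ?v (polar r t)) = ennreal (r * (?km\<^sup>2 * norm (polar r t) powr (2*\<alpha>) * ?v (polar r t)))"
          using True C_nonneg by (intro ennreal_mult[symmetric]) auto
        moreover have "ennreal (?km\<^sup>2 * (r powr (2*\<alpha> - 1) * ?u t)) = ennreal (?km\<^sup>2) * (ennreal (r powr (2*\<alpha> - 1)) * ennreal (?u t))"
          using C_nonneg by (simp add: ennreal_mult)
        ultimately have E: "ennreal r * ennreal (?km\<^sup>2 * norm (polar r t) powr (2*\<alpha>) * ?v (polar r t)) = ennreal (?km\<^sup>2) * (ennreal (r powr (2*\<alpha> - 1)) * ennreal (?u t))"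
          by (simp only:)
        have "indicator {0<..} r = (1::ennreal)" "indicator {0..\<rho>} (norm (polar r t)) = (indicator {0..\<rho>} r :: ennreal)"
          using True by simp_all
        note ind = this
        let ?X = "ennreal (?km\<^sup>2 * norm (polar r t) powr (2*\<alpha>) * ?v (polar r t))"
        let ?J = "indicator {0..<2*pi} t :: ennreal" and ?I = "indicator {0..\<rho>} r :: ennreal"
        have "ennreal r * indicator {0<..} r * ?J * f (polar r t) = (ennreal r * ?X) * (?J * ?I)"
          unfolding f_def ind by (simp only: mult_1_right mult_1_left mult_ac)
        also have "\<dots> = (ennreal (?km\<^sup>2) * (ennreal (r powr (2*\<alpha> - 1)) * ?I)) * (?J * ennreal (?u t))"
          unfolding E by (simp only: mult_ac)
        finally show ?thesis .
      next
        case False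
        then have z: "ennreal (r powr (2*\<alpha> - 1)) * indicator {0..\<rho>} r = 0" by (cases "r = 0") simp_all
        show ?thesis unfolding z using False by simp
      qed
    qed
    also have "\<dots> = (\<integral>\<^sup>+r. (ennreal (?km\<^sup>2) * (ennreal (r powr (2*\<alpha> - 1)) * indicator {0..\<rho>} r)) * ennreal (2 * \<psi> \<zeta>) \<partial>lborel)"
    proof (intro nn_integral_cong)
      have "(\<integral>\<^sup>+t. indicator {0..<2*pi} t * ennreal (?u t) \<partial>lborel) = ennreal (2 * \<psi> \<zeta>)"
        using nn_integral_circ[OF uc C_nonneg] by (simp add: \<psi>_def)
      then show "(\<integral>\<^sup>+t. k * (indicator {0..<2*pi} t * ennreal (?u t)) \<partial>lborel) = k * ennreal (2 * \<psi> \<zeta>)" for k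
        using um by (subst nn_integral_cmult) auto
    qed
    also have "\<dots> = ennreal (?km\<^sup>2) * ennreal ?t * ennreal (2 * \<psi> \<zeta>)"
      using nn_integral_powr_from_0[of "2*\<alpha> - 1" \<rho>] \<alpha> \<rho> by (simp add: nn_integral_multc nn_integral_cmult)
    also have "\<dots> = ennreal (?km\<^sup>2 * ?t * (2 * \<psi> \<zeta>))"
    proof -
      have "ennreal (?km\<^sup>2 * ?t * (2 * \<psi> \<zeta>)) = ennreal (?km\<^sup>2 * ?t) * ennreal (2 * \<psi> \<zeta>)"
        using t0 psi_nonneg[of \<zeta>] by (intro ennreal_mult mult_nonneg_nonneg) auto
      moreover have "ennreal (?km\<^sup>2 * ?t) = ennreal (?km\<^sup>2) * ennreal ?t"
        by (rule ennreal_mult[OF zero_le_power2 t0])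
      ultimately show ?thesis by (simp only:)
    qed
    finally show ?thesis .
  qed
  have "elastic_integral C \<rho> ?I \<le> (\<integral>\<^sup>+x. f x + h x * ennreal b \<partial>lborel)"
    unfolding elastic_integral_def
  proof (rule nn_integral_mono_AE)
    have "AE x in lborel. x \<noteq> (0::real^2)" by (rule AE_lborel_singleton)
    then show "AE x in lborel. ennreal (C (?I x) \<bullet> ?I x) * indicator (ball 0 \<rho>) x \<le> f x + h x * ennreal b"
    proof eventually_elim
      case (elim x)
      have "ennreal (C (?I x) \<bullet> ?I x) \<le> ennreal (?km\<^sup>2 * norm x powr (2*\<alpha>) * ?v x + norm x powr (2*\<alpha> - 2) * b)"
        by (rule ennreal_leI[OF pt[OF elim]])
      also have "\<dots> = ennreal (?km\<^sup>2 * norm x powr (2*\<alpha>) * ?v x) + ennreal (norm x powr (2*\<alpha> - 2) * b)"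
        using C_nonneg b0 by (intro ennreal_plus) auto
      also have "ennreal (norm x powr (2*\<alpha> - 2) * b) = ennreal (norm x powr (2*\<alpha> - 2)) * ennreal b"
        using b0 by (intro ennreal_mult) auto
      finally show ?case unfolding f_def h_def by (auto simp: indicator_def)
    qed
  qed
  also have "\<dots> = ennreal (?km\<^sup>2 * ?t * (2 * \<psi> \<zeta>)) + ennreal (2 * pi * ?t) * ennreal b"
    using fm hm by (subst nn_integral_add) (auto simp: nn_integral_multc fI hI)
  also have "\<dots> = ennreal (?km\<^sup>2 * ?t * (2 * \<psi> \<zeta>) + 2 * pi * ?t * b)"
  proof -
    have n: "0 \<le> ?km\<^sup>2 * ?t * (2 * \<psi> \<zeta>)" "0 \<le> 2 * pi * ?t"
      using t0 psi_nonneg[of \<zeta>] by (intro mult_nonneg_nonneg; simp)+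
    show ?thesis by (simp only: ennreal_plus[OF n(1) mult_nonneg_nonneg[OF n(2) b0]] ennreal_mult[OF n(2) b0])
  qed
  finally have "ennreal \<alpha> * elastic_integral C \<rho> ?I \<le> ennreal \<alpha> * ennreal (?km\<^sup>2 * ?t * (2 * \<psi> \<zeta>) + 2 * pi * ?t * b)"
    by (rule mult_left_mono) simp
  also have "\<dots> = ennreal (\<alpha> * (?km\<^sup>2 * ?t * (2 * \<psi> \<zeta>) + 2 * pi * ?t * b))"
    using \<alpha> t0 b0 psi_nonneg[of \<zeta>] by (intro ennreal_mult[symmetric] add_nonneg_nonneg mult_nonneg_nonneg) auto
  also have "\<dots> \<le> ennreal (?km\<^sup>2 * \<psi> \<zeta> + pi * b)"
  proof (rule ennreal_leI)
    \<comment> \<open>The factor \<alpha> cancels, and what remains of the horizon is a positive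
      power of \<rho> < 1. This makes the estimate uniform in \<rho>.\<close>
    have "\<alpha> * (?km\<^sup>2 * ?t * (2 * \<psi> \<zeta>) + 2 * pi * ?t * b) = \<rho> powr (2*\<alpha>) * (?km\<^sup>2 * \<psi> \<zeta> + pi * b)"
      using \<alpha> by (simp add: field_simps)
    also have "\<dots> \<le> 1 * (?km\<^sup>2 * \<psi> \<zeta> + pi * b)"
      using \<alpha> \<rho> b0 psi_nonneg[of \<zeta>] powr_mono2[of "2*\<alpha>" \<rho> 1] by (intro mult_right_mono add_nonneg_nonneg mult_nonneg_nonneg) auto
    finally show "\<alpha> * (?km\<^sup>2 * ?t * (2 * \<psi> \<zeta>) + 2 * pi * ?t * b) \<le> ?km\<^sup>2 * \<psi> \<zeta> + pi * b" by simp
  qed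
  finally show ?thesis unfolding b_def .
qed

text \<open>The oscillation \<omega> is fixed first, so that the limiting error is below e, and it
  determines \<delta>. Only then does \<alpha> tend to 0, which removes the far field despite its
  factor 1 over \<delta> squared.\<close>

lemma upper_bound:
  assumes e: "e > 0"
  shows "\<forall>\<^sub>F \<alpha> in at_right 0. \<forall>\<rho>\<in>{0<..<1}. \<forall>\<zeta>. norm \<zeta> \<le> L \<longrightarrow>
    ennreal \<alpha> * elastic_integral C \<rho> (riesz_potential w \<alpha> \<rho> (\<eta> \<zeta>)) \<le> ennreal (\<psi> \<zeta> + e)"
proof -
  obtain K where K: "K > 0" "\<And>\<xi> x. x \<noteq> 0 \<Longrightarrow> norm (\<eta> \<xi> x) \<le> K * norm \<xi> / norm x" by (rule eta_bound) blast
  obtain B where B: "B > 0" "\<And>F. norm (C F) \<le> B * norm F" by (rule C_bound) blast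
  obtain P where P: "\<And>\<zeta>. norm \<zeta> \<le> L \<Longrightarrow> \<psi> \<zeta> \<le> P"
  proof -
    have "compact (\<psi> ` cball 0 L)" by (intro compact_continuous_image psi_continuous compact_cball)
    then have "bdd_above (\<psi> ` cball 0 L)" by (intro bounded_imp_bdd_above compact_imp_bounded)
    then show ?thesis using that unfolding bdd_above_def by fastforce
  qed
  define N where "N = pi * (B * L\<^sup>2)"
  have N0: "0 \<le> N" using B(1) by (simp add: N_def)
  \<comment> \<open>The limiting error is N (2 K \<omega> + \<omega> squared); with \<omega> at most
    1 the square counts as \<omega>, and the quotient makes the whole at most e/2. The summands 1
    keep the denominator positive.\<close>
  define \<omega> where "\<omega> = min 1 (e / ((N + 1) * (2 * K + 1) * 2))"
  have den: "0 < (N + 1) * (2 * K + 1) * 2" using N0 K(1) by (intro mult_pos_pos) auto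
  have \<omega>: "0 < \<omega>" "\<omega> \<le> 1" using e den by (auto simp: \<omega>_def)
  have small: "N * (2 * K * \<omega> + \<omega>\<^sup>2) < e"
  proof -
    have "\<omega>\<^sup>2 \<le> \<omega>" using \<omega> by (simp add: power2_eq_square mult_le_cancel_right1)
    then have "N * (2 * K * \<omega> + \<omega>\<^sup>2) \<le> N * (2 * K * \<omega> + \<omega>)" using N0 by (intro mult_left_mono) auto
    also have "\<dots> \<le> (N + 1) * (2 * K + 1) * \<omega>" using N0 \<omega> K(1) by (simp add: algebra_simps)
    also have "\<dots> \<le> e / 2"
    proof -
      have "\<omega> \<le> e / ((N + 1) * (2 * K + 1) * 2)" by (simp add: \<omega>_def)
      then have "\<omega> * ((N + 1) * (2 * K + 1) * 2) \<le> e" using den by (simp only: pos_le_divide_eq)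
      then show ?thesis by (simp add: mult_ac)
    qed
    finally show ?thesis using e by linarith
  qed
  obtain \<delta> where \<delta>: "0 < \<delta>" "\<delta> \<le> 1/2"
    and mod: "\<And>\<zeta> x y. x \<noteq> 0 \<Longrightarrow> norm (x - y) \<le> \<delta> * norm x \<Longrightarrow> norm (\<eta> \<zeta> y - \<eta> \<zeta> x) \<le> \<omega> * norm \<zeta> / norm x"
    by (rule eta_modulus[OF \<omega>(1)]) blast
  let ?D = "4 * pi / \<delta>\<^sup>2 + 16 * pi"
  define \<epsilon> where "\<epsilon> \<alpha> = kernel_mass \<alpha> * \<omega> + K / riesz_gamma \<alpha> * ?D" for \<alpha>
  \<comment> \<open>The reciprocal of \<open>riesz_gamma \<alpha>\<close> is
    \<open>kernel_mass \<alpha> * \<alpha> / (2 * pi)\<close> and so tends to 0.\<close>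
  have "((\<lambda>\<alpha>. kernel_mass \<alpha> * \<omega> + K * (kernel_mass \<alpha> * \<alpha> / (2 * pi)) * ?D) \<longlongrightarrow> 1 * \<omega> + K * (1 * 0 / (2 * pi)) * ?D) (at_right 0)"
    by (intro tendsto_intros kernel_mass_tendsto) simp
  moreover have "\<forall>\<^sub>F \<alpha> in at_right 0. kernel_mass \<alpha> * \<omega> + K * (kernel_mass \<alpha> * \<alpha> / (2 * pi)) * ?D = \<epsilon> \<alpha>"
    using eventually_at_right_real[of 0 "1::real", simplified]
    by eventually_elim (simp add: \<epsilon>_def kernel_mass_def)
  ultimately have \<epsilon>t: "(\<epsilon> \<longlongrightarrow> \<omega>) (at_right 0)" using Lim_transform_eventually by force
  have "((\<lambda>\<alpha>. \<bar>(kernel_mass \<alpha>)\<^sup>2 - 1\<bar> * \<bar>P\<bar> + N * (2 * kernel_mass \<alpha> * K * \<epsilon> \<alpha> + (\<epsilon> \<alpha>)\<^sup>2)) \<longlongrightarrow> \<bar>1\<^sup>2 - 1\<bar> * \<bar>P\<bar> + N * (2 * 1 * K * \<omega> + \<omega>\<^sup>2)) (at_right 0)"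
    by (intro tendsto_intros kernel_mass_tendsto \<epsilon>t)
  then have "\<forall>\<^sub>F \<alpha> in at_right 0. \<bar>(kernel_mass \<alpha>)\<^sup>2 - 1\<bar> * \<bar>P\<bar> + N * (2 * kernel_mass \<alpha> * K * \<epsilon> \<alpha> + (\<epsilon> \<alpha>)\<^sup>2) < e"
    by (rule order_tendstoD(2)) (use small in simp)
  then show ?thesis
    using eventually_at_right_real[of 0 "1/2::real", simplified]
  proof eventually_elim
    case (elim \<alpha>)
    have \<alpha>: "0 < \<alpha>" "\<alpha> \<le> 1/2" "\<alpha> < 1" using elim(2) by auto
    have km: "kernel_mass \<alpha> > 0" by (rule kernel_mass_pos[OF \<alpha>(1,3)])
    have \<epsilon>0: "0 \<le> \<epsilon> \<alpha>"
      unfolding \<epsilon>_def using km \<omega> K(1) riesz_gamma_pos[OF \<alpha>(1,3)]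
      by (intro add_nonneg_nonneg mult_nonneg_nonneg divide_nonneg_nonneg) auto
    show ?case
    proof (intro ballI allI impI)
      fix \<rho> :: real and \<zeta> :: "real^2" assume r: "\<rho> \<in> {0<..<1}" and z: "norm \<zeta> \<le> L"
      have r': "0 < \<rho>" "\<rho> < 1" using r by auto
      have "ennreal \<alpha> * elastic_integral C \<rho> (riesz_potential w \<alpha> \<rho> (\<eta> \<zeta>))
        \<le> ennreal ((kernel_mass \<alpha>)\<^sup>2 * \<psi> \<zeta> + pi * (B * (norm \<zeta>)\<^sup>2 * (2 * kernel_mass \<alpha> * K * \<epsilon> \<alpha> + (\<epsilon> \<alpha>)\<^sup>2)))"
        unfolding \<epsilon>_def by (rule energy_upper[OF \<alpha>(1,2) r' \<delta> mod K \<omega>(1) B])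
      also have "\<dots> \<le> ennreal (\<psi> \<zeta> + e)"
      proof (rule ennreal_leI)
        have "((kernel_mass \<alpha>)\<^sup>2 - 1) * \<psi> \<zeta> \<le> \<bar>(kernel_mass \<alpha>)\<^sup>2 - 1\<bar> * \<bar>P\<bar>"
          using P[OF z] psi_nonneg[of \<zeta>] by (intro mult_mono) auto
        moreover have "pi * (B * (norm \<zeta>)\<^sup>2 * (2 * kernel_mass \<alpha> * K * \<epsilon> \<alpha> + (\<epsilon> \<alpha>)\<^sup>2)) \<le> N * (2 * kernel_mass \<alpha> * K * \<epsilon> \<alpha> + (\<epsilon> \<alpha>)\<^sup>2)"
        proof -
          have "(norm \<zeta>)\<^sup>2 \<le> L\<^sup>2" using z by (intro power_mono) auto
          then have "(pi * (B * (norm \<zeta>)\<^sup>2)) * (2 * kernel_mass \<alpha> * K * \<epsilon> \<alpha> + (\<epsilon> \<alpha>)\<^sup>2) \<le> N * (2 * kernel_mass \<alpha> * K * \<epsilon> \<alpha> + (\<epsilon> \<alpha>)\<^sup>2)"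
            unfolding N_def using B(1) km K(1) \<epsilon>0 by (intro mult_right_mono mult_left_mono add_nonneg_nonneg) auto
          then show ?thesis by (simp only: mult.assoc)
        qed
        ultimately show "(kernel_mass \<alpha>)\<^sup>2 * \<psi> \<zeta> + pi * (B * (norm \<zeta>)\<^sup>2 * (2 * kernel_mass \<alpha> * K * \<epsilon> \<alpha> + (\<epsilon> \<alpha>)\<^sup>2)) \<le> \<psi> \<zeta> + e"
          using elim(1) by (simp add: algebra_simps)
      qed
      finally show "ennreal \<alpha> * elastic_integral C \<rho> (riesz_potential w \<alpha> \<rho> (\<eta> \<zeta>)) \<le> ennreal (\<psi> \<zeta> + e)" .
    qed
  qed
qed

text \<open>A test function on the ball has vanishing derivatives outside, so the curl pairing over
  the ball is the one over the plane.\<close>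

lemma eta_admissible:
  assumes "\<rho> > 0"
  shows "\<eta> \<zeta> \<in> admissible \<zeta> \<rho>"
proof -
  let ?U = "ball (0::real^2) (2*\<rho>)"
  have "set_integrable lborel (cball 0 (2*\<rho>)) (\<eta> \<zeta>)"
    using eta_locally_integrable[of \<zeta>] compact_cball unfolding locally_integrable_def by blast
  then have "set_integrable lborel ?U (\<eta> \<zeta>)" by (rule set_integrable_subset) (auto simp: borel_open)
  moreover have "Curl_eq_dirac ?U (\<eta> \<zeta>) \<zeta>"
    unfolding Curl_eq_dirac_def
  proof
    fix \<phi> assume f: "\<phi> \<in> test_functions ?U"
    have z: "partial_deriv i \<phi> x = 0" if "x \<notin> ?U" for i x
    proof (rule partial_deriv_zero_outside)
      have "closure {x. \<phi> x \<noteq> 0} \<subseteq> ?U" using f by (simp add: test_functions_def)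
      then show "x \<notin> closure {x. \<phi> x \<noteq> 0}" using that by (rule contra_subsetD)
    qed
    have "Curl_pairing ?U (\<eta> \<zeta>) \<phi> = Curl_pairing UNIV (\<eta> \<zeta>) \<phi>"
      unfolding Curl_pairing_def set_lebesgue_integral_def vec_eq_iff
      by (intro allI) (auto intro!: Bochner_Integration.integral_cong simp: indicator_def z simp del: mem_ball)
    moreover have "\<phi> \<in> test_functions UNIV" using f by (simp add: test_functions_def)
    then have "Curl_pairing UNIV (\<eta> \<zeta>) \<phi> = \<phi> 0 *\<^sub>R \<zeta>"
      using \<eta> unfolding dislocation_field_def Curl_eq_dirac_def by blast
    ultimately show "Curl_pairing ?U (\<eta> \<zeta>) \<phi> = \<phi> 0 *\<^sub>R \<zeta>" by simp
  qed
  ultimately show ?thesis by (simp add: admissible_def)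
qed

text \<open>The kernel reaches no further than \<rho>, so at points of the ball of radius \<rho> it
  sees only values inside the ball of radius \<open>2 * \<rho>\<close>.\<close>

lemma potential_zero_extension:
  assumes \<alpha>: "0 < \<alpha>" "\<alpha> < 1" and \<rho>: "0 < \<rho>" and x: "x \<in> ball 0 \<rho>"
  shows "riesz_potential w \<alpha> \<rho> (zero_extension (ball 0 (2*\<rho>)) f) x = riesz_potential w \<alpha> \<rho> f x"
  unfolding riesz_potential_def
proof (rule Bochner_Integration.integral_cong[OF refl])
  fix y
  obtain \<tau> where \<tau>: "1/2 \<le> \<tau>" "\<tau> < 1" "\<And>t. \<tau> \<le> t \<Longrightarrow> w t = 0" by (rule horizon_profile_vanish[OF w]) blast
  show "Q_kernel w \<alpha> \<rho> (x - y) *\<^sub>R zero_extension (ball 0 (2*\<rho>)) f y = Q_kernel w \<alpha> \<rho> (x - y) *\<^sub>R f y"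
  proof (cases "y \<in> ball 0 (2*\<rho>)")
    case False
    then have "\<rho> \<le> norm (x - y)" using x norm_triangle_ineq2[of y x] by (simp add: norm_minus_commute)
    moreover have "\<tau> * \<rho> \<le> \<rho>" using \<tau> \<rho> by simp
    ultimately have "Q_kernel w \<alpha> \<rho> (x - y) = 0" by (intro Q_kernel_zero[OF w \<alpha> \<rho> \<tau>(3)]) auto
    then show ?thesis by simp
  qed (simp add: zero_extension_def)
qed

lemma cell_energy_upper:
  assumes \<alpha>: "0 < \<alpha>" "\<alpha> < 1" and \<rho>: "0 < \<rho>"
  shows "ereal (2*\<alpha>) * cell_energy w C \<zeta> \<alpha> \<rho> \<le> enn2ereal (ennreal \<alpha> * elastic_integral C \<rho> (riesz_potential w \<alpha> \<rho> (\<eta> \<zeta>)))"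
proof -
  let ?X = "elastic_integral C \<rho> (riesz_potential w \<alpha> \<rho> (\<eta> \<zeta>))"
  have "elastic_integral C \<rho> (riesz_potential w \<alpha> \<rho> (zero_extension (ball 0 (2*\<rho>)) (\<eta> \<zeta>))) = ?X"
    unfolding elastic_integral_def
    by (intro nn_integral_cong) (simp add: indicator_def potential_zero_extension[OF \<alpha> \<rho>] del: mem_ball)
  then have "cell_energy w C \<zeta> \<alpha> \<rho> \<le> enn2ereal (ennreal (1/2) * ?X)"
    unfolding cell_energy_def less_eq_ennreal.rep_eq[symmetric]
    by (intro INF_lower2[OF eta_admissible[OF \<rho>]]) simp
  then have "ereal (2*\<alpha>) * cell_energy w C \<zeta> \<alpha> \<rho> \<le> ereal (2*\<alpha>) * enn2ereal (ennreal (1/2) * ?X)"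
    using \<alpha> by (intro ereal_mult_left_mono) auto
  also have "\<dots> = enn2ereal (ennreal (2*\<alpha>) * (ennreal (1/2) * ?X))"
    using \<alpha> by (simp only: times_ennreal.rep_eq) (simp add: enn2ereal_ennreal)
  also have "ennreal (2*\<alpha>) * (ennreal (1/2) * ?X) = ennreal \<alpha> * ?X"
  proof -
    have "ennreal (2*\<alpha>) * ennreal (1/2) = ennreal \<alpha>" using \<alpha> by (subst ennreal_mult[symmetric]) auto
    then show ?thesis by (simp only: mult.assoc[symmetric])
  qed
  finally show ?thesis .
qed

end

section \<open>Passage to the limit in the extended reals\<close>

lemma tendsto_ereal_squeeze:
  fixes f :: "'a \<Rightarrow> ereal"
  assumes "\<And>\<epsilon>. \<epsilon> > 0 \<Longrightarrow> \<forall>\<^sub>F x in F. ereal (l - \<epsilon>) \<le> f x \<and> f x \<le> ereal (l + \<epsilon>)"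
  shows "(f \<longlongrightarrow> ereal l) F"
proof (rule order_tendstoI)
  fix a assume "a < ereal l"
  then obtain z where z: "a < ereal z" "z < l" using ereal_dense2 by force
  from assms[of "l - z"] z(2) have "\<forall>\<^sub>F x in F. ereal z \<le> f x \<and> f x \<le> ereal (l + (l - z))" by simp
  then show "\<forall>\<^sub>F x in F. a < f x" by eventually_elim (use z(1) in \<open>auto intro: less_le_trans\<close>)
next
  fix a assume "ereal l < a"
  then obtain z where z: "ereal z < a" "l < z" using ereal_dense2 by force
  from assms[of "z - l"] z(2) have "\<forall>\<^sub>F x in F. ereal (l - (z - l)) \<le> f x \<and> f x \<le> ereal z" by simp
  then show "\<forall>\<^sub>F x in F. f x < a" by eventually_elim (use z(1) in \<open>auto intro: le_less_trans\<close>)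
qed

lemma ereal_abs_diff_le:
  assumes "ereal (l - \<epsilon>) \<le> x" "x \<le> ereal (l + \<epsilon>)"
  shows "\<bar>x - ereal l\<bar> \<le> ereal \<epsilon>"
  using assms by (cases x) auto

context cell_setting
begin

lemma psi_Gamma:
  "set_integrable lborel {0..<2*pi} (\<lambda>t. C (\<Gamma> \<xi> t) \<bullet> \<Gamma> \<xi> t)"
  "\<psi> \<xi> = 1/2 * (LINT t:{0..<2*pi}|lborel. C (\<Gamma> \<xi> t) \<bullet> \<Gamma> \<xi> t)"
proof -
  let ?v = "\<lambda>t. C (\<eta> \<xi> (polar 1 t)) \<bullet> \<eta> \<xi> (polar 1 t)"
  have eq: "(\<lambda>t. indicator {0..<2*pi} t *\<^sub>R (C (\<Gamma> \<xi> t) \<bullet> \<Gamma> \<xi> t)) = (\<lambda>t. indicator {0..<2*pi} t * ?v t)"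
  proof
    fix t
    show "indicator {0..<2*pi} t *\<^sub>R (C (\<Gamma> \<xi> t) \<bullet> \<Gamma> \<xi> t) = indicator {0..<2*pi} t * ?v t"
      using eta_Gamma[of 1 t \<xi>] by (cases "t \<in> {0..<2*pi}") simp_all
  qed
  note c = circ_lborel[OF energy_continuous[of _ \<xi> \<xi>]]
  show "set_integrable lborel {0..<2*pi} (\<lambda>t. C (\<Gamma> \<xi> t) \<bullet> \<Gamma> \<xi> t)"
    unfolding set_integrable_def eq by (rule c(1))
  show "\<psi> \<xi> = 1/2 * (LINT t:{0..<2*pi}|lborel. C (\<Gamma> \<xi> t) \<bullet> \<Gamma> \<xi> t)"
    unfolding set_lebesgue_integral_def eq c(2) by (rule \<psi>_def)
qed

lemma cell_energy_eventually_le: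
  assumes \<epsilon>: "\<epsilon> > 0" and \<rho>: "\<And>\<alpha>. \<alpha> \<in> {0<..<1} \<Longrightarrow> \<rho> \<alpha> \<in> {0<..<1}"
  shows "\<forall>\<^sub>F \<alpha> in at_right 0. \<forall>\<xi>. norm \<xi> \<le> L \<longrightarrow>
     ereal (2*\<alpha>) * cell_energy w C \<xi> \<alpha> (\<rho> \<alpha>) \<le> ereal \<alpha> * enn2ereal (elastic_integral C (\<rho> \<alpha>) (riesz_potential w \<alpha> (\<rho> \<alpha>) (\<eta> \<xi>)))
     \<and> ereal \<alpha> * enn2ereal (elastic_integral C (\<rho> \<alpha>) (riesz_potential w \<alpha> (\<rho> \<alpha>) (\<eta> \<xi>))) \<le> ereal (\<psi> \<xi> + \<epsilon>)"
  using upper_bound[OF \<epsilon>, of L] eventually_at_right_real[of 0 "1::real", simplified]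
proof eventually_elim
  case (elim \<alpha>)
  have \<alpha>: "0 < \<alpha>" "\<alpha> < 1" and r: "\<rho> \<alpha> \<in> {0<..<1}" using elim(2) \<rho> by auto
  show ?case
  proof (intro allI impI conjI)
    fix \<xi> :: "real^2" assume x: "norm \<xi> \<le> L"
    let ?X = "elastic_integral C (\<rho> \<alpha>) (riesz_potential w \<alpha> (\<rho> \<alpha>) (\<eta> \<xi>))"
    have e: "enn2ereal (ennreal \<alpha> * ?X) = ereal \<alpha> * enn2ereal ?X"
      using \<alpha> by (simp add: times_ennreal.rep_eq enn2ereal_ennreal)
    show "ereal (2*\<alpha>) * cell_energy w C \<xi> \<alpha> (\<rho> \<alpha>) \<le> ereal \<alpha> * enn2ereal ?X"
      unfolding e[symmetric] using r by (intro cell_energy_upper \<alpha>) simp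
    have "enn2ereal (ennreal \<alpha> * ?X) \<le> enn2ereal (ennreal (\<psi> \<xi> + \<epsilon>))"
      unfolding less_eq_ennreal.rep_eq[symmetric] using elim(1) r x by blast
    also have "\<dots> = ereal (\<psi> \<xi> + \<epsilon>)" using psi_nonneg[of \<xi>] \<epsilon> by (intro enn2ereal_ennreal) simp
    finally show "ereal \<alpha> * enn2ereal ?X \<le> ereal (\<psi> \<xi> + \<epsilon>)" unfolding e .
  qed
qed

lemma cell_energy_eventually_ge:
  assumes \<epsilon>: "\<epsilon> > 0" and \<rho>: "\<And>\<alpha>. \<alpha> \<in> {0<..<1} \<Longrightarrow> \<rho> \<alpha> \<in> {0<..<1}" "((\<lambda>\<alpha>. \<alpha> * ln (\<rho> \<alpha>)) \<longlongrightarrow> 0) (at_right 0)"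
  shows "\<forall>\<^sub>F \<alpha> in at_right 0. ereal (\<psi> \<xi> - \<epsilon>) \<le> ereal (2*\<alpha>) * cell_energy w C \<xi> \<alpha> (\<rho> \<alpha>)"
proof (cases "\<xi> = 0")
  case True
  obtain a b c where "\<And>\<xi>. \<psi> \<xi> = a * (\<xi>$1)\<^sup>2 + b * (\<xi>$1 * \<xi>$2) + c * (\<xi>$2)\<^sup>2" by (rule psi_quadratic) blast
  then have p: "\<psi> \<xi> = 0" using True by simp
  show ?thesis
    \<comment> \<open>At \<xi> = 0 there is no positive work to test with; the bound is then just
      nonnegativity of the cell energy.\<close>
    using eventually_at_right_real[of 0 "1::real", simplified]
  proof eventually_elim
    case (elim \<alpha>)
    have "ereal (\<psi> \<xi> - \<epsilon>) \<le> 0" using p \<epsilon> by simp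
    also have "0 \<le> ereal (2*\<alpha>) * cell_energy w C \<xi> \<alpha> (\<rho> \<alpha>)"
      using elim unfolding cell_energy_def by (intro ereal_0_le_mult) auto
    finally show ?case .
  qed
next
  case False
  obtain U where U: "\<xi> \<in> U" "\<forall>\<^sub>F \<alpha> in at_right 0. \<forall>\<zeta>\<in>U. ereal (\<psi> \<zeta> - \<epsilon>) \<le> ereal (2*\<alpha>) * cell_energy w C \<zeta> \<alpha> (\<rho> \<alpha>)"
    by (rule lower_bound[OF False \<epsilon>, of \<rho>]) (use \<rho> in auto)
  from U(2) show ?thesis by eventually_elim (use U(1) in blast)
qed

lemma cell_energy_uniform_ge:
  assumes \<epsilon>: "\<epsilon> > 0" and \<rho>: "\<And>\<alpha>. \<alpha> \<in> {0<..<1} \<Longrightarrow> \<rho> \<alpha> \<in> {0<..<1}" "((\<lambda>\<alpha>. \<alpha> * ln (\<rho> \<alpha>)) \<longlongrightarrow> 0) (at_right 0)"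
  shows "\<forall>\<^sub>F \<alpha> in at_right 0. \<forall>\<xi>\<in>sphere 0 1. ereal (\<psi> \<xi> - \<epsilon>) \<le> ereal (2*\<alpha>) * cell_energy w C \<xi> \<alpha> (\<rho> \<alpha>)"
proof -
  define G where "G U \<longleftrightarrow> (\<forall>\<^sub>F \<alpha> in at_right 0. \<forall>\<zeta>\<in>U. ereal (\<psi> \<zeta> - \<epsilon>) \<le> ereal (2*\<alpha>) * cell_energy w C \<zeta> \<alpha> (\<rho> \<alpha>))" for U
  have ex: "\<exists>U. open U \<and> \<xi> \<in> U \<and> G U" if "\<xi> \<in> sphere 0 1" for \<xi>
  proof -
    have "\<xi> \<noteq> 0" using that by auto
    then show ?thesis unfolding G_def using lower_bound[OF _ \<epsilon> \<rho>] by blast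
  qed
  have "sphere 0 1 \<subseteq> \<Union>{U. open U \<and> G U}" using ex by blast
  then obtain D where D: "D \<subseteq> {U. open U \<and> G U}" "finite D" "sphere 0 1 \<subseteq> \<Union>D"
    by (rule compactE[OF compact_sphere]) auto
  have "\<forall>\<^sub>F \<alpha> in at_right 0. \<forall>U\<in>D. \<forall>\<zeta>\<in>U. ereal (\<psi> \<zeta> - \<epsilon>) \<le> ereal (2*\<alpha>) * cell_energy w C \<zeta> \<alpha> (\<rho> \<alpha>)"
    by (rule eventually_ball_finite[OF D(2)]) (use D(1) in \<open>auto simp: G_def\<close>)
  then show ?thesis by eventually_elim (use D(3) in blast)
qed

end

theorem proposition4p2:
  fixes w :: "real \<Rightarrow> real"
    and C :: "real^2^2 \<Rightarrow> real^2^2"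
    and \<nu>\<^sub>1 \<nu>\<^sub>2 :: real
    and \<eta> :: "real^2 \<Rightarrow> real^2 \<Rightarrow> real^2^2"
    and \<Gamma> :: "real^2 \<Rightarrow> real \<Rightarrow> real^2^2"
  assumes w: "horizon_profile w"
    and C: "elasticity_tensor C \<nu>\<^sub>1 \<nu>\<^sub>2"
    and \<eta>: "dislocation_field C \<eta> \<Gamma>"
  shows "\<exists>\<psi> :: real^2 \<Rightarrow> real.
    (\<forall>\<xi>. \<forall>\<rho>\<in>{0<..<1}.
       ((\<lambda>\<alpha>. ereal (2 * \<alpha>) * cell_energy w C \<xi> \<alpha> \<rho>) \<longlongrightarrow> ereal (\<psi> \<xi>)) (at_right 0) \<and>
       ((\<lambda>\<alpha>. ereal \<alpha> * enn2ereal (elastic_integral C \<rho> (riesz_potential w \<alpha> \<rho> (\<eta> \<xi>))))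
          \<longlongrightarrow> ereal (\<psi> \<xi>)) (at_right 0) \<and>
       set_integrable lborel {0..<2*pi} (\<lambda>\<theta>. C (\<Gamma> \<xi> \<theta>) \<bullet> \<Gamma> \<xi> \<theta>) \<and>
       \<psi> \<xi> = 1/2 * (LINT \<theta>:{0..<2*pi}|lborel. C (\<Gamma> \<xi> \<theta>) \<bullet> \<Gamma> \<xi> \<theta>)) \<and>
    (\<exists>c>0. \<forall>\<xi>. \<psi> \<xi> \<ge> c * (norm \<xi>)\<^sup>2) \<and>
    (\<forall>\<rho> :: real \<Rightarrow> real.
       (\<forall>\<alpha>\<in>{0<..<1}. \<rho> \<alpha> \<in> {0<..<1}) \<longrightarrow>
       ((\<lambda>\<alpha>. \<alpha> * ln (\<rho> \<alpha>)) \<longlongrightarrow> 0) (at_right 0) \<longrightarrow>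
       ((\<lambda>\<alpha>. SUP \<xi>\<in>sphere 0 1. \<bar>ereal (2 * \<alpha>) * cell_energy w C \<xi> \<alpha> (\<rho> \<alpha>) - ereal (\<psi> \<xi>)\<bar>)
          \<longlongrightarrow> 0) (at_right 0))"
proof -
  interpret cell_setting w C \<nu>\<^sub>1 \<nu>\<^sub>2 \<eta> \<Gamma> by unfold_locales (fact w C \<eta>)+
  have lim: "((\<lambda>\<alpha>. ereal (2*\<alpha>) * cell_energy w C \<xi> \<alpha> \<rho>) \<longlongrightarrow> ereal (\<psi> \<xi>)) (at_right 0) \<and>
       ((\<lambda>\<alpha>. ereal \<alpha> * enn2ereal (elastic_integral C \<rho> (riesz_potential w \<alpha> \<rho> (\<eta> \<xi>)))) \<longlongrightarrow> ereal (\<psi> \<xi>)) (at_right 0)"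
    if \<rho>: "\<rho> \<in> {0<..<1}" for \<rho> \<xi>
  proof -
    have "((\<lambda>\<alpha>. \<alpha> * ln \<rho>) \<longlongrightarrow> 0 * ln \<rho>) (at_right 0)" by (intro tendsto_intros)
    then have l: "((\<lambda>\<alpha>. \<alpha> * ln \<rho>) \<longlongrightarrow> 0) (at_right 0)" by simp
    \<comment> \<open>The rescaled cell energy lies below the rescaled energy of \<eta>, so a lower
      bound for the former and an upper bound for the latter trap both quantities.\<close>
    have "\<forall>\<^sub>F \<alpha> in at_right 0. ereal (\<psi> \<xi> - \<epsilon>) \<le> ereal (2*\<alpha>) * cell_energy w C \<xi> \<alpha> \<rho> \<and>
       ereal (2*\<alpha>) * cell_energy w C \<xi> \<alpha> \<rho> \<le> ereal \<alpha> * enn2ereal (elastic_integral C \<rho> (riesz_potential w \<alpha> \<rho> (\<eta> \<xi>))) \<and>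
       ereal \<alpha> * enn2ereal (elastic_integral C \<rho> (riesz_potential w \<alpha> \<rho> (\<eta> \<xi>))) \<le> ereal (\<psi> \<xi> + \<epsilon>)" if "\<epsilon> > 0" for \<epsilon>
      using cell_energy_eventually_ge[where \<rho>="\<lambda>_. \<rho>" and \<xi>=\<xi>, OF that \<rho> l] cell_energy_eventually_le[where \<rho>="\<lambda>_. \<rho>" and L="norm \<xi>", OF that \<rho>]
      by eventually_elim blast
    note ev = this
    show ?thesis
      by (intro conjI tendsto_ereal_squeeze; drule ev; erule eventually_mono; blast intro: order_trans)
  qed
  have uniform: "((\<lambda>\<alpha>. SUP \<xi>\<in>sphere 0 1. \<bar>ereal (2 * \<alpha>) * cell_energy w C \<xi> \<alpha> (\<rho> \<alpha>) - ereal (\<psi> \<xi>)\<bar>) \<longlongrightarrow> ereal 0) (at_right 0)"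
    if \<rho>: "\<And>\<alpha>. \<alpha> \<in> {0<..<1} \<Longrightarrow> \<rho> \<alpha> \<in> {0<..<1}" "((\<lambda>\<alpha>. \<alpha> * ln (\<rho> \<alpha>)) \<longlongrightarrow> 0) (at_right 0)" for \<rho>
  proof (rule tendsto_ereal_squeeze)
    fix \<epsilon> :: real assume e: "\<epsilon> > 0"
    have ge: "\<forall>\<^sub>F \<alpha> in at_right 0. \<forall>\<xi>\<in>sphere 0 1. ereal (\<psi> \<xi> - \<epsilon>) \<le> ereal (2*\<alpha>) * cell_energy w C \<xi> \<alpha> (\<rho> \<alpha>)"
      by (rule cell_energy_uniform_ge[OF e \<rho>])
    have le: "\<forall>\<^sub>F \<alpha> in at_right 0. \<forall>\<xi>. norm \<xi> \<le> 1 \<longrightarrow>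
     ereal (2*\<alpha>) * cell_energy w C \<xi> \<alpha> (\<rho> \<alpha>) \<le> ereal \<alpha> * enn2ereal (elastic_integral C (\<rho> \<alpha>) (riesz_potential w \<alpha> (\<rho> \<alpha>) (\<eta> \<xi>)))
     \<and> ereal \<alpha> * enn2ereal (elastic_integral C (\<rho> \<alpha>) (riesz_potential w \<alpha> (\<rho> \<alpha>) (\<eta> \<xi>))) \<le> ereal (\<psi> \<xi> + \<epsilon>)"
      by (rule cell_energy_eventually_le[OF e]) (rule \<rho>(1))
    show "\<forall>\<^sub>F \<alpha> in at_right 0. ereal (0 - \<epsilon>) \<le> (SUP \<xi>\<in>sphere 0 1. \<bar>ereal (2 * \<alpha>) * cell_energy w C \<xi> \<alpha> (\<rho> \<alpha>) - ereal (\<psi> \<xi>)\<bar>)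
       \<and> (SUP \<xi>\<in>sphere 0 1. \<bar>ereal (2 * \<alpha>) * cell_energy w C \<xi> \<alpha> (\<rho> \<alpha>) - ereal (\<psi> \<xi>)\<bar>) \<le> ereal (0 + \<epsilon>)"
      using ge le
    proof eventually_elim
      case (elim \<alpha>)
      \<comment> \<open>A point of the circle is needed because the supremum over an empty set of
        extended reals would be minus infinity.\<close>
      have "axis 1 1 \<in> sphere (0::real^2) 1" by (simp add: norm_axis_1)
      then have "0 \<le> (SUP \<xi>\<in>sphere 0 1. \<bar>ereal (2 * \<alpha>) * cell_energy w C \<xi> \<alpha> (\<rho> \<alpha>) - ereal (\<psi> \<xi>)\<bar>)"
        by (rule SUP_upper2) simp
      moreover have "ereal (0 - \<epsilon>) \<le> 0" using e by simp
      moreover have "(SUP \<xi>\<in>sphere 0 1. \<bar>ereal (2 * \<alpha>) * cell_energy w C \<xi> \<alpha> (\<rho> \<alpha>) - ereal (\<psi> \<xi>)\<bar>) \<le> ereal \<epsilon>"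
      proof (rule SUP_least, rule ereal_abs_diff_le)
        fix \<xi> :: "real^2" assume x: "\<xi> \<in> sphere 0 1"
        then have "norm \<xi> \<le> 1" by simp
        with elim(2) show "ereal (2 * \<alpha>) * cell_energy w C \<xi> \<alpha> (\<rho> \<alpha>) \<le> ereal (\<psi> \<xi> + \<epsilon>)" by (blast intro: order_trans)
        show "ereal (\<psi> \<xi> - \<epsilon>) \<le> ereal (2 * \<alpha>) * cell_energy w C \<xi> \<alpha> (\<rho> \<alpha>)" using elim(1) x by blast
      qed
      ultimately show ?case unfolding add_0 by (blast intro: order_trans)
    qed
  qed
  show ?thesis
  proof (intro exI[of _ \<psi>] conjI allI ballI impI psi_coercive psi_Gamma)
    fix \<xi> :: "real^2" and \<rho> :: real assume "\<rho> \<in> {0<..<1}"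
    then show "((\<lambda>\<alpha>. ereal (2*\<alpha>) * cell_energy w C \<xi> \<alpha> \<rho>) \<longlongrightarrow> ereal (\<psi> \<xi>)) (at_right 0)"
       "((\<lambda>\<alpha>. ereal \<alpha> * enn2ereal (elastic_integral C \<rho> (riesz_potential w \<alpha> \<rho> (\<eta> \<xi>)))) \<longlongrightarrow> ereal (\<psi> \<xi>)) (at_right 0)"
      using lim by blast+
  next
    fix \<rho> :: "real \<Rightarrow> real"
    assume "\<forall>\<alpha>\<in>{0<..<1}. \<rho> \<alpha> \<in> {0<..<1}" "((\<lambda>\<alpha>. \<alpha> * ln (\<rho> \<alpha>)) \<longlongrightarrow> 0) (at_right 0)"
    then show "((\<lambda>\<alpha>. SUP \<xi>\<in>sphere 0 1. \<bar>ereal (2 * \<alpha>) * cell_energy w C \<xi> \<alpha> (\<rho> \<alpha>) - ereal (\<psi> \<xi>)\<bar>) \<longlongrightarrow> 0) (at_right 0)"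
      using uniform[of \<rho>] unfolding zero_ereal_def by blast
  qed
qed

end
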